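(* There exists a universal constant $C^*>0$ such that for any solution $u$ of the Navier-Stokes equations $$\partial_t u-\Delta u+\operatorname{div}(u\otimes u)+\nabla p=0,\qquad \operatorname{div}(u)=0$$ on $[-1,1]\times\mathbb{R}^3$ satisfying $\|u\|_{L^6([-1,1]\times\mathbb{R}^3)}\le C^*$, we have $|u|\le 1$ almost everywhere on $[-\tfrac12,1]\times\mathbb{R}^3$.
   Context: Here $u$ takes values in $\mathbb{R}^3$ and $p$ is scalar. A solution on $[-1,1]\times\mathbb{R}^3$ means a weak solution in the energy class: $u\in L^\infty(-1,1;L^2(\mathbb{R}^3))\cap L^2(-1,1;\dot H^1(\mathbb{R}^3))$ satisfying the equations in the sense of distributions on $(-1,1)\times\mathbb{R}^3$ (for some pressure distribution $p$). *)

theory Defs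
  imports "HOL-Analysis.Analysis"
begin

section \<open>Lebesgue spaces\<close>

definition Lp_space :: "real \<Rightarrow> 'a::euclidean_space set \<Rightarrow> ('a \<Rightarrow> 'b::euclidean_space) \<Rightarrow> bool" where
  "Lp_space p S f \<longleftrightarrow>
     f \<in> borel_measurable (lebesgue_on S) \<and>
     integrable (lebesgue_on S) (\<lambda>x. norm (f x) powr p)"

text \<open>Meaningful only together with \<^const>\<open>Lp_space\<close>: the Bochner integral of a
  non-integrable function is \<open>0\<close>.\<close>

definition Lp_norm :: "real \<Rightarrow> 'a::euclidean_space set \<Rightarrow> ('a \<Rightarrow> 'b::euclidean_space) \<Rightarrow> real" where
  "Lp_norm p S f = (\<integral>x. norm (f x) powr p \<partial>(lebesgue_on S)) powr (1 / p)"


section \<open>Test functions and distributions\<close>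

definition dir_deriv :: "'a::euclidean_space \<Rightarrow> ('a \<Rightarrow> real) \<Rightarrow> 'a \<Rightarrow> real" where
  "dir_deriv v f = (\<lambda>x. frechet_derivative f (at x) v)"

definition iter_deriv :: "'a::euclidean_space list \<Rightarrow> ('a \<Rightarrow> real) \<Rightarrow> 'a \<Rightarrow> real" where
  "iter_deriv vs f = foldr dir_deriv vs f"

text \<open>A function all of whose iterated partial derivatives are (Frechet) differentiable
  everywhere has continuous partial derivatives of every order, and conversely.\<close>

definition smooth :: "('a::euclidean_space \<Rightarrow> real) \<Rightarrow> bool" where
  "smooth f \<longleftrightarrow> (\<forall>vs. set vs \<subseteq> Basis \<longrightarrow> (\<forall>x. iter_deriv vs f differentiable (at x)))"

definition test_functions :: "'a::euclidean_space set \<Rightarrow> ('a \<Rightarrow> real) set" where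
  "test_functions \<Omega> =
     {\<phi>. smooth \<phi> \<and> compact (closure {x. \<phi> x \<noteq> 0}) \<and> closure {x. \<phi> x \<noteq> 0} \<subseteq> \<Omega>}"

text \<open>A distribution on \<open>\<Omega>\<close> is a functional on all functions, of which only the values on
  \<^term>\<open>test_functions \<Omega>\<close> matter. Continuity is expressed by the usual seminorm
  estimates on each compact subset of \<open>\<Omega>\<close>.\<close>

definition distribution :: "'a::euclidean_space set \<Rightarrow> (('a \<Rightarrow> real) \<Rightarrow> real) \<Rightarrow> bool" where
  "distribution \<Omega> T \<longleftrightarrow>
     (\<forall>\<phi>\<in>test_functions \<Omega>. \<forall>\<psi>\<in>test_functions \<Omega>. T (\<lambda>x. \<phi> x + \<psi> x) = T \<phi> + T \<psi>) \<and>
     (\<forall>c. \<forall>\<phi>\<in>test_functions \<Omega>. T (\<lambda>x. c * \<phi> x) = c * T \<phi>) \<and>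
     (\<forall>K. compact K \<and> K \<subseteq> \<Omega> \<longrightarrow>
        (\<exists>C N. \<forall>\<phi>\<in>test_functions \<Omega>. closure {x. \<phi> x \<noteq> 0} \<subseteq> K \<longrightarrow>
           \<bar>T \<phi>\<bar> \<le> C * (\<Sum>vs | set vs \<subseteq> Basis \<and> length vs \<le> N. SUP x. \<bar>iter_deriv vs \<phi> x\<bar>)))"

definition fun_dist :: "'a::euclidean_space set \<Rightarrow> ('a \<Rightarrow> real) \<Rightarrow> ('a \<Rightarrow> real) \<Rightarrow> real" where
  "fun_dist \<Omega> f = (\<lambda>\<phi>. \<integral>x. f x * \<phi> x \<partial>(lebesgue_on \<Omega>))"

definition dist_deriv :: "'a::euclidean_space \<Rightarrow> (('a \<Rightarrow> real) \<Rightarrow> real) \<Rightarrow> ('a \<Rightarrow> real) \<Rightarrow> real" where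
  "dist_deriv v T = (\<lambda>\<phi>. - T (dir_deriv v \<phi>))"


section \<open>Weak solutions of the Navier-Stokes equations\<close>

text \<open>The entry \<open>A x $ i $ j\<close> is the distributional derivative of \<open>f $ i\<close> in the
  \<open>j\<close>-th coordinate direction.\<close>

definition weak_gradient :: "(real^3 \<Rightarrow> real^3) \<Rightarrow> (real^3 \<Rightarrow> real^3^3) \<Rightarrow> bool" where
  "weak_gradient f A \<longleftrightarrow>
     (\<forall>i j. \<forall>\<phi>\<in>test_functions UNIV.
        dist_deriv (axis j 1) (fun_dist UNIV (\<lambda>x. f x $ i)) \<phi> = fun_dist UNIV (\<lambda>x. A x $ i $ j) \<phi>)"

definition Linf_L2 :: "real \<Rightarrow> real \<Rightarrow> (real \<times> (real^3) \<Rightarrow> real^3) \<Rightarrow> bool" where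
  "Linf_L2 a b u \<longleftrightarrow>
     (\<exists>M. AE t in lebesgue_on {a<..<b}.
        Lp_space 2 UNIV (\<lambda>x. u (t, x)) \<and> Lp_norm 2 UNIV (\<lambda>x. u (t, x)) \<le> M)"

text \<open>By Tonelli, square integrability of the spatial gradient on \<open>(a,b) \<times> R^3\<close> is the same
  as finiteness of the time integral of the squared homogeneous Sobolev norms of the slices.\<close>

definition L2_Hdot1 :: "real \<Rightarrow> real \<Rightarrow> (real \<times> (real^3) \<Rightarrow> real^3) \<Rightarrow> bool" where
  "L2_Hdot1 a b u \<longleftrightarrow>
     (\<exists>G. Lp_space 2 ({a<..<b} \<times> UNIV) G \<and>
        (AE t in lebesgue_on {a<..<b}. weak_gradient (\<lambda>x. u (t, x)) (\<lambda>x. G (t, x))))"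

abbreviation time_dir :: "real \<times> (real^3)" where
  "time_dir \<equiv> (1, 0)"

abbreviation space_dir :: "3 \<Rightarrow> real \<times> (real^3)" where
  "space_dir j \<equiv> (0, axis j 1)"

text \<open>The \<open>i\<close>-th component of \<open>div (u \<otimes> u)\<close> is the sum over \<open>j\<close> of the
  \<open>j\<close>-th derivatives of \<open>u $ i * u $ j\<close>; products are taken pointwise before passing to
  distributions.\<close>

definition NS_equations :: "real \<Rightarrow> real \<Rightarrow> (real \<times> (real^3) \<Rightarrow> real^3) \<Rightarrow>
    ((real \<times> (real^3) \<Rightarrow> real) \<Rightarrow> real) \<Rightarrow> bool" where
  "NS_equations a b u p \<longleftrightarrow>
     (let \<Omega> = {a<..<b} \<times> UNIV in
       (\<forall>\<phi>\<in>test_functions \<Omega>. \<forall>i.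
          dist_deriv time_dir (fun_dist \<Omega> (\<lambda>z. u z $ i)) \<phi>
          - (\<Sum>j\<in>UNIV. dist_deriv (space_dir j)
                (dist_deriv (space_dir j) (fun_dist \<Omega> (\<lambda>z. u z $ i))) \<phi>)
          + (\<Sum>j\<in>UNIV. dist_deriv (space_dir j) (fun_dist \<Omega> (\<lambda>z. u z $ i * u z $ j)) \<phi>)
          + dist_deriv (space_dir i) p \<phi> = 0) \<and>
       (\<forall>\<phi>\<in>test_functions \<Omega>.
          (\<Sum>j\<in>UNIV. dist_deriv (space_dir j) (fun_dist \<Omega> (\<lambda>z. u z $ j)) \<phi>) = 0))"

definition NS_solution :: "real \<Rightarrow> real \<Rightarrow> (real \<times> (real^3) \<Rightarrow> real^3) \<Rightarrow> bool" where
  "NS_solution a b u \<longleftrightarrow>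
     u \<in> borel_measurable (lebesgue_on ({a..b} \<times> UNIV)) \<and>
     Linf_L2 a b u \<and> L2_Hdot1 a b u \<and>
     (\<exists>p. distribution ({a<..<b} \<times> UNIV) p \<and> NS_equations a b u p)"

end

theory Submission
  imports Defs "HOL-Probability.Distributions"
begin

text \<open>
  Only the \<open>L\<^sup>6\<close> bound and the equations matter. For a test function \<open>\<Psi>\<close>, the divergence free field
  \<open>curl curl (\<Psi> e\<^sub>k)\<close> tested against the equations eliminates the pressure. Taking for \<open>\<Psi>\<close> a time weight
  \<open>eta\<close>, which vanishes before \<open>-3/4\<close> and is at least \<open>1\<close> after \<open>-1/2\<close>, times the space-time potential
  of a test function with respect to a truncated heat kernel integrated once more in its time parameter gives, in
  the limit, an Oseen type representation of \<open>eta u\<close> and hence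
  \<open>eta \<bar>u\<bar> \<le> D ker * (\<bar>u\<bar> + eta \<bar>u\<bar>\<^sup>2)\<close> almost everywhere, where \<open>ker\<close> lies in \<open>L\<^bsup>6/5\<^esup>\<close>.
  As \<open>6/5\<close> is dual to \<open>6\<close>, a small \<open>L\<^sup>6\<close> norm makes \<open>D ker * \<bar>u\<bar> \<le> 1/2\<close>, so that
  \<open>v = max 0 (eta \<bar>u\<bar> - 1)\<close> satisfies \<open>v \<le> D ker * (\<bar>u\<bar> v)\<close>. By the Cauchy-Schwarz inequality and smallness again
  the square integral of \<open>v\<close> is at most half of itself, and \<open>v = 0\<close>.
\<close>

section \<open>Smooth functions and test functions\<close>

text \<open>Nothing is known about the pressure except that it is a distribution, so it cannot be
  estimated, and the Leray projection of a test function has no compact support. Hence the double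
  curl of a compactly supported potential; the potential then has to invert the Laplacian as well as
  the heat operator. Integrating the heat kernel over later heat times does this, but decays too
  slowly. Cutting space at radius \<open>R\<close> and heat time at \<open>R\<^sup>2\<close> costs
  an error of order \<open>R powr (-3/10)\<close>.

  Three derivatives of the potential behave like the power -4 of the parabolic distance in parabolic
  dimension 5, which is locally integrable to every power below 5/4. Since 6/5 < 5/4, the exponent 6
  lies on the good side of the scale invariant exponent 5, and absolute values of kernels suffice
  throughout.

  An \<open>L\<^sup>6\<close> bound alone gives no square integrability on the whole space, while
  "at most half of itself" says nothing about an infinite quantity. The excess \<open>v\<close> is
  nonzero only where \<open>eta \<bar>u\<bar> > 1\<close>; there its square is below the sixth power
  of \<open>eta \<bar>u\<bar>\<close>, so its square integral is finite beforehand.\<close>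

lemma dir_deriv_eq:
  assumes "(f has_derivative f') (at x)"
  shows "dir_deriv v f x = f' v"
  using frechet_derivative_at[OF assms] by (simp add: dir_deriv_def)

lemma smooth_differentiable: "smooth f \<Longrightarrow> f differentiable (at x)"
  unfolding smooth_def by (metis empty_set empty_subsetI foldr_Nil id_apply iter_deriv_def)

lemma smooth_has_derivative: "smooth f \<Longrightarrow> (f has_derivative (\<lambda>v. dir_deriv v f x)) (at x)"
  using smooth_differentiable[of f x] unfolding dir_deriv_def frechet_derivative_works .

lemma smooth_dir_deriv:
  assumes "smooth f" "b \<in> Basis"
  shows "smooth (dir_deriv b f)"
  unfolding smooth_def
proof (intro allI impI)
  fix vs :: "'a list" and x assume "set vs \<subseteq> Basis"
  then have "set (vs @ [b]) \<subseteq> Basis" using assms by auto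
  then have "iter_deriv (vs @ [b]) f differentiable (at x)" using assms unfolding smooth_def by blast
  then show "iter_deriv vs (dir_deriv b f) differentiable (at x)" by (simp add: iter_deriv_def)
qed

text \<open>Smoothness quantifies over all lists of derivatives; a class of differentiable functions
  that is closed under partial derivatives contains all of them. The closure properties below rest
  on exhibiting such a class.\<close>

lemma smooth_coinduct:
  assumes "f \<in> C"
    and diff: "\<And>g x. g \<in> C \<Longrightarrow> g differentiable (at x)"
    and der: "\<And>g b. g \<in> C \<Longrightarrow> b \<in> Basis \<Longrightarrow> dir_deriv b g \<in> C"
  shows "smooth f"
proof -
  have "iter_deriv vs f \<in> C" if "set vs \<subseteq> Basis" for vs
    using that by (induction vs) (auto simp: iter_deriv_def \<open>f \<in> C\<close> intro: der)
  then show ?thesis unfolding smooth_def using diff by blast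
qed

lemma dir_deriv_const: "dir_deriv v (\<lambda>x. c) = (\<lambda>x. 0)"
  by (rule ext, rule dir_deriv_eq) (auto intro!: derivative_eq_intros)

lemma smooth_const: "smooth (\<lambda>x. c)"
  by (rule smooth_coinduct[where C = "range (\<lambda>c x. c)"]) (auto simp: dir_deriv_const)

lemma dir_deriv_add:
  "f differentiable (at x) \<Longrightarrow> g differentiable (at x) \<Longrightarrow>
    dir_deriv v (\<lambda>x. f x + g x) x = dir_deriv v f x + dir_deriv v g x"
  unfolding frechet_derivative_works
  by (subst dir_deriv_eq[where f' = "\<lambda>v. dir_deriv v f x + dir_deriv v g x"])
     (auto intro!: derivative_eq_intros simp: dir_deriv_def)

lemma dir_deriv_mult:
  "f differentiable (at x) \<Longrightarrow> g differentiable (at x) \<Longrightarrow>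
    dir_deriv v (\<lambda>x. f x * g x) x = f x * dir_deriv v g x + dir_deriv v f x * g x"
  unfolding frechet_derivative_works
  by (subst dir_deriv_eq[where f' = "\<lambda>v. f x * dir_deriv v g x + dir_deriv v f x * g x"])
     (auto intro!: derivative_eq_intros simp: dir_deriv_def)

lemma smooth_dir_deriv_add:
  "smooth f \<Longrightarrow> smooth g \<Longrightarrow> dir_deriv v (\<lambda>x. f x + g x) = (\<lambda>x. dir_deriv v f x + dir_deriv v g x)"
  by (rule ext, rule dir_deriv_add) (auto intro: smooth_differentiable)

lemma smooth_dir_deriv_mult:
  "smooth f \<Longrightarrow> smooth g \<Longrightarrow>
    dir_deriv v (\<lambda>x. f x * g x) = (\<lambda>x. f x * dir_deriv v g x + dir_deriv v f x * g x)"
  by (rule ext, rule dir_deriv_mult) (auto intro: smooth_differentiable)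

text \<open>Products alone are not closed under differentiation, because the Leibniz rule yields a
  sum of two of them. Closing under sums gives a class fit for \<open>smooth_coinduct\<close>; sums
  of smooth functions come out as \<open>f * 1 + g * 1\<close>.\<close>

inductive_set product_sums :: "('a::euclidean_space \<Rightarrow> real) set" where
  prod: "smooth f \<Longrightarrow> smooth g \<Longrightarrow> (\<lambda>x. f x * g x) \<in> product_sums"
| sum: "f \<in> product_sums \<Longrightarrow> g \<in> product_sums \<Longrightarrow> (\<lambda>x. f x + g x) \<in> product_sums"

lemma product_sums_differentiable: "g \<in> product_sums \<Longrightarrow> g differentiable (at x)"
proof (induction rule: product_sums.induct)
  case (prod f g)
  then show ?case by (intro differentiable_mult smooth_differentiable)
qed (rule differentiable_add)

lemma product_sums_smooth:
  fixes f :: "'a::euclidean_space \<Rightarrow> real"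
  assumes "f \<in> product_sums" shows "smooth f"
proof (rule smooth_coinduct[OF assms product_sums_differentiable])
  fix g :: "'a \<Rightarrow> real" and b :: 'a assume g: "g \<in> product_sums" and b: "b \<in> Basis"
  show "dir_deriv b g \<in> product_sums" using g
  proof (induction rule: product_sums.induct)
    case (prod f g)
    then show ?case
      by (simp add: smooth_dir_deriv_mult product_sums.intros smooth_dir_deriv b)
  next
    case (sum f g)
    have "dir_deriv b (\<lambda>x. f x + g x) = (\<lambda>x. dir_deriv b f x + dir_deriv b g x)"
      by (rule ext, rule dir_deriv_add) (auto intro: product_sums_differentiable sum)
    then show ?case by (simp add: product_sums.sum sum)
  qed
qed

lemma smooth_mult: "smooth f \<Longrightarrow> smooth g \<Longrightarrow> smooth (\<lambda>x. f x * g x)"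
  by (rule product_sums_smooth) (rule product_sums.prod)

lemma smooth_add:
  assumes "smooth f" "smooth g" shows "smooth (\<lambda>x. f x + g x)"
proof -
  have "(\<lambda>x. f x * 1 + g x * 1) \<in> product_sums"
    by (intro product_sums.intros assms smooth_const)
  then show ?thesis by (simp add: product_sums_smooth)
qed

lemma smooth_cmult: "smooth f \<Longrightarrow> smooth (\<lambda>x. c * f x)"
  by (intro smooth_mult smooth_const)

lemma smooth_diff: assumes "smooth f" "smooth g" shows "smooth (\<lambda>x. f x - g x)"
  using smooth_add[OF assms(1) smooth_cmult[OF assms(2), of "-1"]] by simp

lemma smooth_sum: "(\<And>i. i \<in> I \<Longrightarrow> smooth (f i)) \<Longrightarrow> smooth (\<lambda>x. \<Sum>i\<in>I. f i x)"
  by (induction I rule: infinite_finite_induct) (auto intro: smooth_const smooth_add)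

lemma smooth_prod: "(\<And>i. i \<in> I \<Longrightarrow> smooth (f i)) \<Longrightarrow> smooth (\<lambda>x. \<Prod>i\<in>I. f i x)"
  by (induction I rule: infinite_finite_induct) (auto intro: smooth_const smooth_mult)

lemma smooth_power: "smooth f \<Longrightarrow> smooth (\<lambda>x. f x ^ n)"
  by (induction n) (auto intro: smooth_const smooth_mult)

lemma smooth_dir_deriv_cmult:
  "smooth f \<Longrightarrow> dir_deriv v (\<lambda>x. c * f x) = (\<lambda>x. c * dir_deriv v f x)"
  using smooth_dir_deriv_mult[OF smooth_const, of f v c] by (simp add: dir_deriv_const)

lemma smooth_dir_deriv_diff:
  "smooth f \<Longrightarrow> smooth g \<Longrightarrow> dir_deriv v (\<lambda>x. f x - g x) = (\<lambda>x. dir_deriv v f x - dir_deriv v g x)"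
  using smooth_dir_deriv_add[of f "\<lambda>x. (-1) * g x" v] smooth_dir_deriv_cmult[of g v "-1"]
  by (simp add: smooth_cmult[of g "-1", simplified])

lemma smooth_dir_deriv_sum:
  assumes "\<And>i. i \<in> I \<Longrightarrow> smooth (f i)"
  shows "dir_deriv v (\<lambda>x. \<Sum>i\<in>I. f i x) = (\<lambda>x. \<Sum>i\<in>I. dir_deriv v (f i) x)"
  using assms
  by (induction I rule: infinite_finite_induct)
     (auto simp: dir_deriv_const smooth_dir_deriv_add smooth_sum)

lemma smooth_continuous_on: "smooth f \<Longrightarrow> continuous_on S f"
  by (meson continuous_at_imp_continuous_on differentiable_imp_continuous_within smooth_differentiable)

lemma smooth_borel_measurable: "smooth f \<Longrightarrow> f \<in> borel_measurable borel"
  by (intro borel_measurable_continuous_onI smooth_continuous_on)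

lemma dir_deriv_line:
  assumes "f differentiable (at (x + r *\<^sub>R v))"
  shows "((\<lambda>r. f (x + r *\<^sub>R v)) has_real_derivative dir_deriv v f (x + r *\<^sub>R v)) (at r within S)"
proof -
  let ?D = "frechet_derivative f (at (x + r *\<^sub>R v))"
  have D: "(f has_derivative ?D) (at (x + r *\<^sub>R v))"
    using assms by (simp add: frechet_derivative_works)
  have "((\<lambda>r. f (x + r *\<^sub>R v)) has_derivative (\<lambda>h. ?D (h *\<^sub>R v))) (at r within S)"
    by (rule has_derivative_compose[where g = f]) (use D in \<open>auto intro!: derivative_eq_intros\<close>)
  moreover have "?D (h *\<^sub>R v) = h * ?D v" for h
    using has_derivative_linear[OF D] by (simp add: linear_cmul)
  ultimately show ?thesis
    by (simp add: has_field_derivative_def dir_deriv_def mult_commute_abs)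
qed

lemma smooth_line:
  "smooth f \<Longrightarrow> ((\<lambda>r. f (x + r *\<^sub>R v)) has_real_derivative dir_deriv v f (x + r *\<^sub>R v)) (at r within S)"
  by (intro dir_deriv_line smooth_differentiable)

lemma smooth_dir_deriv_Basis:
  assumes "smooth f"
  shows "dir_deriv v f x = (\<Sum>b\<in>Basis. (v \<bullet> b) * dir_deriv b f x)"
proof -
  have lin: "linear (\<lambda>v. dir_deriv v f x)"
    using smooth_has_derivative[OF assms] by (rule has_derivative_linear)
  have "dir_deriv v f x = dir_deriv (\<Sum>b\<in>Basis. (v \<bullet> b) *\<^sub>R b) f x"
    by (simp add: euclidean_representation)
  also have "\<dots> = (\<Sum>b\<in>Basis. (v \<bullet> b) * dir_deriv b f x)"
    using linear_sum[OF lin, of "\<lambda>b. (v \<bullet> b) *\<^sub>R b" Basis] linear_cmul[OF lin] by simp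
  finally show ?thesis .
qed

text \<open>The mean value theorem is used twice: along \<open>u\<close> for the difference of
  \<open>f\<close> and its translate by \<open>h *\<^sub>R v\<close>, then along \<open>v\<close>
  for the derivative so obtained. The left side is symmetric in \<open>u\<close> and
  \<open>v\<close> and the right side is not, which is what \<open>dir_deriv_commute\<close>
  exploits.\<close>

lemma second_difference_mean_value:
  assumes f: "smooth f" and u: "u \<in> Basis" and h: "h > 0"
  obtains p where "dist p x \<le> h * (norm u + norm v)"
    "f (x + h *\<^sub>R u + h *\<^sub>R v) - f (x + h *\<^sub>R u) - f (x + h *\<^sub>R v) + f x
      = h\<^sup>2 * dir_deriv v (dir_deriv u f) p"
proof -
  define \<phi> where "\<phi> r = f ((x + h *\<^sub>R v) + r *\<^sub>R u) - f (x + r *\<^sub>R u)" for r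
  define g where "g = dir_deriv u f"
  have g: "smooth g" unfolding g_def by (intro smooth_dir_deriv f u)
  have "(\<phi> has_real_derivative g ((x + h *\<^sub>R v) + r *\<^sub>R u) - g (x + r *\<^sub>R u)) (at r)" for r
    unfolding \<phi>_def g_def by (intro DERIV_diff smooth_line f)
  from MVT2[OF h this] obtain \<xi> where \<xi>: "0 < \<xi>" "\<xi> < h"
    "\<phi> h - \<phi> 0 = h * (g ((x + h *\<^sub>R v) + \<xi> *\<^sub>R u) - g (x + \<xi> *\<^sub>R u))" by auto
  have "((\<lambda>r. g ((x + \<xi> *\<^sub>R u) + r *\<^sub>R v)) has_real_derivative
      dir_deriv v g ((x + \<xi> *\<^sub>R u) + r *\<^sub>R v)) (at r)" for r
    by (rule smooth_line[OF g])
  from MVT2[OF h this] obtain \<zeta> where \<zeta>: "0 < \<zeta>" "\<zeta> < h"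
    "g (x + \<xi> *\<^sub>R u + h *\<^sub>R v) - g (x + \<xi> *\<^sub>R u) = h * dir_deriv v g ((x + \<xi> *\<^sub>R u) + \<zeta> *\<^sub>R v)" by auto
  define p where "p = (x + \<xi> *\<^sub>R u) + \<zeta> *\<^sub>R v"
  have "dist p x = norm (\<xi> *\<^sub>R u + \<zeta> *\<^sub>R v)" by (simp add: p_def dist_norm algebra_simps)
  also have "\<dots> \<le> \<xi> * norm u + \<zeta> * norm v"
    using norm_triangle_ineq[of "\<xi> *\<^sub>R u" "\<zeta> *\<^sub>R v"] \<xi> \<zeta> by simp
  also have "\<dots> \<le> h * norm u + h * norm v"
    using \<xi> \<zeta> by (intro add_mono mult_right_mono) auto
  finally have 1: "dist p x \<le> h * (norm u + norm v)" by (simp add: algebra_simps)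
  have "f (x + h *\<^sub>R u + h *\<^sub>R v) - f (x + h *\<^sub>R u) - f (x + h *\<^sub>R v) + f x = \<phi> h - \<phi> 0"
    by (simp add: \<phi>_def algebra_simps)
  also have "\<dots> = h * (h * dir_deriv v g p)"
    using \<xi>(3) \<zeta>(3) by (simp add: p_def algebra_simps)
  finally have "f (x + h *\<^sub>R u + h *\<^sub>R v) - f (x + h *\<^sub>R u) - f (x + h *\<^sub>R v) + f x = h\<^sup>2 * dir_deriv v g p"
    by (simp add: power2_eq_square)
  with 1 show ?thesis unfolding g_def by (rule that)
qed

lemma dir_deriv_commute:
  assumes f: "smooth f" and u: "u \<in> Basis" and v: "v \<in> Basis"
  shows "dir_deriv v (dir_deriv u f) = dir_deriv u (dir_deriv v f)"
proof
  fix x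
  let ?A = "dir_deriv v (dir_deriv u f)" and ?B = "dir_deriv u (dir_deriv v f)"
  have "continuous (at x) ?A" "continuous (at x) ?B"
    using smooth_continuous_on[of ?A UNIV] smooth_continuous_on[of ?B UNIV]
      smooth_dir_deriv[OF smooth_dir_deriv[OF f]] u v
    by (auto simp: continuous_on_eq_continuous_at)
  note c = this[unfolded continuous_at_eps_delta, rule_format]
  have "\<bar>?A x - ?B x\<bar> \<le> e" if e: "e > 0" for e
  proof -
    obtain d1 where d1: "d1 > 0" "\<And>y. dist y x < d1 \<Longrightarrow> dist (?A y) (?A x) < e / 2"
      using c(1)[of "e/2"] e by (auto simp: )
    obtain d2 where d2: "d2 > 0" "\<And>y. dist y x < d2 \<Longrightarrow> dist (?B y) (?B x) < e / 2"
      using c(2)[of "e/2"] e by (auto simp: )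
    \<comment> \<open>Basis vectors have norm 1, so both intermediate points lie within
      \<open>2 * h\<close> of \<open>x\<close>, hence in both neighbourhoods.\<close>
    define h where "h = min d1 d2 / 4"
    have h: "h > 0" using d1 d2 by (simp add: h_def)
    have hd: "h * (1 + 1) < d1" "h * (1 + 1) < d2" using d1(1) d2(1) by (auto simp: h_def min_def)
    obtain p where p: "dist p x \<le> h * (norm u + norm v)"
      "f (x + h *\<^sub>R u + h *\<^sub>R v) - f (x + h *\<^sub>R u) - f (x + h *\<^sub>R v) + f x = h\<^sup>2 * ?A p"
      using second_difference_mean_value[OF f u h] by blast
    obtain q where q: "dist q x \<le> h * (norm v + norm u)"
      "f (x + h *\<^sub>R v + h *\<^sub>R u) - f (x + h *\<^sub>R v) - f (x + h *\<^sub>R u) + f x = h\<^sup>2 * ?B q"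
      using second_difference_mean_value[OF f v h] by blast
    have "h\<^sup>2 * ?A p = h\<^sup>2 * ?B q"
      unfolding p(2)[symmetric] q(2)[symmetric] by (simp add: algebra_simps)
    then have "?A p = ?B q" using h by simp
    moreover have "dist (?A p) (?A x) < e/2" using p(1) u v hd by (intro d1) auto
    moreover have "dist (?B q) (?B x) < e/2" using q(1) u v hd by (intro d2) auto
    ultimately show ?thesis unfolding dist_real_def by linarith
  qed
  then have "\<bar>?A x - ?B x\<bar> \<le> 0" by (rule field_le_epsilon[of _ 0, simplified])
  then show "?A x = ?B x" by simp
qed

section \<open>Flat functions and bumps supported in boxes\<close>

definition flat :: "real poly \<Rightarrow> real \<Rightarrow> real" where
  "flat p x = (if x > 0 then poly p (1 / x) * exp (- (1 / x)) else 0)"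

lemma poly_times_exp_minus_tendsto_0: "((\<lambda>y. poly p y * exp (- y :: real)) \<longlongrightarrow> 0) at_top"
proof -
  have "((\<lambda>y. \<Sum>i\<le>degree p. coeff p i * (y ^ i / exp y)) \<longlongrightarrow> (\<Sum>i\<le>degree p. coeff p i * 0)) at_top"
    by (intro tendsto_sum tendsto_mult tendsto_const tendsto_power_div_exp_0)
  then show ?thesis
    by (simp add: poly_altdef sum_distrib_right exp_minus divide_inverse mult.assoc)
qed

text \<open>In the variable \<open>y = 1/x\<close> the derivative of \<open>p(y) * exp (- y)\<close>
  is \<open>y\<^sup>2 * (p - p')(y) * exp (- y)\<close>, and \<open>[:0, 0, 1:]\<close> is the
  square of the variable; so the family indexed by polynomials is closed under differentiation. At
  the origin the right difference quotient is \<open>y * p(y) * exp (- y)\<close>, which tends to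
  0.\<close>

lemma flat_has_derivative:
  "(flat p has_real_derivative flat ([:0, 0, 1:] * (p - pderiv p)) x) (at x)"
proof -
  consider "x > 0" | "x < 0" | "x = 0" by linarith
  then show ?thesis
  proof cases
    case 1
    have "((\<lambda>x. poly p (1 / x) * exp (- (1 / x))) has_real_derivative flat ([:0, 0, 1:] * (p - pderiv p)) x) (at x)"
      unfolding flat_def using 1
      by (auto intro!: derivative_eq_intros DERIV_chain2[OF poly_DERIV] simp: field_simps power2_eq_square)
    then show ?thesis
      by (rule has_field_derivative_transform_within_open[where S = "{0<..}"]) (use 1 in \<open>auto simp: flat_def\<close>)
  next
    case 2
    have "((\<lambda>x. 0) has_real_derivative flat ([:0, 0, 1:] * (p - pderiv p)) x) (at x)"
      using 2 by (auto simp: flat_def)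
    then show ?thesis
      by (rule has_field_derivative_transform_within_open[where S = "{..<0}"]) (use 2 in \<open>auto simp: flat_def\<close>)
  next
    case 3
    have "((\<lambda>y. poly ([:0,1:] * p) y * exp (- y)) \<longlongrightarrow> 0) at_top"
      by (rule poly_times_exp_minus_tendsto_0)
    then have "((\<lambda>h. poly ([:0,1:] * p) (inverse h) * exp (- inverse h)) \<longlongrightarrow> 0) (at_right 0)"
      by (rule filterlim_compose[OF _ filterlim_inverse_at_top_right])
    then have R: "((\<lambda>h. flat p h / h) \<longlongrightarrow> 0) (at_right 0)"
      by (rule Lim_transform_eventually)
         (auto simp: eventually_at_filter flat_def field_simps)
    have L: "((\<lambda>h. flat p h / h) \<longlongrightarrow> 0) (at_left 0)"
      by (rule Lim_transform_eventually[OF tendsto_const])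
         (auto simp: eventually_at_filter flat_def)
    have "((\<lambda>h. flat p h / h) \<longlongrightarrow> 0) (at 0)"
      using L R by (rule filterlim_split_at)
    then show ?thesis using 3 by (simp add: DERIV_def flat_def)
  qed
qed

lemma smooth_flat: "smooth (\<lambda>z. flat p (c + z \<bullet> v))"
proof (rule smooth_coinduct[where C = "range (\<lambda>p z. flat p (c + z \<bullet> v))"])
  have D: "((\<lambda>z. flat p (c + z \<bullet> v)) has_derivative
     (\<lambda>h. (h \<bullet> v) * flat ([:0, 0, 1:] * (p - pderiv p)) (c + x \<bullet> v))) (at x)" for p x
  proof -
    have 1: "((\<lambda>z. c + z \<bullet> v) has_derivative (\<lambda>h. h \<bullet> v)) (at x)"
      by (auto intro!: derivative_eq_intros)
    show ?thesis
      using has_derivative_compose[OF 1 flat_has_derivative[unfolded has_field_derivative_def]]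
      by (simp only: mult.commute)
  qed
  fix g x b assume g: "g \<in> range (\<lambda>p z. flat p (c + z \<bullet> v))"
  then obtain p where p: "g = (\<lambda>z. flat p (c + z \<bullet> v))" by auto
  show "g differentiable (at x)"
    unfolding p by (rule differentiableI[OF D])
  \<comment> \<open>The chain rule factor is absorbed into the polynomial, so the derivative stays
    in the class.\<close>
  have "dir_deriv b g = (\<lambda>z. flat (smult (b \<bullet> v) ([:0, 0, 1:] * (p - pderiv p))) (c + z \<bullet> v))"
    unfolding p by (rule ext, subst dir_deriv_eq[OF D]) (simp add: flat_def algebra_simps)
  then show "dir_deriv b g \<in> range (\<lambda>p z. flat p (c + z \<bullet> v))" by blast
qed auto

definition bump :: "'a::euclidean_space \<Rightarrow> 'a \<Rightarrow> 'a \<Rightarrow> real" where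
  "bump a b z = (\<Prod>i\<in>Basis. flat 1 (z \<bullet> i - a \<bullet> i) * flat 1 (b \<bullet> i - z \<bullet> i))"

lemma flat_1_pos_iff: "flat 1 x > 0 \<longleftrightarrow> x > 0" and flat_1_bounds: "0 \<le> flat 1 x" "flat 1 x < 1"
  by (auto simp: flat_def)

lemma flat_1_nz_iff: "flat 1 x \<noteq> 0 \<longleftrightarrow> x > 0"
  by (auto simp: flat_def)

lemma smooth_bump: "smooth (bump a b)"
proof -
  have "smooth (\<lambda>z. \<Prod>i\<in>Basis. flat 1 (- (a \<bullet> i) + z \<bullet> i) * flat 1 (b \<bullet> i + z \<bullet> (- i)))"
    by (intro smooth_prod smooth_mult smooth_flat)
  then show ?thesis unfolding bump_def[abs_def] by (simp add: algebra_simps)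
qed

lemma bump_nz_iff: "bump a b z \<noteq> 0 \<longleftrightarrow> z \<in> box a b"
  by (auto simp: bump_def mem_box flat_1_nz_iff)

lemma bump_bounds: "0 \<le> bump a b z" "bump a b z < 1"
proof -
  show "0 \<le> bump a b z" unfolding bump_def by (intro prod_nonneg) (simp add: flat_1_bounds)
  have 1: "flat 1 x * flat 1 y < 1" for x y
    using mult_strict_mono'[OF flat_1_bounds(2) flat_1_bounds(2) flat_1_bounds(1) flat_1_bounds(1)] by simp
  have "bump a b z < (\<Prod>i\<in>(Basis::'a set). 1)"
    unfolding bump_def
    by (rule prod_mono_strict[where i = "SOME i. i \<in> Basis"])
       (auto simp: 1 flat_1_bounds some_in_eq intro!: less_imp_le[OF 1])
  then show "bump a b z < 1" by simp
qed

section \<open>Test functions and bounds that are uniform in the point\<close>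

lemma test_functionsD:
  assumes "f \<in> test_functions \<Omega>"
  shows "smooth f" "compact (closure {x. f x \<noteq> 0})" "closure {x. f x \<noteq> 0} \<subseteq> \<Omega>"
  using assms by (auto simp: test_functions_def)

lemma test_functionsI:
  assumes "smooth f" "compact K" "K \<subseteq> \<Omega>" "\<And>x. x \<notin> K \<Longrightarrow> f x = 0"
  shows "f \<in> test_functions \<Omega>"
proof -
  have "closure {x. f x \<noteq> 0} \<subseteq> K"
    using assms by (intro closure_minimal compact_imp_closed) auto
  moreover from this have "compact (closure {x. f x \<noteq> 0})"
    using compact_Int_closed[OF assms(2), of "closure {x. f x \<noteq> 0}"] by (simp add: Int_absorb1)
  ultimately show ?thesis using assms by (auto simp: test_functions_def)
qed

lemma outside_support: "x \<notin> closure {x. f x \<noteq> 0} \<Longrightarrow> f x = 0"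
  using closure_subset[of "{x. f x \<noteq> 0}"] by auto

lemma dir_deriv_outside_support:
  assumes "x \<notin> closure {x. f x \<noteq> 0}"
  shows "dir_deriv v f x = 0"
proof -
  have "((\<lambda>x. 0) has_derivative (\<lambda>v. 0)) (at x)" by simp
  then have "(f has_derivative (\<lambda>v. 0)) (at x)"
    by (rule has_derivative_transform_within_open[where s = "- closure {x. f x \<noteq> 0}"])
       (use assms in \<open>auto dest!: outside_support\<close>)
  then show ?thesis by (rule dir_deriv_eq)
qed

lemma test_functions_dir_deriv:
  assumes "f \<in> test_functions \<Omega>" "b \<in> Basis"
  shows "dir_deriv b f \<in> test_functions \<Omega>"
  by (rule test_functionsI[where K = "closure {x. f x \<noteq> 0}"],
      rule smooth_dir_deriv[OF test_functionsD(1)[OF assms(1)] assms(2)])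
     (use assms in \<open>auto dest: test_functionsD intro: dir_deriv_outside_support\<close>)

lemma test_functions_add:
  assumes "f \<in> test_functions \<Omega>" "g \<in> test_functions \<Omega>"
  shows "(\<lambda>x. f x + g x) \<in> test_functions \<Omega>"
proof (rule test_functionsI[where K = "closure {x. f x \<noteq> 0} \<union> closure {x. g x \<noteq> 0}"])
  fix x assume "x \<notin> closure {x. f x \<noteq> 0} \<union> closure {x. g x \<noteq> 0}"
  then show "f x + g x = 0" using outside_support[of x f] outside_support[of x g] by simp
qed (use test_functionsD[OF assms(1)] test_functionsD[OF assms(2)] in \<open>auto intro: smooth_add\<close>)

lemma test_functions_mult:
  assumes "f \<in> test_functions \<Omega>" "smooth g"
  shows "(\<lambda>x. f x * g x) \<in> test_functions \<Omega>" 
proof (rule test_functionsI[where K = "closure {x. f x \<noteq> 0}"])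
  fix x assume "x \<notin> closure {x. f x \<noteq> 0}"
  then show "f x * g x = 0" using outside_support[of x f] by simp
qed (use test_functionsD[OF assms(1)] assms in \<open>auto intro: smooth_mult\<close>)

lemma test_functions_cmult:
  "f \<in> test_functions \<Omega> \<Longrightarrow> (\<lambda>x. c * f x) \<in> test_functions \<Omega>"
  using test_functions_mult[OF _ smooth_const, of f \<Omega> c] by (simp add: mult.commute)

lemma test_functions_zero: "(\<lambda>x. 0) \<in> test_functions \<Omega>"
  by (simp add: test_functions_def smooth_const)

lemma test_functions_diff:
  "f \<in> test_functions \<Omega> \<Longrightarrow> g \<in> test_functions \<Omega> \<Longrightarrow> (\<lambda>x. f x - g x) \<in> test_functions \<Omega>"
  using test_functions_add[OF _ test_functions_cmult[of g \<Omega> "-1"]] by simp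

lemma test_functions_sum:
  "(\<And>i. i \<in> I \<Longrightarrow> f i \<in> test_functions \<Omega>) \<Longrightarrow> (\<lambda>x. \<Sum>i\<in>I. f i x) \<in> test_functions \<Omega>"
  by (induction I rule: infinite_finite_induct) (auto intro: test_functions_zero test_functions_add)

lemma test_functions_bounded:
  assumes "f \<in> test_functions \<Omega>"
  obtains B where "B \<ge> 0" "\<And>x. \<bar>f x\<bar> \<le> B"
proof -
  let ?K = "closure {x. f x \<noteq> 0}"
  have "compact (f ` ?K)"
    using test_functionsD[OF assms] by (intro compact_continuous_image smooth_continuous_on) auto
  then obtain B where B: "\<And>x. x \<in> ?K \<Longrightarrow> \<bar>f x\<bar> \<le> B"
    by (metis bounded_iff compact_imp_bounded image_eqI real_norm_def)
  have "\<bar>f x\<bar> \<le> max B 0" for x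
    using B[of x] outside_support[of x f] by (cases "x \<in> ?K") auto
  then show ?thesis by (intro that[of "max B 0"]) auto
qed

lemma test_functions_bounded_support:
  assumes "f \<in> test_functions \<Omega>"
  obtains \<rho> where "\<rho> > 0" "\<And>x. norm x > \<rho> \<Longrightarrow> f x = 0"
proof -
  obtain \<rho> where \<rho>: "\<rho> > 0" "\<And>x. x \<in> closure {x. f x \<noteq> 0} \<Longrightarrow> norm x \<le> \<rho>"
    using compact_imp_bounded[OF test_functionsD(2)[OF assms]] unfolding bounded_pos by auto
  then show ?thesis using that[of \<rho>] outside_support by (metis not_le)
qed

lemma test_functions_borel: "f \<in> test_functions \<Omega> \<Longrightarrow> f \<in> borel_measurable borel"
  by (intro smooth_borel_measurable test_functionsD)

lemma test_functions_integrable: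
  assumes "f \<in> test_functions \<Omega>"
  shows "integrable lborel f"
proof -
  obtain B where B: "B \<ge> 0" "\<And>x. \<bar>f x\<bar> \<le> B" using test_functions_bounded[OF assms] by blast
  obtain \<rho> where \<rho>: "\<rho> > 0" "\<And>x. norm x > \<rho> \<Longrightarrow> f x = 0" using test_functions_bounded_support[OF assms] by blast
  have "integrable lborel (\<lambda>x. B * indicator (cball 0 \<rho>) x)"
    by (intro integrable_mult_right integrable_real_indicator) (auto simp: emeasure_lborel_cball_finite[simplified])
  then show ?thesis
    by (rule Bochner_Integration.integrable_bound)
       (use B \<rho> test_functions_borel[OF assms] in \<open>auto simp: indicator_def split: if_splits intro!: AE_I2\<close>)
qed

lemma test_functions_Lipschitz:
  assumes "f \<in> test_functions \<Omega>"
  obtains C where "C \<ge> 0" "\<And>x v. \<bar>f (x + v) - f x\<bar> \<le> C * norm v"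
proof -
  have "\<exists>B\<ge>0. \<forall>x. \<bar>dir_deriv b f x\<bar> \<le> B" if "b \<in> Basis" for b
    using test_functions_bounded[OF test_functions_dir_deriv[OF assms that]] by metis
  then obtain B where B: "\<And>b. b \<in> Basis \<Longrightarrow> B b \<ge> 0" "\<And>b x. b \<in> Basis \<Longrightarrow> \<bar>dir_deriv b f x\<bar> \<le> B b"
    by metis
  define C where "C = (\<Sum>b\<in>Basis. B b)"
  have D: "\<bar>dir_deriv v f x\<bar> \<le> C * norm v" for x v
  proof -
    have "\<bar>dir_deriv v f x\<bar> \<le> (\<Sum>b\<in>Basis. \<bar>v \<bullet> b\<bar> * \<bar>dir_deriv b f x\<bar>)"
      unfolding smooth_dir_deriv_Basis[OF test_functionsD(1)[OF assms], of v]
      by (rule order_trans[OF sum_abs]) (simp add: abs_mult)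
    also have "\<dots> \<le> (\<Sum>b\<in>Basis. norm v * B b)"
      by (intro sum_mono mult_mono B Basis_le_norm) auto
    finally show ?thesis by (simp add: C_def sum_distrib_left mult.commute)
  qed
  have "\<bar>f (x + v) - f x\<bar> \<le> C * norm v" for x v
  proof -
    have "((\<lambda>r. f (x + r *\<^sub>R v)) has_real_derivative dir_deriv v f (x + r *\<^sub>R v)) (at r)" for r
      by (rule smooth_line[OF test_functionsD(1)[OF assms]])
    from MVT2[of 0 1, OF _ this] obtain r where "f (x + v) - f x = dir_deriv v f (x + r *\<^sub>R v)" by auto
    then show ?thesis using D by simp
  qed
  then show ?thesis using that[of C] B by (auto simp: C_def intro: sum_nonneg)
qed

text \<open>The constant comes from Lipschitz bounds of the partial derivatives and does not depend
  on \<open>x\<close>, so the remainder can be integrated against any integrable kernel. This is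
  what differentiates \<open>conv\<close>.\<close>

lemma test_functions_Taylor:
  assumes "f \<in> test_functions \<Omega>"
  obtains C where "C \<ge> 0" "\<And>x v. \<bar>f (x + v) - f x - dir_deriv v f x\<bar> \<le> C * (norm v)\<^sup>2"
proof -
  have "\<exists>B\<ge>0. \<forall>x v. \<bar>dir_deriv b f (x + v) - dir_deriv b f x\<bar> \<le> B * norm v" if "b \<in> Basis" for b
    using test_functions_Lipschitz[OF test_functions_dir_deriv[OF assms that]] by metis
  then obtain B where B: "\<And>b. b \<in> Basis \<Longrightarrow> B b \<ge> 0"
    "\<And>b x v. b \<in> Basis \<Longrightarrow> \<bar>dir_deriv b f (x + v) - dir_deriv b f x\<bar> \<le> B b * norm v"
    by metis
  define C where "C = (\<Sum>b\<in>Basis. B b)"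
  note Basis_eq = smooth_dir_deriv_Basis[OF test_functionsD(1)[OF assms]]
  have "\<bar>f (x + v) - f x - dir_deriv v f x\<bar> \<le> C * (norm v)\<^sup>2" for x v
  proof -
    have "((\<lambda>r. f (x + r *\<^sub>R v)) has_real_derivative dir_deriv v f (x + r *\<^sub>R v)) (at r)" for r
      by (rule smooth_line[OF test_functionsD(1)[OF assms]])
    from MVT2[of 0 1, OF _ this] obtain r where
      r: "0 < r" "r < 1" "f (x + v) - f x = dir_deriv v f (x + r *\<^sub>R v)" by auto
    have "\<bar>f (x + v) - f x - dir_deriv v f x\<bar>
        = \<bar>\<Sum>b\<in>Basis. (v \<bullet> b) * (dir_deriv b f (x + r *\<^sub>R v) - dir_deriv b f x)\<bar>"
      unfolding r(3) Basis_eq[of v] by (simp only: sum_subtractf right_diff_distrib)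
    also have "\<dots> \<le> (\<Sum>b\<in>Basis. \<bar>v \<bullet> b\<bar> * \<bar>dir_deriv b f (x + r *\<^sub>R v) - dir_deriv b f x\<bar>)"
      by (rule order_trans[OF sum_abs]) (simp add: abs_mult)
    also have "\<dots> \<le> (\<Sum>b\<in>Basis. norm v * (B b * norm v))"
    proof (intro sum_mono mult_mono Basis_le_norm)
      fix b :: 'a assume b: "b \<in> Basis"
      have "\<bar>dir_deriv b f (x + r *\<^sub>R v) - dir_deriv b f x\<bar> \<le> B b * norm (r *\<^sub>R v)" by (rule B(2)[OF b])
      also have "\<dots> \<le> B b * norm v" using r B(1)[OF b] by (intro mult_left_mono) (auto simp: mult_left_le_one_le)
      finally show "\<bar>dir_deriv b f (x + r *\<^sub>R v) - dir_deriv b f x\<bar> \<le> B b * norm v" .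
    qed auto
    finally show ?thesis by (simp add: C_def sum_distrib_left sum_distrib_right power2_eq_square mult_ac)
  qed
  then show ?thesis using that[of C] B by (auto simp: C_def intro: sum_nonneg)
qed

text \<open>The parameter \<open>\<omega>\<close> may carry more than a displacement: with
  \<open>\<pi>\<close> the identity this is integration against a space-time kernel, and with
  \<open>\<pi> = fst\<close> the kernel also depends on a heat time that is integrated out. The
  displacement is added, so a kernel supported at positive times looks into the future of
  \<open>z\<close>, as the backward heat equation of test functions requires.\<close>

definition conv :: "'w measure \<Rightarrow> ('w \<Rightarrow> 'a::euclidean_space) \<Rightarrow> ('w \<Rightarrow> real) \<Rightarrow> ('a \<Rightarrow> real) \<Rightarrow> 'a \<Rightarrow> real" where
  "conv \<mu> \<pi> k f z = (\<integral>\<omega>. f (z + \<pi> \<omega>) * k \<omega> \<partial>\<mu>)"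

lemma conv_integrable:
  assumes f: "f \<in> test_functions \<Omega>" and [measurable]: "\<pi> \<in> borel_measurable \<mu>" and k: "integrable \<mu> k"
  shows "integrable \<mu> (\<lambda>\<omega>. f (z + \<pi> \<omega>) * k \<omega>)"
proof -
  obtain B where B: "B \<ge> 0" "\<And>x. \<bar>f x\<bar> \<le> B" using test_functions_bounded[OF f] by blast
  note [measurable] = test_functions_borel[OF f] borel_measurable_integrable[OF k]
  show ?thesis
    by (rule Bochner_Integration.integrable_bound[where f = "\<lambda>\<omega>. B * k \<omega>"])
       (use B k in \<open>auto intro!: AE_I2 mult_right_mono simp: abs_mult\<close>)
qed

text \<open>All derivatives fall on \<open>f\<close>, so the kernel may well be discontinuous. The
  quadratic Taylor remainder, uniform in the point, is integrated against the absolute value of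
  \<open>k\<close>; no interchange of limit and integral is involved.\<close>

lemma conv_has_derivative:
  fixes f :: "'a::euclidean_space \<Rightarrow> real"
  assumes f: "f \<in> test_functions \<Omega>" and \<pi>: "\<pi> \<in> borel_measurable \<mu>" and k: "integrable \<mu> k"
  shows "(conv \<mu> \<pi> k f has_derivative (\<lambda>v. \<Sum>b\<in>Basis. (v \<bullet> b) * conv \<mu> \<pi> k (dir_deriv b f) z)) (at z)"
proof -
  let ?D = "\<lambda>v. \<Sum>b\<in>Basis. (v \<bullet> b) * conv \<mu> \<pi> k (dir_deriv b f) z"
  note int = conv_integrable[OF f \<pi> k] 
  note int' = conv_integrable[OF test_functions_dir_deriv[OF f] \<pi> k] 
  obtain C where C: "C \<ge> 0" "\<And>x v. \<bar>f (x + v) - f x - dir_deriv v f x\<bar> \<le> C * (norm v)\<^sup>2"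
    using test_functions_Taylor[OF f] by blast
  define A where "A = C * (\<integral>\<omega>. \<bar>k \<omega>\<bar> \<partial>\<mu>)"
  have A: "A \<ge> 0" using C by (simp add: A_def)
  have bl: "bounded_linear ?D"
    by (rule bounded_linear_sum) (rule bounded_linear_mult_const[OF bounded_linear_inner_left])
  have rem: "\<bar>conv \<mu> \<pi> k f (z + v) - conv \<mu> \<pi> k f z - ?D v\<bar> \<le> A * (norm v)\<^sup>2" for v
  proof -
    have "conv \<mu> \<pi> k f (z + v) - conv \<mu> \<pi> k f z - ?D v =
      (\<integral>\<omega>. f (z + v + \<pi> \<omega>) * k \<omega> \<partial>\<mu>) - (\<integral>\<omega>. f (z + \<pi> \<omega>) * k \<omega> \<partial>\<mu>)
       - (\<integral>\<omega>. (\<Sum>b\<in>Basis. (v \<bullet> b) * (dir_deriv b f (z + \<pi> \<omega>) * k \<omega>)) \<partial>\<mu>)"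
      unfolding conv_def by (subst Bochner_Integration.integral_sum) (auto intro!: int' integrable_mult_right)
    also have "\<dots> = (\<integral>\<omega>. f (z + v + \<pi> \<omega>) * k \<omega> - f (z + \<pi> \<omega>) * k \<omega> 
       - (\<Sum>b\<in>Basis. (v \<bullet> b) * (dir_deriv b f (z + \<pi> \<omega>) * k \<omega>)) \<partial>\<mu>)"
      by (subst Bochner_Integration.integral_diff,
          (intro int int' Bochner_Integration.integrable_sum Bochner_Integration.integrable_diff
            integrable_mult_right; assumption)+)+ (rule refl)
    also have "\<dots> = (\<integral>\<omega>. (f ((z + \<pi> \<omega>) + v) - f (z + \<pi> \<omega>) - dir_deriv v f (z + \<pi> \<omega>)) * k \<omega> \<partial>\<mu>)"
      by (intro Bochner_Integration.integral_cong refl)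
         (simp add: smooth_dir_deriv_Basis[OF test_functionsD(1)[OF f], of v] left_diff_distrib
            sum_distrib_right mult.assoc add_ac)
    finally have "\<bar>conv \<mu> \<pi> k f (z + v) - conv \<mu> \<pi> k f z - ?D v\<bar> \<le>
      (\<integral>\<omega>. \<bar>(f ((z + \<pi> \<omega>) + v) - f (z + \<pi> \<omega>) - dir_deriv v f (z + \<pi> \<omega>)) * k \<omega>\<bar> \<partial>\<mu>)"
      by (simp add: integral_abs_bound)
    also have "\<dots> \<le> (\<integral>\<omega>. (C * (norm v)\<^sup>2) * \<bar>k \<omega>\<bar> \<partial>\<mu>)"
      by (rule Bochner_Integration.integral_mono')
         (use k C in \<open>auto intro!: mult_right_mono integrable_mult_right integrable_abs simp: abs_mult\<close>)
    finally show ?thesis by (simp add: A_def mult_ac)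
  qed
  have "((\<lambda>v::'a. A * norm v) \<longlongrightarrow> A * norm (0::'a)) (at 0)"
    by (intro tendsto_mult_left tendsto_norm tendsto_ident_at)
  then have lim: "((\<lambda>v::'a. A * norm v) \<longlongrightarrow> 0) (at 0)" by simp
  have "((\<lambda>v. norm (conv \<mu> \<pi> k f (z + v) - conv \<mu> \<pi> k f z - ?D v) / norm v) \<longlongrightarrow> 0) (at 0)"
  proof (rule tendsto_0_le[OF lim, where K = 1], rule always_eventually, rule allI)
    fix v
    define e where "e = \<bar>conv \<mu> \<pi> k f (z + v) - conv \<mu> \<pi> k f z - ?D v\<bar>"
    have "e \<le> A * (norm v)\<^sup>2" using rem[of v] by (simp only: e_def)
    then have "e / norm v \<le> A * norm v"
      using A by (cases "v = 0") (simp_all add: pos_divide_le_eq power2_eq_square mult.assoc)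
    then have "\<bar>e / norm v\<bar> \<le> \<bar>A * norm v\<bar> * 1" using A by (simp add: e_def)
    then show "norm (norm (conv \<mu> \<pi> k f (z + v) - conv \<mu> \<pi> k f z - ?D v) / norm v) \<le> norm (A * norm v) * 1"
      by (simp only: e_def real_norm_def)
  qed
  then show ?thesis unfolding has_derivative_at using bl by blast
qed

lemma conv_dir_deriv:
  assumes f: "f \<in> test_functions \<Omega>" and \<pi>: "\<pi> \<in> borel_measurable \<mu>" and k: "integrable \<mu> k"
    and b: "b \<in> Basis"
  shows "dir_deriv b (conv \<mu> \<pi> k f) = conv \<mu> \<pi> k (dir_deriv b f)"
  by (rule ext, subst dir_deriv_eq[OF conv_has_derivative[OF f \<pi> k]])
     (use b in \<open>simp add: inner_Basis if_distrib[where f = "\<lambda>c. c * _"] cong: if_cong\<close>)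

lemma smooth_conv:
  fixes f :: "'a::euclidean_space \<Rightarrow> real"
  assumes f: "f \<in> test_functions \<Omega>" and \<pi>: "\<pi> \<in> borel_measurable \<mu>" and k: "integrable \<mu> k"
  shows "smooth (conv \<mu> \<pi> k f)"
proof (rule smooth_coinduct[where C = "conv \<mu> \<pi> k ` test_functions \<Omega>"])
  fix g b x assume "g \<in> conv \<mu> \<pi> k ` test_functions \<Omega>"
  then show "g differentiable (at x)"
    using conv_has_derivative[OF _ \<pi> k] by (auto simp: differentiable_def)
next
  fix g and b :: 'a assume "g \<in> conv \<mu> \<pi> k ` test_functions \<Omega>" "b \<in> Basis"
  then show "dir_deriv b g \<in> conv \<mu> \<pi> k ` test_functions \<Omega>"
    by (auto simp: conv_dir_deriv[OF _ \<pi> k] intro!: imageI test_functions_dir_deriv)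
qed (use f in auto)

text \<open>Each difference quotient integrates to zero by translation invariance, and dominated
  convergence hands this on to the derivative. Only the direction \<open>v\<close> is looked at,
  because the kernels to which this is applied jump in their time variables.\<close>

lemma integral_dir_deriv_zero:
  fixes F F' :: "'a::euclidean_space \<Rightarrow> real"
  assumes [measurable]: "F \<in> borel_measurable borel" "F' \<in> borel_measurable borel"
    and deriv: "\<And>x. ((\<lambda>r. F (x + r *\<^sub>R v)) has_real_derivative F' x) (at 0)"
    and bound: "\<And>x. \<bar>F' x\<bar> \<le> B" and int: "integrable lborel F"
    and supp: "\<And>x. norm x > \<rho> \<Longrightarrow> F x = 0"
  shows "(\<integral>x. F' x \<partial>lborel) = 0"
proof -
  define h where "h n = 1 / real (Suc n)" for n
  have h: "h n > 0" "h n \<le> 1" for n by (auto simp: h_def)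
  have h0: "h \<longlonglongrightarrow> 0" unfolding h_def using lim_1_over_n[THEN LIMSEQ_Suc] by simp
  define D where "D n x = (F (x + h n *\<^sub>R v) - F x) / h n" for n x
  have B: "B \<ge> 0" using bound[of 0] by linarith
  have deriv': "((\<lambda>r. F (x + r *\<^sub>R v)) has_real_derivative F' (x + r *\<^sub>R v)) (at r)" for x r
    using DERIV_shift[of "\<lambda>r. F (x + r *\<^sub>R v)" "F' (x + r *\<^sub>R v)" 0 r] deriv[of "x + r *\<^sub>R v"]
    by (simp add: scaleR_left_distrib add_ac)
  have "(\<lambda>n. \<integral>x. D n x \<partial>lborel) \<longlonglongrightarrow> (\<integral>x. F' x \<partial>lborel)"
  \<comment> \<open>The steps \<open>h n\<close> are at most 1, so all quotients vanish outside the
    ball of radius \<open>\<rho> + norm v\<close>; inside it the mean value theorem bounds them by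
    \<open>B\<close>.\<close>
  proof (rule integral_dominated_convergence[where w = "\<lambda>x. B * indicator (cball 0 (\<rho> + norm v)) x"])
    show "integrable lborel (\<lambda>x. B * indicator (cball 0 (\<rho> + norm v)) x)"
      by (intro integrable_mult_right integrable_real_indicator) (auto simp: emeasure_lborel_cball_finite[simplified])
    show "AE x in lborel. (\<lambda>n. D n x) \<longlonglongrightarrow> F' x"
    proof (rule AE_I2)
      fix x
      have "(\<lambda>t. (F (x + t *\<^sub>R v) - F x) / t) \<midarrow>0\<rightarrow> F' x"
        using deriv[of x] by (simp add: DERIV_def)
      moreover have "filterlim h (at 0) sequentially"
        using h0 h(1) by (auto simp: filterlim_at intro!: always_eventually less_imp_neq[symmetric])
      ultimately show "(\<lambda>n. D n x) \<longlonglongrightarrow> F' x"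
        unfolding D_def by (rule filterlim_compose)
    qed
    fix n
    show "AE x in lborel. norm (D n x) \<le> B * indicator (cball 0 (\<rho> + norm v)) x"
    proof (rule AE_I2)
      fix x
      show "norm (D n x) \<le> B * indicator (cball 0 (\<rho> + norm v)) x"
      proof (cases "norm x \<le> \<rho> + norm v")
        case True
        from MVT2[OF h(1) deriv', of n x] obtain r where "F (x + h n *\<^sub>R v) - F x = h n * F' (x + r *\<^sub>R v)" by auto
        then have "D n x = F' (x + r *\<^sub>R v)" using h(1)[of n] by (simp add: D_def)
        then show ?thesis using True bound by (simp add: dist_norm)
      next
        case False
        have "norm (h n *\<^sub>R v) \<le> norm v" using h[of n] by (simp add: mult_left_le_one_le)
        then have "norm (x + h n *\<^sub>R v) > \<rho>" 
          using False norm_triangle_ineq4[of "x + h n *\<^sub>R v" "h n *\<^sub>R v"] by simp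
        moreover have "norm x > \<rho>" using False norm_ge_zero[of v] by linarith
        ultimately show ?thesis using False by (simp add: D_def supp dist_norm)
      qed
    qed
  qed (auto simp: D_def)
  moreover have "(\<integral>x. D n x \<partial>lborel) = 0" for n
  proof -
    let ?c = "h n *\<^sub>R v"
    have eq: "lborel = distr lborel borel (\<lambda>x. ?c + x)" using lborel_distr_plus[of ?c] by simp
    have int': "integrable lborel (\<lambda>x. F (x + ?c))"
      using int by (subst (asm) eq, subst (asm) integrable_distr_eq) (auto simp: add.commute)
    have "(\<integral>x. F x \<partial>lborel) = (\<integral>x. F (x + ?c) \<partial>lborel)"
      by (subst eq, subst integral_distr) (auto simp: add.commute)
    then show ?thesis unfolding D_def using int int' by simp
  qed
  ultimately show ?thesis by (simp add: LIMSEQ_const_iff)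
qed

section \<open>Elimination of the pressure\<close>

abbreviation lap :: "(real \<times> (real^3) \<Rightarrow> real) \<Rightarrow> real \<times> (real^3) \<Rightarrow> real" where
  "lap f \<equiv> (\<lambda>z. \<Sum>j\<in>UNIV. dir_deriv (space_dir j) (dir_deriv (space_dir j) f) z)"

abbreviation heat :: "(real \<times> (real^3) \<Rightarrow> real) \<Rightarrow> real \<times> (real^3) \<Rightarrow> real" where
  "heat f \<equiv> (\<lambda>z. dir_deriv time_dir f z + lap f z)"

text \<open>The vector field with components \<open>leray k i f\<close> is \<open>curl curl (f e\<^sub>k)\<close>.\<close>

definition leray :: "3 \<Rightarrow> 3 \<Rightarrow> (real \<times> (real^3) \<Rightarrow> real) \<Rightarrow> real \<times> (real^3) \<Rightarrow> real" where
  "leray k i f = (\<lambda>z. dir_deriv (space_dir i) (dir_deriv (space_dir k) f) z - (if i = k then lap f z else 0))"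

lemma time_dir_Basis [simp]: "time_dir \<in> Basis"
  by (simp add: Basis_prod_def)

lemma space_dir_Basis [simp]: "space_dir j \<in> Basis"
  by (auto simp: Basis_prod_def Basis_vec_def)

lemma test_functions_lap: "f \<in> test_functions \<Omega> \<Longrightarrow> lap f \<in> test_functions \<Omega>"
  by (intro test_functions_sum test_functions_dir_deriv space_dir_Basis)

lemma test_functions_heat: "f \<in> test_functions \<Omega> \<Longrightarrow> heat f \<in> test_functions \<Omega>"
  by (intro test_functions_add test_functions_lap test_functions_dir_deriv time_dir_Basis)

lemma test_functions_leray: "f \<in> test_functions \<Omega> \<Longrightarrow> leray k i f \<in> test_functions \<Omega>"
  unfolding leray_def
  by (cases "i = k")
     (auto intro!: test_functions_diff test_functions_lap test_functions_dir_deriv)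

lemma smooth_lap: "smooth f \<Longrightarrow> smooth (lap f)"
  by (intro smooth_sum smooth_dir_deriv space_dir_Basis)

lemma dir_deriv_lap:
  assumes "smooth f" "b \<in> Basis"
  shows "dir_deriv b (lap f) = lap (dir_deriv b f)"
proof -
  have "dir_deriv b (lap f) = (\<lambda>z. \<Sum>j\<in>UNIV. dir_deriv b (dir_deriv (space_dir j) (dir_deriv (space_dir j) f)) z)"
    by (intro smooth_dir_deriv_sum smooth_dir_deriv space_dir_Basis assms)
  also have "\<dots> = lap (dir_deriv b f)"
    by (simp add: dir_deriv_commute[OF _ space_dir_Basis assms(2)] smooth_dir_deriv assms)
  finally show ?thesis .
qed

lemma heat_dir_deriv:
  assumes "smooth f" "b \<in> Basis"
  shows "dir_deriv b (heat f) = heat (dir_deriv b f)"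
  using assms
  by (simp add: smooth_dir_deriv_add smooth_lap smooth_dir_deriv dir_deriv_lap
      dir_deriv_commute[OF assms(1) time_dir_Basis assms(2)])

lemma heat_diff: "smooth f \<Longrightarrow> smooth g \<Longrightarrow> heat (\<lambda>z. f z - g z) = (\<lambda>z. heat f z - heat g z)"
  by (rule ext) (simp add: smooth_dir_deriv_diff smooth_dir_deriv sum_subtractf)

text \<open>The form matters: the first term is the \<open>i\<close>-th derivative of a function
  that does not depend on \<open>i\<close>. Tested against the velocity and summed over
  \<open>i\<close>, it is annihilated by incompressibility, and only the Laplacian term
  remains.\<close>

lemma heat_leray:
  assumes f: "smooth f"
  shows "heat (leray k i f) = (\<lambda>z. dir_deriv (space_dir i) (heat (dir_deriv (space_dir k) f)) z
    - (if i = k then heat (lap f) z else 0))"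
proof -
  let ?g = "dir_deriv (space_dir i) (dir_deriv (space_dir k) f)"
  have g: "smooth ?g" by (intro smooth_dir_deriv f space_dir_Basis)
  have 1: "heat ?g = dir_deriv (space_dir i) (heat (dir_deriv (space_dir k) f))"
    by (intro heat_dir_deriv[symmetric] smooth_dir_deriv f space_dir_Basis)
  have 2: "heat (\<lambda>z. ?g z - lap f z) = (\<lambda>z. heat ?g z - heat (lap f) z)"
    by (rule heat_diff[OF g smooth_lap[OF f]])
  show ?thesis
  proof (cases "i = k")
    case True
    have L: "leray k i f = (\<lambda>z. ?g z - lap f z)" using True by (simp add: leray_def)
    show ?thesis unfolding L 2
      by (rule ext) (simp only: fun_cong[OF 1[unfolded True]] True if_True refl)
  next
    case False
    have L: "leray k i f = ?g" using False by (simp add: leray_def)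
    show ?thesis unfolding L
      by (rule ext) (simp only: fun_cong[OF 1] False if_False diff_zero)
  qed
qed

lemma div_leray:
  assumes f: "smooth f"
  shows "(\<Sum>i\<in>UNIV. dir_deriv (space_dir i) (leray k i f) z) = 0"
proof -
  have "dir_deriv (space_dir i) (leray k i f) z = dir_deriv (space_dir i) (dir_deriv (space_dir i) (dir_deriv (space_dir k) f)) z
     - (if i = k then dir_deriv (space_dir k) (lap f) z else 0)" for i
    unfolding leray_def using f
    by (cases "i = k") (simp_all add: smooth_dir_deriv_diff smooth_dir_deriv smooth_lap)
  then have "(\<Sum>i\<in>UNIV. dir_deriv (space_dir i) (leray k i f) z) 
    = lap (dir_deriv (space_dir k) f) z - dir_deriv (space_dir k) (lap f) z"
    by (simp add: sum_subtractf)
  then show ?thesis by (simp add: dir_deriv_lap f)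
qed

text \<open>Linearity turns the vanishing divergence of the field \<open>leray k i \<Psi>\<close>
  into a vanishing pairing with the pressure, however large the pressure is.\<close>

lemma distribution_zero_sum:
  assumes p: "distribution \<Omega> p" and \<phi>: "\<And>i. i \<in> I \<Longrightarrow> \<phi> i \<in> test_functions \<Omega>"
    and zero: "\<And>z. (\<Sum>i\<in>I. \<phi> i z) = 0"
  shows "(\<Sum>i\<in>I. p (\<phi> i)) = 0"
proof -
  have add: "p (\<lambda>x. f x + g x) = p f + p g" if "f \<in> test_functions \<Omega>" "g \<in> test_functions \<Omega>" for f g
    using p that unfolding distribution_def by blast
  have 0: "p (\<lambda>x. 0) = 0"
    using add[OF test_functions_zero test_functions_zero] by simp
  have "p (\<lambda>z. \<Sum>i\<in>I. \<phi> i z) = (\<Sum>i\<in>I. p (\<phi> i))" using \<phi>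
    by (induction I rule: infinite_finite_induct) (auto simp: 0 add test_functions_sum)
  then show ?thesis using zero 0 by simp
qed

text \<open>The \<open>i\<close>-th momentum equation is tested with \<open>leray k i \<Psi>\<close>
  and the results are added. The pressure terms cancel by \<open>div_leray\<close>; by
  \<open>heat_leray\<close> and incompressibility the linear terms reduce to minus
  \<open>heat (lap \<Psi>)\<close> tested against the single component \<open>k\<close>.\<close>

lemma NS_weak_form:
  assumes p: "distribution ({a<..<b} \<times> UNIV) p" and NS: "NS_equations a b u p"
    and int1: "\<And>i \<phi>. \<phi> \<in> test_functions ({a<..<b} \<times> UNIV) \<Longrightarrow>
      integrable (lebesgue_on ({a<..<b} \<times> UNIV)) (\<lambda>z. u z $ i * \<phi> z)"
    and \<Psi>: "\<Psi> \<in> test_functions ({a<..<b} \<times> UNIV)"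
  shows "fun_dist ({a<..<b} \<times> UNIV) (\<lambda>z. u z $ k) (heat (lap \<Psi>)) =
    (\<Sum>i\<in>UNIV. \<Sum>j\<in>UNIV. fun_dist ({a<..<b} \<times> UNIV) (\<lambda>z. u z $ i * u z $ j)
        (dir_deriv (space_dir j) (leray k i \<Psi>)))"
proof -
  define \<Omega> :: "(real \<times> (real^3)) set" where "\<Omega> = {a<..<b} \<times> UNIV"
  define T where "T i = fun_dist \<Omega> (\<lambda>z. u z $ i)" for i
  define S where "S i j = fun_dist \<Omega> (\<lambda>z. u z $ i * u z $ j)" for i j
  note int = int1[folded \<Omega>_def] and \<Psi> = \<Psi>[folded \<Omega>_def]
  have T_add: "T i (\<lambda>x. f x + g x) = T i f + T i g"
    if "f \<in> test_functions \<Omega>" "g \<in> test_functions \<Omega>" for i f g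
    unfolding T_def fun_dist_def using int[OF that(1), of i] int[OF that(2), of i]
    by (simp add: distrib_left)
  have T_diff: "T i (\<lambda>x. f x - g x) = T i f - T i g"
    if "f \<in> test_functions \<Omega>" "g \<in> test_functions \<Omega>" for i f g
    unfolding T_def fun_dist_def using int[OF that(1), of i] int[OF that(2), of i]
    by (simp add: right_diff_distrib)
  have T_sum: "T i (\<lambda>x. \<Sum>j\<in>J. f j x) = (\<Sum>j\<in>J. T i (f j))"
    if "\<And>j. j \<in> J \<Longrightarrow> f j \<in> test_functions \<Omega>" for i f and J :: "3 set"
    unfolding T_def fun_dist_def sum_distrib_left
    by (intro Bochner_Integration.integral_sum int that)
  have mom: "T i (heat \<phi>) + (\<Sum>j\<in>UNIV. S i j (dir_deriv (space_dir j) \<phi>)) + p (dir_deriv (space_dir i) \<phi>) = 0"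
    if \<phi>: "\<phi> \<in> test_functions \<Omega>" for i \<phi>
  proof -
    have "T i (heat \<phi>) = T i (dir_deriv time_dir \<phi>) + (\<Sum>j\<in>UNIV. T i (dir_deriv (space_dir j) (dir_deriv (space_dir j) \<phi>)))"
      using \<phi> by (simp add: T_add T_sum test_functions_dir_deriv test_functions_sum)
    moreover have "dist_deriv time_dir (T i) \<phi>
          - (\<Sum>j\<in>UNIV. dist_deriv (space_dir j) (dist_deriv (space_dir j) (T i)) \<phi>)
          + (\<Sum>j\<in>UNIV. dist_deriv (space_dir j) (S i j) \<phi>)
          + dist_deriv (space_dir i) p \<phi> = 0"
      using NS \<phi> unfolding NS_equations_def Let_def T_def S_def \<Omega>_def by blast
    ultimately show ?thesis by (simp add: dist_deriv_def sum_negf)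
  qed
  have div: "(\<Sum>i\<in>UNIV. T i (dir_deriv (space_dir i) \<phi>)) = 0" if \<phi>: "\<phi> \<in> test_functions \<Omega>" for \<phi>
  proof -
    have "(\<Sum>j\<in>UNIV. dist_deriv (space_dir j) (T j) \<phi>) = 0"
      using NS \<phi> unfolding NS_equations_def Let_def T_def \<Omega>_def by blast
    then show ?thesis by (simp add: dist_deriv_def sum_negf)
  qed
  have s\<Psi>: "smooth \<Psi>" using \<Psi> by (rule test_functionsD)
  let ?G = "heat (dir_deriv (space_dir k) \<Psi>)"
  have G: "?G \<in> test_functions \<Omega>"
    by (intro test_functions_heat test_functions_dir_deriv \<Psi> space_dir_Basis)
  have H: "heat (lap \<Psi>) \<in> test_functions \<Omega>"
    by (intro test_functions_heat test_functions_lap \<Psi>)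
  have "(\<Sum>i\<in>UNIV. p (dir_deriv (space_dir i) (leray k i \<Psi>))) = 0"
    by (intro distribution_zero_sum[OF p[folded \<Omega>_def]] test_functions_dir_deriv test_functions_leray \<Psi>
        space_dir_Basis div_leray s\<Psi>)
  moreover have "(\<Sum>i\<in>UNIV. T i (heat (leray k i \<Psi>)) + (\<Sum>j\<in>UNIV. S i j (dir_deriv (space_dir j) (leray k i \<Psi>)))
      + p (dir_deriv (space_dir i) (leray k i \<Psi>))) = 0"
    by (intro sum.neutral ballI mom test_functions_leray \<Psi>)
  ultimately have eq: "(\<Sum>i\<in>UNIV. T i (heat (leray k i \<Psi>)))
      + (\<Sum>i\<in>UNIV. \<Sum>j\<in>UNIV. S i j (dir_deriv (space_dir j) (leray k i \<Psi>))) = 0"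
    by (simp add: sum.distrib)
  have "T i (heat (leray k i \<Psi>)) = T i (dir_deriv (space_dir i) ?G) - (if i = k then T k (heat (lap \<Psi>)) else 0)" for i
    unfolding heat_leray[OF s\<Psi>]
    by (cases "i = k") (simp_all add: T_diff[OF test_functions_dir_deriv[OF G space_dir_Basis] H])
  then have "(\<Sum>i\<in>UNIV. T i (heat (leray k i \<Psi>))) = - T k (heat (lap \<Psi>))"
    using div[OF G] by (simp add: sum_subtractf)
  with eq show ?thesis unfolding T_def S_def \<Omega>_def by simp
qed

lemma power_le_one_plus_power:
  fixes x :: real
  assumes "0 \<le> x" "k \<le> n"
  shows "x ^ k \<le> 1 + x ^ n"
proof (cases "x \<le> 1")
  case True
  then show ?thesis using power_le_one[OF assms(1) True, of k] zero_le_power[OF assms(1), of n] by linarith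
next
  case False
  then have "x ^ k \<le> x ^ n" by (intro power_increasing assms) auto
  then show ?thesis by simp
qed

text \<open>The field \<open>u\<close> is only Lebesgue measurable on the slab and arbitrary outside
  it. A Borel representative extended by zero lives on the whole space, where Fubini, translations
  and reflections for \<open>lborel\<close> apply.\<close>

lemma NS_lborel_form:
  fixes u :: "real \<times> (real^3) \<Rightarrow> real^3"
  assumes sol: "NS_solution (-1) 1 u" and Lp: "Lp_space 6 ({-1..1} \<times> UNIV) u"
  obtains U :: "real \<times> (real^3) \<Rightarrow> real^3" where
    "U \<in> borel_measurable borel"
    "\<And>z. fst z \<notin> {-1<..<1} \<Longrightarrow> U z = 0"
    "AE z in lebesgue. fst z \<in> {-1<..<1} \<longrightarrow> u z = U z"
    "(\<integral>\<^sup>+z. ennreal (norm (U z) ^ 6) \<partial>lborel) \<le> ennreal (Lp_norm 6 ({-1..1} \<times> UNIV) u ^ 6)"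
    "\<And>k \<Psi>. \<Psi> \<in> test_functions ({-1<..<1} \<times> UNIV) \<Longrightarrow>
       (\<integral>z. U z $ k * heat (lap \<Psi>) z \<partial>lborel) =
       (\<Sum>i\<in>UNIV. \<Sum>j\<in>UNIV. \<integral>z. U z $ i * U z $ j * dir_deriv (space_dir j) (leray k i \<Psi>) z \<partial>lborel)"
proof -
  define S :: "(real \<times> (real^3)) set" where "S = {-1..1} \<times> UNIV"
  define \<Omega> :: "(real \<times> (real^3)) set" where "\<Omega> = {-1<..<1} \<times> UNIV"
  have S: "S \<in> sets lebesgue" unfolding S_def
    by (intro sets_completionI_sets) (simp add: borel_closed closed_Times)
  have \<Omega>b: "\<Omega> \<in> sets borel" unfolding \<Omega>_def by (simp add: borel_open open_Times)
  then have \<Omega>: "\<Omega> \<in> sets lebesgue" by (intro sets_completionI_sets) simp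
  have sub: "\<Omega> \<subseteq> S" by (auto simp: S_def \<Omega>_def)
  have meas: "(\<lambda>z. indicator S z *\<^sub>R u z) \<in> borel_measurable lebesgue"
    using sol S unfolding NS_solution_def S_def[symmetric]
    by (simp add: borel_measurable_restrict_space_iff)
  \<comment> \<open>The Borel representative is found for one real component at a time and the
    components are reassembled in \<open>U\<close>.\<close>
  have "\<exists>g\<in>borel_measurable lborel. AE z in lborel. indicator S z * u z $ i = g z" for i
  proof (rule completion_ex_borel_measurable_real)
    have "(\<lambda>z. (indicator S z *\<^sub>R u z) \<bullet> axis i 1) \<in> borel_measurable lebesgue"
      using meas by measurable
    then show "(\<lambda>z. indicator S z * u z $ i) \<in> borel_measurable lebesgue"
      by (simp add: inner_axis)
  qed
  then have "\<forall>i. \<exists>g. g \<in> borel_measurable lborel \<and> (AE z in lborel. indicator S z * u z $ i = g z)" by blast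
  from choice[OF this] obtain g where
    "\<forall>i. g i \<in> borel_measurable lborel \<and> (AE z in lborel. indicator S z * u z $ i = g i z)" by blast
  then have g [measurable]: "\<And>i. g i \<in> borel_measurable borel"
    and g_AE: "\<And>i. AE z in lborel. indicator S z * u z $ i = g i z" by simp_all
  \<comment> \<open>Cutting with the open slab instead of \<open>S\<close> makes \<open>U\<close>
    vanish exactly outside the open time interval; the equations say nothing at the two boundary
    times.\<close>
  define U where "U z = (\<Sum>i\<in>UNIV. (indicator \<Omega> z * g i z) *\<^sub>R (axis i 1 :: real^3))" for z
  note [measurable] = \<Omega>b
  have U [measurable]: "U \<in> borel_measurable borel" unfolding U_def[abs_def] by measurable
  have U_nth: "U z $ i = indicator \<Omega> z * g i z" for z i
    by (simp add: U_def sum_component axis_def if_distrib cong: if_cong)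
  have U0: "U z = 0" if "z \<notin> \<Omega>" for z using that by (simp add: vec_eq_iff U_nth)
  have "AE z in lborel. \<forall>i. indicator S z * u z $ i = g i z" using g_AE by (simp add: AE_all_countable)
  then have AE_lborel: "AE z in lborel. indicator \<Omega> z *\<^sub>R u z = U z"
    by eventually_elim (use sub in \<open>auto simp: vec_eq_iff U_nth indicator_def split: if_splits\<close>)
  then have AE: "AE z in lebesgue. indicator \<Omega> z *\<^sub>R u z = U z" by (rule AE_completion)
  have int6: "integrable (lebesgue_on S) (\<lambda>z. norm (u z) ^ 6)"
    using Lp unfolding Lp_space_def S_def[symmetric] by (simp add: powr_numeral)
  have N6: "(\<integral>\<^sup>+z. ennreal (norm (U z) ^ 6) \<partial>lborel) \<le> ennreal (\<integral>z. norm (u z) ^ 6 \<partial>lebesgue_on S)"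
  proof -
    have "(\<integral>\<^sup>+z. ennreal (norm (U z) ^ 6) \<partial>lborel) = (\<integral>\<^sup>+z. ennreal (norm (U z) ^ 6) \<partial>lebesgue)"
      by (simp add: nn_integral_completion)
    also have "\<dots> \<le> (\<integral>\<^sup>+z. ennreal (norm (u z) ^ 6) * indicator S z \<partial>lebesgue)"
    proof (rule nn_integral_mono_AE)
      show "AE z in lebesgue. ennreal (norm (U z) ^ 6) \<le> ennreal (norm (u z) ^ 6) * indicator S z"
        using AE
      proof eventually_elim
        case (elim z)
        then show ?case using sub U0[of z] by (cases "z \<in> \<Omega>") auto
      qed
    qed
    also have "\<dots> = (\<integral>\<^sup>+z. ennreal (norm (u z) ^ 6) \<partial>lebesgue_on S)"
      using S by (simp add: nn_integral_restrict_space)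
    also have "\<dots> = ennreal (\<integral>z. norm (u z) ^ 6 \<partial>lebesgue_on S)"
      by (rule nn_integral_eq_integral[OF int6]) simp
    finally show ?thesis .
  qed
  have Lp_pow: "(\<integral>z. norm (u z) ^ 6 \<partial>lebesgue_on S) = Lp_norm 6 S u ^ 6"
  proof -
    have "0 \<le> (\<integral>z. norm (u z) ^ 6 \<partial>lebesgue_on S)" by simp
    then have "(\<integral>z. norm (u z) ^ 6 \<partial>lebesgue_on S) = ((\<integral>z. norm (u z) ^ 6 \<partial>lebesgue_on S) powr (1 / 6)) powr 6"
      by (simp add: powr_powr)
    then show ?thesis unfolding Lp_norm_def by (simp add: powr_numeral)
  qed
  have U6: "integrable lborel (\<lambda>z. norm (U z) ^ 6)"
    using N6 by (intro integrableI_bounded) (auto intro: order_le_less_trans)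
  \<comment> \<open>Linear and quadratic expressions in \<open>U\<close> are both at most
    \<open>1 + norm (U z) ^ 6\<close>. The test function makes the 1 integrable, and the sixth power
    is integrable anyway.\<close>
  have U_int: "integrable lborel (\<lambda>z. v z * \<phi> z)"
    if \<phi>: "\<phi> \<in> test_functions \<Omega>" and [measurable]: "v \<in> borel_measurable borel" and v: "\<And>z. \<bar>v z\<bar> \<le> 1 + norm (U z) ^ 6" for v \<phi>
  proof -
    obtain B where B: "B \<ge> 0" "\<And>x. \<bar>\<phi> x\<bar> \<le> B" using test_functions_bounded[OF \<phi>] by blast
    have "integrable lborel (\<lambda>z. \<bar>\<phi> z\<bar> + B * norm (U z) ^ 6)"
      using U6 test_functions_integrable[OF \<phi>] by simp
    then show ?thesis
    proof (rule Bochner_Integration.integrable_bound)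
      show "(\<lambda>z. v z * \<phi> z) \<in> borel_measurable lborel" using test_functions_borel[OF \<phi>] by measurable
      show "AE z in lborel. norm (v z * \<phi> z) \<le> norm (\<bar>\<phi> z\<bar> + B * norm (U z) ^ 6)"
      proof (rule AE_I2)
        fix z
        have "\<bar>v z\<bar> * \<bar>\<phi> z\<bar> \<le> (1 + norm (U z) ^ 6) * \<bar>\<phi> z\<bar>" by (intro mult_right_mono v) auto
        also have "\<dots> \<le> \<bar>\<phi> z\<bar> + B * norm (U z) ^ 6"
          using mult_left_mono[OF B(2)[of z], of "norm (U z) ^ 6"] by (simp add: algebra_simps)
        finally show "norm (v z * \<phi> z) \<le> norm (\<bar>\<phi> z\<bar> + B * norm (U z) ^ 6)" by (simp add: abs_mult)
      qed
    qed
  qed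
  have N1: "norm (U z) \<le> 1 + norm (U z) ^ 6" for z
    using power_le_one_plus_power[of "norm (U z)" 1 6] by simp
  have v1: "\<bar>U z $ i\<bar> \<le> 1 + norm (U z) ^ 6" for z i
    using component_le_norm_cart[of "U z" i] N1[of z] by linarith
  \<comment> \<open>One transfer from \<open>lebesgue_on \<Omega>\<close> to \<open>lborel\<close>
    serves both integrands: \<open>a\<close> is an expression in \<open>u\<close> and
    \<open>v\<close> the same expression in \<open>U\<close>, equal wherever the two fields
    agree.\<close>
  have conv: "integrable (lebesgue_on \<Omega>) (\<lambda>z. a z * \<phi> z)" (is ?A)
    "(\<integral>z. a z * \<phi> z \<partial>lebesgue_on \<Omega>) = (\<integral>z. v z * \<phi> z \<partial>lborel)" (is ?B)
    if \<phi>: "\<phi> \<in> test_functions \<Omega>" and v [measurable]: "v \<in> borel_measurable borel"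
      and vi: "integrable lborel (\<lambda>z. v z * \<phi> z)"
      and av: "\<And>z. indicator \<Omega> z *\<^sub>R u z = U z \<Longrightarrow> indicator \<Omega> z * a z = v z" for v \<phi> a
  proof -
    note [measurable] = test_functions_borel[OF \<phi>]
    have eq: "AE z in lebesgue. indicator \<Omega> z *\<^sub>R (a z * \<phi> z) = v z * \<phi> z"
      using AE by eventually_elim (use av in \<open>auto simp: mult.assoc[symmetric]\<close>)
    have vm: "(\<lambda>z. v z * \<phi> z) \<in> borel_measurable lborel" by measurable
    have vm': "(\<lambda>z. v z * \<phi> z) \<in> borel_measurable lebesgue" by (rule measurable_completion[OF vm])
    have am: "(\<lambda>z. indicator \<Omega> z *\<^sub>R (a z * \<phi> z)) \<in> borel_measurable lebesgue"
    proof (rule borel_measurable_AE[OF vm'])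
      show "AE z in lebesgue. v z * \<phi> z = indicator \<Omega> z *\<^sub>R (a z * \<phi> z)"
        using eq by eventually_elim (rule sym)
    qed
    have "integrable lebesgue (\<lambda>z. v z * \<phi> z)" using vi vm by (simp add: integrable_completion)
    then have "integrable lebesgue (\<lambda>z. indicator \<Omega> z *\<^sub>R (a z * \<phi> z))"
      by (subst integrable_cong_AE[OF am vm' eq])
    then show ?A using \<Omega> by (simp add: integrable_restrict_space)
    show ?B using \<Omega> integral_cong_AE[OF am vm' eq] vm
      by (simp add: integral_restrict_space integral_completion)
  qed
  obtain p where p: "distribution \<Omega> p" and NS: "NS_equations (-1) 1 u p"
    using sol unfolding NS_solution_def \<Omega>_def by blast
  have i1: "integrable (lebesgue_on \<Omega>) (\<lambda>z. u z $ i * \<phi> z)"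
    "(\<integral>z. u z $ i * \<phi> z \<partial>lebesgue_on \<Omega>) = (\<integral>z. U z $ i * \<phi> z \<partial>lborel)"
    if \<phi>: "\<phi> \<in> test_functions \<Omega>" for i \<phi>
  proof -
    have 1: "indicator \<Omega> z * u z $ i = U z $ i" if "indicator \<Omega> z *\<^sub>R u z = U z" for z
      using arg_cong[OF that, of "\<lambda>v. v $ i"] by simp
    have 2: "(\<lambda>z. U z $ i) \<in> borel_measurable borel" by (simp add: U_nth)
    show "integrable (lebesgue_on \<Omega>) (\<lambda>z. u z $ i * \<phi> z)"
      by (rule conv(1)[OF \<phi> 2 U_int[OF \<phi> 2 v1] 1])
    show "(\<integral>z. u z $ i * \<phi> z \<partial>lebesgue_on \<Omega>) = (\<integral>z. U z $ i * \<phi> z \<partial>lborel)"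
      by (rule conv(2)[OF \<phi> 2 U_int[OF \<phi> 2 v1] 1])
  qed
  have v2: "\<bar>U z $ i * U z $ j\<bar> \<le> 1 + norm (U z) ^ 6" for z i j
  proof -
    have "\<bar>U z $ i * U z $ j\<bar> \<le> norm (U z) * norm (U z)"
      unfolding abs_mult by (intro mult_mono component_le_norm_cart) auto
    also have "\<dots> \<le> 1 + norm (U z) ^ 6"
      using power_le_one_plus_power[of "norm (U z)" 2 6] by (simp add: power2_eq_square)
    finally show ?thesis .
  qed
  have i2: "(\<integral>z. u z $ i * u z $ j * \<phi> z \<partial>lebesgue_on \<Omega>) = (\<integral>z. U z $ i * U z $ j * \<phi> z \<partial>lborel)"
    if \<phi>: "\<phi> \<in> test_functions \<Omega>" for i j \<phi>
  proof -
    have 1: "indicator \<Omega> z * (u z $ i * u z $ j) = U z $ i * U z $ j" if "indicator \<Omega> z *\<^sub>R u z = U z" for z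
      using arg_cong[OF that, of "\<lambda>v. v $ i"] arg_cong[OF that, of "\<lambda>v. v $ j"] U0[of z]
      by (cases "z \<in> \<Omega>") auto
    have 2: "(\<lambda>z. U z $ i * U z $ j) \<in> borel_measurable borel" by (simp add: U_nth)
    show ?thesis by (rule conv(2)[OF \<phi> 2 U_int[OF \<phi> 2 v2] 1])
  qed
  show ?thesis
  proof (rule that[OF U])
    show "U z = 0" if "fst z \<notin> {-1<..<1}" for z using that by (intro U0) (auto simp: \<Omega>_def)
    show "AE z in lebesgue. fst z \<in> {-1<..<1} \<longrightarrow> u z = U z"
      using AE by eventually_elim (auto simp: \<Omega>_def indicator_def split: if_splits)
    show "(\<integral>\<^sup>+z. ennreal (norm (U z) ^ 6) \<partial>lborel) \<le> ennreal (Lp_norm 6 ({-1..1} \<times> UNIV) u ^ 6)"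
      using N6 unfolding Lp_pow by (simp add: S_def)
    fix k and \<Psi> :: "real \<times> (real^3) \<Rightarrow> real" assume \<Psi>: "\<Psi> \<in> test_functions ({-1<..<1} \<times> (UNIV :: (real^3) set))"
    have t: "heat (lap \<Psi>) \<in> test_functions \<Omega>" "dir_deriv (space_dir j) (leray k i \<Psi>) \<in> test_functions \<Omega>" for i j
      using \<Psi> unfolding \<Omega>_def
      by (intro test_functions_heat test_functions_lap test_functions_leray test_functions_dir_deriv space_dir_Basis; assumption)+
    show "(\<integral>z. U z $ k * heat (lap \<Psi>) z \<partial>lborel) =
       (\<Sum>i\<in>UNIV. \<Sum>j\<in>UNIV. \<integral>z. U z $ i * U z $ j * dir_deriv (space_dir j) (leray k i \<Psi>) z \<partial>lborel)"
      using NS_weak_form[OF p[unfolded \<Omega>_def] NS i1(1)[unfolded \<Omega>_def] \<Psi>, of k]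
      unfolding fun_dist_def \<Omega>_def[symmetric] i1(2)[OF t(1)] i2[OF t(2)] .
  qed
qed

section \<open>Bounds for truncated heat kernels\<close>

text \<open>The two powers are integrable to the exponent \<open>6/5\<close> near zero and near infinity respectively. The kernel
  \<open>ker\<close> replaces the parabolic kernel \<open>(\<bar>y\<bar> + s powr (1/2)) powr -4\<close>, up to a constant, by a larger product of
  functions of one variable.\<close>

definition hm :: "real \<Rightarrow> real" where
  "hm r = min (\<bar>r\<bar> powr (-4/5)) (\<bar>r\<bar> powr (-9/10))"

definition ker :: "real \<times> (real^3) \<Rightarrow> real" where
  "ker w = indicator {0<..<2} (fst w) * fst w powr (-4/5) * (\<Prod>i\<in>UNIV. hm (snd w $ i))"

lemma hm_nonneg: "0 \<le> hm r" by (simp add: hm_def)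

lemma ker_nonneg: "0 \<le> ker w"
  by (simp add: ker_def prod_nonneg hm_nonneg)

lemma hm_measurable [measurable]: "hm \<in> borel_measurable borel"
  unfolding hm_def[abs_def] by measurable

lemma vec_nth_measurable [measurable]: "(\<lambda>y::real^3. y $ i) \<in> borel_measurable borel"
  by (intro borel_measurable_continuous_onI continuous_intros)

lemma ker_measurable [measurable]: "ker \<in> borel_measurable borel"
  unfolding ker_def[abs_def] borel_prod[symmetric] by measurable

lemma exp_minus_le_powr:
  fixes x :: real
  assumes "x > 0" "0 \<le> \<beta>" "\<beta> \<le> 1"
  shows "exp (- x) \<le> x powr (- \<beta>)"
proof -
  have "x powr \<beta> \<le> exp x"
  proof (cases "x \<ge> 1")
    case True
    then have "x powr \<beta> \<le> x powr 1" using assms by (intro powr_mono) auto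
    also have "\<dots> = x" using assms by simp
    finally show ?thesis using exp_ge_add_one_self[of x] by linarith
  next
    case False
    then have "x powr \<beta> \<le> 1" using assms by (intro powr_le1) auto
    then show ?thesis using assms exp_ge_add_one_self[of x] by linarith
  qed
  then show ?thesis using assms by (simp add: exp_minus powr_minus le_imp_inverse_le)
qed

text \<open>The bound \<open>exp (- x) \<le> x powr (- \<beta>)\<close> with \<open>\<beta>\<close>
  equal to 2/5 and to 9/20 produces the two powers in \<open>hm\<close>, and the sum of the two time
  factors covers the minimum. The point \<open>r = 0\<close> is excluded because
  \<open>0 powr x = 0\<close> makes \<open>hm 0 = 0\<close>.\<close>

lemma gauss_le_hm:
  assumes "\<tau> > 0" "r \<noteq> 0"
  shows "exp (- (r\<^sup>2 / (8 * \<tau>))) \<le> 8 * (\<tau> powr (2/5) + \<tau> powr (9/20)) * hm r"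
proof -
  have *: "exp (- (r\<^sup>2 / (8 * \<tau>))) \<le> 8 * \<tau> powr \<beta> * \<bar>r\<bar> powr (- (2 * \<beta>))" if "0 \<le> \<beta>" "\<beta> \<le> 1" for \<beta>
  proof -
    define q where "q = \<bar>r\<bar> powr 2"
    have q: "q > 0" "r\<^sup>2 = q" using assms by (simp_all add: q_def)
    have "exp (- (r\<^sup>2 / (8 * \<tau>))) \<le> (r\<^sup>2 / (8 * \<tau>)) powr (- \<beta>)"
      using assms that by (intro exp_minus_le_powr) auto
    also have "\<dots> = (8 powr \<beta> * \<tau> powr \<beta>) * q powr (- \<beta>)"
      using assms q by (simp add: powr_divide powr_mult powr_minus field_simps)
    also have "\<dots> = 8 powr \<beta> * (\<tau> powr \<beta> * \<bar>r\<bar> powr (- (2 * \<beta>)))"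
      unfolding q_def by (simp only: powr_powr) simp
    also have "\<dots> \<le> 8 powr 1 * (\<tau> powr \<beta> * \<bar>r\<bar> powr (- (2 * \<beta>)))"
      using that by (intro mult_right_mono powr_mono) auto
    finally show ?thesis by simp
  qed
  define p where "p = 8 * (\<tau> powr (2/5) + \<tau> powr (9/20))"
  have p: "p > 0" using assms by (simp add: p_def add_pos_pos)
  have "exp (- (r\<^sup>2 / (8 * \<tau>))) \<le> p * \<bar>r\<bar> powr (-4/5)"
    using *[of "2/5"] by (rule order_trans) (auto simp: p_def intro!: mult_right_mono)
  moreover have "exp (- (r\<^sup>2 / (8 * \<tau>))) \<le> p * \<bar>r\<bar> powr (-9/10)"
    using *[of "9/20"] by (rule order_trans) (auto simp: p_def intro!: mult_right_mono)
  ultimately show ?thesis unfolding p_def[symmetric] hm_def by (simp add: min_def)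
qed

text \<open>The heat kernel itself has 4 in place of 8; the wider Gaussian leaves room to absorb the
  polynomial factors of its derivatives.\<close>

definition gauss8 :: "real \<Rightarrow> real^3 \<Rightarrow> real" where
  "gauss8 \<tau> y = (\<Prod>i\<in>UNIV. exp (- ((y $ i)\<^sup>2 / (8 * \<tau>))))"

lemma gauss8_nonneg: "0 \<le> gauss8 \<tau> y" by (simp add: gauss8_def prod_nonneg)

lemma gauss8_le:
  assumes \<tau>: "\<tau> > 0" and y: "\<And>i. y $ i \<noteq> 0"
  shows "gauss8 \<tau> y \<le> 2048 * (\<tau> powr (6/5) + \<tau> powr (27/20)) * (\<Prod>i\<in>UNIV. hm (y $ i))"
proof -
  define a b where "a = \<tau> powr (2/5)" and "b = \<tau> powr (9/20)"
  have ab: "a \<ge> 0" "b \<ge> 0" by (auto simp: a_def b_def)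
  have "gauss8 \<tau> y \<le> (\<Prod>i\<in>UNIV. 8 * (a + b) * hm (y $ i))"
    unfolding gauss8_def a_def b_def using assms by (intro prod_mono conjI gauss_le_hm) auto
  also have "\<dots> = (8 * (a + b)) ^ 3 * (\<Prod>i\<in>UNIV. hm (y $ i))" by (simp add: prod.distrib)
  \<comment> \<open>Expanding the cube would create mixed powers of \<tau>; convexity of the cube
    keeps the two pure ones, at the price \<open>2048 = 4 * 8 ^ 3\<close>.\<close>
  also have "\<dots> \<le> (2048 * (a ^ 3 + b ^ 3)) * (\<Prod>i\<in>UNIV. hm (y $ i))"
  proof (rule mult_right_mono)
    have "0 \<le> 3 * (a + b) * (a - b)\<^sup>2" using ab by simp
    also have "\<dots> = 4 * (a ^ 3 + b ^ 3) - (a + b) ^ 3" by algebra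
    finally have "(a + b) ^ 3 \<le> 4 * (a ^ 3 + b ^ 3)" by simp
    moreover have "(8 * (a + b)) ^ 3 = 512 * (a + b) ^ 3" by (simp only: power_mult_distrib) simp
    ultimately show "(8 * (a + b)) ^ 3 \<le> 2048 * (a ^ 3 + b ^ 3)" by linarith
  qed (simp add: prod_nonneg hm_nonneg)
  also have "a ^ 3 = \<tau> powr (6/5)" unfolding a_def using \<tau> by (simp add: powr_powr flip: powr_numeral)
  also have "b ^ 3 = \<tau> powr (27/20)" unfolding b_def using \<tau> by (simp add: powr_powr flip: powr_numeral)
  finally show ?thesis .
qed

lemma nn_integral_powr_atLeast:
  assumes "e < -1" "a > (0::real)"
  shows "(\<integral>\<^sup>+x. indicator {a..} x * ennreal (x powr e) \<partial>lborel) = ennreal (a powr (e + 1) / (- (e + 1)))"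
proof -
  have "((\<lambda>x. x powr e) has_integral -(a powr (e+1)) / (e+1)) {a..}"
    by (rule has_integral_powr_to_inf[OF assms])
  from nn_integral_has_integral_lebesgue[OF _ this]
  have "(\<integral>\<^sup>+x. ennreal (indicator {a..} x * x powr e) \<partial>lborel) = ennreal (-(a powr (e+1)) / (e+1))" by simp
  also have "-(a powr (e+1)) / (e+1) = a powr (e + 1) / (- (e + 1))" using assms by (simp add: field_simps)
  finally show ?thesis by (simp add: ennreal_mult' ennreal_indicator)
qed

lemma nn_integral_powr_Icc:
  assumes "e > -1" "c \<ge> (0::real)"
  shows "(\<integral>\<^sup>+x. indicator {0..c} x * ennreal (x powr e) \<partial>lborel) = ennreal (c powr (e + 1) / (e + 1))"
  using nn_integral_has_integral_lebesgue[OF _ has_integral_powr_from_0[OF assms]]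
  by (simp add: ennreal_mult' ennreal_indicator)

lemma nn_integral_hm_finite: "(\<integral>\<^sup>+r. ennreal (hm r powr (6/5)) \<partial>lborel) < \<infinity>"
proof -
  define g where "g r = indicator {0..1} r * ennreal (r powr (-24/25)) + indicator {1..} r * ennreal (r powr (-27/25))" for r :: real
  have [measurable]: "g \<in> borel_measurable borel" unfolding g_def[abs_def] by measurable
  have g: "(\<integral>\<^sup>+r. g r \<partial>lborel) < \<infinity>"
    unfolding g_def by (subst nn_integral_add) (simp_all add: nn_integral_powr_Icc nn_integral_powr_atLeast)
  have hm1: "hm r powr (6/5) \<le> \<bar>r\<bar> powr (-24/25)" "hm r powr (6/5) \<le> \<bar>r\<bar> powr (-27/25)" for r
  proof -
    have "hm r powr (6/5) \<le> (\<bar>r\<bar> powr (-4/5)) powr (6/5)"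
      by (intro powr_mono2) (auto simp: hm_nonneg hm_def)
    then show "hm r powr (6/5) \<le> \<bar>r\<bar> powr (-24/25)" by (simp add: powr_powr)
    have "hm r powr (6/5) \<le> (\<bar>r\<bar> powr (-9/10)) powr (6/5)"
      by (intro powr_mono2) (auto simp: hm_nonneg hm_def)
    then show "hm r powr (6/5) \<le> \<bar>r\<bar> powr (-27/25)" by (simp add: powr_powr)
  qed
  have le: "ennreal (hm r powr (6/5)) \<le> g \<bar>r\<bar>" for r
    using hm1[of r] by (cases "\<bar>r\<bar> \<le> 1")
      (auto simp: g_def indicator_def ennreal_leI add_increasing2 split: if_splits)
  \<comment> \<open>The function \<open>g\<close> vanishes on the negative half line, so the two
    halves are added. The reflection is written in the affine shape of
    \<open>nn_integral_real_affine\<close>.\<close>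
  have "(\<integral>\<^sup>+r. ennreal (hm r powr (6/5)) \<partial>lborel) \<le> (\<integral>\<^sup>+r. g r + g (0 + (-1) * r) \<partial>lborel)"
  proof (rule nn_integral_mono)
    fix r show "ennreal (hm r powr (6/5)) \<le> g r + g (0 + (-1) * r)"
      using le[of r] by (cases "r \<ge> 0") (auto intro: add_increasing add_increasing2)
  qed
  also have "\<dots> = (\<integral>\<^sup>+r. g r \<partial>lborel) + (\<integral>\<^sup>+r. g (0 + (-1) * r) \<partial>lborel)"
    by (rule nn_integral_add) measurable
  also have "(\<integral>\<^sup>+r. g (0 + (-1) * r) \<partial>lborel) = (\<integral>\<^sup>+r. g r \<partial>lborel)"
    using nn_integral_real_affine[of g "-1" 0] by simp
  also have "(\<integral>\<^sup>+r. g r \<partial>lborel) + (\<integral>\<^sup>+r. g r \<partial>lborel) < \<infinity>" using g by simp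
  finally show ?thesis .
qed

lemma nn_integral_vec_prod:
  assumes [measurable]: "f \<in> borel_measurable borel"
  shows "(\<integral>\<^sup>+y. (\<Prod>i\<in>UNIV. f (y $ i)) \<partial>(lborel :: (real^3) measure)) = (\<integral>\<^sup>+r. f r \<partial>lborel) ^ 3"
proof -
  have B: "(Basis :: (real^3) set) = range (\<lambda>i. axis i 1)" by (auto simp: Basis_vec_def)
  have inj: "inj (\<lambda>i::3. axis i (1::real))" by (auto simp: inj_on_def axis_eq_axis)
  have "(\<Prod>i\<in>UNIV. f (y $ i)) = (\<Prod>b\<in>Basis. f (y \<bullet> b))" for y :: "real^3"
    unfolding B by (simp add: prod.reindex[OF inj] inner_axis)
  then have "(\<integral>\<^sup>+y. (\<Prod>i\<in>UNIV. f (y $ i)) \<partial>(lborel :: (real^3) measure)) = (\<Prod>b\<in>(Basis :: (real^3) set). (\<integral>\<^sup>+r. f r \<partial>lborel))"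
    by (simp add: nn_integral_lborel_prod[where f = "\<lambda>_. f"])
  then show ?thesis by simp
qed

text \<open>The product form of \<open>ker\<close> pays off here: Tonelli splits the integral into
  one-dimensional ones, and the time exponent becomes \<open>-4/5 * 6/5 = -24/25\<close>, integrable
  at zero.\<close>

lemma nn_integral_ker_finite: "(\<integral>\<^sup>+w. ennreal (ker w powr (6/5)) \<partial>lborel) < \<infinity>"
proof -
  define a where "a s = indicator {0<..<2} s * ennreal (s powr (-24/25))" for s :: real
  define h where "h y = (\<Prod>i\<in>UNIV. ennreal (hm (y $ i) powr (6/5)))" for y :: "real^3"
  have [measurable]: "a \<in> borel_measurable borel" "h \<in> borel_measurable borel"
    unfolding a_def[abs_def] h_def[abs_def] by measurable
  have a: "(\<integral>\<^sup>+s. a s \<partial>lborel) < \<infinity>"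
  proof -
    have "(\<integral>\<^sup>+s. a s \<partial>lborel) \<le> (\<integral>\<^sup>+s. indicator {0..2} s * ennreal (s powr (-24/25)) \<partial>lborel)"
      unfolding a_def by (intro nn_integral_mono) (auto simp: indicator_def)
    also have "\<dots> < \<infinity>" by (subst nn_integral_powr_Icc) auto
    finally show ?thesis .
  qed
  have h: "(\<integral>\<^sup>+y. h y \<partial>lborel) < \<infinity>"
    unfolding h_def using nn_integral_hm_finite by (subst nn_integral_vec_prod) (auto simp: power_less_top_ennreal)
  have eq: "ennreal (ker (s, y) powr (6/5)) = a s * h y" for s y
  proof (cases "s \<in> {0<..<2}")
    case True
    then have "ker (s, y) powr (6/5) = s powr (-24/25) * (\<Prod>i\<in>UNIV. hm (y $ i) powr (6/5))"
      by (simp add: ker_def powr_mult prod_nonneg hm_nonneg powr_powr prod_powr_distrib)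
    then show ?thesis using True by (simp add: a_def h_def ennreal_mult' prod_ennreal)
  qed (auto simp: ker_def a_def)
  have "(\<integral>\<^sup>+w. ennreal (ker w powr (6/5)) \<partial>lborel) = (\<integral>\<^sup>+s. \<integral>\<^sup>+y. a s * h y \<partial>lborel \<partial>lborel)"
    unfolding lborel_prod[symmetric] by (subst lborel.nn_integral_fst[symmetric]) (simp_all add: eq lborel_prod)
  also have "\<dots> = (\<integral>\<^sup>+s. a s \<partial>lborel) * (\<integral>\<^sup>+y. h y \<partial>lborel)"
    by (simp add: nn_integral_cmult nn_integral_multc)
  also have "\<dots> < \<infinity>" using a h by (simp add: ennreal_mult_less_top)
  finally show ?thesis .
qed

lemma powr_le_powr_time:
  fixes s :: real
  assumes "0 < s" "s < 2" "a \<le> b" "b - a \<le> 1"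
  shows "s powr (- a) \<le> 2 * s powr (- b)"
proof -
  have "s powr (- a) = s powr (b - a) * s powr (- b)" using assms by (simp flip: powr_add)
  also have "s powr (b - a) \<le> 2 powr (b - a)" using assms by (intro powr_mono2) auto
  also have "2 powr (b - a) \<le> 2 powr (1::real)" using assms by (intro powr_mono) auto
  finally show ?thesis by (simp add: mult_right_mono)
qed

text \<open>The index counts derivatives of a bump normalised to 1 at the origin. The bump is not
  constant near the origin, but this is enough: as the truncation radius grows, the rescaled
  argument tends to 0 and the value to 1, while every derivative of the dilated bump carries a
  factor \<open>1 / R\<close>.\<close>

definition cutoff :: "nat \<Rightarrow> real \<Rightarrow> real" where
  "cutoff j = (dir_deriv 1 ^^ j) (\<lambda>r. inverse (bump (-1) 1 (0::real)) * bump (-1) 1 r)"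

lemma cutoff_test: "cutoff j \<in> test_functions {-1..1}"
proof (induction j)
  case 0
  have "bump (-1) 1 r = 0" if "r \<notin> {-1..1}" for r :: real
    using bump_nz_iff[of "-1" 1 r] that by auto
  then show ?case unfolding cutoff_def
    by (auto intro!: test_functionsI[where K = "{-1..1}"] smooth_cmult smooth_bump)
next
  case (Suc j)
  then show ?case by (simp add: cutoff_def test_functions_dir_deriv)
qed

lemma cutoff_deriv: "(cutoff j has_real_derivative cutoff (Suc j) r) (at r)"
  using smooth_line[OF test_functionsD(1)[OF cutoff_test[of j]], of 0 1 r UNIV]
  by (simp add: cutoff_def)

lemma cutoff_outside: "\<bar>r\<bar> > 1 \<Longrightarrow> cutoff j r = 0"
  using test_functionsD(3)[OF cutoff_test[of j]] by (intro outside_support[of r "cutoff j"]) (auto dest!: subsetD)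

lemma cutoff_0: "cutoff 0 0 = 1"
  using bump_nz_iff[of "-1" 1 "0::real"] by (simp add: cutoff_def)

lemma cutoff_measurable [measurable]: "cutoff j \<in> borel_measurable borel"
  by (rule test_functions_borel[OF cutoff_test])

lemma cutoff_bounded:
  obtains B where "B \<ge> 1" "\<And>j r. j \<le> 3 \<Longrightarrow> \<bar>cutoff j r\<bar> \<le> B"
proof -
  have "\<exists>B\<ge>0. \<forall>r. \<bar>cutoff j r\<bar> \<le> B" for j
    using test_functions_bounded[OF cutoff_test[of j]] by metis
  then obtain B where B: "\<And>j. B j \<ge> 0" "\<And>j r. \<bar>cutoff j r\<bar> \<le> B j" by metis
  have "\<bar>cutoff j r\<bar> \<le> 1 + (\<Sum>i\<le>3. B i)" if "j \<le> 3" for j r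
    using B(2)[of j r] member_le_sum[of j "{..3}" B] B(1) that by fastforce
  then show ?thesis using that[of "1 + (\<Sum>i\<le>3. B i)"] B(1) by (simp add: sum_nonneg)
qed

text \<open>Rescaled Hermite polynomials, up to sign: the \<open>j\<close>-th derivative of
  \<open>exp (- (x\<^sup>2 / 4))\<close> is \<open>herm j\<close> times this Gaussian, and the
  recursion is the product rule.\<close>

fun herm :: "nat \<Rightarrow> real poly" where
  "herm 0 = 1"
| "herm (Suc j) = pderiv (herm j) - [:0, 1/2:] * herm j"

text \<open>The derivatives of the heat kernel on the line without its normalization \<open>(4 * pi) powr (-1/2)\<close>.\<close>

definition gk :: "nat \<Rightarrow> real \<Rightarrow> real \<Rightarrow> real" where
  "gk j \<tau> r = poly (herm j) (r * \<tau> powr (-1/2)) * (\<tau> powr (-1/2)) ^ Suc j * exp (- ((r * \<tau> powr (-1/2))\<^sup>2 / 4))"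

lemma gk_deriv: "(gk j \<tau> has_real_derivative gk (Suc j) \<tau> r) (at r)"
proof -
  define a where "a = \<tau> powr (-1/2)"
  have "((\<lambda>r. poly (herm j) (r * a) * a ^ Suc j * exp (- ((r * a)\<^sup>2 / 4))) has_real_derivative
     poly (herm (Suc j)) (r * a) * a ^ Suc (Suc j) * exp (- ((r * a)\<^sup>2 / 4))) (at r)"
    by (auto intro!: derivative_eq_intros DERIV_chain2[OF poly_DERIV] simp: algebra_simps power2_eq_square)
  then show ?thesis unfolding gk_def[abs_def] a_def .
qed

lemma powr_minus_half_square: "(\<tau>::real) > 0 \<Longrightarrow> (\<tau> powr (-1/2))\<^sup>2 = 1 / \<tau>"
  by (simp add: powr_minus powr_half_sqrt field_simps)

text \<open>The heat equation on the line, since \<open>gk 2\<close> is also the second space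
  derivative. Once everything is expressed through \<open>\<tau> powr (-1/2)\<close>, it is an
  identity of polynomials.\<close>

lemma gk_time_deriv:
  assumes "\<tau> > 0"
  shows "((\<lambda>\<tau>. gk 0 \<tau> r) has_real_derivative gk 2 \<tau> r) (at \<tau>)"
proof -
  have "((\<lambda>\<tau>. \<tau> powr (-1/2) * exp (- (r\<^sup>2 / (4 * \<tau>)))) has_real_derivative
     (r\<^sup>2 / (4 * \<tau>\<^sup>2) - 1 / (2 * \<tau>)) * (\<tau> powr (-1/2) * exp (- (r\<^sup>2 / (4 * \<tau>))))) (at \<tau>)"
    using assms
    by (auto intro!: derivative_eq_intros simp: field_simps power2_eq_square powr_mult_base)
  then have "((\<lambda>\<tau>. gk 0 \<tau> r) has_real_derivative
     (r\<^sup>2 / (4 * \<tau>\<^sup>2) - 1 / (2 * \<tau>)) * (\<tau> powr (-1/2) * exp (- (r\<^sup>2 / (4 * \<tau>))))) (at \<tau>)"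
    by (rule has_field_derivative_transform_within_open[where S = "{0<..}"])
       (use assms in \<open>auto simp: gk_def power_mult_distrib powr_minus_half_square[simplified]\<close>)
  moreover have "(r\<^sup>2 / (4 * \<tau>\<^sup>2) - 1 / (2 * \<tau>)) * (\<tau> powr (-1/2) * exp (- (r\<^sup>2 / (4 * \<tau>)))) = gk 2 \<tau> r"
  proof -
    define a where "a = \<tau> powr (-1/2)"
    have a: "1 / \<tau> = a\<^sup>2" using powr_minus_half_square[OF assms] by (simp add: a_def)
    have e1: "r\<^sup>2 / (4 * \<tau>\<^sup>2) - 1 / (2 * \<tau>) = (r * a\<^sup>2)\<^sup>2 / 4 - a\<^sup>2 / 2"
      by (simp add: a[symmetric] power_divide)
    have e2: "r\<^sup>2 / (4 * \<tau>) = (r * a)\<^sup>2 / 4"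
      by (simp add: a[symmetric] power_mult_distrib)
    show ?thesis
      unfolding gk_def a_def[symmetric] e1 e2
      by (simp add: numeral_2_eq_2 pderiv_pCons algebra_simps)
  qed
  ultimately show ?thesis by simp
qed

text \<open>Monomials suffice. The inequality \<open>(1 + y / n) ^ n \<le> exp y\<close> with
  \<open>y = x\<^sup>2 / 8\<close> bounds even powers, and
  \<open>\<bar>x\<bar> ^ n \<le> 1 + \<bar>x\<bar> ^ (2 * n)\<close> reduces all powers to even
  ones.\<close>

lemma poly_exp_bounded: "\<exists>C. \<forall>x::real. \<bar>poly p x\<bar> * exp (- (x\<^sup>2 / 8)) \<le> C"
proof -
  have mono: "\<exists>C\<ge>0. \<forall>x::real. \<bar>x\<bar> ^ n * exp (- (x\<^sup>2 / 8)) \<le> C" for n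
  proof -
    define K :: real where "K = 8 ^ n * real n ^ n"
    have K: "K \<ge> 0" by (simp add: K_def)
    have "\<bar>x\<bar> ^ n * exp (- (x\<^sup>2 / 8)) \<le> 1 + K" for x :: real
    proof -
      have e: "(x\<^sup>2 / 8) ^ n \<le> real n ^ n * exp (x\<^sup>2 / 8)"
      proof (cases "n = 0")
        case False
        have "(x\<^sup>2 / 8) ^ n = real n ^ n * ((x\<^sup>2 / 8) / n) ^ n" using False by (simp add: power_divide)
        also have "\<dots> \<le> real n ^ n * (1 + (x\<^sup>2 / 8) / n) ^ n"
          by (intro mult_left_mono power_mono) auto
        also have "\<dots> \<le> real n ^ n * exp (x\<^sup>2 / 8)"
          using False by (intro mult_left_mono exp_ge_one_plus_x_over_n_power_n) (auto intro: order_trans[of _ 0])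
        finally show ?thesis .
      qed simp
      have "\<bar>x\<bar> ^ n \<le> 1 + \<bar>x\<bar> ^ (2 * n)" by (rule power_le_one_plus_power) auto
      also have "\<bar>x\<bar> ^ (2 * n) = 8 ^ n * (x\<^sup>2 / 8) ^ n"
        by (simp add: power_mult power_divide)
      also have "1 + 8 ^ n * (x\<^sup>2 / 8) ^ n \<le> exp (x\<^sup>2 / 8) + 8 ^ n * (real n ^ n * exp (x\<^sup>2 / 8))"
        by (intro add_mono mult_left_mono e) auto
      also have "\<dots> = (1 + K) * exp (x\<^sup>2 / 8)" by (simp add: K_def algebra_simps)
      finally have "\<bar>x\<bar> ^ n \<le> (1 + K) * exp (x\<^sup>2 / 8)" .
      then show ?thesis by (simp add: exp_minus pos_divide_le_eq flip: divide_inverse)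
    qed
    then show ?thesis using K by (intro exI[of _ "1 + K"]) auto
  qed
  then obtain C where C: "\<And>n. C n \<ge> 0" "\<And>n x::real. \<bar>x\<bar> ^ n * exp (- (x\<^sup>2 / 8)) \<le> C n" by metis
  have "\<bar>poly p x\<bar> * exp (- (x\<^sup>2 / 8)) \<le> (\<Sum>i\<le>degree p. \<bar>coeff p i\<bar> * C i)" for x
  proof -
    have "\<bar>poly p x\<bar> * exp (- (x\<^sup>2 / 8)) \<le> (\<Sum>i\<le>degree p. \<bar>coeff p i\<bar> * \<bar>x\<bar> ^ i) * exp (- (x\<^sup>2 / 8))"
      unfolding poly_altdef by (intro mult_right_mono order_trans[OF sum_abs]) (auto simp: abs_mult power_abs)
    also have "\<dots> = (\<Sum>i\<le>degree p. \<bar>coeff p i\<bar> * (\<bar>x\<bar> ^ i * exp (- (x\<^sup>2 / 8))))"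
      by (simp add: sum_distrib_right mult.assoc)
    also have "\<dots> \<le> (\<Sum>i\<le>degree p. \<bar>coeff p i\<bar> * C i)"
      by (intro sum_mono mult_left_mono C) auto
    finally show ?thesis .
  qed
  then show ?thesis by blast
qed

lemma gk_bound:
  obtains C where "C \<ge> 1" "\<And>j \<tau> r. j \<le> 3 \<Longrightarrow> \<tau> > 0 \<Longrightarrow>
    \<bar>gk j \<tau> r\<bar> \<le> C * (\<tau> powr (-1/2)) ^ Suc j * exp (- (r\<^sup>2 / (8 * \<tau>)))"
proof -
  obtain C where C: "\<And>j x. \<bar>poly (herm j) x\<bar> * exp (- (x\<^sup>2 / 8)) \<le> C j"
    using choice[of "\<lambda>j C. \<forall>x. \<bar>poly (herm j) x\<bar> * exp (- (x\<^sup>2 / 8)) \<le> C"] poly_exp_bounded by blast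
  have C0: "C j \<ge> 0" for j using C[of j 0] by (smt (verit) mult_nonneg_nonneg abs_ge_zero exp_ge_zero)
  define D where "D = 1 + (\<Sum>j\<le>3. C j)"
  have "\<bar>gk j \<tau> r\<bar> \<le> D * (\<tau> powr (-1/2)) ^ Suc j * exp (- (r\<^sup>2 / (8 * \<tau>)))"
    if "j \<le> 3" "\<tau> > 0" for j \<tau> r
  proof -
    define a x where "a = \<tau> powr (-1/2)" and "x = r * a"
    have x2: "x\<^sup>2 / 8 = r\<^sup>2 / (8 * \<tau>)"
      unfolding x_def power_mult_distrib a_def powr_minus_half_square[OF that(2)] by simp
    have "C j \<le> D" using member_le_sum[of j "{..3}" C] C0 that by (auto simp: D_def)
    then have P: "\<bar>poly (herm j) x\<bar> * exp (- (x\<^sup>2 / 8)) \<le> D" using C[of j x] by simp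
    \<comment> \<open>Half of the exponent absorbs the polynomial; the other half survives as a
      factor of \<open>gauss8\<close>.\<close>
    have "exp (- (x\<^sup>2 / 4)) = exp (- (x\<^sup>2 / 8)) * exp (- (x\<^sup>2 / 8))" by (simp flip: exp_add)
    then have "\<bar>gk j \<tau> r\<bar> = (\<bar>poly (herm j) x\<bar> * exp (- (x\<^sup>2 / 8))) * (a ^ Suc j * exp (- (x\<^sup>2 / 8)))"
      unfolding gk_def a_def[symmetric] x_def[symmetric] by (simp add: abs_mult a_def)
    also have "\<dots> \<le> D * (a ^ Suc j * exp (- (x\<^sup>2 / 8)))"
      by (intro mult_right_mono P) (simp add: a_def)
    finally show ?thesis unfolding x2 by (simp only: a_def mult.assoc)
  qed
  moreover have "D \<ge> 1" unfolding D_def using sum_nonneg[of "{..3}" C] C0 by simp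
  ultimately show ?thesis by (rule that[rotated])
qed

text \<open>One term of the Leibniz rule for a Gaussian cut off at distance \<open>R\<close>:
  \<open>l\<close> derivatives fall on the cutoff, each worth \<open>1 / R\<close>, and
  \<open>j\<close> on the Gaussian.\<close>

definition cg :: "nat \<Rightarrow> nat \<Rightarrow> real \<Rightarrow> real \<Rightarrow> real \<Rightarrow> real" where
  "cg l j R \<tau> r = cutoff l (r / R) / R ^ l * gk j \<tau> r"

lemma cg_deriv:
  assumes "R > 0"
  shows "(cg l j R \<tau> has_real_derivative cg (Suc l) j R \<tau> r + cg l (Suc j) R \<tau> r) (at r)"
  unfolding cg_def[abs_def] using assms
  by (auto intro!: derivative_eq_intros DERIV_chain2[OF cutoff_deriv] gk_deriv simp: field_simps)

lemma gk_measurable [measurable]: "(\<lambda>p. gk j (fst p) (snd p)) \<in> borel_measurable (borel \<Otimes>\<^sub>M borel)"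
proof -
  have [measurable]: "poly (herm j) \<in> borel_measurable borel"
    by (intro borel_measurable_continuous_onI continuous_intros)
  show ?thesis unfolding gk_def by measurable
qed

text \<open>The derivatives of order at most \<open>3\<close> of the truncated one-dimensional heat kernel; for larger orders the
  function is junk.\<close>

fun qk :: "nat \<Rightarrow> real \<Rightarrow> real \<Rightarrow> real \<Rightarrow> real" where
  "qk 0 R \<tau> r = cg 0 0 R \<tau> r"
| "qk (Suc 0) R \<tau> r = cg 1 0 R \<tau> r + cg 0 1 R \<tau> r"
| "qk (Suc (Suc 0)) R \<tau> r = cg 2 0 R \<tau> r + 2 * cg 1 1 R \<tau> r + cg 0 2 R \<tau> r"
| "qk (Suc (Suc (Suc j))) R \<tau> r = cg 3 0 R \<tau> r + 3 * cg 2 1 R \<tau> r + 3 * cg 1 2 R \<tau> r + cg 0 3 R \<tau> r"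

lemma qk_deriv:
  assumes "R > 0" "j < 3"
  shows "(qk j R \<tau> has_real_derivative qk (Suc j) R \<tau> r) (at r)"
proof -
  note d = cg_deriv[OF assms(1), of _ _ \<tau> r]
  have e0: "qk 0 R \<tau> = cg 0 0 R \<tau>"
    and e1: "qk 1 R \<tau> = (\<lambda>r. cg 1 0 R \<tau> r + cg 0 1 R \<tau> r)"
    and e2: "qk 2 R \<tau> = (\<lambda>r. cg 2 0 R \<tau> r + 2 * cg 1 1 R \<tau> r + cg 0 2 R \<tau> r)"
    by (auto simp: numeral_2_eq_2)
  from assms(2) consider "j = 0" | "j = 1" | "j = 2" by linarith
  then show ?thesis
  proof cases
    case 1
    then show ?thesis using d[of 0 0] by (simp add: e0)
  next
    case 2
    then show ?thesis unfolding 2 e1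
      by (auto intro!: derivative_eq_intros d simp: numeral_2_eq_2)
  next
    case 3
    then show ?thesis unfolding 3 e2
      by (auto intro!: derivative_eq_intros d simp: numeral_2_eq_2 numeral_3_eq_3)
  qed
qed

lemma qk_measurable [measurable]: "(\<lambda>p. qk j R (fst p) (snd p)) \<in> borel_measurable (borel \<Otimes>\<^sub>M borel)"
proof -
  have [measurable]: "(\<lambda>p. cg l j R (fst p) (snd p)) \<in> borel_measurable (borel \<Otimes>\<^sub>M borel)" for l j
    unfolding cg_def by measurable
  show ?thesis by (cases "(j, R, 0::real, 0::real)" rule: qk.cases) (simp_all, measurable)
qed

lemma qk_outside: "R > 0 \<Longrightarrow> \<bar>r\<bar> > R \<Longrightarrow> qk j R \<tau> r = 0"
  by (cases "(j, R, \<tau>, r)" rule: qk.cases) (simp_all add: cg_def cutoff_outside)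

lemma cg_bound:
  obtains C where "C \<ge> 1" "\<And>l j R \<tau> r. l \<le> 3 \<Longrightarrow> j \<le> 3 \<Longrightarrow> 0 < \<tau> \<Longrightarrow> 0 < R \<Longrightarrow>
    \<bar>cg l j R \<tau> r\<bar> \<le> C * (1 / R) ^ l * (\<tau> powr (-1/2)) ^ Suc j * exp (- (r\<^sup>2 / (8 * \<tau>)))"
proof -
  obtain B where B: "B \<ge> 1" "\<And>j r. j \<le> 3 \<Longrightarrow> \<bar>cutoff j r\<bar> \<le> B" using cutoff_bounded by blast
  obtain C where C: "C \<ge> 1" "\<And>j \<tau> r. j \<le> 3 \<Longrightarrow> \<tau> > 0 \<Longrightarrow>
    \<bar>gk j \<tau> r\<bar> \<le> C * (\<tau> powr (-1/2)) ^ Suc j * exp (- (r\<^sup>2 / (8 * \<tau>)))" using gk_bound by blast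
  show ?thesis
  proof (rule that[of "B * C"])
    show "B * C \<ge> 1" using mult_mono[OF B(1) C(1)] B(1) by simp
    fix l j :: nat and R \<tau> r :: real
    assume a: "l \<le> 3" "j \<le> 3" "0 < \<tau>" "0 < R"
    have "\<bar>cg l j R \<tau> r\<bar> = (\<bar>cutoff l (r / R)\<bar> * (1 / R) ^ l) * \<bar>gk j \<tau> r\<bar>"
      using a by (simp add: cg_def abs_mult power_divide)
    also have "\<dots> \<le> (B * (1 / R) ^ l) * (C * (\<tau> powr (-1/2)) ^ Suc j * exp (- (r\<^sup>2 / (8 * \<tau>))))"
      using a B(1) by (intro mult_mono B C) auto
    finally show "\<bar>cg l j R \<tau> r\<bar> \<le> B * C * (1 / R) ^ l * (\<tau> powr (-1/2)) ^ Suc j * exp (- (r\<^sup>2 / (8 * \<tau>)))"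
      by (simp add: mult_ac)
  qed
qed

text \<open>For \<open>\<tau> \<le> R\<^sup>2\<close> a derivative that hits the cutoff costs
  \<open>1 / R\<close>, which is at most the \<open>\<tau> powr (-1/2)\<close> that it would cost on
  the Gaussian. The second bound retains one \<open>1 / R\<close>: \<open>cg 0 2\<close> is the only
  Leibniz term of the second derivative that leaves the cutoff undifferentiated.\<close>

lemma qk_bounds:
  obtains C where "C \<ge> 1"
    "\<And>j R \<tau> r. j \<le> 3 \<Longrightarrow> 0 < \<tau> \<Longrightarrow> 0 < R \<Longrightarrow> \<tau> \<le> R\<^sup>2 \<Longrightarrow>
      \<bar>qk j R \<tau> r\<bar> \<le> C * (\<tau> powr (-1/2)) ^ Suc j * exp (- (r\<^sup>2 / (8 * \<tau>)))"
    "\<And>R \<tau> r. 0 < \<tau> \<Longrightarrow> 0 < R \<Longrightarrow> \<tau> \<le> R\<^sup>2 \<Longrightarrow>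
      \<bar>qk 2 R \<tau> r - cg 0 2 R \<tau> r\<bar> \<le> C * (1 / R) * (\<tau> powr (-1/2)) ^ 2 * exp (- (r\<^sup>2 / (8 * \<tau>)))"
proof -
  obtain C where C: "C \<ge> 1" "\<And>l j R \<tau> r. l \<le> 3 \<Longrightarrow> j \<le> 3 \<Longrightarrow> 0 < \<tau> \<Longrightarrow> 0 < R \<Longrightarrow>
    \<bar>cg l j R \<tau> r\<bar> \<le> C * (1 / R) ^ l * (\<tau> powr (-1/2)) ^ Suc j * exp (- (r\<^sup>2 / (8 * \<tau>)))"
    using cg_bound by blast
  have aR: "1 / R \<le> \<tau> powr (-1/2)" if "0 < \<tau>" "0 < R" "\<tau> \<le> R\<^sup>2" for R \<tau> :: real
  proof -
    have "sqrt \<tau> \<le> R" using real_sqrt_le_mono[OF that(3)] that by simp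
    then show ?thesis using that by (simp add: powr_minus powr_half_sqrt field_simps)
  qed
  have cgb: "\<bar>cg l j R \<tau> r\<bar> \<le> C * (\<tau> powr (-1/2)) ^ Suc (l + j) * exp (- (r\<^sup>2 / (8 * \<tau>)))"
    if a: "l \<le> 3" "j \<le> 3" "0 < \<tau>" "0 < R" "\<tau> \<le> R\<^sup>2" for l j R \<tau> r
  proof -
    have "\<bar>cg l j R \<tau> r\<bar> \<le> C * (1 / R) ^ l * (\<tau> powr (-1/2)) ^ Suc j * exp (- (r\<^sup>2 / (8 * \<tau>)))"
      by (rule C(2)[OF a(1-4)])
    also have "\<dots> \<le> C * (\<tau> powr (-1/2)) ^ l * (\<tau> powr (-1/2)) ^ Suc j * exp (- (r\<^sup>2 / (8 * \<tau>)))"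
      using a C(1) by (intro mult_right_mono mult_left_mono power_mono aR) auto
    finally show ?thesis by (simp add: power_add mult_ac)
  qed
  show ?thesis
  \<comment> \<open>The Leibniz coefficients 1, 3, 3, 1 of the third derivative add up to 8, which
    also covers the lower orders.\<close>
  proof (rule that[of "8 * C"])
    show "8 * C \<ge> 1" using C(1) by simp
    fix j :: nat and R \<tau> r :: real
    assume a: "j \<le> 3" "0 < \<tau>" "0 < R" "\<tau> \<le> R\<^sup>2"
    let ?E = "exp (- (r\<^sup>2 / (8 * \<tau>)))"
    define b where "b = C * (\<tau> powr (-1/2)) ^ Suc j * ?E"
    have b: "b \<ge> 0" using C(1) by (simp add: b_def)
    have cj: "\<bar>cg l i R \<tau> r\<bar> \<le> b" if "l + i = j" for l i
      using cgb[of l i \<tau> R r] a that by (simp add: b_def)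
    from a(1) consider "j = 0" | "j = Suc 0" | "j = Suc (Suc 0)" | "j = Suc (Suc (Suc 0))" by linarith
    then have "\<bar>qk j R \<tau> r\<bar> \<le> 8 * b"
    proof cases
      case 1 then show ?thesis using cj[of 0 0] b by simp
    next
      case 2 then show ?thesis using cj[of 1 0] cj[of 0 1] b by simp
    next
      case 3 then show ?thesis using cj[of 2 0] cj[of 1 1] cj[of 0 2] b by simp
    next
      case 4 then show ?thesis using cj[of 3 0] cj[of 2 1] cj[of 1 2] cj[of 0 3] b by simp
    qed
    then show "\<bar>qk j R \<tau> r\<bar> \<le> 8 * C * (\<tau> powr (-1/2)) ^ Suc j * ?E" by (simp add: b_def mult.assoc)
  next
    fix R \<tau> r :: real
    assume a: "0 < \<tau>" "0 < R" "\<tau> \<le> R\<^sup>2"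
    let ?E = "exp (- (r\<^sup>2 / (8 * \<tau>)))" and ?a = "\<tau> powr (-1/2)"
    have 1: "\<bar>cg 2 0 R \<tau> r\<bar> \<le> C * (1 / R) * ?a ^ 2 * ?E"
    proof -
      have "\<bar>cg 2 0 R \<tau> r\<bar> \<le> C * (1 / R) ^ 2 * ?a ^ Suc 0 * ?E" using a by (intro C) auto
      also have "\<dots> = C * (1 / R) * (1 / R) * ?a * ?E" by (simp add: power2_eq_square)
      also have "\<dots> \<le> C * (1 / R) * ?a * ?a * ?E"
        using a C(1) by (intro mult_right_mono mult_left_mono aR) auto
      finally show ?thesis by (simp add: power2_eq_square mult.assoc)
    qed
    have 2: "\<bar>cg 1 1 R \<tau> r\<bar> \<le> C * (1 / R) * ?a ^ 2 * ?E"
      using C(2)[of 1 1 \<tau> R r] a by (simp add: power2_eq_square mult.assoc)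
    have 3: "C * (1 / R) * ?a ^ 2 * ?E \<ge> 0" using C(1) a by simp
    have "\<bar>qk 2 R \<tau> r - cg 0 2 R \<tau> r\<bar> = \<bar>cg 2 0 R \<tau> r + 2 * cg 1 1 R \<tau> r\<bar>" by (simp add: numeral_2_eq_2)
    also have "\<dots> \<le> 8 * (C * (1 / R) * ?a ^ 2 * ?E)" using 1 2 3 by linarith
    finally show "\<bar>qk 2 R \<tau> r - cg 0 2 R \<tau> r\<bar> \<le> 8 * C * (1 / R) * ?a ^ 2 * ?E" by (simp only: mult.assoc)
  qed
qed

text \<open>The truncated heat kernel \<open>Qk (\<lambda>_. 0) R\<close> has the spatial derivatives \<open>Qk a R\<close>, the time derivative \<open>Qt R\<close> and the
  Laplacian \<open>Ql R\<close>; the remainder \<open>Qr R\<close> is the error in the heat equation that the truncation causes.\<close>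

definition Qk :: "(3 \<Rightarrow> nat) \<Rightarrow> real \<Rightarrow> real \<Rightarrow> real^3 \<Rightarrow> real" where
  "Qk a R \<tau> y = (\<Prod>i\<in>UNIV. qk (a i) R \<tau> (y $ i))"

definition Qt :: "real \<Rightarrow> real \<Rightarrow> real^3 \<Rightarrow> real" where
  "Qt R \<tau> y = (\<Sum>i\<in>UNIV. cg 0 2 R \<tau> (y $ i) * (\<Prod>l\<in>UNIV - {i}. qk 0 R \<tau> (y $ l)))"

definition Ql :: "real \<Rightarrow> real \<Rightarrow> real^3 \<Rightarrow> real" where
  "Ql R \<tau> y = (\<Sum>i\<in>UNIV. Qk ((\<lambda>_. 0)(i := 2)) R \<tau> y)"

definition Qr :: "real \<Rightarrow> real \<Rightarrow> real^3 \<Rightarrow> real" where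
  "Qr R \<tau> y = Ql R \<tau> y - Qt R \<tau> y"

lemma Qk_update:
  "Qk (a(j := n)) R \<tau> y = qk n R \<tau> (y $ j) * (\<Prod>l\<in>UNIV - {j}. qk (a l) R \<tau> (y $ l))"
proof -
  have "Qk (a(j := n)) R \<tau> y = qk n R \<tau> (y $ j) * (\<Prod>l\<in>UNIV - {j}. qk ((a(j := n)) l) R \<tau> (y $ l))"
    unfolding Qk_def by (subst prod.remove[of UNIV j]) auto
  also have "(\<Prod>l\<in>UNIV - {j}. qk ((a(j := n)) l) R \<tau> (y $ l)) = (\<Prod>l\<in>UNIV - {j}. qk (a l) R \<tau> (y $ l))"
    by (rule prod.cong) auto
  finally show ?thesis .
qed

lemma Qk_deriv:
  assumes "R > 0" "a j < 3"
  shows "((\<lambda>r. Qk a R \<tau> (y + r *\<^sub>R axis j 1)) has_real_derivative Qk (a(j := Suc (a j))) R \<tau> y) (at 0)"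
proof -
  let ?P = "\<Prod>l\<in>UNIV - {j}. qk (a l) R \<tau> (y $ l)"
  have "Qk a R \<tau> (y + r *\<^sub>R axis j 1) = qk (a j) R \<tau> (y $ j + r) * ?P" for r
  proof -
    have "Qk a R \<tau> (y + r *\<^sub>R axis j 1) = Qk (a(j := a j)) R \<tau> (y + r *\<^sub>R axis j 1)" by simp
    also have "\<dots> = qk (a j) R \<tau> (y $ j + r) * ?P"
      unfolding Qk_update by (simp, intro disjI2 prod.cong) (auto simp: axis_def)
    finally show ?thesis .
  qed
  moreover have "((\<lambda>r. qk (a j) R \<tau> (y $ j + r)) has_real_derivative qk (Suc (a j)) R \<tau> (y $ j)) (at 0)"
    using qk_deriv[OF assms, of \<tau> "y $ j"] DERIV_shift[of "qk (a j) R \<tau>" _ 0 "y $ j"]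
    by (simp add: add.commute)
  ultimately show ?thesis unfolding Qk_update by (auto intro!: derivative_eq_intros)
qed

text \<open>The cutoff does not depend on time, so the time derivative falls on the Gaussian
  factors, where it becomes a second space derivative with the cutoff untouched. Hence
  \<open>Qt\<close> and the Laplacian \<open>Ql\<close> differ only in terms with a differentiated
  cutoff.\<close>

lemma Qk_time_deriv:
  assumes "R > 0" "\<tau> > 0"
  shows "((\<lambda>\<tau>. Qk (\<lambda>_. 0) R \<tau> y) has_real_derivative Qt R \<tau> y) (at \<tau>)"
proof -
  have d: "((\<lambda>\<tau>. qk 0 R \<tau> r) has_real_derivative cg 0 2 R \<tau> r) (at \<tau>)" for r
    by (auto simp: cg_def intro!: derivative_eq_intros gk_time_deriv assms)
  have "((\<lambda>\<tau>. \<Prod>i\<in>UNIV. qk 0 R \<tau> (y $ i)) has_real_derivative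
      (\<Sum>i\<in>UNIV. cg 0 2 R \<tau> (y $ i) * (\<Prod>l\<in>UNIV - {i}. qk 0 R \<tau> (y $ l)))) (at \<tau>)"
    by (rule has_field_derivative_prod) (rule d)
  then show ?thesis by (simp add: Qk_def Qt_def)
qed

lemma Qk_measurable [measurable]: "(\<lambda>p. Qk a R (fst p) (snd p)) \<in> borel_measurable (borel \<Otimes>\<^sub>M borel)"
proof -
  have p: "(\<lambda>p :: real \<times> (real^3). (fst p, snd p $ i)) \<in> (borel \<Otimes>\<^sub>M borel) \<rightarrow>\<^sub>M (borel \<Otimes>\<^sub>M borel)" for i :: 3
    by measurable
  have [measurable]: "(\<lambda>p. qk j R (fst p) (snd p $ i)) \<in> borel_measurable (borel \<Otimes>\<^sub>M borel)" for j and i :: 3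
    using measurable_compose[OF p[of i] qk_measurable[of j R]] by simp
  show ?thesis unfolding Qk_def by measurable
qed

text \<open>The form in which the remainder is seen to be small: each difference consists of terms
  with a differentiated cutoff and therefore contains a factor \<open>1 / R\<close>.\<close>

lemma Qr_alt: "Qr R \<tau> y = (\<Sum>i\<in>UNIV. (qk 2 R \<tau> (y $ i) - cg 0 2 R \<tau> (y $ i)) * (\<Prod>l\<in>UNIV - {i}. qk 0 R \<tau> (y $ l)))"
  unfolding Qr_def Ql_def Qt_def Qk_update by (simp add: sum_subtractf left_diff_distrib)

lemma Qr_measurable [measurable]: "(\<lambda>p. Qr R (fst p) (snd p)) \<in> borel_measurable (borel \<Otimes>\<^sub>M borel)"
proof -
  have p: "(\<lambda>p :: real \<times> (real^3). (fst p, snd p $ i)) \<in> (borel \<Otimes>\<^sub>M borel) \<rightarrow>\<^sub>M (borel \<Otimes>\<^sub>M borel)" for i :: 3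
    by measurable
  have [measurable]: "(\<lambda>p. qk j R (fst p) (snd p $ i)) \<in> borel_measurable (borel \<Otimes>\<^sub>M borel)" for j and i :: 3
    using measurable_compose[OF p[of i] qk_measurable[of j R]] by simp
  have [measurable]: "(\<lambda>p. gk j (fst p) (snd p $ i)) \<in> borel_measurable (borel \<Otimes>\<^sub>M borel)" for j and i :: 3
    using measurable_compose[OF p[of i] gk_measurable[of j]] by simp
  show ?thesis unfolding Qr_alt cg_def by measurable
qed

lemma exists_large_coordinate:
  fixes y :: "real^3"
  assumes "norm y > 3 * R"
  obtains i where "\<bar>y $ i\<bar> > R"
proof (rule ccontr)
  assume "\<not> thesis"
  then have "(\<Sum>i\<in>UNIV. \<bar>y $ i\<bar>) \<le> (\<Sum>i\<in>(UNIV::3 set). R)"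
    using that by (intro sum_mono) (metis not_le)
  then show False using norm_le_l1_cart[of y] assms by simp
qed

lemma Qk_outside:
  assumes "R > 0" "norm y > 3 * R"
  shows "Qk a R \<tau> y = 0"
proof -
  obtain i where "\<bar>y $ i\<bar> > R" using exists_large_coordinate[OF assms(2)] .
  then show ?thesis using qk_outside[OF assms(1)] by (auto simp: Qk_def)
qed

lemma Qt_outside:
  assumes "R > 0" "norm y > 3 * R"
  shows "Qt R \<tau> y = 0"
  unfolding Qt_def
proof (intro sum.neutral ballI)
  fix m :: 3
  obtain i where i: "\<bar>y $ i\<bar> > R" using exists_large_coordinate[OF assms(2)] .
  show "cg 0 2 R \<tau> (y $ m) * (\<Prod>l\<in>UNIV - {m}. qk 0 R \<tau> (y $ l)) = 0"
  proof (cases "m = i")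
    case True
    then show ?thesis using i assms(1) by (simp add: cg_def cutoff_outside)
  next
    case False
    then have "(\<Prod>l\<in>UNIV - {m}. qk 0 R \<tau> (y $ l)) = 0"
      by (intro prod_zero bexI[of _ i] qk_outside assms i) auto
    then show ?thesis by simp
  qed
qed

lemma Qk_bounds:
  obtains C where "C \<ge> 1"
    "\<And>a R \<tau> y. (\<And>i. a i \<le> 3) \<Longrightarrow> 0 < \<tau> \<Longrightarrow> 0 < R \<Longrightarrow> \<tau> \<le> R\<^sup>2 \<Longrightarrow>
      \<bar>Qk a R \<tau> y\<bar> \<le> C * (\<tau> powr (-1/2)) ^ (3 + sum a UNIV) * gauss8 \<tau> y"
    "\<And>R \<tau> y. 0 < \<tau> \<Longrightarrow> 0 < R \<Longrightarrow> \<tau> \<le> R\<^sup>2 \<Longrightarrow>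
      \<bar>Qr R \<tau> y\<bar> \<le> C * (1 / R) * (\<tau> powr (-1/2)) ^ 4 * gauss8 \<tau> y"
proof -
  obtain C where C: "C \<ge> 1"
    "\<And>j R \<tau> r. j \<le> 3 \<Longrightarrow> 0 < \<tau> \<Longrightarrow> 0 < R \<Longrightarrow> \<tau> \<le> R\<^sup>2 \<Longrightarrow>
      \<bar>qk j R \<tau> r\<bar> \<le> C * (\<tau> powr (-1/2)) ^ Suc j * exp (- (r\<^sup>2 / (8 * \<tau>)))"
    "\<And>R \<tau> r. 0 < \<tau> \<Longrightarrow> 0 < R \<Longrightarrow> \<tau> \<le> R\<^sup>2 \<Longrightarrow>
      \<bar>qk 2 R \<tau> r - cg 0 2 R \<tau> r\<bar> \<le> C * (1 / R) * (\<tau> powr (-1/2)) ^ 2 * exp (- (r\<^sup>2 / (8 * \<tau>)))"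
    using qk_bounds by blast
  show ?thesis
  proof (rule that[of "3 * C ^ 3"])
    have C3: "C ^ 3 \<ge> 1" using C(1) by (rule one_le_power)
    then show "3 * C ^ 3 \<ge> 1" by linarith
    fix a :: "3 \<Rightarrow> nat" and R \<tau> :: real and y :: "real^3"
    assume a: "\<And>i. a i \<le> 3" and t: "0 < \<tau>" "0 < R" "\<tau> \<le> R\<^sup>2"
    have "\<bar>Qk a R \<tau> y\<bar> \<le> (\<Prod>i\<in>UNIV. C * (\<tau> powr (-1/2)) ^ Suc (a i) * exp (- ((y $ i)\<^sup>2 / (8 * \<tau>))))"
      unfolding Qk_def abs_prod by (intro prod_mono conjI C a t) auto
    also have "\<dots> = C ^ 3 * (\<tau> powr (-1/2)) ^ (\<Sum>i\<in>UNIV. Suc (a i)) * gauss8 \<tau> y"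
      by (simp add: prod.distrib gauss8_def power_sum)
    also have "(\<Sum>i\<in>UNIV. Suc (a i)) = 3 + sum a UNIV" by (simp add: sum_Suc)
    finally have "\<bar>Qk a R \<tau> y\<bar> \<le> C ^ 3 * (\<tau> powr (-1/2)) ^ (3 + sum a UNIV) * gauss8 \<tau> y" .
    also have "\<dots> \<le> 3 * C ^ 3 * (\<tau> powr (-1/2)) ^ (3 + sum a UNIV) * gauss8 \<tau> y"
      using C3 C(1) by (intro mult_right_mono gauss8_nonneg) auto
    finally show "\<bar>Qk a R \<tau> y\<bar> \<le> 3 * C ^ 3 * (\<tau> powr (-1/2)) ^ (3 + sum a UNIV) * gauss8 \<tau> y" .
  next
    fix R \<tau> :: real and y :: "real^3"
    assume t: "0 < \<tau>" "0 < R" "\<tau> \<le> R\<^sup>2"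
    define e where "e i = exp (- ((y $ i)\<^sup>2 / (8 * \<tau>)))" for i :: 3
    have "\<bar>Qr R \<tau> y\<bar> \<le> (\<Sum>i\<in>UNIV. \<bar>qk 2 R \<tau> (y $ i) - cg 0 2 R \<tau> (y $ i)\<bar> * (\<Prod>l\<in>UNIV - {i}. \<bar>qk 0 R \<tau> (y $ l)\<bar>))"
      unfolding Qr_alt by (rule order_trans[OF sum_abs]) (simp add: abs_mult abs_prod)
    also have "\<dots> \<le> (\<Sum>i\<in>(UNIV::3 set). (C * (1 / R) * (\<tau> powr (-1/2)) ^ 2 * e i) * (\<Prod>l\<in>UNIV - {i}. C * (\<tau> powr (-1/2)) ^ Suc 0 * e l))"
      unfolding e_def using C(1) t by (intro sum_mono mult_mono prod_mono conjI C prod_nonneg) auto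
    also have "\<dots> = (\<Sum>i\<in>(UNIV::3 set). C ^ 3 * (1 / R) * (\<tau> powr (-1/2)) ^ 4 * gauss8 \<tau> y)"
    proof (rule sum.cong[OF refl])
      fix i :: 3
      have "gauss8 \<tau> y = e i * (\<Prod>l\<in>UNIV - {i}. e l)"
        unfolding gauss8_def e_def by (rule prod.remove) auto
      moreover have "card (UNIV - {i}) = 2" by (simp add: card_Diff_singleton)
      ultimately show "(C * (1 / R) * (\<tau> powr (-1/2)) ^ 2 * e i) * (\<Prod>l\<in>UNIV - {i}. C * (\<tau> powr (-1/2)) ^ Suc 0 * e l)
        = C ^ 3 * (1 / R) * (\<tau> powr (-1/2)) ^ 4 * gauss8 \<tau> y"
        by (simp add: prod.distrib power2_eq_square power3_eq_cube power4_eq_xxxx)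
    qed
    also have "\<dots> = 3 * C ^ 3 * (1 / R) * (\<tau> powr (-1/2)) ^ 4 * gauss8 \<tau> y" by simp
    finally show "\<bar>Qr R \<tau> y\<bar> \<le> 3 * C ^ 3 * (1 / R) * (\<tau> powr (-1/2)) ^ 4 * gauss8 \<tau> y" .
  qed
qed

lemma powr_half_power: "\<tau> > 0 \<Longrightarrow> (\<tau> powr (-1/2)) ^ n = (\<tau>::real) powr (- (real n / 2))"
  by (simp add: powr_powr flip: powr_realpow)

text \<open>A factor \<open>(\<tau> powr (-1/2)) ^ n\<close> turns the powers 6/5 and 27/20 of
  \<open>gauss8_le\<close> into \<open>6/5 - n/2\<close> and \<open>27/20 - n/2\<close>. The three
  bounds are the cases \<open>n = 3\<close> for the kernel, \<open>n = 6\<close> for three space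
  derivatives and \<open>n = 4\<close> for the remainder, with its extra
  \<open>1 / R\<close>.\<close>

lemma Qk_hm_bounds:
  obtains C where "C \<ge> 1"
    "\<And>R \<tau> y. 0 < \<tau> \<Longrightarrow> 0 < R \<Longrightarrow> \<tau> \<le> R\<^sup>2 \<Longrightarrow> (\<And>i. y $ i \<noteq> 0) \<Longrightarrow>
      \<bar>Qk (\<lambda>_. 0) R \<tau> y\<bar> \<le> C * (\<tau> powr (-3/10) + \<tau> powr (-3/20)) * (\<Prod>i\<in>UNIV. hm (y $ i))"
    "\<And>a R \<tau> y. (\<And>i. a i \<le> 3) \<Longrightarrow> sum a UNIV = 3 \<Longrightarrow> 0 < \<tau> \<Longrightarrow> 0 < R \<Longrightarrow> \<tau> \<le> R\<^sup>2 \<Longrightarrow> (\<And>i. y $ i \<noteq> 0) \<Longrightarrow>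
      \<bar>Qk a R \<tau> y\<bar> \<le> C * (\<tau> powr (-9/5) + \<tau> powr (-33/20)) * (\<Prod>i\<in>UNIV. hm (y $ i))"
    "\<And>R \<tau> y. 0 < \<tau> \<Longrightarrow> 0 < R \<Longrightarrow> \<tau> \<le> R\<^sup>2 \<Longrightarrow> (\<And>i. y $ i \<noteq> 0) \<Longrightarrow>
      \<bar>Qr R \<tau> y\<bar> \<le> C * (1 / R) * (\<tau> powr (-4/5) + \<tau> powr (-13/20)) * (\<Prod>i\<in>UNIV. hm (y $ i))"
proof -
  obtain C where C: "C \<ge> 1"
    "\<And>a R \<tau> y. (\<And>i. a i \<le> 3) \<Longrightarrow> 0 < \<tau> \<Longrightarrow> 0 < R \<Longrightarrow> \<tau> \<le> R\<^sup>2 \<Longrightarrow>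
      \<bar>Qk a R \<tau> y\<bar> \<le> C * (\<tau> powr (-1/2)) ^ (3 + sum a UNIV) * gauss8 \<tau> y"
    "\<And>R \<tau> y. 0 < \<tau> \<Longrightarrow> 0 < R \<Longrightarrow> \<tau> \<le> R\<^sup>2 \<Longrightarrow>
      \<bar>Qr R \<tau> y\<bar> \<le> C * (1 / R) * (\<tau> powr (-1/2)) ^ 4 * gauss8 \<tau> y"
    using Qk_bounds by blast
  have step: "C' * (\<tau> powr (-1/2)) ^ n * gauss8 \<tau> y \<le>
      2048 * C' * (\<tau> powr (6/5 - n/2) + \<tau> powr (27/20 - n/2)) * (\<Prod>i\<in>UNIV. hm (y $ i))"
    if "C' \<ge> 0" "\<tau> > 0" "\<And>i. y $ i \<noteq> 0" for C' \<tau> y and n :: nat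
  proof -
    have "C' * (\<tau> powr (-1/2)) ^ n * gauss8 \<tau> y \<le> C' * (\<tau> powr (-1/2)) ^ n *
       (2048 * (\<tau> powr (6/5) + \<tau> powr (27/20)) * (\<Prod>i\<in>UNIV. hm (y $ i)))"
      using that by (intro mult_left_mono gauss8_le) auto
    also have "\<dots> = 2048 * C' * (\<tau> powr (-(real n/2)) * \<tau> powr (6/5) + \<tau> powr (-(real n/2)) * \<tau> powr (27/20)) * (\<Prod>i\<in>UNIV. hm (y $ i))"
      unfolding powr_half_power[OF that(2)] by (simp add: algebra_simps)
    finally show ?thesis by (simp flip: powr_add)
  qed
  show ?thesis
  proof (rule that[of "2048 * C"])
    show "2048 * C \<ge> 1" using C(1) by simp
    fix R \<tau> :: real and y :: "real^3"
    assume t: "0 < \<tau>" "0 < R" "\<tau> \<le> R\<^sup>2" "\<And>i. y $ i \<noteq> 0"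
    show "\<bar>Qk (\<lambda>_. 0) R \<tau> y\<bar> \<le> 2048 * C * (\<tau> powr (-3/10) + \<tau> powr (-3/20)) * (\<Prod>i\<in>UNIV. hm (y $ i))"
      by (rule order_trans[OF C(2)[OF _ t(1-3)]]) (use step[of C \<tau> y 3] C(1) t in auto)
    show "\<bar>Qr R \<tau> y\<bar> \<le> 2048 * C * (1 / R) * (\<tau> powr (-4/5) + \<tau> powr (-13/20)) * (\<Prod>i\<in>UNIV. hm (y $ i))"
      by (rule order_trans[OF C(3)[OF t(1-3)]]) (use step[of "C * (1 / R)" \<tau> y 4] C(1) t in \<open>auto simp: mult.assoc\<close>)
    fix a :: "3 \<Rightarrow> nat" assume a: "\<And>i. a i \<le> 3" "sum a UNIV = 3"
    show "\<bar>Qk a R \<tau> y\<bar> \<le> 2048 * C * (\<tau> powr (-9/5) + \<tau> powr (-33/20)) * (\<Prod>i\<in>UNIV. hm (y $ i))"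
      by (rule order_trans[OF C(2)[OF a(1) t(1-3)]]) (use step[of C \<tau> y 6] C(1) t a in auto)
  qed
qed

lemma ker_eq: "0 < s \<Longrightarrow> s < 2 \<Longrightarrow> ker (s, y) = s powr (-4/5) * (\<Prod>i\<in>UNIV. hm (y $ i))"
  by (simp add: ker_def)

text \<open>The time exponent of \<open>ker\<close> originates here as \<open>-9/5 + 1\<close>. The
  milder power \<open>-33/20 + 1\<close> is traded for it at the cost of a constant, as
  \<open>s\<close> stays below 2.\<close>

lemma nn_integral_time_tail:
  assumes "0 < s" "s < 2"
  shows "(\<integral>\<^sup>+\<tau>. indicator {s..} \<tau> * ennreal (\<tau> powr (-9/5) + \<tau> powr (-33/20)) \<partial>lborel) \<le> ennreal (6 * s powr (-4/5))"
proof -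
  have "(\<integral>\<^sup>+\<tau>. indicator {s..} \<tau> * ennreal (\<tau> powr (-9/5) + \<tau> powr (-33/20)) \<partial>lborel)
    = (\<integral>\<^sup>+\<tau>. indicator {s..} \<tau> * ennreal (\<tau> powr (-9/5)) + indicator {s..} \<tau> * ennreal (\<tau> powr (-33/20)) \<partial>lborel)"
    by (simp add: distrib_left)
  also have "\<dots> = ennreal (s powr (-4/5) / (4/5)) + ennreal (s powr (-13/20) / (13/20))"
    using assms by (subst nn_integral_add) (simp_all add: nn_integral_powr_atLeast)
  also have "\<dots> = ennreal (s powr (-4/5) / (4/5) + s powr (-13/20) / (13/20))"
    by simp
  also have "\<dots> \<le> ennreal (6 * s powr (-4/5))"
  proof (rule ennreal_leI)
    have "s powr (-13/20) \<le> 2 * s powr (-4/5)"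
      using powr_le_powr_time[OF assms, of "13/20" "4/5"] by simp
    then show "s powr (-4/5) / (4/5) + s powr (-13/20) / (13/20) \<le> 6 * s powr (-4/5)"
      using powr_ge_zero[of s "-4/5"] unfolding divide_divide_eq_right by linarith
  qed
  finally show ?thesis .
qed

text \<open>The growth \<open>R powr (7/10)\<close> is slower than \<open>R\<close>, so the factor
  \<open>1 / R\<close> of \<open>Qr\<close> leaves the decay \<open>R powr (-3/10)\<close> with
  which the truncation errors disappear.\<close>

lemma nn_integral_time_initial:
  assumes "R \<ge> 1"
  shows "(\<integral>\<^sup>+\<tau>. indicator {0..R\<^sup>2} \<tau> * ennreal (\<tau> powr (-4/5) + \<tau> powr (-13/20)) \<partial>lborel) \<le> ennreal (8 * R powr (7/10))"
proof -
  have R2: "R\<^sup>2 powr e = R powr (2 * e)" for e using assms by (simp add: powr_powr flip: powr_numeral)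
  have "(\<integral>\<^sup>+\<tau>. indicator {0..R\<^sup>2} \<tau> * ennreal (\<tau> powr (-4/5) + \<tau> powr (-13/20)) \<partial>lborel)
    = (\<integral>\<^sup>+\<tau>. indicator {0..R\<^sup>2} \<tau> * ennreal (\<tau> powr (-4/5)) + indicator {0..R\<^sup>2} \<tau> * ennreal (\<tau> powr (-13/20)) \<partial>lborel)"
    by (simp add: distrib_left)
  also have "\<dots> = ennreal (R powr (2/5) / (1/5)) + ennreal (R powr (7/10) / (7/20))"
    by (subst nn_integral_add) (simp_all add: nn_integral_powr_Icc R2)
  also have "\<dots> = ennreal (R powr (2/5) / (1/5) + R powr (7/10) / (7/20))"
    by simp
  also have "\<dots> \<le> ennreal (8 * R powr (7/10))"
  proof (rule ennreal_leI)
    have "R powr (2/5) \<le> R powr (7/10)" using assms by (intro powr_mono) auto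
    then show "R powr (2/5) / (1/5) + R powr (7/10) / (7/20) \<le> 8 * R powr (7/10)"
      using powr_ge_zero[of R "7/10"] unfolding divide_divide_eq_right by linarith
  qed
  finally show ?thesis .
qed

text \<open>In this order the bounds control the heat kernel at the shifted time, its truncation
  error, the third derivatives of the potential, and the two parts of
  \<open>corr R \<delta>\<close>: the kernel at the final heat time and the accumulated truncation
  error. The constant depends neither on \<delta> nor on \<open>R\<close>, since limits in both are
  taken later.\<close>

lemma kernel_bounds:
  obtains C where "C \<ge> 1"
    "\<And>R s \<delta> y. 0 < s \<Longrightarrow> s < 2 \<Longrightarrow> 0 \<le> \<delta> \<Longrightarrow> \<delta> \<le> 1 \<Longrightarrow> 2 \<le> R \<Longrightarrow> (\<And>i. y $ i \<noteq> 0) \<Longrightarrow>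
      \<bar>Qk (\<lambda>_. 0) R (s + \<delta>) y\<bar> \<le> C * ker (s, y)"
    "\<And>R s \<delta> y. 0 < s \<Longrightarrow> s < 2 \<Longrightarrow> 0 \<le> \<delta> \<Longrightarrow> \<delta> \<le> 1 \<Longrightarrow> 2 \<le> R \<Longrightarrow> (\<And>i. y $ i \<noteq> 0) \<Longrightarrow>
      \<bar>Qr R (s + \<delta>) y\<bar> \<le> C * R powr (-3/10) * ker (s, y)"
    "\<And>a R s \<delta> y. (\<And>i. a i \<le> 3) \<Longrightarrow> sum a UNIV = 3 \<Longrightarrow> 0 < s \<Longrightarrow> s < 2 \<Longrightarrow> 0 \<le> \<delta> \<Longrightarrow> 2 \<le> R \<Longrightarrow> (\<And>i. y $ i \<noteq> 0) \<Longrightarrow>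
      (\<integral>\<^sup>+\<tau>. indicator {s + \<delta><..<R\<^sup>2} \<tau> * ennreal \<bar>Qk a R \<tau> y\<bar> \<partial>lborel) \<le> ennreal (C * ker (s, y))"
    "\<And>R s y. 0 < s \<Longrightarrow> s < 2 \<Longrightarrow> 2 \<le> R \<Longrightarrow> (\<And>i. y $ i \<noteq> 0) \<Longrightarrow>
      \<bar>Qk (\<lambda>_. 0) R (R\<^sup>2) y\<bar> \<le> C * R powr (-3/10) * ker (s, y)"
    "\<And>R s y. 0 < s \<Longrightarrow> s < 2 \<Longrightarrow> 2 \<le> R \<Longrightarrow> (\<And>i. y $ i \<noteq> 0) \<Longrightarrow>
      (\<integral>\<^sup>+\<tau>. indicator {0<..<R\<^sup>2} \<tau> * ennreal \<bar>Qr R \<tau> y\<bar> \<partial>lborel) \<le> ennreal (C * R powr (-3/10) * ker (s, y))"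
proof -
  define H where "H y = (\<Prod>i\<in>UNIV. hm (y $ i))" for y :: "real^3"
  have H: "H y \<ge> 0" for y by (simp add: H_def prod_nonneg hm_nonneg)
  obtain C where C: "C \<ge> 1"
    "\<And>R \<tau> y. 0 < \<tau> \<Longrightarrow> 0 < R \<Longrightarrow> \<tau> \<le> R\<^sup>2 \<Longrightarrow> (\<And>i. y $ i \<noteq> 0) \<Longrightarrow>
      \<bar>Qk (\<lambda>_. 0) R \<tau> y\<bar> \<le> C * (\<tau> powr (-3/10) + \<tau> powr (-3/20)) * H y"
    "\<And>a R \<tau> y. (\<And>i. a i \<le> 3) \<Longrightarrow> sum a UNIV = 3 \<Longrightarrow> 0 < \<tau> \<Longrightarrow> 0 < R \<Longrightarrow> \<tau> \<le> R\<^sup>2 \<Longrightarrow> (\<And>i. y $ i \<noteq> 0) \<Longrightarrow>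
      \<bar>Qk a R \<tau> y\<bar> \<le> C * (\<tau> powr (-9/5) + \<tau> powr (-33/20)) * H y"
    "\<And>R \<tau> y. 0 < \<tau> \<Longrightarrow> 0 < R \<Longrightarrow> \<tau> \<le> R\<^sup>2 \<Longrightarrow> (\<And>i. y $ i \<noteq> 0) \<Longrightarrow>
      \<bar>Qr R \<tau> y\<bar> \<le> C * (1 / R) * (\<tau> powr (-4/5) + \<tau> powr (-13/20)) * H y"
    using Qk_hm_bounds unfolding H_def[symmetric] by blast
  have R4: "R\<^sup>2 \<ge> 4" if "R \<ge> 2" for R :: real using power_mono[OF that, of 2] by simp
  \<comment> \<open>All powers of time that occur are negative, so the shift by \<delta> only
    decreases them and leaves no trace in the bounds.\<close>
  have anti: "(s + \<delta>) powr (- a) \<le> 2 * s powr (-4/5)" if "0 < s" "s < 2" "0 \<le> \<delta>" "0 \<le> a" "a \<le> 4/5" for s \<delta> a :: real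
  proof -
    have "(s + \<delta>) powr (- a) \<le> s powr (- a)" using that by (intro powr_mono2') auto
    also have "\<dots> \<le> 2 * s powr (- (4/5))" using that by (intro powr_le_powr_time) auto
    finally show ?thesis by simp
  qed
  have Rinv: "1 / R \<le> R powr (-3/10)" if "R \<ge> 2" for R :: real
  proof -
    have "R powr (-1) \<le> R powr (-3/10)" using that by (intro powr_mono) auto
    then show ?thesis using that by (simp add: powr_minus_divide)
  qed
  have Hker: "H y \<le> 2 * ker (s, y)" if "0 < s" "s < 2" for s y
    using mult_right_mono[OF powr_le_powr_time[OF that, of 0 "4/5"] H[of y]] that
    by (simp add: ker_eq H_def)
  show ?thesis
  proof (rule that[of "16 * C"])
    show "16 * C \<ge> 1" using C(1) by simp
    fix R s :: real and y :: "real^3"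
    assume t: "0 < s" "s < 2" "2 \<le> R" "\<And>i. y $ i \<noteq> 0"
    have kn: "ker (s, y) = s powr (-4/5) * H y" using t by (simp add: ker_eq H_def)
    note k0 = ker_nonneg[of "(s, y)"]
    have R2: "R\<^sup>2 powr e = R powr (2 * e)" for e using t by (simp add: powr_powr flip: powr_numeral)
    have Rp: "R powr (-3/10) > 0" using t by simp
    {
      fix \<delta> :: real assume \<delta>: "0 \<le> \<delta>" "\<delta> \<le> 1"
      have le: "s + \<delta> \<le> R\<^sup>2" using R4[OF t(3)] t \<delta> by linarith
      have "\<bar>Qk (\<lambda>_. 0) R (s + \<delta>) y\<bar> \<le> C * ((s + \<delta>) powr (-3/10) + (s + \<delta>) powr (-3/20)) * H y"
        using t \<delta> le by (intro C) auto
      also have "\<dots> \<le> C * (2 * s powr (-4/5) + 2 * s powr (-4/5)) * H y"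
        using anti[OF t(1,2) \<delta>(1), of "3/10"] anti[OF t(1,2) \<delta>(1), of "3/20"] C(1)
        by (intro mult_right_mono mult_left_mono add_mono H) auto
      also have "\<dots> = 4 * C * ker (s, y)" by (simp add: kn)
      also have "\<dots> \<le> 16 * C * ker (s, y)" using k0 C(1) by (intro mult_right_mono) auto
      finally show "\<bar>Qk (\<lambda>_. 0) R (s + \<delta>) y\<bar> \<le> 16 * C * ker (s, y)" .
      have "\<bar>Qr R (s + \<delta>) y\<bar> \<le> C * (1 / R) * ((s + \<delta>) powr (-4/5) + (s + \<delta>) powr (-13/20)) * H y"
        using t \<delta> le by (intro C) auto
      also have "\<dots> \<le> C * (R powr (-3/10)) * (2 * s powr (-4/5) + 2 * s powr (-4/5)) * H y"
        using anti[OF t(1,2) \<delta>(1), of "4/5"] anti[OF t(1,2) \<delta>(1), of "13/20"] C(1) t(3) Rinv[OF t(3)]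
        by (intro mult_right_mono mult_mono add_mono H) auto
      also have "\<dots> = 4 * (C * R powr (-3/10) * ker (s, y))" by (simp add: kn)
      also have "\<dots> \<le> 16 * C * R powr (-3/10) * ker (s, y)" using k0 C(1) Rp by simp
      finally show "\<bar>Qr R (s + \<delta>) y\<bar> \<le> 16 * C * R powr (-3/10) * ker (s, y)" .
    }
    {
      fix a :: "3 \<Rightarrow> nat" and \<delta> :: real
      assume a: "\<And>i. a i \<le> 3" "sum a UNIV = 3" and \<delta>: "0 \<le> \<delta>"
      have "(\<integral>\<^sup>+\<tau>. indicator {s + \<delta><..<R\<^sup>2} \<tau> * ennreal \<bar>Qk a R \<tau> y\<bar> \<partial>lborel)
        \<le> (\<integral>\<^sup>+\<tau>. ennreal (C * H y) * (indicator {s..} \<tau> * ennreal (\<tau> powr (-9/5) + \<tau> powr (-33/20))) \<partial>lborel)"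
      proof (rule nn_integral_mono)
        fix \<tau> :: real
        show "indicator {s + \<delta><..<R\<^sup>2} \<tau> * ennreal \<bar>Qk a R \<tau> y\<bar>
          \<le> ennreal (C * H y) * (indicator {s..} \<tau> * ennreal (\<tau> powr (-9/5) + \<tau> powr (-33/20)))"
        proof (cases "\<tau> \<in> {s + \<delta><..<R\<^sup>2}")
          case True
          then have "\<bar>Qk a R \<tau> y\<bar> \<le> C * (\<tau> powr (-9/5) + \<tau> powr (-33/20)) * H y"
            using t a \<delta> by (intro C) auto
          then have "ennreal \<bar>Qk a R \<tau> y\<bar> \<le> ennreal ((C * H y) * (\<tau> powr (-9/5) + \<tau> powr (-33/20)))"
            by (intro ennreal_leI) (simp add: mult_ac)
          then show ?thesis using True \<delta> C(1) H[of y] by (simp add: ennreal_mult)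
        qed auto
      qed
      also have "\<dots> = ennreal (C * H y) * (\<integral>\<^sup>+\<tau>. indicator {s..} \<tau> * ennreal (\<tau> powr (-9/5) + \<tau> powr (-33/20)) \<partial>lborel)"
        by (rule nn_integral_cmult) measurable
      also have "\<dots> \<le> ennreal (C * H y) * ennreal (6 * s powr (-4/5))"
        using t by (intro mult_left_mono nn_integral_time_tail) auto
      also have "\<dots> = ennreal (6 * (C * ker (s, y)))"
        using C(1) H[of y] by (simp add: kn mult_ac flip: ennreal_mult)
      also have "\<dots> \<le> ennreal (16 * C * ker (s, y))" using k0 C(1) by (intro ennreal_leI) simp
      finally show "(\<integral>\<^sup>+\<tau>. indicator {s + \<delta><..<R\<^sup>2} \<tau> * ennreal \<bar>Qk a R \<tau> y\<bar> \<partial>lborel) \<le> ennreal (16 * C * ker (s, y))" .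
    }
    have "\<bar>Qk (\<lambda>_. 0) R (R\<^sup>2) y\<bar> \<le> C * (R\<^sup>2 powr (-3/10) + R\<^sup>2 powr (-3/20)) * H y"
      using t by (intro C) auto
    \<comment> \<open>The powers -3/10 and -3/20 of \<open>R\<^sup>2\<close> are the powers -3/5 and
      -3/10 of \<open>R\<close>; the second dominates.\<close>
    also have "\<dots> \<le> C * (R powr (-3/10) + R powr (-3/10)) * (2 * ker (s, y))"
      unfolding R2 using t C(1) H[of y]
      by (intro mult_mono mult_left_mono add_mono powr_mono Hker) auto
    also have "\<dots> = 4 * (C * R powr (-3/10) * ker (s, y))" by simp
    also have "\<dots> \<le> 16 * C * R powr (-3/10) * ker (s, y)" using k0 C(1) Rp by simp
    finally show "\<bar>Qk (\<lambda>_. 0) R (R\<^sup>2) y\<bar> \<le> 16 * C * R powr (-3/10) * ker (s, y)" .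
    have "(\<integral>\<^sup>+\<tau>. indicator {0<..<R\<^sup>2} \<tau> * ennreal \<bar>Qr R \<tau> y\<bar> \<partial>lborel)
      \<le> (\<integral>\<^sup>+\<tau>. ennreal (C * (1 / R) * H y) * (indicator {0..R\<^sup>2} \<tau> * ennreal (\<tau> powr (-4/5) + \<tau> powr (-13/20))) \<partial>lborel)"
    proof (rule nn_integral_mono)
      fix \<tau> :: real
      show "indicator {0<..<R\<^sup>2} \<tau> * ennreal \<bar>Qr R \<tau> y\<bar>
        \<le> ennreal (C * (1 / R) * H y) * (indicator {0..R\<^sup>2} \<tau> * ennreal (\<tau> powr (-4/5) + \<tau> powr (-13/20)))"
      proof (cases "\<tau> \<in> {0<..<R\<^sup>2}")
        case True
        then have "\<bar>Qr R \<tau> y\<bar> \<le> C * (1 / R) * (\<tau> powr (-4/5) + \<tau> powr (-13/20)) * H y"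
          using t by (intro C) auto
        then have "ennreal \<bar>Qr R \<tau> y\<bar> \<le> ennreal ((C * (1 / R) * H y) * (\<tau> powr (-4/5) + \<tau> powr (-13/20)))"
          by (intro ennreal_leI) (simp add: mult_ac)
        moreover have "0 \<le> C * (1 / R) * H y" using C(1) H[of y] t(3) by simp
        ultimately have "ennreal \<bar>Qr R \<tau> y\<bar> \<le> ennreal (C * (1 / R) * H y) * ennreal (\<tau> powr (-4/5) + \<tau> powr (-13/20))"
          by (simp only: ennreal_mult[OF _ add_nonneg_nonneg[OF powr_ge_zero powr_ge_zero]])
        then show ?thesis using True by (simp del: ennreal_plus)
      qed auto
    qed
    also have "\<dots> = ennreal (C * (1 / R) * H y) * (\<integral>\<^sup>+\<tau>. indicator {0..R\<^sup>2} \<tau> * ennreal (\<tau> powr (-4/5) + \<tau> powr (-13/20)) \<partial>lborel)"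
      by (rule nn_integral_cmult) measurable
    also have "\<dots> \<le> ennreal (C * (1 / R) * H y) * ennreal (8 * R powr (7/10))"
      using t by (intro mult_left_mono nn_integral_time_initial) auto
    also have "\<dots> = ennreal (8 * C * ((1 / R) * R powr (7/10)) * H y)"
      using C(1) H[of y] t(3) by (simp add: mult_ac flip: ennreal_mult)
    also have "(1 / R) * R powr (7/10) = R powr (-3/10)"
    proof -
      have "(1 / R) * R powr (7/10) = R powr (-1) * R powr (7/10)" using t(3) by (simp only: powr_neg_one)
      also have "\<dots> = R powr (-1 + 7/10)" by (simp only: powr_add)
      also have "\<dots> = R powr (-3/10)" by simp
      finally show ?thesis .
    qed
    also have "ennreal (8 * C * R powr (-3/10) * H y) \<le> ennreal (8 * C * R powr (-3/10) * (2 * ker (s, y)))"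
      using C(1) t Rp by (intro ennreal_leI mult_left_mono Hker) auto
    finally show "(\<integral>\<^sup>+\<tau>. indicator {0<..<R\<^sup>2} \<tau> * ennreal \<bar>Qr R \<tau> y\<bar> \<partial>lborel) \<le> ennreal (16 * C * R powr (-3/10) * ker (s, y))"
      by (simp add: mult_ac)
  qed
qed

section \<open>Convolutions: linearity, integration by parts, bounds through
  \<open>ker\<close>\<close>

lemma conv_cong_sum:
  assumes "\<And>i. i \<in> I \<Longrightarrow> f i \<in> test_functions \<Omega>" "\<pi> \<in> borel_measurable \<mu>" "integrable \<mu> k"
  shows "conv \<mu> \<pi> k (\<lambda>x. \<Sum>i\<in>I. f i x) z = (\<Sum>i\<in>I. conv \<mu> \<pi> k (f i) z)"
  unfolding conv_def sum_distrib_right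
  by (rule Bochner_Integration.integral_sum) (rule conv_integrable[OF assms])

lemma conv_add:
  assumes "f \<in> test_functions \<Omega>" "g \<in> test_functions \<Omega>" "\<pi> \<in> borel_measurable \<mu>" "integrable \<mu> k"
  shows "conv \<mu> \<pi> k (\<lambda>x. f x + g x) z = conv \<mu> \<pi> k f z + conv \<mu> \<pi> k g z"
  unfolding conv_def distrib_right
  by (rule Bochner_Integration.integral_add) (rule conv_integrable[OF _ assms(3,4)], rule assms)+

lemma conv_diff_kernel:
  assumes "f \<in> test_functions \<Omega>" "\<pi> \<in> borel_measurable \<mu>" "integrable \<mu> k" "integrable \<mu> k'"
  shows "conv \<mu> \<pi> (\<lambda>w. k w - k' w) f z = conv \<mu> \<pi> k f z - conv \<mu> \<pi> k' f z"
  unfolding conv_def right_diff_distrib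
  by (rule Bochner_Integration.integral_diff) (rule conv_integrable[OF assms(1,2)], rule assms)+

lemma conv_sum_kernel:
  assumes "f \<in> test_functions \<Omega>" "\<pi> \<in> borel_measurable \<mu>" "\<And>i. i \<in> I \<Longrightarrow> integrable \<mu> (k i)"
  shows "conv \<mu> \<pi> (\<lambda>w. \<Sum>i\<in>I. k i w) f z = (\<Sum>i\<in>I. conv \<mu> \<pi> (k i) f z)"
  unfolding conv_def sum_distrib_left
  by (rule Bochner_Integration.integral_sum) (rule conv_integrable[OF assms(1,2)], rule assms)

lemma integrable_bounded_support:
  fixes K :: "'a::euclidean_space \<Rightarrow> real"
  assumes [measurable]: "K \<in> borel_measurable borel"
    and "\<And>x. \<bar>K x\<bar> \<le> B" and "\<And>x. norm x > \<rho> \<Longrightarrow> K x = 0"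
  shows "integrable lborel K"
proof -
  have int: "integrable lborel (\<lambda>x::'a. B * indicator (cball 0 \<rho>) x)"
    by (intro integrable_mult_right integrable_real_indicator) (auto simp: emeasure_lborel_cball_finite[simplified])
  have le: "norm (K x) \<le> norm (B * indicator (cball 0 \<rho>) x)" for x
    using assms(2)[of x] assms(3)[of x] by (cases "norm x > \<rho>") auto
  show ?thesis by (rule Bochner_Integration.integrable_bound[OF int _ AE_I2[OF le]]) simp
qed

text \<open>Moving the parameter along \<open>v\<close> translates the argument of \<open>f\<close>
  along \<open>b\<close>. So the product \<open>f (z + \<pi> \<omega>) * K \<omega>\<close> has a
  derivative along \<open>v\<close> given by the product rule, and this derivative integrates to
  zero.\<close>

lemma conv_by_parts:
  fixes \<pi> :: "'w::euclidean_space \<Rightarrow> 'a::euclidean_space" and f :: "'a \<Rightarrow> real"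
  assumes f: "f \<in> test_functions \<Omega>" and b: "b \<in> Basis"
    and \<pi> [measurable]: "\<pi> \<in> borel_measurable borel" and \<pi>v: "\<And>\<omega> r. \<pi> (\<omega> + r *\<^sub>R v) = \<pi> \<omega> + r *\<^sub>R b"
    and K [measurable]: "K \<in> borel_measurable borel" "K' \<in> borel_measurable borel"
    and bound: "\<And>\<omega>. \<bar>K \<omega>\<bar> \<le> B" "\<And>\<omega>. \<bar>K' \<omega>\<bar> \<le> B"
    and supp: "\<And>\<omega>. norm \<omega> > \<rho> \<Longrightarrow> K \<omega> = 0" "\<And>\<omega>. norm \<omega> > \<rho> \<Longrightarrow> K' \<omega> = 0"
    and deriv: "\<And>\<omega>. ((\<lambda>r. K (\<omega> + r *\<^sub>R v)) has_real_derivative K' \<omega>) (at 0)"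
  shows "conv lborel \<pi> K (dir_deriv b f) z = - conv lborel \<pi> K' f z"
proof -
  have int: "integrable lborel K" "integrable lborel K'"
    using integrable_bounded_support[OF K(1) bound(1) supp(1)] integrable_bounded_support[OF K(2) bound(2) supp(2)] by auto
  have \<pi>': "\<pi> \<in> borel_measurable lborel" by simp
  have f': "dir_deriv b f \<in> test_functions \<Omega>" by (rule test_functions_dir_deriv[OF f b])
  note [measurable] = test_functions_borel[OF f] test_functions_borel[OF f']
  obtain A where A: "A \<ge> 0" "\<And>x. \<bar>f x\<bar> \<le> A" using test_functions_bounded[OF f] by blast
  obtain A' where A': "A' \<ge> 0" "\<And>x. \<bar>dir_deriv b f x\<bar> \<le> A'" using test_functions_bounded[OF f'] by blast
  define F where "F \<omega> = f (z + \<pi> \<omega>) * K \<omega>" for \<omega>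
  define F' where "F' \<omega> = f (z + \<pi> \<omega>) * K' \<omega> + dir_deriv b f (z + \<pi> \<omega>) * K \<omega>" for \<omega>
  have "(\<integral>\<omega>. F' \<omega> \<partial>lborel) = 0"
  proof (rule integral_dir_deriv_zero[where F = F and v = v and B = "A * B + A' * B" and \<rho> = \<rho>])
    show "F \<in> borel_measurable borel" "F' \<in> borel_measurable borel"
      unfolding F_def[abs_def] F'_def[abs_def] by measurable
    show "integrable lborel F" unfolding F_def[abs_def] by (rule conv_integrable[OF f \<pi>' int(1)])
    fix \<omega>
    show "((\<lambda>r. F (\<omega> + r *\<^sub>R v)) has_real_derivative F' \<omega>) (at 0)"
    proof -
      have "((\<lambda>r. f ((z + \<pi> \<omega>) + r *\<^sub>R b)) has_real_derivative dir_deriv b f ((z + \<pi> \<omega>) + 0 *\<^sub>R b)) (at 0)"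
        by (rule smooth_line[OF test_functionsD(1)[OF f]])
      from DERIV_mult'[OF this deriv[of \<omega>]] show ?thesis
        by (simp add: F_def F'_def \<pi>v add.assoc)
    qed
    have "\<bar>F' \<omega>\<bar> \<le> \<bar>f (z + \<pi> \<omega>)\<bar> * \<bar>K' \<omega>\<bar> + \<bar>dir_deriv b f (z + \<pi> \<omega>)\<bar> * \<bar>K \<omega>\<bar>"
      unfolding F'_def by (rule order_trans[OF abs_triangle_ineq]) (simp add: abs_mult)
    also have "\<dots> \<le> A * B + A' * B" using A A' bound by (intro add_mono mult_mono) auto
    finally show "\<bar>F' \<omega>\<bar> \<le> A * B + A' * B" .
    show "F \<omega> = 0" if "norm \<omega> > \<rho>" using supp that by (simp add: F_def)
  qed
  also have "(\<integral>\<omega>. F' \<omega> \<partial>lborel) = conv lborel \<pi> K' f z + conv lborel \<pi> K (dir_deriv b f) z"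
    unfolding F'_def conv_def
    by (rule Bochner_Integration.integral_add) (rule conv_integrable[OF f \<pi>' int(2)], rule conv_integrable[OF f' \<pi>' int(1)])
  finally show ?thesis by simp
qed

text \<open>On the coordinate hyperplanes \<open>ker\<close> is zero, because
  \<open>0 powr x = 0\<close>, and cannot serve as a majorant there. They form a null set, so kernel
  bounds away from them are enough.\<close>

lemma AE_coordinates_nonzero: "AE w in (lborel :: (real \<times> (real^3)) measure). \<forall>i. snd w $ i \<noteq> 0"
proof -
  have "AE w in (lborel :: (real \<times> (real^3)) measure). snd w $ i \<noteq> 0" for i
  proof -
    have "negligible {w :: real \<times> (real^3). space_dir i \<bullet> w = 0}"
      by (rule negligible_hyperplane) (use space_dir_Basis[of i] nonzero_Basis in blast)
    then have "{w :: real \<times> (real^3). space_dir i \<bullet> w = 0} \<in> null_sets lebesgue"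
      by (simp add: negligible_iff_null_sets)
    then have "AE w in lebesgue. w \<notin> {w :: real \<times> (real^3). space_dir i \<bullet> w = 0}" by (rule AE_not_in)
    then show ?thesis unfolding AE_completion_iff by (simp add: inner_prod_def inner_axis')
  qed
  then show ?thesis by (simp add: AE_all_countable)
qed

lemma conv_id_bound:
  assumes f: "f \<in> test_functions \<Omega>" and k: "integrable lborel k" and c: "c \<ge> 0"
    and le: "AE w in lborel. \<bar>k w\<bar> \<le> c * ker w"
  shows "ennreal \<bar>conv lborel (\<lambda>w. w) k f z\<bar> \<le> ennreal c * (\<integral>\<^sup>+w. ennreal (\<bar>f (z + w)\<bar> * ker w) \<partial>lborel)"
proof -
  note [measurable] = test_functions_borel[OF f]
  have "ennreal \<bar>conv lborel (\<lambda>w. w) k f z\<bar> \<le> (\<integral>\<^sup>+w. ennreal (norm (f (z + w) * k w)) \<partial>lborel)"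
    unfolding conv_def real_norm_def[symmetric]
    by (intro integral_norm_bound_ennreal conv_integrable[OF f _ k, of "\<lambda>w. w"]) simp
  also have "\<dots> \<le> (\<integral>\<^sup>+w. ennreal c * ennreal (\<bar>f (z + w)\<bar> * ker w) \<partial>lborel)"
  proof (rule nn_integral_mono_AE, use le in eventually_elim)
    fix w assume "\<bar>k w\<bar> \<le> c * ker w"
    then have "norm (f (z + w) * k w) \<le> c * (\<bar>f (z + w)\<bar> * ker w)"
      using mult_left_mono[of "\<bar>k w\<bar>" "c * ker w" "\<bar>f (z + w)\<bar>"] by (simp add: abs_mult mult_ac)
    then show "ennreal (norm (f (z + w) * k w)) \<le> ennreal c * ennreal (\<bar>f (z + w)\<bar> * ker w)"
      using c by (simp add: ker_nonneg ennreal_leI flip: ennreal_mult)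
  qed
  also have "\<dots> = ennreal c * (\<integral>\<^sup>+w. ennreal (\<bar>f (z + w)\<bar> * ker w) \<partial>lborel)"
    by (rule nn_integral_cmult) measurable
  finally show ?thesis .
qed

text \<open>What \<open>ker\<close> dominates is the integral of the kernel over the heat time, so
  this variable is integrated first, with the absolute value inside.\<close>

lemma conv_fst_bound:
  fixes k :: "(real \<times> (real^3)) \<times> real \<Rightarrow> real"
  assumes f: "f \<in> test_functions \<Omega>" and k: "integrable lborel k" and c: "c \<ge> 0"
    and le: "AE w in lborel. (\<integral>\<^sup>+\<tau>. ennreal \<bar>k (w, \<tau>)\<bar> \<partial>lborel) \<le> ennreal (c * ker w)"
  shows "ennreal \<bar>conv lborel fst k f z\<bar> \<le> ennreal c * (\<integral>\<^sup>+w. ennreal (\<bar>f (z + w)\<bar> * ker w) \<partial>lborel)"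
proof -
  note [measurable] = test_functions_borel[OF f]
  have [measurable]: "k \<in> borel_measurable (lborel \<Otimes>\<^sub>M lborel)" using k unfolding lborel_prod by measurable
  have "ennreal \<bar>conv lborel fst k f z\<bar> \<le> (\<integral>\<^sup>+\<omega>. ennreal (norm (f (z + fst \<omega>) * k \<omega>)) \<partial>lborel)"
    unfolding conv_def real_norm_def[symmetric]
    by (intro integral_norm_bound_ennreal conv_integrable[OF f _ k]) (simp add: borel_prod[symmetric])
  also have "\<dots> = (\<integral>\<^sup>+w. \<integral>\<^sup>+\<tau>. ennreal (norm (f (z + w) * k (w, \<tau>))) \<partial>lborel \<partial>lborel)"
  proof -
    have "(\<lambda>\<omega>. ennreal (norm (f (z + fst \<omega>) * k \<omega>))) \<in> borel_measurable (lborel \<Otimes>\<^sub>M lborel)"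
      by measurable
    from lborel.nn_integral_fst[OF this] show ?thesis by (simp add: lborel_prod)
  qed
  also have "\<dots> = (\<integral>\<^sup>+w. ennreal \<bar>f (z + w)\<bar> * (\<integral>\<^sup>+\<tau>. ennreal \<bar>k (w, \<tau>)\<bar> \<partial>lborel) \<partial>lborel)"
    by (simp add: abs_mult ennreal_mult nn_integral_cmult)
  also have "\<dots> \<le> (\<integral>\<^sup>+w. ennreal c * ennreal (\<bar>f (z + w)\<bar> * ker w) \<partial>lborel)"
  proof (rule nn_integral_mono_AE, use le in eventually_elim)
    fix w assume "(\<integral>\<^sup>+\<tau>. ennreal \<bar>k (w, \<tau>)\<bar> \<partial>lborel) \<le> ennreal (c * ker w)"
    then have "ennreal \<bar>f (z + w)\<bar> * (\<integral>\<^sup>+\<tau>. ennreal \<bar>k (w, \<tau>)\<bar> \<partial>lborel) \<le> ennreal \<bar>f (z + w)\<bar> * ennreal (c * ker w)"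
      by (rule mult_left_mono) simp
    also have "\<dots> = ennreal c * ennreal (\<bar>f (z + w)\<bar> * ker w)"
      using c by (simp add: ker_nonneg mult_ac flip: ennreal_mult)
    finally show "ennreal \<bar>f (z + w)\<bar> * (\<integral>\<^sup>+\<tau>. ennreal \<bar>k (w, \<tau>)\<bar> \<partial>lborel) \<le> ennreal c * ennreal (\<bar>f (z + w)\<bar> * ker w)" .
  qed
  also have "\<dots> = ennreal c * (\<integral>\<^sup>+w. ennreal (\<bar>f (z + w)\<bar> * ker w) \<partial>lborel)"
    by (rule nn_integral_cmult) measurable
  finally show ?thesis .
qed

text \<open>For the Laplacian of the potential the integral over the heat time is evaluated exactly
  rather than bounded, and its cancellation has to be used before any absolute value is
  taken.\<close>

lemma conv_fst_eq_conv_id: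
  fixes k :: "(real \<times> (real^3)) \<times> real \<Rightarrow> real"
  assumes f: "f \<in> test_functions \<Omega>" and k: "integrable lborel k"
  shows "conv lborel fst k f z = conv lborel (\<lambda>w. w) (\<lambda>w. \<integral>\<tau>. k (w, \<tau>) \<partial>lborel) f z"
    and "integrable lborel (\<lambda>w. \<integral>\<tau>. k (w, \<tau>) \<partial>lborel)"
proof -
  have int: "integrable (lborel \<Otimes>\<^sub>M lborel) (\<lambda>\<omega>. f (z + fst \<omega>) * k \<omega>)"
    unfolding lborel_prod by (rule conv_integrable[OF f _ k]) (simp add: borel_prod[symmetric])
  have "conv lborel fst k f z = (\<integral>w. \<integral>\<tau>. f (z + w) * k (w, \<tau>) \<partial>lborel \<partial>lborel)"
    unfolding conv_def using lborel_pair.integral_fst'[OF int] by (simp add: lborel_prod)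
  then show "conv lborel fst k f z = conv lborel (\<lambda>w. w) (\<lambda>w. \<integral>\<tau>. k (w, \<tau>) \<partial>lborel) f z"
    by (simp add: conv_def)
  show "integrable lborel (\<lambda>w. \<integral>\<tau>. k (w, \<tau>) \<partial>lborel)"
    using lborel_pair.integrable_fst'[of k] k by (simp add: lborel_prod)
qed

section \<open>Potentials of test functions\<close>

lemma integral_FTC_open:
  fixes F f :: "real \<Rightarrow> real"
  assumes "a \<le> b" and deriv: "\<And>x. a \<le> x \<Longrightarrow> x \<le> b \<Longrightarrow> (F has_real_derivative f x) (at x)"
    and [measurable]: "f \<in> borel_measurable borel" and bound: "\<And>x. a < x \<Longrightarrow> x < b \<Longrightarrow> \<bar>f x\<bar> \<le> B"
  shows "integrable lborel (\<lambda>x. indicator {a<..<b} x * f x)"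
    and "(\<integral>x. indicator {a<..<b} x * f x \<partial>lborel) = F b - F a"
proof -
  show int: "integrable lborel (\<lambda>x. indicator {a<..<b} x * f x)"
  proof (rule integrable_bounded_support[where B = "max B 0" and \<rho> = "\<bar>a\<bar> + \<bar>b\<bar>"])
    fix x
    show "\<bar>indicator {a<..<b} x * f x\<bar> \<le> max B 0"
      using bound[of x] by (cases "a < x \<and> x < b") auto
    show "indicator {a<..<b} x * f x = 0" if "norm x > \<bar>a\<bar> + \<bar>b\<bar>"
    proof -
      have "x \<notin> {a<..<b}" using that by (auto simp: abs_if split: if_splits)
      then show ?thesis by simp
    qed
  qed measurable
  have "(f has_integral (F b - F a)) {a..b}"
  proof (rule fundamental_theorem_of_calculus[OF assms(1)])
    fix x assume "x \<in> {a..b}"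
    then have "(F has_vector_derivative f x) (at x)"
      using deriv[of x] by (simp add: has_real_derivative_iff_has_vector_derivative)
    then show "(F has_vector_derivative f x) (at x within {a..b})" by (rule has_vector_derivative_at_within)
  qed
  then have "((\<lambda>x. if x \<in> {a..b} then f x else 0) has_integral (F b - F a)) UNIV"
    by (simp only: has_integral_restrict_UNIV)
  then have "((\<lambda>x. indicator {a<..<b} x * f x) has_integral (F b - F a)) UNIV"
    by (rule has_integral_spike[where S = "{a, b}", rotated 2]) (auto simp: indicator_def)
  with has_integral_integral_lborel[OF int] show "(\<integral>x. indicator {a<..<b} x * f x \<partial>lborel) = F b - F a"
    by (rule has_integral_unique)
qed

abbreviation Z0 :: "3 \<Rightarrow> nat" where "Z0 \<equiv> (\<lambda>_. 0)"

definition inc :: "3 \<Rightarrow> (3 \<Rightarrow> nat) \<Rightarrow> 3 \<Rightarrow> nat" where "inc j a = a(j := Suc (a j))"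

lemma sum_inc: "sum (inc j a) UNIV = Suc (sum a UNIV)"
proof -
  have "sum (inc j a) UNIV = Suc (a j) + sum a (UNIV - {j})"
    unfolding inc_def by (subst sum.remove[of UNIV j]) auto
  also have "\<dots> = Suc (sum a UNIV)" by (subst sum.remove[of UNIV j a]) auto
  finally show ?thesis .
qed

lemma le_sum_UNIV: "a j \<le> sum a (UNIV :: 3 set)" for a :: "3 \<Rightarrow> nat"
  by (rule member_le_sum) auto

text \<open>With \<open>\<omega> = (w, \<tau>)\<close>, the potential of a test function \<open>h\<close> is its convolution with \<open>kern (\<lambda>_. 0) R \<delta>\<close>: the heat kernel is
  integrated over \<open>fst w + \<delta> < \<tau> < R\<^sup>2\<close>, so that minus its Laplacian is, up to the truncation error, the heat kernel
  at time \<open>fst w + \<delta>\<close>, and \<open>\<delta>\<close> keeps all kernels bounded.\<close>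

definition kern :: "(3 \<Rightarrow> nat) \<Rightarrow> real \<Rightarrow> real \<Rightarrow> (real \<times> (real^3)) \<times> real \<Rightarrow> real" where
  "kern a R \<delta> \<omega> = (if 0 < fst (fst \<omega>) \<and> fst (fst \<omega>) < 2 \<and> fst (fst \<omega>) + \<delta> < snd \<omega> \<and> snd \<omega> < R\<^sup>2
     then Qk a R (snd \<omega>) (snd (fst \<omega>)) else 0)"

text \<open>The displacement stops at 2, the length of the time interval: from a time after -1 this
  already reaches past the support of a test function that lives before time 1. The shift \<delta>
  keeps the heat time away from the singularity at 0.\<close>

definition slice :: "real \<Rightarrow> (real \<Rightarrow> real^3 \<Rightarrow> real) \<Rightarrow> real \<times> (real^3) \<Rightarrow> real" where
  "slice \<delta> q w = (if 0 < fst w \<and> fst w < 2 then q (fst w + \<delta>) (snd w) else 0)"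

lemma gauss8_le_1: "\<tau> > 0 \<Longrightarrow> gauss8 \<tau> y \<le> 1"
  unfolding gauss8_def by (intro prod_le_1) auto

text \<open>The constant depends on \<delta>. These bounds only justify integrability, integration
  by parts and the fundamental theorem of calculus; the estimates that survive the limit come from
  \<open>kernel_bounds\<close>. The exponent 12 is 3 plus at most three derivatives in each of three
  directions.\<close>

lemma Q_crude_bounds:
  assumes "0 < \<delta>"
  obtains B where "B \<ge> 0"
    "\<And>a R \<tau> y. (\<And>i. a i \<le> 3) \<Longrightarrow> \<delta> \<le> \<tau> \<Longrightarrow> 1 \<le> R \<Longrightarrow> \<tau> \<le> R\<^sup>2 \<Longrightarrow> \<bar>Qk a R \<tau> y\<bar> \<le> B"
    "\<And>R \<tau> y. \<delta> \<le> \<tau> \<Longrightarrow> 1 \<le> R \<Longrightarrow> \<tau> \<le> R\<^sup>2 \<Longrightarrow> \<bar>Qr R \<tau> y\<bar> \<le> B"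
    "\<And>R \<tau> y. \<delta> \<le> \<tau> \<Longrightarrow> 1 \<le> R \<Longrightarrow> \<tau> \<le> R\<^sup>2 \<Longrightarrow> \<bar>Qt R \<tau> y\<bar> \<le> B"
proof -
  obtain C where C: "C \<ge> 1"
    "\<And>a R \<tau> y. (\<And>i. a i \<le> 3) \<Longrightarrow> 0 < \<tau> \<Longrightarrow> 0 < R \<Longrightarrow> \<tau> \<le> R\<^sup>2 \<Longrightarrow>
      \<bar>Qk a R \<tau> y\<bar> \<le> C * (\<tau> powr (-1/2)) ^ (3 + sum a UNIV) * gauss8 \<tau> y"
    "\<And>R \<tau> y. 0 < \<tau> \<Longrightarrow> 0 < R \<Longrightarrow> \<tau> \<le> R\<^sup>2 \<Longrightarrow>
      \<bar>Qr R \<tau> y\<bar> \<le> C * (1 / R) * (\<tau> powr (-1/2)) ^ 4 * gauss8 \<tau> y"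
    using Qk_bounds by blast
  define A where "A = 1 + \<delta> powr (-1/2)"
  have A: "A \<ge> 1" by (simp add: A_def)
  have pw: "(\<tau> powr (-1/2)) ^ n \<le> A ^ 12" if "\<delta> \<le> \<tau>" "n \<le> 12" for \<tau> :: real and n
  proof -
    have "\<tau> powr (-1/2) \<le> \<delta> powr (-1/2)" using that assms by (intro powr_mono2') auto
    then have "(\<tau> powr (-1/2)) ^ n \<le> A ^ n" by (intro power_mono) (auto simp: A_def)
    also have "\<dots> \<le> A ^ 12" using A that by (intro power_increasing)
    finally show ?thesis .
  qed
  define B where "B = C * A ^ 12"
  have B: "B \<ge> 0" using C(1) A by (simp add: B_def)
  have Qk: "\<bar>Qk a R \<tau> y\<bar> \<le> B" if a: "\<And>i. a i \<le> 3" and t: "\<delta> \<le> \<tau>" "1 \<le> R" "\<tau> \<le> R\<^sup>2" for a R \<tau> y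
  proof -
    have "sum a UNIV \<le> (\<Sum>i\<in>(UNIV::3 set). 3)" using a by (intro sum_mono) auto
    then have n: "3 + sum a UNIV \<le> 12" by simp
    have "\<bar>Qk a R \<tau> y\<bar> \<le> C * (\<tau> powr (-1/2)) ^ (3 + sum a UNIV) * gauss8 \<tau> y"
      using assms a t by (intro C) auto
    also have "\<dots> \<le> C * A ^ 12 * 1"
      using C(1) A assms t by (intro mult_mono pw n gauss8_le_1 gauss8_nonneg) auto
    finally show ?thesis by (simp add: B_def)
  qed
  have Qr: "\<bar>Qr R \<tau> y\<bar> \<le> B" if t: "\<delta> \<le> \<tau>" "1 \<le> R" "\<tau> \<le> R\<^sup>2" for R \<tau> y
  proof -
    have "\<bar>Qr R \<tau> y\<bar> \<le> C * (1 / R) * (\<tau> powr (-1/2)) ^ 4 * gauss8 \<tau> y"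
      using assms t by (intro C) auto
    also have "\<dots> \<le> C * 1 * A ^ 12 * 1"
      using C(1) A assms t by (intro mult_mono pw gauss8_le_1 gauss8_nonneg) auto
    finally show ?thesis by (simp add: B_def)
  qed
  show ?thesis
  \<comment> \<open>\<open>Qt\<close> is the difference of \<open>Ql\<close>, with its three
    summands, and \<open>Qr\<close>: four terms in all.\<close>
  proof (rule that[of "4 * B"])
    show "4 * B \<ge> 0" using B by simp
    show "\<bar>Qk a R \<tau> y\<bar> \<le> 4 * B" if "\<And>i. a i \<le> 3" "\<delta> \<le> \<tau>" "1 \<le> R" "\<tau> \<le> R\<^sup>2" for a R \<tau> y
    proof -
      have "\<bar>Qk a R \<tau> y\<bar> \<le> B" by (rule Qk) (use that in auto)
      then show ?thesis using B by linarith
    qed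
    show "\<bar>Qr R \<tau> y\<bar> \<le> 4 * B" if "\<delta> \<le> \<tau>" "1 \<le> R" "\<tau> \<le> R\<^sup>2" for R \<tau> y
      using Qr[OF that, where y = y] B by linarith
    show "\<bar>Qt R \<tau> y\<bar> \<le> 4 * B" if t: "\<delta> \<le> \<tau>" "1 \<le> R" "\<tau> \<le> R\<^sup>2" for R \<tau> y
    proof -
      have "\<bar>Ql R \<tau> y\<bar> \<le> (\<Sum>i\<in>(UNIV::3 set). B)"
        unfolding Ql_def by (intro order_trans[OF sum_abs] sum_mono Qk t) auto
      then show ?thesis using Qr[OF t, where y = y] by (simp add: Qr_def)
    qed
  qed
qed

lemma Qt_eq: "Qt R \<tau> y = Ql R \<tau> y - Qr R \<tau> y"
  by (simp add: Qr_def)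

lemma Ql_measurable [measurable]: "(\<lambda>p. Ql R (fst p) (snd p)) \<in> borel_measurable (borel \<Otimes>\<^sub>M borel)"
  unfolding Ql_def by measurable

lemma Qt_measurable [measurable]: "(\<lambda>p. Qt R (fst p) (snd p)) \<in> borel_measurable (borel \<Otimes>\<^sub>M borel)"
  unfolding Qt_eq by measurable

lemma slice_measurable:
  assumes q: "(\<lambda>p. q (fst p) (snd p)) \<in> borel_measurable (borel \<Otimes>\<^sub>M borel)"
  shows "slice \<delta> q \<in> borel_measurable borel"
proof -
  have p: "(\<lambda>w :: real \<times> (real^3). (fst w + \<delta>, snd w)) \<in> (borel \<Otimes>\<^sub>M borel) \<rightarrow>\<^sub>M (borel \<Otimes>\<^sub>M borel)"
    by measurable
  have [measurable]: "(\<lambda>w. q (fst w + \<delta>) (snd w)) \<in> borel_measurable (borel \<Otimes>\<^sub>M borel)"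
    using measurable_compose[OF p q] by simp
  show ?thesis unfolding slice_def[abs_def] borel_prod[symmetric] by measurable
qed

lemma kern_measurable [measurable]: "kern a R \<delta> \<in> borel_measurable borel"
proof -
  have p: "(\<lambda>\<omega> :: (real \<times> (real^3)) \<times> real. (snd \<omega>, snd (fst \<omega>))) \<in> ((borel \<Otimes>\<^sub>M borel) \<Otimes>\<^sub>M borel) \<rightarrow>\<^sub>M (borel \<Otimes>\<^sub>M borel)"
    by measurable
  have [measurable]: "(\<lambda>\<omega> :: (real \<times> (real^3)) \<times> real. Qk a R (snd \<omega>) (snd (fst \<omega>))) \<in> borel_measurable ((borel \<Otimes>\<^sub>M borel) \<Otimes>\<^sub>M borel)"
    using measurable_compose[OF p Qk_measurable[of a R]] by simp
  show ?thesis unfolding kern_def[abs_def] borel_prod[symmetric] by measurable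
qed

context
  fixes R \<delta> :: real
  assumes R: "2 \<le> R" and \<delta>: "0 < \<delta>" "\<delta> \<le> 1"
begin

lemma R2: "4 \<le> R\<^sup>2" using power_mono[OF R, of 2] by simp

lemma kern_bounded:
  obtains B \<rho> where "\<And>a \<omega>. (\<And>i. a i \<le> 3) \<Longrightarrow> \<bar>kern a R \<delta> \<omega>\<bar> \<le> B"
    "\<And>a \<omega>. norm \<omega> > \<rho> \<Longrightarrow> kern a R \<delta> \<omega> = 0"
proof -
  obtain B where B: "B \<ge> 0"
    "\<And>a R \<tau> y. (\<And>i. a i \<le> 3) \<Longrightarrow> \<delta> \<le> \<tau> \<Longrightarrow> 1 \<le> R \<Longrightarrow> \<tau> \<le> R\<^sup>2 \<Longrightarrow> \<bar>Qk a R \<tau> y\<bar> \<le> B"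
    "\<And>R \<tau> y. \<delta> \<le> \<tau> \<Longrightarrow> 1 \<le> R \<Longrightarrow> \<tau> \<le> R\<^sup>2 \<Longrightarrow> \<bar>Qr R \<tau> y\<bar> \<le> B"
    "\<And>R \<tau> y. \<delta> \<le> \<tau> \<Longrightarrow> 1 \<le> R \<Longrightarrow> \<tau> \<le> R\<^sup>2 \<Longrightarrow> \<bar>Qt R \<tau> y\<bar> \<le> B"
    using Q_crude_bounds[OF \<delta>(1)] by blast
  show ?thesis
  proof (rule that[of B "2 + 3 * R + R\<^sup>2"])
    show "\<bar>kern a R \<delta> \<omega>\<bar> \<le> B" if "\<And>i. a i \<le> 3" for a \<omega>
    proof (cases "0 < fst (fst \<omega>) \<and> fst (fst \<omega>) < 2 \<and> fst (fst \<omega>) + \<delta> < snd \<omega> \<and> snd \<omega> < R\<^sup>2")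
      case True
      then have "\<bar>Qk a R (snd \<omega>) (snd (fst \<omega>))\<bar> \<le> B" using R by (intro B(2) that) linarith+
      then show ?thesis using True by (simp add: kern_def)
    next
      case False
      then show ?thesis using B(1) by (simp only: kern_def if_False abs_zero)
    qed
    show "kern a R \<delta> \<omega> = 0" if n: "norm \<omega> > 2 + 3 * R + R\<^sup>2" for a \<omega>
    proof (rule ccontr)
      assume nz: "kern a R \<delta> \<omega> \<noteq> 0"
      then have c: "0 < fst (fst \<omega>)" "fst (fst \<omega>) < 2" "fst (fst \<omega>) + \<delta> < snd \<omega>" "snd \<omega> < R\<^sup>2"
        by (auto simp: kern_def split: if_splits)
      have "Qk a R (snd \<omega>) (snd (fst \<omega>)) \<noteq> 0" using nz c by (simp add: kern_def)
      then have "norm (snd (fst \<omega>)) \<le> 3 * R"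
        using R Qk_outside[of R "snd (fst \<omega>)" a "snd \<omega>"] by linarith
      moreover have "norm \<omega> \<le> norm (fst \<omega>) + norm (snd \<omega>)"
        using norm_Pair_le[of "fst \<omega>" "snd \<omega>"] by simp
      moreover have "norm (fst \<omega>) \<le> norm (fst (fst \<omega>)) + norm (snd (fst \<omega>))"
        using norm_Pair_le[of "fst (fst \<omega>)" "snd (fst \<omega>)"] by simp
      ultimately show False using c n \<delta> by simp
    qed
  qed
qed

lemma kern_integrable:
  assumes "\<And>i. a i \<le> 3"
  shows "integrable lborel (kern a R \<delta>)"
proof -
  obtain B \<rho> where B: "\<And>a \<omega>. (\<And>i. a i \<le> 3) \<Longrightarrow> \<bar>kern a R \<delta> \<omega>\<bar> \<le> B"
    "\<And>a \<omega>. norm \<omega> > \<rho> \<Longrightarrow> kern a R \<delta> \<omega> = 0" using kern_bounded by blast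
  show ?thesis by (rule integrable_bounded_support[OF kern_measurable B(1)[OF assms] B(2)])
qed

lemma kern_by_parts:
  assumes f: "f \<in> test_functions \<Omega>" and a: "\<And>i. inc j a i \<le> 3"
  shows "conv lborel fst (kern a R \<delta>) (dir_deriv (space_dir j) f) z = - conv lborel fst (kern (inc j a) R \<delta>) f z"
proof -
  obtain B \<rho> where B: "\<And>a \<omega>. (\<And>i. a i \<le> 3) \<Longrightarrow> \<bar>kern a R \<delta> \<omega>\<bar> \<le> B"
    "\<And>a \<omega>. norm \<omega> > \<rho> \<Longrightarrow> kern a R \<delta> \<omega> = 0" using kern_bounded by blast
  have a': "a i \<le> 3" for i using a[of i] by (auto simp: inc_def split: if_splits)
  have aj: "a j < 3" using a[of j] by (simp add: inc_def)
  show ?thesis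
  \<comment> \<open>This direction leaves both time variables fixed, so the conditions in
    \<open>kern\<close>, where it jumps, are constant along it.\<close>
  proof (rule conv_by_parts[OF f space_dir_Basis, where v = "(space_dir j, 0)" and B = B and \<rho> = \<rho>])
    show "(fst :: (real \<times> (real^3)) \<times> real \<Rightarrow> _) \<in> borel_measurable borel"
      by (simp add: borel_prod[symmetric])
    fix \<omega> :: "(real \<times> (real^3)) \<times> real"
    have "((\<lambda>r. Qk a R (snd \<omega>) (snd (fst \<omega>) + r *\<^sub>R axis j 1)) has_real_derivative
      Qk (inc j a) R (snd \<omega>) (snd (fst \<omega>))) (at 0)"
      unfolding inc_def using R aj by (intro Qk_deriv) auto
    then show "((\<lambda>r. kern a R \<delta> (\<omega> + r *\<^sub>R (space_dir j, 0))) has_real_derivative kern (inc j a) R \<delta> \<omega>) (at 0)"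
      by (auto simp: kern_def)
  qed (auto intro!: B a a')
qed

lemma kern_by_parts3:
  assumes h: "h \<in> test_functions \<Omega>"
  shows "conv lborel fst (kern Z0 R \<delta>) (dir_deriv (space_dir i) (dir_deriv (space_dir j) (dir_deriv (space_dir k) h))) z
    = - conv lborel fst (kern (inc k (inc j (inc i Z0))) R \<delta>) h z"
proof -
  have le: "inc k (inc j (inc i Z0)) l \<le> 3" "inc j (inc i Z0) l \<le> 3" "inc i Z0 l \<le> 3" for l
    using le_sum_UNIV[of "inc k (inc j (inc i Z0))" l] le_sum_UNIV[of "inc j (inc i Z0)" l] le_sum_UNIV[of "inc i Z0" l]
    by (simp_all add: sum_inc)
  show ?thesis
    using kern_by_parts[OF _ le(3), of "dir_deriv (space_dir j) (dir_deriv (space_dir k) h)" \<Omega>, where z = z]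
      kern_by_parts[OF _ le(2), of "dir_deriv (space_dir k) h" \<Omega>, where z = z] kern_by_parts[OF h le(1), where z = z] h
    by (simp add: test_functions_dir_deriv)
qed

lemma slice_integrable:
  assumes q: "(\<lambda>p. q (fst p) (snd p)) \<in> borel_measurable (borel \<Otimes>\<^sub>M borel)"
    and bound: "\<And>\<tau> y. \<delta> \<le> \<tau> \<Longrightarrow> \<tau> \<le> R\<^sup>2 \<Longrightarrow> \<bar>q \<tau> y\<bar> \<le> B" "B \<ge> 0"
    and supp: "\<And>\<tau> y. norm y > 3 * R \<Longrightarrow> q \<tau> y = 0"
  shows "integrable lborel (slice \<delta> q)" "\<And>w. \<bar>slice \<delta> q w\<bar> \<le> B" "\<And>w. norm w > 2 + 3 * R \<Longrightarrow> slice \<delta> q w = 0"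
proof -
  show b: "\<bar>slice \<delta> q w\<bar> \<le> B" for w
    using bound \<delta> R2 by (auto simp: slice_def)
  show s: "slice \<delta> q w = 0" if "norm w > 2 + 3 * R" for w
  proof (rule ccontr)
    assume "slice \<delta> q w \<noteq> 0"
    then have "0 < fst w" "fst w < 2" "norm (snd w) \<le> 3 * R"
      using supp[of "snd w"] by (force simp: slice_def split: if_splits)+
    then show False using norm_Pair_le[of "fst w" "snd w"] that by simp
  qed
  show "integrable lborel (slice \<delta> q)"
    by (rule integrable_bounded_support[OF slice_measurable[OF q] b s])
qed

lemma Q_outside:
  assumes "norm y > 3 * R"
  shows "Qk a R \<tau> y = 0" "Qt R \<tau> y = 0" "Qr R \<tau> y = 0"
proof -
  have k: "Qk a R \<tau>' y = 0" for a \<tau>' using R assms by (intro Qk_outside) auto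
  then show "Qk a R \<tau> y = 0" .
  have "Qt R \<tau> y = 0" using R assms by (intro Qt_outside) auto
  then show "Qt R \<tau> y = 0" "Qr R \<tau> y = 0" by (simp_all add: Qr_def Ql_def k)
qed

lemma slice_facts:
  obtains B where "B \<ge> 0"
    "\<And>a. (\<And>i. a i \<le> 3) \<Longrightarrow> integrable lborel (slice \<delta> (Qk a R))"
    "\<And>a w. (\<And>i. a i \<le> 3) \<Longrightarrow> \<bar>slice \<delta> (Qk a R) w\<bar> \<le> B"
    "\<And>a w. (\<And>i. a i \<le> 3) \<Longrightarrow> norm w > 2 + 3 * R \<Longrightarrow> slice \<delta> (Qk a R) w = 0"
    "integrable lborel (slice \<delta> (Qt R))" "integrable lborel (slice \<delta> (Qr R))"
    "\<And>w. \<bar>slice \<delta> (Qt R) w\<bar> \<le> B"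
proof -
  obtain B where B: "B \<ge> 0"
    "\<And>a R \<tau> y. (\<And>i. a i \<le> 3) \<Longrightarrow> \<delta> \<le> \<tau> \<Longrightarrow> 1 \<le> R \<Longrightarrow> \<tau> \<le> R\<^sup>2 \<Longrightarrow> \<bar>Qk a R \<tau> y\<bar> \<le> B"
    "\<And>R \<tau> y. \<delta> \<le> \<tau> \<Longrightarrow> 1 \<le> R \<Longrightarrow> \<tau> \<le> R\<^sup>2 \<Longrightarrow> \<bar>Qr R \<tau> y\<bar> \<le> B"
    "\<And>R \<tau> y. \<delta> \<le> \<tau> \<Longrightarrow> 1 \<le> R \<Longrightarrow> \<tau> \<le> R\<^sup>2 \<Longrightarrow> \<bar>Qt R \<tau> y\<bar> \<le> B"
    using Q_crude_bounds[OF \<delta>(1)] by blast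
  have R1: "1 \<le> R" using R by simp
  note k = slice_integrable[OF Qk_measurable B(2)[OF _ _ R1] B(1) Q_outside(1)]
  note t = slice_integrable[OF Qt_measurable B(4)[OF _ R1] B(1) Q_outside(2)]
  note r = slice_integrable[OF Qr_measurable B(3)[OF _ R1] B(1) Q_outside(3)]
  show ?thesis by (rule that[OF B(1) k(1) k(2) k(3) t(1) r(1) t(2)])
qed

lemma slice_Qk_integrable:
  assumes "\<And>i. a i \<le> 3"
  shows "integrable lborel (slice \<delta> (Qk a R))"
proof -
  obtain B where "B \<ge> 0"
    "\<And>a. (\<And>i. a i \<le> 3) \<Longrightarrow> integrable lborel (slice \<delta> (Qk a R))"
    "\<And>a w. (\<And>i. a i \<le> 3) \<Longrightarrow> \<bar>slice \<delta> (Qk a R) w\<bar> \<le> B"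
    "\<And>a w. (\<And>i. a i \<le> 3) \<Longrightarrow> norm w > 2 + 3 * R \<Longrightarrow> slice \<delta> (Qk a R) w = 0"
    "integrable lborel (slice \<delta> (Qt R))" "integrable lborel (slice \<delta> (Qr R))"
    "\<And>w. \<bar>slice \<delta> (Qt R) w\<bar> \<le> B" using slice_facts by blast
  from this(2)[OF assms] show ?thesis .
qed

lemma slice_by_parts:
  assumes f: "f \<in> test_functions \<Omega>" and a: "\<And>i. inc j a i \<le> 3"
  shows "conv lborel (\<lambda>w. w) (slice \<delta> (Qk a R)) (dir_deriv (space_dir j) f) z
    = - conv lborel (\<lambda>w. w) (slice \<delta> (Qk (inc j a) R)) f z"
proof -
  obtain B where "B \<ge> 0"
    "\<And>a. (\<And>i. a i \<le> 3) \<Longrightarrow> integrable lborel (slice \<delta> (Qk a R))"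
    and B: "\<And>a w. (\<And>i. a i \<le> 3) \<Longrightarrow> \<bar>slice \<delta> (Qk a R) w\<bar> \<le> B"
    "\<And>a w. (\<And>i. a i \<le> 3) \<Longrightarrow> norm w > 2 + 3 * R \<Longrightarrow> slice \<delta> (Qk a R) w = 0"
    and "integrable lborel (slice \<delta> (Qt R))" "integrable lborel (slice \<delta> (Qr R))"
    "\<And>w. \<bar>slice \<delta> (Qt R) w\<bar> \<le> B"
    using slice_facts by blast
  have a': "a i \<le> 3" for i using a[of i] by (auto simp: inc_def split: if_splits)
  have aj: "a j < 3" using a[of j] by (simp add: inc_def)
  show ?thesis
  proof (rule conv_by_parts[OF f space_dir_Basis, where v = "space_dir j" and B = B and \<rho> = "2 + 3 * R"])
    fix w :: "real \<times> (real^3)"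
    have "((\<lambda>r. Qk a R (fst w + \<delta>) (snd w + r *\<^sub>R axis j 1)) has_real_derivative
      Qk (inc j a) R (fst w + \<delta>) (snd w)) (at 0)"
      unfolding inc_def using R aj by (intro Qk_deriv) auto
    then show "((\<lambda>r. slice \<delta> (Qk a R) (w + r *\<^sub>R space_dir j)) has_real_derivative slice \<delta> (Qk (inc j a) R) w) (at 0)"
      by (auto simp: slice_def)
  qed (auto intro!: B a a' slice_measurable Qk_measurable)
qed

lemma inc_inc: "inc j (inc j Z0) = Z0(j := 2)"
  by (auto simp: inc_def)

lemma lap_by_parts_slice:
  assumes h: "h \<in> test_functions \<Omega>"
  shows "(\<Sum>j\<in>UNIV. conv lborel (\<lambda>w. w) (slice \<delta> (Qk Z0 R)) (dir_deriv (space_dir j) (dir_deriv (space_dir j) h)) z)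
    = conv lborel (\<lambda>w. w) (slice \<delta> (Ql R)) h z"
proof -
  have le: "inc j (inc j Z0) l \<le> 3" "inc j Z0 l \<le> 3" for l j
    using le_sum_UNIV[of "inc j (inc j Z0)" l] le_sum_UNIV[of "inc j Z0" l]
    by (simp_all add: sum_inc)
  have eq: "slice \<delta> (Ql R) = (\<lambda>w. \<Sum>j\<in>UNIV. slice \<delta> (Qk (inc j (inc j Z0)) R) w)"
    by (rule ext) (auto simp: slice_def Ql_def inc_inc)
  have "conv lborel (\<lambda>w. w) (slice \<delta> (Qk Z0 R)) (dir_deriv (space_dir j) (dir_deriv (space_dir j) h)) z
    = conv lborel (\<lambda>w. w) (slice \<delta> (Qk (inc j (inc j Z0)) R)) h z" for j
    using slice_by_parts[OF _ le(2), of "dir_deriv (space_dir j) h" \<Omega>, where z = z] slice_by_parts[OF h le(1), where z = z] h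
    by (simp add: test_functions_dir_deriv)
  then have "(\<Sum>j\<in>UNIV. conv lborel (\<lambda>w. w) (slice \<delta> (Qk Z0 R)) (dir_deriv (space_dir j) (dir_deriv (space_dir j) h)) z)
    = (\<Sum>j\<in>UNIV. conv lborel (\<lambda>w. w) (slice \<delta> (Qk (inc j (inc j Z0)) R)) h z)" by (simp only:)
  also have "\<dots> = conv lborel (\<lambda>w. w) (slice \<delta> (Ql R)) h z"
    unfolding eq by (rule conv_sum_kernel[symmetric, OF h _ slice_Qk_integrable[OF le(1)]]) simp
  finally show ?thesis .
qed

lemma lap_by_parts_kern:
  assumes h: "h \<in> test_functions \<Omega>"
  shows "(\<Sum>j\<in>UNIV. conv lborel fst (kern Z0 R \<delta>) (dir_deriv (space_dir j) (dir_deriv (space_dir j) h)) z)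
    = conv lborel fst (\<lambda>\<omega>. \<Sum>j\<in>UNIV. kern (Z0(j := 2)) R \<delta> \<omega>) h z"
proof -
  have le: "inc j (inc j Z0) l \<le> 3" "inc j Z0 l \<le> 3" for l j
    using le_sum_UNIV[of "inc j (inc j Z0)" l] le_sum_UNIV[of "inc j Z0" l]
    by (simp_all add: sum_inc)
  have "conv lborel fst (kern Z0 R \<delta>) (dir_deriv (space_dir j) (dir_deriv (space_dir j) h)) z
    = conv lborel fst (kern (Z0(j := 2)) R \<delta>) h z" for j
    using kern_by_parts[OF _ le(2), of "dir_deriv (space_dir j) h" \<Omega>, where z = z] kern_by_parts[OF h le(1), where z = z] h
    by (simp add: test_functions_dir_deriv inc_inc)
  then have "(\<Sum>j\<in>UNIV. conv lborel fst (kern Z0 R \<delta>) (dir_deriv (space_dir j) (dir_deriv (space_dir j) h)) z)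
    = (\<Sum>j\<in>UNIV. conv lborel fst (kern (Z0(j := 2)) R \<delta>) h z)" by (simp only:)
  also have "\<dots> = conv lborel fst (\<lambda>\<omega>. \<Sum>j\<in>UNIV. kern (Z0(j := 2)) R \<delta> \<omega>) h z"
    by (rule conv_sum_kernel[symmetric, OF h _ kern_integrable]) (auto simp: borel_prod[symmetric])
  finally show ?thesis .
qed

end

lemma section_measurable:
  fixes q :: "real \<Rightarrow> real^3 \<Rightarrow> real"
  assumes "(\<lambda>p. q (fst p) (snd p)) \<in> borel_measurable (borel \<Otimes>\<^sub>M borel)"
  shows "(\<lambda>\<tau>. q \<tau> y) \<in> borel_measurable borel" "(\<lambda>y. q \<tau> y) \<in> borel_measurable borel"
  using measurable_compose[of "\<lambda>\<tau>. (\<tau>, y)" borel, OF _ assms]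
    measurable_compose[of "\<lambda>y. (\<tau>, y)" borel, OF _ assms] by simp_all

text \<open>For the exact heat kernel, integrated up to infinite heat time, the two terms would
  cancel. What remains is the effect of stopping at \<open>R\<^sup>2\<close> and of cutting off in
  space.\<close>

definition corr :: "real \<Rightarrow> real \<Rightarrow> real \<times> (real^3) \<Rightarrow> real" where
  "corr R \<delta> w = slice \<delta> (Qk Z0 R) w + (\<integral>\<tau>. (\<Sum>j\<in>UNIV. kern (Z0(j := 2)) R \<delta> (w, \<tau>)) \<partial>lborel)"

context
  fixes R \<delta> :: real
  assumes R: "2 \<le> R" and \<delta>: "0 < \<delta>" "\<delta> \<le> 1"
begin

lemma kern2_integrable: "integrable lborel (\<lambda>\<omega>. \<Sum>j\<in>UNIV. kern (Z0(j := 2)) R \<delta> \<omega>)"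
  by (intro Bochner_Integration.integrable_sum kern_integrable R \<delta>) simp

lemma corr_integrable: "integrable lborel (corr R \<delta>)"
proof -
  have "integrable lborel (\<lambda>w. \<integral>\<tau>. (\<Sum>j\<in>UNIV. kern (Z0(j := 2)) R \<delta> (w, \<tau>)) \<partial>lborel)"
    by (rule conv_fst_eq_conv_id(2)[OF test_functions_zero kern2_integrable])
  moreover have "integrable lborel (slice \<delta> (Qk Z0 R))"
    by (rule slice_Qk_integrable[OF R \<delta>]) simp
  ultimately show ?thesis unfolding corr_def[abs_def] by simp
qed

lemma lap_conv_kern:
  assumes h: "h \<in> test_functions \<Omega>"
  shows "lap (conv lborel fst (kern Z0 R \<delta>) h) z =
    conv lborel (\<lambda>w. w) (corr R \<delta>) h z - conv lborel (\<lambda>w. w) (slice \<delta> (Qk Z0 R)) h z"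
proof -
  have fst: "(fst :: (real \<times> (real^3)) \<times> real \<Rightarrow> _) \<in> borel_measurable lborel"
    by (simp add: borel_prod[symmetric])
  have k0: "integrable lborel (kern Z0 R \<delta>)" by (rule kern_integrable[OF R \<delta>]) simp
  have s0: "integrable lborel (slice \<delta> (Qk Z0 R))" by (rule slice_Qk_integrable[OF R \<delta>]) simp
  have D: "dir_deriv (space_dir j) (dir_deriv (space_dir j) (conv lborel fst (kern Z0 R \<delta>) h))
     = conv lborel fst (kern Z0 R \<delta>) (dir_deriv (space_dir j) (dir_deriv (space_dir j) h))" for j
    by (simp only: conv_dir_deriv[OF h fst k0 space_dir_Basis]
        conv_dir_deriv[OF test_functions_dir_deriv[OF h space_dir_Basis] fst k0 space_dir_Basis])
  have "lap (conv lborel fst (kern Z0 R \<delta>) h) z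
    = conv lborel fst (\<lambda>\<omega>. \<Sum>j\<in>UNIV. kern (Z0(j := 2)) R \<delta> \<omega>) h z"
    unfolding D by (rule lap_by_parts_kern[OF R \<delta> h])
  also have "\<dots> = conv lborel (\<lambda>w. w) (\<lambda>w. \<integral>\<tau>. (\<Sum>j\<in>UNIV. kern (Z0(j := 2)) R \<delta> (w, \<tau>)) \<partial>lborel) h z"
    by (rule conv_fst_eq_conv_id(1)[OF h kern2_integrable])
  also have "(\<lambda>w. \<integral>\<tau>. (\<Sum>j\<in>UNIV. kern (Z0(j := 2)) R \<delta> (w, \<tau>)) \<partial>lborel) = (\<lambda>w. corr R \<delta> w - slice \<delta> (Qk Z0 R) w)"
    by (simp add: corr_def)
  also have "conv lborel (\<lambda>w. w) \<dots> h z =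
    conv lborel (\<lambda>w. w) (corr R \<delta>) h z - conv lborel (\<lambda>w. w) (slice \<delta> (Qk Z0 R)) h z"
    by (rule conv_diff_kernel[OF h _ corr_integrable s0]) simp
  finally show ?thesis .
qed

text \<open>Under the integral \<open>Ql = Qt + Qr\<close>, and \<open>Qt\<close> is a derivative in
  the heat time: it contributes the kernel at \<open>R\<^sup>2\<close> minus the kernel at
  \<open>s + \<delta>\<close>, and the latter cancels the first term of \<open>corr\<close>.\<close>

lemma corr_eq:
  assumes s: "0 < s" "s < 2"
  shows "corr R \<delta> (s, y) = Qk Z0 R (R\<^sup>2) y + (\<integral>\<tau>. indicator {s + \<delta><..<R\<^sup>2} \<tau> * Qr R \<tau> y \<partial>lborel)"
proof -
  obtain B where B: "B \<ge> 0"
    "\<And>a R \<tau> y. (\<And>i. a i \<le> 3) \<Longrightarrow> \<delta> \<le> \<tau> \<Longrightarrow> 1 \<le> R \<Longrightarrow> \<tau> \<le> R\<^sup>2 \<Longrightarrow> \<bar>Qk a R \<tau> y\<bar> \<le> B"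
    "\<And>R \<tau> y. \<delta> \<le> \<tau> \<Longrightarrow> 1 \<le> R \<Longrightarrow> \<tau> \<le> R\<^sup>2 \<Longrightarrow> \<bar>Qr R \<tau> y\<bar> \<le> B"
    "\<And>R \<tau> y. \<delta> \<le> \<tau> \<Longrightarrow> 1 \<le> R \<Longrightarrow> \<tau> \<le> R\<^sup>2 \<Longrightarrow> \<bar>Qt R \<tau> y\<bar> \<le> B"
    using Q_crude_bounds[OF \<delta>(1)] by blast
  have le: "s + \<delta> \<le> R\<^sup>2" using R2[OF R \<delta>] s \<delta> by linarith
  have der: "((\<lambda>\<tau>. Qk Z0 R \<tau> y) has_real_derivative Qt R \<tau> y) (at \<tau>)" if "s + \<delta> \<le> \<tau>" for \<tau>
    using that s \<delta> R by (intro Qk_time_deriv) auto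
  have bt: "\<bar>Qt R \<tau> y\<bar> \<le> B" "\<bar>Qr R \<tau> y\<bar> \<le> B" if "s + \<delta> < \<tau>" "\<tau> < R\<^sup>2" for \<tau>
    using that s \<delta> R by (intro B; linarith)+
  note ft = integral_FTC_open[OF le der section_measurable(1)[OF Qt_measurable] bt(1)]
  have ir: "integrable lborel (\<lambda>\<tau>. indicator {s + \<delta><..<R\<^sup>2} \<tau> * Qr R \<tau> y)"
  proof (rule integrable_bounded_support[where B = B and \<rho> = "R\<^sup>2"])
    show "(\<lambda>\<tau>. indicator {s + \<delta><..<R\<^sup>2} \<tau> * Qr R \<tau> y) \<in> borel_measurable borel"
      using section_measurable(1)[OF Qr_measurable[of R], of y] by measurable
    show "\<bar>indicator {s + \<delta><..<R\<^sup>2} \<tau> * Qr R \<tau> y\<bar> \<le> B" for \<tau>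
      using bt(2)[of \<tau>] B(1) by (cases "\<tau> \<in> {s + \<delta><..<R\<^sup>2}") auto
    show "indicator {s + \<delta><..<R\<^sup>2} \<tau> * Qr R \<tau> y = 0" if "norm \<tau> > R\<^sup>2" for \<tau>
    proof -
      have "\<tau> \<notin> {s + \<delta><..<R\<^sup>2}" using that s \<delta> by auto
      then show ?thesis by simp
    qed
  qed
  have "(\<Sum>j\<in>UNIV. kern (Z0(j := 2)) R \<delta> ((s, y), \<tau>)) =
    indicator {s + \<delta><..<R\<^sup>2} \<tau> * Qt R \<tau> y + indicator {s + \<delta><..<R\<^sup>2} \<tau> * Qr R \<tau> y" for \<tau>
  proof (cases "\<tau> \<in> {s + \<delta><..<R\<^sup>2}")
    case True
    then have "(\<Sum>j\<in>UNIV. kern (Z0(j := 2)) R \<delta> ((s, y), \<tau>)) = Ql R \<tau> y"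
      using s by (simp add: kern_def Ql_def)
    then show ?thesis using True by (simp add: Qr_def)
  next
    case False
    then have "kern (Z0(j := 2)) R \<delta> ((s, y), \<tau>) = 0" for j by (auto simp: kern_def)
    then show ?thesis using False by simp
  qed
  then have "(\<integral>\<tau>. (\<Sum>j\<in>UNIV. kern (Z0(j := 2)) R \<delta> ((s, y), \<tau>)) \<partial>lborel)
    = (Qk Z0 R (R\<^sup>2) y - Qk Z0 R (s + \<delta>) y) + (\<integral>\<tau>. indicator {s + \<delta><..<R\<^sup>2} \<tau> * Qr R \<tau> y \<partial>lborel)"
    using Bochner_Integration.integral_add[OF ft(1) ir] ft(2) by simp
  then show ?thesis using s by (simp add: corr_def slice_def)
qed

lemma corr_outside: "\<not> (0 < fst w \<and> fst w < 2) \<Longrightarrow> corr R \<delta> w = 0"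
  by (auto simp: corr_def slice_def kern_def)

text \<open>Integration by parts in the time displacement \<open>s\<close>. The upper end
  \<open>s = 2\<close> contributes nothing, because \<open>h\<close> vanishes from time 1 on; the
  lower end leaves the kernel at heat time \<delta>, that is, a mollification of \<open>h\<close> in
  space at a fixed time.\<close>

lemma slice_time_identity:
  assumes h: "h \<in> test_functions ({..<1} \<times> UNIV)" and z: "fst z \<ge> -1"
  shows "conv lborel (\<lambda>w. w) (slice \<delta> (Qk Z0 R)) (dir_deriv time_dir h) z
      + conv lborel (\<lambda>w. w) (slice \<delta> (Qt R)) h z
    = - (\<integral>y. h (fst z, snd z + y) * Qk Z0 R \<delta> y \<partial>lborel)"
proof -
  have h': "dir_deriv time_dir h \<in> test_functions ({..<1} \<times> UNIV)"
    by (rule test_functions_dir_deriv[OF h time_dir_Basis])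
  note [measurable] = test_functions_borel[OF h] test_functions_borel[OF h']
  obtain B where B: "B \<ge> 0"
    "\<And>a R \<tau> y. (\<And>i. a i \<le> 3) \<Longrightarrow> \<delta> \<le> \<tau> \<Longrightarrow> 1 \<le> R \<Longrightarrow> \<tau> \<le> R\<^sup>2 \<Longrightarrow> \<bar>Qk a R \<tau> y\<bar> \<le> B"
    "\<And>R \<tau> y. \<delta> \<le> \<tau> \<Longrightarrow> 1 \<le> R \<Longrightarrow> \<tau> \<le> R\<^sup>2 \<Longrightarrow> \<bar>Qr R \<tau> y\<bar> \<le> B"
    "\<And>R \<tau> y. \<delta> \<le> \<tau> \<Longrightarrow> 1 \<le> R \<Longrightarrow> \<tau> \<le> R\<^sup>2 \<Longrightarrow> \<bar>Qt R \<tau> y\<bar> \<le> B"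
    using Q_crude_bounds[OF \<delta>(1)] by blast
  obtain A where A: "A \<ge> 0" "\<And>x. \<bar>h x\<bar> \<le> A" using test_functions_bounded[OF h] by blast
  obtain A' where A': "A' \<ge> 0" "\<And>x. \<bar>dir_deriv time_dir h x\<bar> \<le> A'" using test_functions_bounded[OF h'] by blast
  have ik: "integrable lborel (slice \<delta> (Qk Z0 R))" by (rule slice_Qk_integrable[OF R \<delta>]) simp
  have it: "integrable lborel (slice \<delta> (Qt R))"
    by (rule slice_integrable(1)[OF R \<delta> Qt_measurable B(4) B(1) Q_outside(2)[OF R \<delta>]]) (use R in auto)
  define G where "G w = dir_deriv time_dir h (z + w) * slice \<delta> (Qk Z0 R) w + h (z + w) * slice \<delta> (Qt R) w" for w
  have i1: "integrable lborel (\<lambda>w. dir_deriv time_dir h (z + w) * slice \<delta> (Qk Z0 R) w)"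
    by (rule conv_integrable[OF h' _ ik]) simp
  have i2: "integrable lborel (\<lambda>w. h (z + w) * slice \<delta> (Qt R) w)"
    by (rule conv_integrable[OF h _ it]) simp
  have G: "integrable (lborel \<Otimes>\<^sub>M lborel) (case_prod (\<lambda>s y. G (s, y)))"
    unfolding lborel_prod G_def[abs_def] using i1 i2 by (simp add: case_prod_unfold)
  have inner: "(\<integral>s. G (s, y) \<partial>lborel) = - (h (fst z, snd z + y) * Qk Z0 R \<delta> y)" for y
  proof -
    define p where "p = z + (0, y)"
    define F where "F s = h (p + s *\<^sub>R time_dir) * Qk Z0 R (s + \<delta>) y" for s
    define f where "f s = dir_deriv time_dir h (p + s *\<^sub>R time_dir) * Qk Z0 R (s + \<delta>) y
       + h (p + s *\<^sub>R time_dir) * Qt R (s + \<delta>) y" for s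
    have Geq: "G (s, y) = indicator {0<..<2} s * f s" for s
    proof -
      have "z + (s, y) = p + s *\<^sub>R time_dir" by (simp add: p_def)
      then show ?thesis by (auto simp: G_def slice_def f_def indicator_def)
    qed
    have "(\<integral>s. indicator {0<..<2} s * f s \<partial>lborel) = F 2 - F 0"
    proof (rule integral_FTC_open(2)[where B = "A' * B + A * B"])
      show "f \<in> borel_measurable borel"
      proof -
        have [measurable]: "(\<lambda>s. Qk Z0 R (s + \<delta>) y) \<in> borel_measurable borel" "(\<lambda>s. Qt R (s + \<delta>) y) \<in> borel_measurable borel"
          using measurable_compose[of "\<lambda>s. s + \<delta>" borel, OF _ section_measurable(1)[OF Qk_measurable]]
            measurable_compose[of "\<lambda>s. s + \<delta>" borel, OF _ section_measurable(1)[OF Qt_measurable]] by simp_all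
        show ?thesis unfolding f_def[abs_def] by measurable
      qed
      fix s :: real
      {
        assume s: "0 \<le> s" "s \<le> 2"
        have 1: "((\<lambda>s. h (p + s *\<^sub>R time_dir)) has_real_derivative dir_deriv time_dir h (p + s *\<^sub>R time_dir)) (at s)"
          by (rule smooth_line[OF test_functionsD(1)[OF h]])
        have "((\<lambda>\<tau>. Qk Z0 R \<tau> y) has_real_derivative Qt R (s + \<delta>) y) (at (s + \<delta>))"
          using s \<delta> R by (intro Qk_time_deriv) auto
        then have 2: "((\<lambda>s. Qk Z0 R (s + \<delta>) y) has_real_derivative Qt R (s + \<delta>) y) (at s)"
          by (simp add: DERIV_shift)
        show "(F has_real_derivative f s) (at s)"
          unfolding F_def[abs_def] f_def using DERIV_mult'[OF 1 2] by (simp add: add.commute)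
      }
      assume s: "0 < s" "s < 2"
      have t: "\<delta> \<le> s + \<delta>" "1 \<le> R" "s + \<delta> \<le> R\<^sup>2" using s \<delta> R R2[OF R \<delta>] by linarith+
      have "\<bar>f s\<bar> \<le> \<bar>dir_deriv time_dir h (p + s *\<^sub>R time_dir)\<bar> * \<bar>Qk Z0 R (s + \<delta>) y\<bar>
        + \<bar>h (p + s *\<^sub>R time_dir)\<bar> * \<bar>Qt R (s + \<delta>) y\<bar>"
        unfolding f_def by (rule order_trans[OF abs_triangle_ineq]) (simp add: abs_mult)
      also have "\<dots> \<le> A' * B + A * B"
        by (intro add_mono mult_mono A A' B(2) B(4) t) auto
      finally show "\<bar>f s\<bar> \<le> A' * B + A * B" .
    qed simp
    moreover have "F 2 = 0"
    proof -
      have "p + 2 *\<^sub>R time_dir \<notin> {..<1} \<times> UNIV" using z by (simp add: p_def mem_Times_iff)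
      then have "p + 2 *\<^sub>R time_dir \<notin> closure {x. h x \<noteq> 0}"
        using test_functionsD(3)[OF h] by blast
      then have "h (p + 2 *\<^sub>R time_dir) = 0" by (rule outside_support)
      then show ?thesis by (simp only: F_def mult_zero_left)
    qed
    moreover have "F 0 = h (fst z, snd z + y) * Qk Z0 R \<delta> y"
      by (simp add: F_def p_def plus_prod_def)
    ultimately show ?thesis by (simp add: Geq)
  qed
  have "conv lborel (\<lambda>w. w) (slice \<delta> (Qk Z0 R)) (dir_deriv time_dir h) z + conv lborel (\<lambda>w. w) (slice \<delta> (Qt R)) h z
    = (\<integral>w. G w \<partial>lborel)"
    unfolding conv_def G_def by (rule Bochner_Integration.integral_add[OF i1 i2, symmetric])
  also have "\<dots> = (\<integral>y. (\<integral>s. G (s, y) \<partial>lborel) \<partial>lborel)"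
    using lborel_pair.integral_snd[OF G] by (simp add: lborel_prod case_prod_unfold)
  finally show ?thesis unfolding inner by simp
qed

text \<open>Moved to the kernel, the space derivatives give \<open>Ql\<close>, and the time
  derivative gives \<open>- Qt\<close> together with the boundary term. The difference
  \<open>Ql - Qt = Qr\<close> measures how far the truncated kernel is from solving the heat
  equation.\<close>

lemma heat_conv_slice:
  assumes h: "h \<in> test_functions ({..<1} \<times> UNIV)" and z: "fst z \<ge> -1"
  shows "heat (conv lborel (\<lambda>w. w) (slice \<delta> (Qk Z0 R)) h) z =
    conv lborel (\<lambda>w. w) (slice \<delta> (Qr R)) h z - (\<integral>y. h (fst z, snd z + y) * Qk Z0 R \<delta> y \<partial>lborel)"
proof -
  let ?id = "\<lambda>w :: real \<times> (real^3). w"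
  have id: "?id \<in> borel_measurable lborel" by simp
  have ik: "integrable lborel (slice \<delta> (Qk Z0 R))" by (rule slice_Qk_integrable[OF R \<delta>]) simp
  obtain B where "B \<ge> 0"
    "\<And>a. (\<And>i. a i \<le> 3) \<Longrightarrow> integrable lborel (slice \<delta> (Qk a R))"
    "\<And>a w. (\<And>i. a i \<le> 3) \<Longrightarrow> \<bar>slice \<delta> (Qk a R) w\<bar> \<le> B"
    "\<And>a w. (\<And>i. a i \<le> 3) \<Longrightarrow> norm w > 2 + 3 * R \<Longrightarrow> slice \<delta> (Qk a R) w = 0"
    and it: "integrable lborel (slice \<delta> (Qt R))" and ir: "integrable lborel (slice \<delta> (Qr R))"
    and "\<And>w. \<bar>slice \<delta> (Qt R) w\<bar> \<le> B" using slice_facts[OF R \<delta>] by blast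
  have D: "dir_deriv (space_dir j) (dir_deriv (space_dir j) (conv lborel ?id (slice \<delta> (Qk Z0 R)) h))
     = conv lborel ?id (slice \<delta> (Qk Z0 R)) (dir_deriv (space_dir j) (dir_deriv (space_dir j) h))" for j
    by (simp only: conv_dir_deriv[OF h id ik space_dir_Basis]
        conv_dir_deriv[OF test_functions_dir_deriv[OF h space_dir_Basis] id ik space_dir_Basis])
  have "slice \<delta> (Qr R) = (\<lambda>w. slice \<delta> (Ql R) w - slice \<delta> (Qt R) w)"
    by (rule ext) (simp add: slice_def Qr_def)
  moreover have "slice \<delta> (Ql R) = (\<lambda>w. slice \<delta> (Qr R) w + slice \<delta> (Qt R) w)"
    by (rule ext) (simp add: slice_def Qr_def)
  then have il: "integrable lborel (slice \<delta> (Ql R))" using ir it by simp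
  ultimately have e: "conv lborel ?id (slice \<delta> (Qr R)) h z = conv lborel ?id (slice \<delta> (Ql R)) h z - conv lborel ?id (slice \<delta> (Qt R)) h z"
    using conv_diff_kernel[OF h id il it, of z] by simp
  have "heat (conv lborel ?id (slice \<delta> (Qk Z0 R)) h) z =
     conv lborel ?id (slice \<delta> (Qk Z0 R)) (dir_deriv time_dir h) z + conv lborel ?id (slice \<delta> (Ql R)) h z"
    unfolding D by (simp only: conv_dir_deriv[OF h id ik time_dir_Basis] lap_by_parts_slice[OF R \<delta> h])
  then show ?thesis using slice_time_identity[OF h z] e by linarith
qed

end

section \<open>The approximate identity\<close>

definition gauss4 :: "real^3 \<Rightarrow> real" where
  "gauss4 \<xi> = (\<Prod>i\<in>UNIV. exp (- ((\<xi> $ i)\<^sup>2 / 4)))"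

lemma gauss4_nonneg: "0 \<le> gauss4 \<xi>" by (simp add: gauss4_def prod_nonneg)

lemma gauss4_measurable [measurable]: "gauss4 \<in> borel_measurable borel"
  unfolding gauss4_def[abs_def] by measurable

lemma nn_integral_gauss4: "(\<integral>\<^sup>+\<xi>. ennreal (gauss4 \<xi>) \<partial>lborel) = ennreal (sqrt (4 * pi) ^ 3)"
proof -
  have e: "exp (- (r\<^sup>2 / 4)) = sqrt (4 * pi) * normal_density 0 (sqrt 2) r" for r :: real
    by (simp add: normal_density_def real_sqrt_mult)
  have "(\<integral>\<^sup>+r. ennreal (exp (- (r\<^sup>2 / 4))) \<partial>lborel) = ennreal (\<integral>r. exp (- (r\<^sup>2 / 4)) \<partial>lborel)"
    unfolding e by (intro nn_integral_eq_integral integrable_mult_right integrable_normal_density) auto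
  also have "(\<integral>r. exp (- (r\<^sup>2 / 4)) \<partial>lborel) = sqrt (4 * pi)"
    unfolding e by (simp add: integral_normal_density)
  finally have "(\<integral>\<^sup>+r. ennreal (exp (- (r\<^sup>2 / 4))) \<partial>lborel) = ennreal (sqrt (4 * pi))" .
  then have "(\<integral>\<^sup>+\<xi>. (\<Prod>i\<in>UNIV. ennreal (exp (- ((\<xi> $ i)\<^sup>2 / 4)))) \<partial>(lborel :: (real^3) measure)) = ennreal (sqrt (4 * pi)) ^ 3"
    by (subst nn_integral_vec_prod) simp_all
  then show ?thesis by (simp add: gauss4_def prod_ennreal ennreal_power)
qed

lemma gauss4_integrable: "integrable lborel gauss4"
  by (rule integrableI_nonneg) (auto simp: gauss4_nonneg nn_integral_gauss4)

lemma integral_gauss4: "(\<integral>\<xi>. gauss4 \<xi> \<partial>lborel) = sqrt (4 * pi) ^ 3"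
  using nn_integral_eq_integral[OF gauss4_integrable] nn_integral_gauss4
  by (simp add: gauss4_nonneg)

lemma lborel_integral_scaleR:
  fixes f :: "real^3 \<Rightarrow> real"
  assumes c: "c > 0" and [measurable]: "f \<in> borel_measurable borel"
  shows "(\<integral>y. f y \<partial>lborel) = (\<integral>\<xi>. c ^ 3 * f (c *\<^sub>R \<xi>) \<partial>lborel)"
proof -
  have "(\<integral>y. f y \<partial>lborel) = (\<integral>y. f y \<partial>density (distr lborel borel (\<lambda>x. 0 + c *\<^sub>R x)) (\<lambda>_. ennreal (\<bar>c\<bar> ^ DIM(real^3))))"
    using lborel_affine[of c "0 :: real^3"] c by (simp add: ennreal_power)
  also have "\<dots> = (\<integral>y. \<bar>c\<bar> ^ DIM(real^3) *\<^sub>R f y \<partial>distr lborel borel (\<lambda>x. 0 + c *\<^sub>R x))"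
    by (rule integral_density) auto
  also have "\<dots> = (\<integral>\<xi>. \<bar>c\<bar> ^ DIM(real^3) *\<^sub>R f (0 + c *\<^sub>R \<xi>) \<partial>lborel)"
    by (rule integral_distr) auto
  finally show ?thesis using c by simp
qed

definition cut3 :: "real \<Rightarrow> real^3 \<Rightarrow> real" where
  "cut3 a \<xi> = (\<Prod>i\<in>UNIV. cutoff 0 (a * \<xi> $ i))"

lemma cut3_measurable [measurable]: "cut3 a \<in> borel_measurable borel"
  unfolding cut3_def[abs_def] by measurable

text \<open>In the parabolic variable the Gaussian no longer depends on \<delta>, so it can serve as
  a majorant in the limit, while the cutoff flattens to 1 because \<open>sqrt \<delta> / R\<close>
  tends to 0.\<close>

lemma Qk_scaled:
  assumes "\<delta> > 0"
  shows "sqrt \<delta> ^ 3 * Qk Z0 R \<delta> (sqrt \<delta> *\<^sub>R \<xi>) = cut3 (sqrt \<delta> / R) \<xi> * gauss4 \<xi>"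
proof -
  have s: "sqrt \<delta> * \<delta> powr (-1/2) = 1" using assms by (simp add: powr_minus powr_half_sqrt)
  have q: "sqrt \<delta> * qk 0 R \<delta> (sqrt \<delta> * r) = cutoff 0 (sqrt \<delta> / R * r) * exp (- (r\<^sup>2 / 4))" for r
  proof -
    have "sqrt \<delta> * r * \<delta> powr (-1/2) = r * (sqrt \<delta> * \<delta> powr (-1/2))" by (simp only: mult_ac)
    then have "gk 0 \<delta> (sqrt \<delta> * r) = \<delta> powr (-1/2) * exp (- (r\<^sup>2 / 4))" by (simp only: gk_def s) simp
    then have "sqrt \<delta> * qk 0 R \<delta> (sqrt \<delta> * r) = (sqrt \<delta> * \<delta> powr (-1/2)) * (cutoff 0 (sqrt \<delta> * r / R) * exp (- (r\<^sup>2 / 4)))"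
      by (simp add: cg_def)
    then show ?thesis unfolding s by simp
  qed
  have "sqrt \<delta> ^ 3 * Qk Z0 R \<delta> (sqrt \<delta> *\<^sub>R \<xi>) = (\<Prod>i\<in>(UNIV::3 set). sqrt \<delta> * qk 0 R \<delta> (sqrt \<delta> * \<xi> $ i))"
    by (simp add: Qk_def prod.distrib)
  also have "\<dots> = cut3 (sqrt \<delta> / R) \<xi> * gauss4 \<xi>"
    unfolding q by (simp add: cut3_def gauss4_def prod.distrib)
  finally show ?thesis .
qed

lemma approximate_identity_scaled:
  assumes h: "h \<in> test_functions \<Omega>" and \<delta>: "\<delta> > 0"
  shows "(\<integral>y. h (fst z, snd z + y) * Qk Z0 R \<delta> y \<partial>lborel)
    = (\<integral>\<xi>. h (z + (0, sqrt \<delta> *\<^sub>R \<xi>)) * (cut3 (sqrt \<delta> / R) \<xi> * gauss4 \<xi>) \<partial>lborel)"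
proof -
  note [measurable] = test_functions_borel[OF h]
  have [measurable]: "(\<lambda>y. Qk Z0 R \<delta> y) \<in> borel_measurable borel"
    by (rule section_measurable(2)[OF Qk_measurable])
  have [measurable]: "(\<lambda>y. h (fst z, snd z + y)) \<in> borel_measurable borel"
    using measurable_compose[of "\<lambda>y. (fst z, snd z + y)" borel "borel \<Otimes>\<^sub>M borel" h borel] test_functions_borel[OF h]
    by (simp add: borel_prod)
  have "(\<integral>y. h (fst z, snd z + y) * Qk Z0 R \<delta> y \<partial>lborel)
    = (\<integral>\<xi>. sqrt \<delta> ^ 3 * (h (fst z, snd z + sqrt \<delta> *\<^sub>R \<xi>) * Qk Z0 R \<delta> (sqrt \<delta> *\<^sub>R \<xi>)) \<partial>lborel)"
    using \<delta> by (intro lborel_integral_scaleR) auto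
  also have "\<dots> = (\<integral>\<xi>. h (z + (0, sqrt \<delta> *\<^sub>R \<xi>)) * (cut3 (sqrt \<delta> / R) \<xi> * gauss4 \<xi>) \<partial>lborel)"
    unfolding Qk_scaled[OF \<delta>, symmetric] by (simp add: plus_prod_def mult_ac)
  finally show ?thesis .
qed

lemma lborel_integral_translate:
  fixes f :: "'a::euclidean_space \<Rightarrow> real"
  assumes [measurable]: "f \<in> borel_measurable borel"
  shows "(\<integral>x. f (x + c) \<partial>lborel) = (\<integral>x. f x \<partial>lborel)"
    and "integrable lborel (\<lambda>x. f (x + c)) \<longleftrightarrow> integrable lborel f"
proof -
  have eq: "distr lborel borel (\<lambda>x. c + x) = lborel" using lborel_distr_plus[of c] by simp
  have "(\<integral>x. f x \<partial>distr lborel borel (\<lambda>x. c + x)) = (\<integral>x. f (c + x) \<partial>lborel)"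
    by (rule integral_distr) auto
  then show "(\<integral>x. f (x + c) \<partial>lborel) = (\<integral>x. f x \<partial>lborel)" unfolding eq by (simp add: add.commute)
  have "integrable (distr lborel borel (\<lambda>x. c + x)) f \<longleftrightarrow> integrable lborel (\<lambda>x. f (c + x))"
    by (rule integrable_distr_eq) auto
  then show "integrable lborel (\<lambda>x. f (x + c)) \<longleftrightarrow> integrable lborel f" unfolding eq by (simp add: add.commute)
qed

text \<open>The pointwise bound \<open>\<bar>h\<bar> + A * \<bar>g\<bar> ^ 6\<close> replaces a
  duality argument. Its integral does not change when \<open>h\<close> is translated, so the
  estimate is uniform in \<open>c\<close>, as needed for Fubini and for domination.\<close>

lemma L6_times_test_bound:
  fixes g :: "'a::euclidean_space \<Rightarrow> real"
  assumes [measurable]: "g \<in> borel_measurable borel" and g6: "integrable lborel (\<lambda>z. \<bar>g z\<bar> ^ 6)"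
    and h: "h \<in> test_functions \<Omega>" and A: "\<And>x. \<bar>h x\<bar> \<le> A"
  shows "integrable lborel (\<lambda>z. g z * h (z + c))"
    and "(\<integral>z. \<bar>g z * h (z + c)\<bar> \<partial>lborel) \<le> (\<integral>z. \<bar>h z\<bar> \<partial>lborel) + A * (\<integral>z. \<bar>g z\<bar> ^ 6 \<partial>lborel)"
proof -
  note [measurable] = test_functions_borel[OF h]
  have A0: "A \<ge> 0" using A[of 0] by linarith
  have ih: "integrable lborel (\<lambda>z. \<bar>h (z + c)\<bar>)"
    using lborel_integral_translate(2)[of h c] test_functions_integrable[OF h] by simp
  then have ib: "integrable lborel (\<lambda>z. \<bar>h (z + c)\<bar> + A * \<bar>g z\<bar> ^ 6)" using g6 by simp
  have le: "\<bar>g z * h (z + c)\<bar> \<le> \<bar>h (z + c)\<bar> + A * \<bar>g z\<bar> ^ 6" for z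
  proof -
    have "\<bar>g z\<bar> * \<bar>h (z + c)\<bar> \<le> (1 + \<bar>g z\<bar> ^ 6) * \<bar>h (z + c)\<bar>"
      using power_le_one_plus_power[of "\<bar>g z\<bar>" 1 6] by (intro mult_right_mono) auto
    also have "\<dots> \<le> \<bar>h (z + c)\<bar> + A * \<bar>g z\<bar> ^ 6"
      using mult_left_mono[OF A[of "z + c"], of "\<bar>g z\<bar> ^ 6"] by (simp add: algebra_simps)
    finally show ?thesis by (simp add: abs_mult)
  qed
  have le': "norm (g z * h (z + c)) \<le> norm (\<bar>h (z + c)\<bar> + A * \<bar>g z\<bar> ^ 6)" for z
    using le[of z] A0 by (simp add: real_norm_def)
  show i: "integrable lborel (\<lambda>z. g z * h (z + c))"
    by (rule Bochner_Integration.integrable_bound[OF ib _ AE_I2[OF le']]) measurable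
  have "(\<integral>z. \<bar>g z * h (z + c)\<bar> \<partial>lborel) \<le> (\<integral>z. \<bar>h (z + c)\<bar> + A * \<bar>g z\<bar> ^ 6 \<partial>lborel)"
    by (rule integral_mono[OF integrable_abs[OF i] ib le])
  also have "\<dots> = (\<integral>z. \<bar>h (z + c)\<bar> \<partial>lborel) + A * (\<integral>z. \<bar>g z\<bar> ^ 6 \<partial>lborel)"
    using ih g6 by simp
  also have "(\<integral>z. \<bar>h (z + c)\<bar> \<partial>lborel) = (\<integral>z. \<bar>h z\<bar> \<partial>lborel)"
    using lborel_integral_translate(1)[of "\<lambda>z. \<bar>h z\<bar>" c] by simp
  finally show "(\<integral>z. \<bar>g z * h (z + c)\<bar> \<partial>lborel) \<le> (\<integral>z. \<bar>h z\<bar> \<partial>lborel) + A * (\<integral>z. \<bar>g z\<bar> ^ 6 \<partial>lborel)" .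
qed

text \<open>The translation acts on the continuous \<open>h\<close> and never on \<open>g\<close>,
  so pointwise convergence is immediate. A convergent sequence is bounded, so the supports of all
  translates lie in one ball.\<close>

lemma translation_tendsto:
  fixes g :: "'a::euclidean_space \<Rightarrow> real"
  assumes g [measurable]: "g \<in> borel_measurable borel" and g6: "integrable lborel (\<lambda>z. \<bar>g z\<bar> ^ 6)"
    and h: "h \<in> test_functions \<Omega>" and c: "c \<longlonglongrightarrow> 0"
  shows "(\<lambda>n. \<integral>z. g z * h (z + c n) \<partial>lborel) \<longlonglongrightarrow> (\<integral>z. g z * h z \<partial>lborel)"
proof -
  note [measurable] = test_functions_borel[OF h]
  obtain A where A: "A \<ge> 0" "\<And>x. \<bar>h x\<bar> \<le> A" using test_functions_bounded[OF h] by blast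
  obtain \<rho> where \<rho>: "\<rho> > 0" "\<And>x. norm x > \<rho> \<Longrightarrow> h x = 0" using test_functions_bounded_support[OF h] by blast
  obtain K where K: "\<And>n. norm (c n) \<le> K"
    using convergent_imp_Bseq[OF convergentI[OF c]] unfolding Bseq_def by blast
  define S where "S = (cball 0 (\<rho> + K) :: 'a set)"
  have [measurable]: "S \<in> sets borel" by (simp add: S_def)
  have iS: "integrable lborel (\<lambda>z. indicator S z :: real)"
    unfolding S_def by (intro integrable_real_indicator) (auto simp: emeasure_lborel_cball_finite[simplified])
  show ?thesis
  proof (rule integral_dominated_convergence[where w = "\<lambda>z. A * (indicator S z + \<bar>g z\<bar> ^ 6)"])
    show "integrable lborel (\<lambda>z. A * (indicator S z + \<bar>g z\<bar> ^ 6))" using iS g6 by simp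
    show "AE z in lborel. (\<lambda>n. g z * h (z + c n)) \<longlonglongrightarrow> g z * h z"
    proof (rule AE_I2)
      fix z
      have c': "(\<lambda>n. z + c n) \<longlonglongrightarrow> z" using tendsto_add[OF tendsto_const c, of z] by simp
      have cont: "isCont h z"
        using smooth_continuous_on[OF test_functionsD(1)[OF h], of UNIV] by (simp add: continuous_on_eq_continuous_at)
      have "(\<lambda>n. h (z + c n)) \<longlonglongrightarrow> h z" by (rule isCont_tendsto_compose[OF cont c'])
      then show "(\<lambda>n. g z * h (z + c n)) \<longlonglongrightarrow> g z * h z" by (intro tendsto_intros)
    qed
    fix n
    show "AE z in lborel. norm (g z * h (z + c n)) \<le> A * (indicator S z + \<bar>g z\<bar> ^ 6)"
    proof (rule AE_I2)
      fix z
      show "norm (g z * h (z + c n)) \<le> A * (indicator S z + \<bar>g z\<bar> ^ 6)"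
      proof (cases "z \<in> S")
        case True
        have "\<bar>g z\<bar> * \<bar>h (z + c n)\<bar> \<le> (1 + \<bar>g z\<bar> ^ 6) * A"
          using power_le_one_plus_power[of "\<bar>g z\<bar>" 1 6] A by (intro mult_mono) auto
        then show ?thesis using True by (simp add: abs_mult mult.commute)
      next
        case False
        then have "norm (z + c n) > \<rho>"
          using norm_triangle_ineq4[of "z + c n" "c n"] K[of n] by (simp add: S_def)
        then show ?thesis using False A(1) by (simp add: \<rho>(2))
      qed
    qed
  qed measurable
qed

text \<open>One sequence realises both limits: \<open>R = n + 2\<close> and
  \<open>\<delta> = 1 / (n + 1)\<close> respect the standing bounds \<open>2 \<le> R\<close> and
  \<open>\<delta> \<le> 1\<close>. After the integrals are swapped, each \<open>\<xi>\<close> sees a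
  translate of \<open>h\<close> paired with \<open>g\<close>, which is uniformly bounded, under the
  weight of a fixed Gaussian. The factor in the limit is the normalization omitted from the heat
  kernel.\<close>

lemma approximate_identity_limit:
  fixes g :: "real \<times> (real^3) \<Rightarrow> real"
  assumes g [measurable]: "g \<in> borel_measurable borel" and g6: "integrable lborel (\<lambda>z. \<bar>g z\<bar> ^ 6)"
    and h: "h \<in> test_functions \<Omega>"
  shows "(\<lambda>n. \<integral>z. g z * (\<integral>y. h (fst z, snd z + y) * Qk Z0 (real n + 2) (1 / (real n + 1)) y \<partial>lborel) \<partial>lborel)
    \<longlonglongrightarrow> sqrt (4 * pi) ^ 3 * (\<integral>z. g z * h z \<partial>lborel)"
proof -
  note [measurable] = test_functions_borel[OF h]
  obtain A where A: "A \<ge> 0" "\<And>x. \<bar>h x\<bar> \<le> A" using test_functions_bounded[OF h] by blast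
  obtain B where B: "B \<ge> 1" "\<And>j r. j \<le> 3 \<Longrightarrow> \<bar>cutoff j r\<bar> \<le> B" using cutoff_bounded by blast
  define d where "d n = sqrt (1 / (real n + 1))" for n
  define a where "a n = d n / (real n + 2)" for n
  have d0: "d \<longlonglongrightarrow> 0"
  proof -
    have "(\<lambda>n. sqrt (1 / real (Suc n))) \<longlonglongrightarrow> sqrt 0"
      by (intro tendsto_real_sqrt LIMSEQ_Suc[OF lim_1_over_n])
    then show ?thesis by (simp add: d_def[abs_def] add.commute)
  qed
  have a0: "a \<longlonglongrightarrow> 0"
  proof (rule tendsto_0_le[OF d0, of _ 1], rule always_eventually, rule allI)
    fix n
    have "d n \<ge> 0" by (simp add: d_def)
    then show "norm (a n) \<le> norm (d n) * 1" using mult_left_mono[of 1 "real n + 2" "d n"] by (simp add: a_def divide_le_eq)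
  qed
  define K where "K = (\<integral>z. \<bar>h z\<bar> \<partial>lborel) + A * (\<integral>z. \<bar>g z\<bar> ^ 6 \<partial>lborel)"
  define J where "J n \<xi> = (\<integral>z. g z * h (z + (0, d n *\<^sub>R \<xi>)) \<partial>lborel)" for n \<xi>
  note bd = L6_times_test_bound[OF g g6 h A(2)]
  have K: "K \<ge> 0" unfolding K_def using A(1) by simp
  have JK: "\<bar>J n \<xi>\<bar> \<le> K" for n \<xi>
    unfolding J_def K_def using order_trans[OF integral_abs_bound bd(2)] .
  have cut: "\<bar>cut3 a \<xi>\<bar> \<le> B ^ 3" for a \<xi>
  proof -
    have "\<bar>cut3 a \<xi>\<bar> \<le> (\<Prod>i\<in>(UNIV::3 set). B)"
      unfolding cut3_def abs_prod by (intro prod_mono conjI B(2)) auto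
    then show ?thesis by simp
  qed
  have [measurable]: "(\<lambda>p. h (snd p + (0, d n *\<^sub>R fst p))) \<in> borel_measurable (borel \<Otimes>\<^sub>M borel)" for n
  proof -
    have "(\<lambda>p :: (real^3) \<times> (real \<times> (real^3)). snd p + (0, d n *\<^sub>R fst p)) \<in> borel_measurable borel"
      by (intro borel_measurable_continuous_onI continuous_intros)
    from measurable_compose[OF this test_functions_borel[OF h]] show ?thesis by (simp add: borel_prod)
  qed
  have swap: "(\<integral>z. g z * (\<integral>y. h (fst z, snd z + y) * Qk Z0 (real n + 2) (1 / (real n + 1)) y \<partial>lborel) \<partial>lborel)
    = (\<integral>\<xi>. (cut3 (a n) \<xi> * gauss4 \<xi>) * J n \<xi> \<partial>lborel)" for n
  proof -
    define F where "F p = (cut3 (a n) (fst p) * gauss4 (fst p)) * (g (snd p) * h (snd p + (0, d n *\<^sub>R fst p)))" for p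
    have Fm [measurable]: "F \<in> borel_measurable (lborel \<Otimes>\<^sub>M lborel)" unfolding F_def[abs_def] by measurable
    have inner: "(\<integral>z. norm (F (\<xi>, z)) \<partial>lborel) = \<bar>cut3 (a n) \<xi> * gauss4 \<xi>\<bar> * (\<integral>z. \<bar>g z * h (z + (0, d n *\<^sub>R \<xi>))\<bar> \<partial>lborel)" for \<xi>
      by (simp add: F_def abs_mult)
    have F: "integrable (lborel \<Otimes>\<^sub>M lborel) F"
    proof (rule lborel_pair.Fubini_integrable[OF Fm])
      show "AE \<xi> in lborel. integrable lborel (\<lambda>z. F (\<xi>, z))"
        unfolding F_def using bd(1) by (intro AE_I2) simp
      show "integrable lborel (\<lambda>\<xi>. \<integral>z. norm (F (\<xi>, z)) \<partial>lborel)"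
      proof (rule Bochner_Integration.integrable_bound[where f = "\<lambda>\<xi>. (B ^ 3 * K) * gauss4 \<xi>"])
        show "integrable lborel (\<lambda>\<xi>. (B ^ 3 * K) * gauss4 \<xi>)" using gauss4_integrable by simp
        show "AE \<xi> in lborel. norm (\<integral>z. norm (F (\<xi>, z)) \<partial>lborel) \<le> norm ((B ^ 3 * K) * gauss4 \<xi>)"
        proof (rule AE_I2)
          fix \<xi>
          have "norm (\<integral>z. norm (F (\<xi>, z)) \<partial>lborel) = \<bar>cut3 (a n) \<xi>\<bar> * gauss4 \<xi> * (\<integral>z. \<bar>g z * h (z + (0, d n *\<^sub>R \<xi>))\<bar> \<partial>lborel)"
            unfolding inner by (simp add: abs_mult gauss4_nonneg)
          also have "\<dots> \<le> B ^ 3 * gauss4 \<xi> * K"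
            unfolding K_def using B(1) by (intro mult_mono cut bd(2) gauss4_nonneg) (auto simp: gauss4_nonneg)
          finally show "norm (\<integral>z. norm (F (\<xi>, z)) \<partial>lborel) \<le> norm ((B ^ 3 * K) * gauss4 \<xi>)"
            using B(1) K gauss4_nonneg[of \<xi>] by (simp add: mult_ac)
        qed
      qed measurable
    qed
    have "(\<integral>z. g z * (\<integral>y. h (fst z, snd z + y) * Qk Z0 (real n + 2) (1 / (real n + 1)) y \<partial>lborel) \<partial>lborel)
      = (\<integral>z. \<integral>\<xi>. F (\<xi>, z) \<partial>lborel \<partial>lborel)"
    proof (rule Bochner_Integration.integral_cong[OF refl])
      fix z
      have "g z * (\<integral>y. h (fst z, snd z + y) * Qk Z0 (real n + 2) (1 / (real n + 1)) y \<partial>lborel)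
        = g z * (\<integral>\<xi>. h (z + (0, d n *\<^sub>R \<xi>)) * (cut3 (a n) \<xi> * gauss4 \<xi>) \<partial>lborel)"
        by (subst approximate_identity_scaled[OF h]) (simp_all add: d_def a_def)
      also have "\<dots> = (\<integral>\<xi>. F (\<xi>, z) \<partial>lborel)"
        unfolding F_def integral_mult_right_zero[symmetric] by (intro Bochner_Integration.integral_cong) (simp_all add: mult_ac)
      finally show "g z * (\<integral>y. h (fst z, snd z + y) * Qk Z0 (real n + 2) (1 / (real n + 1)) y \<partial>lborel) = (\<integral>\<xi>. F (\<xi>, z) \<partial>lborel)" .
    qed
    also have "\<dots> = (\<integral>\<xi>. \<integral>z. F (\<xi>, z) \<partial>lborel \<partial>lborel)"
      using lborel_pair.Fubini_integral[of "\<lambda>\<xi> z. F (\<xi>, z)"] F by (simp add: case_prod_unfold)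
    also have "\<dots> = (\<integral>\<xi>. (cut3 (a n) \<xi> * gauss4 \<xi>) * J n \<xi> \<partial>lborel)"
      by (simp add: F_def J_def)
    finally show ?thesis .
  qed
  have "(\<lambda>n. \<integral>\<xi>. (cut3 (a n) \<xi> * gauss4 \<xi>) * J n \<xi> \<partial>lborel) \<longlonglongrightarrow> (\<integral>\<xi>. (1 * gauss4 \<xi>) * (\<integral>z. g z * h z \<partial>lborel) \<partial>lborel)"
  proof (rule integral_dominated_convergence[where w = "\<lambda>\<xi>. (B ^ 3 * K) * gauss4 \<xi>"])
    show "integrable lborel (\<lambda>\<xi>. (B ^ 3 * K) * gauss4 \<xi>)" using gauss4_integrable by simp
    show "(\<lambda>\<xi>. (cut3 (a n) \<xi> * gauss4 \<xi>) * J n \<xi>) \<in> borel_measurable lborel" for n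
      unfolding J_def by measurable
    show "AE \<xi> in lborel. (\<lambda>n. (cut3 (a n) \<xi> * gauss4 \<xi>) * J n \<xi>) \<longlonglongrightarrow> (1 * gauss4 \<xi>) * (\<integral>z. g z * h z \<partial>lborel)"
    proof (rule AE_I2)
      fix \<xi>
      have "(\<lambda>n. cut3 (a n) \<xi>) \<longlonglongrightarrow> (\<Prod>i\<in>(UNIV::3 set). cutoff 0 (0 * \<xi> $ i))"
      proof -
        have "(\<lambda>n. cutoff 0 (a n * \<xi> $ i)) \<longlonglongrightarrow> cutoff 0 (0 * \<xi> $ i)" for i
          by (rule isCont_tendsto_compose[OF DERIV_isCont[OF cutoff_deriv] tendsto_mult[OF a0 tendsto_const]])
        then show ?thesis unfolding cut3_def by (rule tendsto_prod)
      qed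
      then have 1: "(\<lambda>n. cut3 (a n) \<xi>) \<longlonglongrightarrow> 1" by (simp add: cutoff_0)
      have "(\<lambda>n. (0::real, d n *\<^sub>R \<xi>)) \<longlonglongrightarrow> (0, 0 *\<^sub>R \<xi>)" by (intro tendsto_intros d0)
      then have c: "(\<lambda>n. (0::real, d n *\<^sub>R \<xi>)) \<longlonglongrightarrow> 0" by (simp add: zero_prod_def)
      show "(\<lambda>n. (cut3 (a n) \<xi> * gauss4 \<xi>) * J n \<xi>) \<longlonglongrightarrow> (1 * gauss4 \<xi>) * (\<integral>z. g z * h z \<partial>lborel)"
        unfolding J_def by (intro tendsto_mult 1 tendsto_const translation_tendsto[OF g g6 h c])
    qed
    fix n
    show "AE \<xi> in lborel. norm ((cut3 (a n) \<xi> * gauss4 \<xi>) * J n \<xi>) \<le> (B ^ 3 * K) * gauss4 \<xi>"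
    proof (rule AE_I2)
      fix \<xi>
      have "norm ((cut3 (a n) \<xi> * gauss4 \<xi>) * J n \<xi>) = \<bar>cut3 (a n) \<xi>\<bar> * gauss4 \<xi> * \<bar>J n \<xi>\<bar>"
        by (simp add: abs_mult gauss4_nonneg)
      also have "\<dots> \<le> B ^ 3 * gauss4 \<xi> * K"
        using B(1) by (intro mult_mono cut JK gauss4_nonneg) (auto simp: gauss4_nonneg)
      finally show "norm ((cut3 (a n) \<xi> * gauss4 \<xi>) * J n \<xi>) \<le> (B ^ 3 * K) * gauss4 \<xi>" by (simp add: mult_ac)
    qed
  qed measurable
  then show ?thesis unfolding swap by (simp add: integral_gauss4)
qed

section \<open>The pointwise inequality\<close>

text \<open>Since \<open>flat 1 (1/4) = exp (-4)\<close>, the factor makes the weight equal to 1 at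
  time -1/2, from where it increases. The start at -3/4 lies strictly after -1, which keeps the
  tested potential away from the initial time; near time 1 the support of the test function takes
  over.\<close>

definition eta :: "real \<times> (real^3) \<Rightarrow> real" where
  "eta z = exp 4 * flat 1 (3/4 + fst z)"

definition eta' :: "real \<times> (real^3) \<Rightarrow> real" where
  "eta' z = exp 4 * flat [:0, 0, 1:] (3/4 + fst z)"

lemma eta_nonneg: "0 \<le> eta z"
  by (simp add: eta_def flat_1_bounds)

lemma eta_ge_1: "fst z \<ge> -1/2 \<Longrightarrow> eta z \<ge> 1"
proof -
  assume "fst z \<ge> -1/2"
  then have x: "3/4 + fst z \<ge> 1/4" by simp
  then have "1 / (3/4 + fst z) \<le> 1 / (1/4)" by (intro divide_left_mono) auto
  then have "exp (-4) \<le> flat 1 (3/4 + fst z)" using x by (simp add: flat_def)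
  then have "exp 4 * exp (-4) \<le> eta z" unfolding eta_def by (intro mult_left_mono) auto
  then show ?thesis by (simp flip: exp_add)
qed

lemma eta_zero: "fst z \<le> -3/4 \<Longrightarrow> eta z = 0"
  by (simp add: eta_def flat_def)

lemma eta_le: "eta z \<le> 2 * exp 4"
  unfolding eta_def using flat_1_bounds(2)[of "3/4 + fst z"] by simp

lemma eta'_bound: "\<bar>eta' z\<bar> \<le> 2 * exp 4"
proof -
  have "0 \<le> flat [:0, 0, 1:] x \<and> flat [:0, 0, 1:] x \<le> 2" for x
  proof (cases "x > 0")
    case True
    define y where "y = 1 / x"
    have y: "y \<ge> 0" using True by (simp add: y_def)
    have "y\<^sup>2 \<le> 2 * exp y" using exp_lower_Taylor_quadratic[OF y] y by simp
    then have "y\<^sup>2 * exp (- y) \<le> 2" by (simp add: exp_minus pos_divide_le_eq flip: divide_inverse)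
    then show ?thesis using True by (simp add: flat_def y_def power2_eq_square)
  qed (simp add: flat_def)
  then show ?thesis unfolding eta'_def by (simp add: abs_mult)
qed

lemma eta_has_derivative: "(eta has_derivative (\<lambda>v. fst v * eta' z)) (at z)"
proof -
  have 1: "((\<lambda>z. 3/4 + fst z) has_derivative fst) (at z)"
    by (auto intro!: derivative_eq_intros)
  have "(flat 1 has_real_derivative flat [:0, 0, 1:] (3/4 + fst z)) (at (3/4 + fst z))"
    using flat_has_derivative[of 1 "3/4 + fst z"] by (simp add: pderiv_1)
  from has_derivative_compose[OF 1 this[unfolded has_field_derivative_def]]
  have "((\<lambda>z. exp 4 * flat 1 (3/4 + fst z)) has_derivative (\<lambda>v. exp 4 * (flat [:0, 0, 1:] (3/4 + fst z) * fst v))) (at z)"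
    by (rule has_derivative_mult_right)
  then show ?thesis unfolding eta_def[abs_def] eta'_def by (simp add: mult_ac)
qed

lemma eta_dir_deriv: "dir_deriv time_dir eta z = eta' z" "dir_deriv (space_dir j) eta z = 0"
  by (simp_all add: dir_deriv_eq[OF eta_has_derivative])

lemma smooth_eta: "smooth eta"
  using smooth_cmult[OF smooth_flat[of 1 "3/4" time_dir], of "exp 4"]
  by (simp add: eta_def[abs_def] inner_prod_def)

lemma eta_measurable [measurable]: "eta \<in> borel_measurable borel" "eta' \<in> borel_measurable borel"
  using smooth_borel_measurable[OF smooth_eta]
    smooth_borel_measurable[OF smooth_dir_deriv[OF smooth_eta time_dir_Basis]]
  by (simp_all add: eta_dir_deriv[abs_def])

lemma space_deriv_eta_mult:
  "smooth f \<Longrightarrow> dir_deriv (space_dir j) (\<lambda>z. eta z * f z) = (\<lambda>z. eta z * dir_deriv (space_dir j) f z)"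
  by (simp add: smooth_dir_deriv_mult[OF smooth_eta] eta_dir_deriv)

lemma lap_eta_mult: "smooth f \<Longrightarrow> lap (\<lambda>z. eta z * f z) = (\<lambda>z. eta z * lap f z)"
  by (simp add: space_deriv_eta_mult smooth_dir_deriv sum_distrib_left)

lemma heat_eta_mult:
  assumes "smooth f"
  shows "heat (\<lambda>z. eta z * f z) = (\<lambda>z. eta z * heat f z + eta' z * f z)"
proof
  fix z
  have "dir_deriv time_dir (\<lambda>z. eta z * f z) z = eta z * dir_deriv time_dir f z + eta' z * f z"
    by (simp add: smooth_dir_deriv_mult[OF smooth_eta assms] eta_dir_deriv)
  then show "heat (\<lambda>z. eta z * f z) z = eta z * heat f z + eta' z * f z"
    using fun_cong[OF lap_eta_mult[OF assms], of z] by (simp only: distrib_left)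
qed

lemma leray_eta_mult:
  assumes f: "smooth f"
  shows "leray k i (\<lambda>z. eta z * f z) = (\<lambda>z. eta z * leray k i f z)"
proof -
  have "dir_deriv (space_dir i) (dir_deriv (space_dir k) (\<lambda>z. eta z * f z))
    = (\<lambda>z. eta z * dir_deriv (space_dir i) (dir_deriv (space_dir k) f) z)"
    by (simp only: space_deriv_eta_mult[OF f] space_deriv_eta_mult[OF smooth_dir_deriv[OF f space_dir_Basis]])
  then show ?thesis
    unfolding leray_def
    by (intro ext, cases "i = k") (simp_all only: fun_cong[OF lap_eta_mult[OF f]] right_diff_distrib refl if_True if_False mult_zero_right)
qed

lemma smooth_leray: "smooth f \<Longrightarrow> smooth (leray k i f)"
  unfolding leray_def by (cases "i = k") (auto intro!: smooth_diff smooth_lap smooth_dir_deriv)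

lemma heat_conv:
  assumes h: "h \<in> test_functions \<Omega>" and k: "integrable lborel k"
  shows "heat (conv lborel (\<lambda>w. w) k h) z = conv lborel (\<lambda>w. w) k (heat h) z"
proof -
  have id: "(\<lambda>w :: real \<times> (real^3). w) \<in> borel_measurable lborel" by simp
  have D: "dir_deriv (space_dir j) (dir_deriv (space_dir j) (conv lborel (\<lambda>w. w) k h))
     = conv lborel (\<lambda>w. w) k (dir_deriv (space_dir j) (dir_deriv (space_dir j) h))" for j
    by (simp only: conv_dir_deriv[OF h id k space_dir_Basis]
        conv_dir_deriv[OF test_functions_dir_deriv[OF h space_dir_Basis] id k space_dir_Basis])
  have "conv lborel (\<lambda>w. w) k (heat h) z = conv lborel (\<lambda>w. w) k (dir_deriv time_dir h) z + conv lborel (\<lambda>w. w) k (lap h) z"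
    by (rule conv_add[OF test_functions_dir_deriv[OF h time_dir_Basis] test_functions_lap[OF h] id k])
  also have "conv lborel (\<lambda>w. w) k (lap h) z = (\<Sum>j\<in>UNIV. conv lborel (\<lambda>w. w) k (dir_deriv (space_dir j) (dir_deriv (space_dir j) h)) z)"
    by (rule conv_cong_sum[where \<Omega> = \<Omega>, OF _ id k]) (intro test_functions_dir_deriv[OF _ space_dir_Basis] h)
  finally show ?thesis unfolding D conv_dir_deriv[OF h id k time_dir_Basis] ..
qed

text \<open>The adjoint of convolution with \<open>ker\<close>, applied to the absolute value of
  \<open>f\<close>. With values in \<open>ennreal\<close> it can be integrated and swapped before
  anything is known to be finite.\<close>

definition kpot :: "(real \<times> (real^3) \<Rightarrow> real) \<Rightarrow> real \<times> (real^3) \<Rightarrow> ennreal" where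
  "kpot f z = (\<integral>\<^sup>+w. ennreal (\<bar>f (z + w)\<bar> * ker w) \<partial>lborel)"

lemma kpot_measurable [measurable]:
  assumes [measurable]: "f \<in> borel_measurable borel"
  shows "kpot f \<in> borel_measurable borel"
proof -
  have [measurable]: "(\<lambda>p. f (fst p + snd p)) \<in> borel_measurable (borel \<Otimes>\<^sub>M borel)" by measurable
  have "(\<lambda>z. \<integral>\<^sup>+w. ennreal (\<bar>f (z + w)\<bar> * ker w) \<partial>lborel) \<in> borel_measurable borel" by measurable
  then show ?thesis unfolding kpot_def[abs_def] .
qed

text \<open>The separate kernel bounds become bounds by a single potential of \<open>h\<close>,
  uniformly in \<delta>. The constant is doubled to cover the two parts of
  \<open>corr\<close>.\<close>

lemma kpot_estimates:
  obtains C where "C \<ge> 1"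
    "\<And>R \<delta> h i j k z. 2 \<le> R \<Longrightarrow> 0 < \<delta> \<Longrightarrow> \<delta> \<le> 1 \<Longrightarrow> h \<in> test_functions ({..<1} \<times> UNIV) \<Longrightarrow>
      ennreal \<bar>dir_deriv (space_dir i) (dir_deriv (space_dir j) (dir_deriv (space_dir k) (conv lborel fst (kern Z0 R \<delta>) h))) z\<bar> \<le> ennreal C * kpot h z"
    "\<And>R \<delta> h z. 2 \<le> R \<Longrightarrow> 0 < \<delta> \<Longrightarrow> \<delta> \<le> 1 \<Longrightarrow> h \<in> test_functions ({..<1} \<times> UNIV) \<Longrightarrow>
      ennreal \<bar>conv lborel (\<lambda>w. w) (slice \<delta> (Qk Z0 R)) h z\<bar> \<le> ennreal C * kpot h z"
    "\<And>R \<delta> h z. 2 \<le> R \<Longrightarrow> 0 < \<delta> \<Longrightarrow> \<delta> \<le> 1 \<Longrightarrow> h \<in> test_functions ({..<1} \<times> UNIV) \<Longrightarrow>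
      ennreal \<bar>conv lborel (\<lambda>w. w) (slice \<delta> (Qr R)) h z\<bar> \<le> ennreal (C * R powr (-3/10)) * kpot h z"
    "\<And>R \<delta> h z. 2 \<le> R \<Longrightarrow> 0 < \<delta> \<Longrightarrow> \<delta> \<le> 1 \<Longrightarrow> h \<in> test_functions ({..<1} \<times> UNIV) \<Longrightarrow>
      ennreal \<bar>conv lborel (\<lambda>w. w) (corr R \<delta>) h z\<bar> \<le> ennreal (C * R powr (-3/10)) * kpot h z"
proof -
  obtain C where C: "C \<ge> 1"
    "\<And>R s \<delta> y. 0 < s \<Longrightarrow> s < 2 \<Longrightarrow> 0 \<le> \<delta> \<Longrightarrow> \<delta> \<le> 1 \<Longrightarrow> 2 \<le> R \<Longrightarrow> (\<And>i. y $ i \<noteq> 0) \<Longrightarrow>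
      \<bar>Qk (\<lambda>_. 0) R (s + \<delta>) y\<bar> \<le> C * ker (s, y)"
    "\<And>R s \<delta> y. 0 < s \<Longrightarrow> s < 2 \<Longrightarrow> 0 \<le> \<delta> \<Longrightarrow> \<delta> \<le> 1 \<Longrightarrow> 2 \<le> R \<Longrightarrow> (\<And>i. y $ i \<noteq> 0) \<Longrightarrow>
      \<bar>Qr R (s + \<delta>) y\<bar> \<le> C * R powr (-3/10) * ker (s, y)"
    "\<And>a R s \<delta> y. (\<And>i. a i \<le> 3) \<Longrightarrow> sum a UNIV = 3 \<Longrightarrow> 0 < s \<Longrightarrow> s < 2 \<Longrightarrow> 0 \<le> \<delta> \<Longrightarrow> 2 \<le> R \<Longrightarrow> (\<And>i. y $ i \<noteq> 0) \<Longrightarrow>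
      (\<integral>\<^sup>+\<tau>. indicator {s + \<delta><..<R\<^sup>2} \<tau> * ennreal \<bar>Qk a R \<tau> y\<bar> \<partial>lborel) \<le> ennreal (C * ker (s, y))"
    "\<And>R s y. 0 < s \<Longrightarrow> s < 2 \<Longrightarrow> 2 \<le> R \<Longrightarrow> (\<And>i. y $ i \<noteq> 0) \<Longrightarrow>
      \<bar>Qk (\<lambda>_. 0) R (R\<^sup>2) y\<bar> \<le> C * R powr (-3/10) * ker (s, y)"
    "\<And>R s y. 0 < s \<Longrightarrow> s < 2 \<Longrightarrow> 2 \<le> R \<Longrightarrow> (\<And>i. y $ i \<noteq> 0) \<Longrightarrow>
      (\<integral>\<^sup>+\<tau>. indicator {0<..<R\<^sup>2} \<tau> * ennreal \<bar>Qr R \<tau> y\<bar> \<partial>lborel) \<le> ennreal (C * R powr (-3/10) * ker (s, y))"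
    using kernel_bounds by blast
  have wt: "C * x \<le> 2 * C * x" if "x \<ge> 0" for x using that C(1) by simp
  show ?thesis
  proof (rule that[of "2 * C"])
    show "2 * C \<ge> 1" using C(1) by simp
    fix R \<delta> :: real and h :: "real \<times> (real^3) \<Rightarrow> real" and z
    assume R: "2 \<le> R" and \<delta>: "0 < \<delta>" "\<delta> \<le> 1" and h: "h \<in> test_functions ({..<1} \<times> UNIV)"
    have Rp: "0 \<le> R powr (-3/10)" by simp
    have ik: "integrable lborel (slice \<delta> (Qk Z0 R))" by (rule slice_Qk_integrable[OF R \<delta>]) simp
    obtain B where "B \<ge> 0"
      "\<And>a. (\<And>i. a i \<le> 3) \<Longrightarrow> integrable lborel (slice \<delta> (Qk a R))"
      "\<And>a w. (\<And>i. a i \<le> 3) \<Longrightarrow> \<bar>slice \<delta> (Qk a R) w\<bar> \<le> B"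
      "\<And>a w. (\<And>i. a i \<le> 3) \<Longrightarrow> norm w > 2 + 3 * R \<Longrightarrow> slice \<delta> (Qk a R) w = 0"
      and "integrable lborel (slice \<delta> (Qt R))" and ir: "integrable lborel (slice \<delta> (Qr R))"
      and "\<And>w. \<bar>slice \<delta> (Qt R) w\<bar> \<le> B" using slice_facts[OF R \<delta>] by blast
    show "ennreal \<bar>conv lborel (\<lambda>w. w) (slice \<delta> (Qk Z0 R)) h z\<bar> \<le> ennreal (2 * C) * kpot h z"
      unfolding kpot_def
    proof (rule conv_id_bound[OF h ik])
      show "AE w in lborel. \<bar>slice \<delta> (Qk Z0 R) w\<bar> \<le> 2 * C * ker w"
        using AE_coordinates_nonzero
      proof eventually_elim
        case (elim w)
        show ?case
        proof (cases "0 < fst w \<and> fst w < 2")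
          case True
          then have "\<bar>Qk Z0 R (fst w + \<delta>) (snd w)\<bar> \<le> C * ker (fst w, snd w)"
            using \<delta> R elim by (intro C) auto
          also have "\<dots> \<le> 2 * C * ker w" using wt[OF ker_nonneg[of w]] by simp
          finally show ?thesis using True by (simp add: slice_def)
        next
          case False
          then have "slice \<delta> (Qk Z0 R) w = 0" by (simp only: slice_def if_False)
          then show ?thesis using C(1) ker_nonneg[of w] by simp
        qed
      qed
    qed (use C(1) in simp)
    show "ennreal \<bar>conv lborel (\<lambda>w. w) (slice \<delta> (Qr R)) h z\<bar> \<le> ennreal (2 * C * R powr (-3/10)) * kpot h z"
      unfolding kpot_def
    proof (rule conv_id_bound[OF h ir])
      show "AE w in lborel. \<bar>slice \<delta> (Qr R) w\<bar> \<le> 2 * C * R powr (-3/10) * ker w"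
        using AE_coordinates_nonzero
      proof eventually_elim
        case (elim w)
        show ?case
        proof (cases "0 < fst w \<and> fst w < 2")
          case True
          then have "\<bar>Qr R (fst w + \<delta>) (snd w)\<bar> \<le> C * R powr (-3/10) * ker (fst w, snd w)"
            using \<delta> R elim by (intro C) auto
          also have "\<dots> \<le> 2 * C * R powr (-3/10) * ker w"
            using wt[of "R powr (-3/10) * ker w"] Rp ker_nonneg[of w] by (simp add: mult.assoc)
          finally show ?thesis using True by (simp add: slice_def)
        next
          case False
          then have "slice \<delta> (Qr R) w = 0" by (simp only: slice_def if_False)
          then show ?thesis using C(1) ker_nonneg[of w] by simp
        qed
      qed
    qed (use C(1) in simp)
    show "ennreal \<bar>conv lborel (\<lambda>w. w) (corr R \<delta>) h z\<bar> \<le> ennreal (2 * C * R powr (-3/10)) * kpot h z"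
      unfolding kpot_def
    proof (rule conv_id_bound[OF h corr_integrable[OF R \<delta>]])
      show "AE w in lborel. \<bar>corr R \<delta> w\<bar> \<le> 2 * C * R powr (-3/10) * ker w"
        using AE_coordinates_nonzero
      proof eventually_elim
        case (elim w)
        show ?case
        proof (cases "0 < fst w \<and> fst w < 2")
          case True
          obtain s y where w: "w = (s, y)" by (cases w)
          have s: "0 < s" "s < 2" using True by (auto simp: w)
          have y: "y $ i \<noteq> 0" for i using elim by (simp add: w)
          let ?I = "\<integral>\<tau>. indicator {s + \<delta><..<R\<^sup>2} \<tau> * Qr R \<tau> y \<partial>lborel"
          have "ennreal \<bar>?I\<bar> \<le> ennreal (C * R powr (-3/10) * ker (s, y))"
          proof (cases "integrable lborel (\<lambda>\<tau>. indicator {s + \<delta><..<R\<^sup>2} \<tau> * Qr R \<tau> y)")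
            case True
            have "ennreal \<bar>?I\<bar> \<le> (\<integral>\<^sup>+\<tau>. ennreal (norm (indicator {s + \<delta><..<R\<^sup>2} \<tau> * Qr R \<tau> y)) \<partial>lborel)"
              using integral_norm_bound_ennreal[OF True] by simp
            also have "\<dots> \<le> (\<integral>\<^sup>+\<tau>. indicator {0<..<R\<^sup>2} \<tau> * ennreal \<bar>Qr R \<tau> y\<bar> \<partial>lborel)"
              using s \<delta> by (intro nn_integral_mono) (auto simp: indicator_def)
            also have "\<dots> \<le> ennreal (C * R powr (-3/10) * ker (s, y))" by (rule C(6)[OF s R y])
            finally show ?thesis .
          \<comment> \<open>A non-integrable function has Bochner integral 0, for which the bound is
            trivial.\<close>
          qed (simp add: not_integrable_integral_eq)
          then have "\<bar>?I\<bar> \<le> C * R powr (-3/10) * ker (s, y)"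
            using C(1) Rp ker_nonneg[of "(s, y)"] by (subst (asm) ennreal_le_iff) auto
          moreover have "\<bar>Qk Z0 R (R\<^sup>2) y\<bar> \<le> C * R powr (-3/10) * ker (s, y)" by (rule C(5)[OF s R y])
          ultimately show ?thesis unfolding w corr_eq[OF R \<delta> s] by linarith
        next
          case False
          then show ?thesis using C(1) ker_nonneg[of w] by (simp add: corr_outside[OF R \<delta> False])
        qed
      qed
    qed (use C(1) in simp)
    fix i j k
    let ?a = "inc k (inc j (inc i Z0))"
    have a3: "sum ?a UNIV = 3" by (simp add: sum_inc)
    have a: "?a l \<le> 3" for l using le_sum_UNIV[of ?a l] a3 by simp
    have k0: "integrable lborel (kern Z0 R \<delta>)" by (rule kern_integrable[OF R \<delta>]) simp
    have fst: "(fst :: (real \<times> (real^3)) \<times> real \<Rightarrow> _) \<in> borel_measurable lborel"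
      by (simp add: borel_prod[symmetric])
    have h1: "dir_deriv (space_dir k) h \<in> test_functions ({..<1} \<times> UNIV)"
      and h2: "dir_deriv (space_dir j) (dir_deriv (space_dir k) h) \<in> test_functions ({..<1} \<times> UNIV)"
      by (intro test_functions_dir_deriv h space_dir_Basis)+
    have eq: "dir_deriv (space_dir i) (dir_deriv (space_dir j) (dir_deriv (space_dir k) (conv lborel fst (kern Z0 R \<delta>) h))) z
      = - conv lborel fst (kern ?a R \<delta>) h z"
      unfolding conv_dir_deriv[OF h fst k0 space_dir_Basis] conv_dir_deriv[OF h1 fst k0 space_dir_Basis]
        conv_dir_deriv[OF h2 fst k0 space_dir_Basis] by (rule kern_by_parts3[OF R \<delta> h])
    show "ennreal \<bar>dir_deriv (space_dir i) (dir_deriv (space_dir j) (dir_deriv (space_dir k) (conv lborel fst (kern Z0 R \<delta>) h))) z\<bar> \<le> ennreal (2 * C) * kpot h z"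
      unfolding eq abs_minus_cancel kpot_def
    proof (rule conv_fst_bound[OF h kern_integrable[OF R \<delta> a]])
      show "AE w in lborel. (\<integral>\<^sup>+\<tau>. ennreal \<bar>kern ?a R \<delta> (w, \<tau>)\<bar> \<partial>lborel) \<le> ennreal (2 * C * ker w)"
        using AE_coordinates_nonzero
      proof eventually_elim
        case (elim w)
        show ?case
        proof (cases "0 < fst w \<and> fst w < 2")
          case True
          have "(\<integral>\<^sup>+\<tau>. ennreal \<bar>kern ?a R \<delta> (w, \<tau>)\<bar> \<partial>lborel)
            = (\<integral>\<^sup>+\<tau>. indicator {fst w + \<delta><..<R\<^sup>2} \<tau> * ennreal \<bar>Qk ?a R \<tau> (snd w)\<bar> \<partial>lborel)"
            using True by (intro nn_integral_cong) (auto simp: kern_def indicator_def)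
          also have "\<dots> \<le> ennreal (C * ker (fst w, snd w))"
            using True \<delta> R elim a a3 by (intro C) auto
          also have "\<dots> \<le> ennreal (2 * C * ker w)" using wt[OF ker_nonneg[of w]] by (intro ennreal_leI) simp
          finally show ?thesis .
        next
          case False
          then have "kern ?a R \<delta> (w, \<tau>) = 0" for \<tau> by (auto simp: kern_def)
          then show ?thesis by simp
        qed
      qed
    qed (use C(1) in simp)
  qed
qed

lemma nn_integral_translate:
  fixes f :: "'a::euclidean_space \<Rightarrow> ennreal"
  assumes [measurable]: "f \<in> borel_measurable borel"
  shows "(\<integral>\<^sup>+x. f (x + c) \<partial>lborel) = (\<integral>\<^sup>+x. f x \<partial>lborel)"
proof -
  have eq: "distr lborel borel (\<lambda>x. c + x) = lborel" using lborel_distr_plus[of c] by simp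
  have "(\<integral>\<^sup>+x. f x \<partial>distr lborel borel (\<lambda>x. c + x)) = (\<integral>\<^sup>+x. f (c + x) \<partial>lborel)"
    by (rule nn_integral_distr) auto
  then show ?thesis unfolding eq by (simp add: add.commute)
qed

lemma nn_integral_reflect:
  fixes f :: "'a::euclidean_space \<Rightarrow> ennreal"
  assumes [measurable]: "f \<in> borel_measurable borel"
  shows "(\<integral>\<^sup>+x. f (c - x) \<partial>lborel) = (\<integral>\<^sup>+x. f x \<partial>lborel)"
proof -
  have eq: "distr lborel borel (\<lambda>x::'a. c - x) = lborel"
    using lborel_affine[of "-1" c] by (simp add: density_1)
  have "(\<integral>\<^sup>+x. f x \<partial>distr lborel borel (\<lambda>x. c - x)) = (\<integral>\<^sup>+x. f (c - x) \<partial>lborel)"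
    by (rule nn_integral_distr) auto
  then show ?thesis unfolding eq by simp
qed

lemma nn_integral_shift_swap:
  fixes F k g :: "'a::euclidean_space \<Rightarrow> ennreal"
  assumes [measurable]: "F \<in> borel_measurable borel" "k \<in> borel_measurable borel" "g \<in> borel_measurable borel"
  shows "(\<integral>\<^sup>+z. (\<integral>\<^sup>+w. F (z + w) * k w \<partial>lborel) * g z \<partial>lborel) = (\<integral>\<^sup>+z. F z * (\<integral>\<^sup>+w. k w * g (z - w) \<partial>lborel) \<partial>lborel)"
proof -
  have "(\<integral>\<^sup>+z. (\<integral>\<^sup>+w. F (z + w) * k w \<partial>lborel) * g z \<partial>lborel) = (\<integral>\<^sup>+z. \<integral>\<^sup>+w. F (z + w) * k w * g z \<partial>lborel \<partial>lborel)"
    by (simp add: nn_integral_multc)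
  also have "\<dots> = (\<integral>\<^sup>+w. \<integral>\<^sup>+z. F (z + w) * k w * g z \<partial>lborel \<partial>lborel)"
    by (rule lborel_pair.Fubini') measurable
  also have "\<dots> = (\<integral>\<^sup>+w. \<integral>\<^sup>+z. F z * k w * g (z - w) \<partial>lborel \<partial>lborel)"
  proof (rule nn_integral_cong)
    fix w
    show "(\<integral>\<^sup>+z. F (z + w) * k w * g z \<partial>lborel) = (\<integral>\<^sup>+z. F z * k w * g (z - w) \<partial>lborel)"
      using nn_integral_translate[of "\<lambda>z. F z * k w * g (z - w)" w] by simp
  qed
  also have "\<dots> = (\<integral>\<^sup>+z. \<integral>\<^sup>+w. F z * k w * g (z - w) \<partial>lborel \<partial>lborel)"
    by (rule lborel_pair.Fubini') measurable
  finally show ?thesis by (simp add: nn_integral_cmult mult.assoc)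
qed

text \<open>Tonelli and a translation move the kernel from the test function to the field. The test
  function then stands alone, as \<open>AE_le_of_test_functions\<close> requires.\<close>

lemma kpot_swap:
  assumes [measurable]: "f \<in> borel_measurable borel" "g \<in> borel_measurable borel"
  shows "(\<integral>\<^sup>+z. kpot f z * g z \<partial>lborel) = (\<integral>\<^sup>+z. ennreal \<bar>f z\<bar> * (\<integral>\<^sup>+w. ennreal (ker w) * g (z - w) \<partial>lborel) \<partial>lborel)"
  using nn_integral_shift_swap[of "\<lambda>z. ennreal \<bar>f z\<bar>" "\<lambda>w. ennreal (ker w)" g]
  by (simp add: kpot_def ennreal_mult ker_nonneg)

text \<open>The larger of \<open>a\<close> and \<open>b ^ 5\<close> decides: the product is at most
  \<open>b ^ 6\<close> in one case and at most \<open>a powr (6/5)\<close> in the other.\<close>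

lemma Young_6_5:
  fixes a b :: real
  assumes "a \<ge> 0" "b \<ge> 0"
  shows "a * b \<le> a powr (6/5) + b ^ 6"
proof (cases "a \<le> b ^ 5")
  case True
  then have "a * b \<le> b ^ 5 * b" using assms by (intro mult_right_mono) auto
  also have "b ^ 5 * b = b ^ 6" by (simp add: power_numeral_reduce)
  finally show ?thesis by (simp add: add_increasing)
next
  case False
  then have "b \<le> a powr (1/5)"
  proof -
    have "b = (b ^ 5) powr (1/5)" using assms by (cases "b = 0") (simp_all add: powr_powr flip: powr_numeral)
    also have "\<dots> \<le> a powr (1/5)" using assms False by (intro powr_mono2) auto
    finally show ?thesis .
  qed
  then have "a * b \<le> a * a powr (1/5)" using assms by (intro mult_left_mono) auto
  also have "\<dots> = a powr (6/5)" using assms by (simp add: powr_mult_base)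
  finally show ?thesis using assms by (simp add: add_increasing2)
qed

text \<open>The free parameter of the scaled Young inequality replaces an appeal to Hoelder's inequality.\<close>

lemma ker_Young:
  fixes g :: "real \<times> (real^3) \<Rightarrow> real"
  assumes \<mu>: "\<mu> > 0" and [measurable]: "g \<in> borel_measurable borel" and g: "\<And>z. g z \<ge> 0"
  shows "(\<integral>\<^sup>+w. ennreal (ker w) * ennreal (g (z - w)) \<partial>lborel)
    \<le> ennreal (\<mu> powr (6/5)) * (\<integral>\<^sup>+w. ennreal (ker w powr (6/5)) \<partial>lborel)
      + ennreal ((1 / \<mu>) ^ 6) * (\<integral>\<^sup>+z. ennreal (g z ^ 6) \<partial>lborel)"
proof -
  have le: "ker w * g (z - w) \<le> \<mu> powr (6/5) * ker w powr (6/5) + (1 / \<mu>) ^ 6 * g (z - w) ^ 6" for w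
  proof -
    have "ker w * g (z - w) = (\<mu> * ker w) * (1 / \<mu> * g (z - w))" using \<mu> by simp
    also have "\<dots> \<le> (\<mu> * ker w) powr (6/5) + (1 / \<mu> * g (z - w)) ^ 6"
      using \<mu> g ker_nonneg by (intro Young_6_5) auto
    finally show ?thesis using \<mu> ker_nonneg[of w] by (simp add: powr_mult power_mult_distrib power_divide)
  qed
  have "(\<integral>\<^sup>+w. ennreal (ker w) * ennreal (g (z - w)) \<partial>lborel)
    \<le> (\<integral>\<^sup>+w. ennreal (\<mu> powr (6/5)) * ennreal (ker w powr (6/5)) + ennreal ((1 / \<mu>) ^ 6) * ennreal (g (z - w) ^ 6) \<partial>lborel)"
  proof (rule nn_integral_mono)
    fix w
    have "ennreal (ker w) * ennreal (g (z - w)) = ennreal (ker w * g (z - w))"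
      using ker_nonneg g by (simp add: ennreal_mult)
    also have "\<dots> \<le> ennreal (\<mu> powr (6/5) * ker w powr (6/5) + (1 / \<mu>) ^ 6 * g (z - w) ^ 6)"
      by (rule ennreal_leI[OF le])
    also have "\<dots> = ennreal (\<mu> powr (6/5)) * ennreal (ker w powr (6/5)) + ennreal ((1 / \<mu>) ^ 6) * ennreal (g (z - w) ^ 6)"
      using \<mu> g by (simp add: ennreal_plus ennreal_mult)
    finally show "ennreal (ker w) * ennreal (g (z - w)) \<le> ennreal (\<mu> powr (6/5)) * ennreal (ker w powr (6/5)) + ennreal ((1 / \<mu>) ^ 6) * ennreal (g (z - w) ^ 6)" .
  qed
  also have "\<dots> = ennreal (\<mu> powr (6/5)) * (\<integral>\<^sup>+w. ennreal (ker w powr (6/5)) \<partial>lborel)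
      + ennreal ((1 / \<mu>) ^ 6) * (\<integral>\<^sup>+w. ennreal (g (z - w) ^ 6) \<partial>lborel)"
    by (simp add: nn_integral_add nn_integral_cmult)
  also have "(\<integral>\<^sup>+w. ennreal (g (z - w) ^ 6) \<partial>lborel) = (\<integral>\<^sup>+z. ennreal (g z ^ 6) \<partial>lborel)"
    by (rule nn_integral_reflect[of "\<lambda>z. ennreal (g z ^ 6)"]) measurable
  finally show ?thesis .
qed

text \<open>Ensures that the integral multiplied by \<open>R powr (-3/10)\<close> is finite, so that
  the truncation error vanishes in the limit. The support of \<open>f\<close> makes the outer
  integral finite.\<close>

lemma kpot_L6_finite:
  assumes f: "f \<in> test_functions \<Omega>" and [measurable]: "g \<in> borel_measurable borel" and g: "\<And>z. g z \<ge> 0"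
    and g6: "(\<integral>\<^sup>+z. ennreal (g z ^ 6) \<partial>lborel) < \<infinity>"
  shows "(\<integral>\<^sup>+z. kpot f z * ennreal (g z) \<partial>lborel) < \<infinity>"
proof -
  note [measurable] = test_functions_borel[OF f]
  define K where "K = (\<integral>\<^sup>+w. ennreal (ker w powr (6/5)) \<partial>lborel) + (\<integral>\<^sup>+z. ennreal (g z ^ 6) \<partial>lborel)"
  have K: "K < \<infinity>" unfolding K_def using nn_integral_ker_finite g6 by simp
  have "(\<integral>\<^sup>+z. kpot f z * ennreal (g z) \<partial>lborel)
    = (\<integral>\<^sup>+z. ennreal \<bar>f z\<bar> * (\<integral>\<^sup>+w. ennreal (ker w) * ennreal (g (z - w)) \<partial>lborel) \<partial>lborel)"
    by (rule kpot_swap) measurable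
  also have "\<dots> \<le> (\<integral>\<^sup>+z. ennreal \<bar>f z\<bar> * K \<partial>lborel)"
    using ker_Young[of 1 g] g by (intro nn_integral_mono mult_left_mono) (auto simp: K_def)
  also have "\<dots> = (\<integral>\<^sup>+z. ennreal \<bar>f z\<bar> \<partial>lborel) * K" by (rule nn_integral_multc) measurable
  also have "\<dots> < \<infinity>"
    using K test_functions_integrable[OF f] by (simp add: integrable_iff_bounded ennreal_mult_less_top)
  finally show ?thesis .
qed

text \<open>Three cuts produce the compact support: \<open>eta\<close> bounds the time from below,
  the support of \<open>h\<close> bounds it from above because the kernel only looks forward in
  time, and the truncation bounds space.\<close>

lemma conv_kern_test_function:
  assumes R: "2 \<le> R" and \<delta>: "0 < \<delta>" "\<delta> \<le> 1" and h: "h \<in> test_functions ({..<1} \<times> UNIV)"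
  shows "(\<lambda>z. eta z * conv lborel fst (kern Z0 R \<delta>) h z) \<in> test_functions ({-1<..<1} \<times> UNIV)"
proof -
  define S where "S = closure {x. h x \<noteq> 0}"
  define W :: "(real \<times> (real^3)) set" where "W = {0..2} \<times> cball 0 (3 * R)"
  define K where "K = ({-3/4..} \<times> UNIV) \<inter> (\<Union>x\<in>S. \<Union>w\<in>W. {x - w})"
  have S: "compact S" "S \<subseteq> {..<1} \<times> UNIV" using test_functionsD[OF h] by (auto simp: S_def)
  have W: "compact W" unfolding W_def by (intro compact_Times compact_Icc compact_cball)
  have fst: "(fst :: (real \<times> (real^3)) \<times> real \<Rightarrow> _) \<in> borel_measurable lborel"
    by (simp add: borel_prod[symmetric])
  have k0: "integrable lborel (kern Z0 R \<delta>)" by (rule kern_integrable[OF R \<delta>]) simp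
  show ?thesis
  proof (rule test_functionsI[where K = K])
    show "smooth (\<lambda>z. eta z * conv lborel fst (kern Z0 R \<delta>) h z)"
      by (intro smooth_mult smooth_eta smooth_conv[OF h fst k0])
    have "compact {x - w | x w. x \<in> S \<and> w \<in> W}" by (rule compact_differences[OF S(1) W])
    moreover have "{x - w | x w. x \<in> S \<and> w \<in> W} = (\<Union>x\<in>S. \<Union>w\<in>W. {x - w})" by blast
    ultimately show "compact K" unfolding K_def by (intro closed_Int_compact closed_Times) auto
    show "K \<subseteq> {-1<..<1} \<times> UNIV"
    proof
      fix p assume p: "p \<in> K"
      then obtain x w where xw: "x \<in> S" "w \<in> W" "p = x - w" by (auto simp: K_def)
      have "fst x < 1" using S(2) xw(1) by (auto simp: mem_Times_iff)
      moreover have "fst w \<ge> 0" using xw(2) by (auto simp: W_def)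
      moreover have "fst p \<ge> -3/4" using p by (auto simp: K_def)
      ultimately show "p \<in> {-1<..<1} \<times> UNIV" using xw(3) by (simp add: mem_Times_iff)
    qed
    fix z assume z: "z \<notin> K"
    show "eta z * conv lborel fst (kern Z0 R \<delta>) h z = 0"
    proof (cases "fst z \<ge> -3/4")
      case False
      then show ?thesis by (simp add: eta_zero)
    next
      case True
      have zero: "h (z + fst \<omega>) * kern Z0 R \<delta> \<omega> = 0" for \<omega>
      proof (rule ccontr)
        assume nz: "h (z + fst \<omega>) * kern Z0 R \<delta> \<omega> \<noteq> 0"
        then have "z + fst \<omega> \<in> S" using outside_support[of "z + fst \<omega>" h] by (auto simp: S_def)
        moreover have "fst \<omega> \<in> W"
        proof -
          have k: "kern Z0 R \<delta> \<omega> \<noteq> 0" using nz by auto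
          then have c: "0 < fst (fst \<omega>)" "fst (fst \<omega>) < 2" and q: "Qk Z0 R (snd \<omega>) (snd (fst \<omega>)) \<noteq> 0"
            unfolding kern_def by presburger+
          then have "norm (snd (fst \<omega>)) \<le> 3 * R" using R Qk_outside[of R "snd (fst \<omega>)" Z0 "snd \<omega>"] by linarith
          then show ?thesis using c by (simp add: W_def mem_Times_iff)
        qed
        ultimately have "z \<in> (\<Union>x\<in>S. \<Union>w\<in>W. {x - w})" by (intro UN_I) auto
        then show False using z True by (auto simp: K_def mem_Times_iff)
      qed
      show ?thesis by (simp only: conv_def zero) simp
    qed
  qed
qed

definition weak_NS :: "(real \<times> (real^3) \<Rightarrow> real^3) \<Rightarrow> bool" where
  "weak_NS U \<longleftrightarrow> (\<forall>k. \<forall>\<Psi>\<in>test_functions ({-1<..<1} \<times> UNIV).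
     (\<integral>z. U z $ k * heat (lap \<Psi>) z \<partial>lborel) =
     (\<Sum>i\<in>UNIV. \<Sum>j\<in>UNIV. \<integral>z. U z $ i * U z $ j * dir_deriv (space_dir j) (leray k i \<Psi>) z \<partial>lborel))"

lemma integrable_of_nn_bound:
  fixes f :: "'a \<Rightarrow> real"
  assumes "f \<in> borel_measurable M" "(\<integral>\<^sup>+x. ennreal \<bar>f x\<bar> \<partial>M) \<le> K" "K < \<infinity>"
  shows "integrable M f" "ennreal \<bar>\<integral>x. f x \<partial>M\<bar> \<le> K"
proof -
  show i: "integrable M f"
    using assms by (intro integrableI_bounded) (auto intro: order_le_less_trans)
  show "ennreal \<bar>\<integral>x. f x \<partial>M\<bar> \<le> K"
    using integral_norm_bound_ennreal[OF i] assms(2) by simp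
qed

lemma ennreal_abs_sum_le: "ennreal \<bar>\<Sum>i\<in>I. f i\<bar> \<le> (\<Sum>i\<in>I. ennreal \<bar>f i\<bar>)"
  by (rule order_trans[OF ennreal_leI[OF sum_abs]]) (simp add: sum_ennreal)

lemma ennreal_abs_add_le: "ennreal \<bar>a + b\<bar> \<le> ennreal \<bar>a\<bar> + ennreal \<bar>b\<bar>"
  by (rule order_trans[OF ennreal_leI[OF abs_triangle_ineq]]) (simp add: ennreal_plus)

lemma ennreal_abs_diff_le: "ennreal \<bar>a - b\<bar> \<le> ennreal \<bar>a\<bar> + ennreal \<bar>b\<bar>"
  using ennreal_abs_add_le[of a "-b"] by simp

text \<open>The factor 4 counts one third derivative from the mixed term and three from the
  Laplacian.\<close>

lemma leray_deriv_bound: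
  assumes f: "smooth f"
    and b: "\<And>i j k. ennreal \<bar>dir_deriv (space_dir i) (dir_deriv (space_dir j) (dir_deriv (space_dir k) f)) z\<bar> \<le> K"
  shows "ennreal \<bar>dir_deriv (space_dir j) (leray k i f) z\<bar> \<le> 4 * K"
proof -
  let ?g = "dir_deriv (space_dir i) (dir_deriv (space_dir k) f)"
  have g: "smooth ?g" by (intro smooth_dir_deriv f space_dir_Basis)
  have "dir_deriv (space_dir j) (leray k i f) z = dir_deriv (space_dir j) ?g z
     - (if i = k then dir_deriv (space_dir j) (lap f) z else 0)"
    unfolding leray_def using smooth_dir_deriv_diff[OF g smooth_lap[OF f], of "space_dir j"]
    by (cases "i = k") simp_all
  moreover have "dir_deriv (space_dir j) (lap f) z
    = (\<Sum>l\<in>UNIV. dir_deriv (space_dir j) (dir_deriv (space_dir l) (dir_deriv (space_dir l) f)) z)"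
    using fun_cong[OF smooth_dir_deriv_sum[of UNIV "\<lambda>l. dir_deriv (space_dir l) (dir_deriv (space_dir l) f)" "space_dir j"], of z]
    by (simp add: smooth_dir_deriv f)
  moreover have "ennreal \<bar>\<Sum>l\<in>UNIV. dir_deriv (space_dir j) (dir_deriv (space_dir l) (dir_deriv (space_dir l) f)) z\<bar> \<le> 3 * K"
  proof -
    have "ennreal \<bar>\<Sum>l\<in>UNIV. dir_deriv (space_dir j) (dir_deriv (space_dir l) (dir_deriv (space_dir l) f)) z\<bar>
      \<le> (\<Sum>l\<in>(UNIV::3 set). K)"
      by (rule order_trans[OF ennreal_abs_sum_le]) (intro sum_mono b)
    then show ?thesis by simp
  qed
  ultimately have eq: "dir_deriv (space_dir j) (leray k i f) z = dir_deriv (space_dir j) ?g z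
     - (if i = k then dir_deriv (space_dir j) (lap f) z else 0)"
    and le: "ennreal \<bar>dir_deriv (space_dir j) (lap f) z\<bar> \<le> 3 * K" by simp_all
  have "ennreal \<bar>if i = k then dir_deriv (space_dir j) (lap f) z else 0\<bar> \<le> 3 * K"
    using le by (cases "i = k") simp_all
  then have "ennreal \<bar>dir_deriv (space_dir j) (leray k i f) z\<bar> \<le> K + 3 * K"
    unfolding eq by (intro order_trans[OF ennreal_abs_diff_le] add_mono b)
  also have "K + 3 * K = 4 * K"
    using distrib_right[of 1 3 K] by simp
  finally show ?thesis .
qed

text \<open>For \<open>\<Psi> = eta * \<Psi>0\<close> the linear side of the weak form tests
  \<open>U\<close> against \<open>eta * (ZH - Er + I) + eta' * (Z - V)\<close>. Here
  \<open>I\<close> is the mollification of \<open>h\<close> and is what gets estimated;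
  \<open>V\<close> is the heat potential, bounded by \<open>kpot h\<close>; \<open>Z\<close>,
  \<open>ZH\<close> and \<open>Er\<close> stem from the truncation and carry
  \<open>R powr (-3/10)\<close>. The quadratic side contains third derivatives of
  \<open>\<Psi>0\<close> and a single factor \<open>eta\<close>, which space derivatives do not
  touch.\<close>

lemma mollified_estimate:
  obtains C where "C \<ge> 0"
    "\<And>U h k R \<delta>. U \<in> borel_measurable borel \<Longrightarrow> (\<And>z. fst z \<notin> {-1<..<1} \<Longrightarrow> U z = 0) \<Longrightarrow>
      (\<integral>\<^sup>+z. ennreal (norm (U z) ^ 6) \<partial>lborel) < \<infinity> \<Longrightarrow> weak_NS U \<Longrightarrow>
      h \<in> test_functions ({..<1} \<times> UNIV) \<Longrightarrow> 2 \<le> R \<Longrightarrow> 0 < \<delta> \<Longrightarrow> \<delta> \<le> 1 \<Longrightarrow>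
      ennreal \<bar>\<integral>z. U z $ k * eta z * (\<integral>y. h (fst z, snd z + y) * Qk Z0 R \<delta> y \<partial>lborel) \<partial>lborel\<bar>
      \<le> ennreal C * (\<integral>\<^sup>+z. kpot h z * ennreal (norm (U z) + eta z * norm (U z) ^ 2) \<partial>lborel)
        + ennreal (C * R powr (-3/10)) * (\<integral>\<^sup>+z. (kpot h z + kpot (heat h) z) * ennreal (norm (U z)) \<partial>lborel)"
proof -
  obtain C where C: "C \<ge> 1"
    "\<And>R \<delta> h i j k z. 2 \<le> R \<Longrightarrow> 0 < \<delta> \<Longrightarrow> \<delta> \<le> 1 \<Longrightarrow> h \<in> test_functions ({..<1} \<times> UNIV) \<Longrightarrow>
      ennreal \<bar>dir_deriv (space_dir i) (dir_deriv (space_dir j) (dir_deriv (space_dir k) (conv lborel fst (kern Z0 R \<delta>) h))) z\<bar> \<le> ennreal C * kpot h z"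
    "\<And>R \<delta> h z. 2 \<le> R \<Longrightarrow> 0 < \<delta> \<Longrightarrow> \<delta> \<le> 1 \<Longrightarrow> h \<in> test_functions ({..<1} \<times> UNIV) \<Longrightarrow>
      ennreal \<bar>conv lborel (\<lambda>w. w) (slice \<delta> (Qk Z0 R)) h z\<bar> \<le> ennreal C * kpot h z"
    "\<And>R \<delta> h z. 2 \<le> R \<Longrightarrow> 0 < \<delta> \<Longrightarrow> \<delta> \<le> 1 \<Longrightarrow> h \<in> test_functions ({..<1} \<times> UNIV) \<Longrightarrow>
      ennreal \<bar>conv lborel (\<lambda>w. w) (slice \<delta> (Qr R)) h z\<bar> \<le> ennreal (C * R powr (-3/10)) * kpot h z"
    "\<And>R \<delta> h z. 2 \<le> R \<Longrightarrow> 0 < \<delta> \<Longrightarrow> \<delta> \<le> 1 \<Longrightarrow> h \<in> test_functions ({..<1} \<times> UNIV) \<Longrightarrow>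
      ennreal \<bar>conv lborel (\<lambda>w. w) (corr R \<delta>) h z\<bar> \<le> ennreal (C * R powr (-3/10)) * kpot h z"
    using kpot_estimates by blast
  define E :: real where "E = 2 * exp 4"
  have E: "E \<ge> 1" unfolding E_def using one_le_exp_iff[of 4] by linarith
  \<comment> \<open>36 is the number 9 of products \<open>U z $ i * U z $ j\<close> times the 4 of
    \<open>leray_deriv_bound\<close>; the remaining 1 pays for the term with
    \<open>eta' z * V z\<close>.\<close>
  define D where "D = 37 * C * E"
  show ?thesis
  proof (rule that[of D])
    show D0: "D \<ge> 0" using C(1) E by (simp add: D_def)
    fix U :: "real \<times> (real^3) \<Rightarrow> real^3" and h :: "real \<times> (real^3) \<Rightarrow> real" and k :: 3 and R \<delta> :: real
    assume U [measurable]: "U \<in> borel_measurable borel" and U0: "\<And>z. fst z \<notin> {-1<..<1} \<Longrightarrow> U z = 0"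
      and U6: "(\<integral>\<^sup>+z. ennreal (norm (U z) ^ 6) \<partial>lborel) < \<infinity>" and NS: "weak_NS U"
      and h: "h \<in> test_functions ({..<1} \<times> UNIV)" and R: "2 \<le> R" and \<delta>: "0 < \<delta>" "\<delta> \<le> 1"
    define r where "r = R powr (-3/10)"
    have r: "0 \<le> r" "r \<le> 1" unfolding r_def using R by (auto intro: powr_le1 simp: powr_minus inverse_le_1_iff ge_one_powr_ge_zero)
    let ?N = "\<lambda>z. norm (U z)"
    have Unth: "\<bar>U z $ i\<bar> \<le> ?N z" for z i by (rule component_le_norm_cart)
    have Um [measurable]: "(\<lambda>z. U z $ i) \<in> borel_measurable borel" for i
      using measurable_compose[OF U vec_nth_measurable[of i]] by simp
    define \<Psi>0 where "\<Psi>0 = conv lborel fst (kern Z0 R \<delta>) h"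
    define V where "V = conv lborel (\<lambda>w. w) (slice \<delta> (Qk Z0 R)) h"
    define Z where "Z = conv lborel (\<lambda>w. w) (corr R \<delta>) h"
    \<comment> \<open>In the correction term the heat operator stays on \<open>h\<close>, so no
      derivative of \<open>corr\<close> is ever needed; its decay in \<open>R\<close> outweighs the
      fixed constant that depends on \<open>heat h\<close>.\<close>
    define ZH where "ZH = conv lborel (\<lambda>w. w) (corr R \<delta>) (heat h)"
    define Er where "Er = conv lborel (\<lambda>w. w) (slice \<delta> (Qr R)) h"
    define I where "I z = (\<integral>y. h (fst z, snd z + y) * Qk Z0 R \<delta> y \<partial>lborel)" for z
    define \<Psi> where "\<Psi> = (\<lambda>z. eta z * \<Psi>0 z)"
    have hh: "heat h \<in> test_functions ({..<1} \<times> UNIV)" by (rule test_functions_heat[OF h])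
    have fst: "(fst :: (real \<times> (real^3)) \<times> real \<Rightarrow> _) \<in> borel_measurable lborel"
      by (simp add: borel_prod[symmetric])
    have id: "(\<lambda>w :: real \<times> (real^3). w) \<in> borel_measurable lborel" by simp
    have k0: "integrable lborel (kern Z0 R \<delta>)" by (rule kern_integrable[OF R \<delta>]) simp
    have ik: "integrable lborel (slice \<delta> (Qk Z0 R))" by (rule slice_Qk_integrable[OF R \<delta>]) simp
    obtain B where "B \<ge> 0"
      "\<And>a. (\<And>i. a i \<le> 3) \<Longrightarrow> integrable lborel (slice \<delta> (Qk a R))"
      "\<And>a w. (\<And>i. a i \<le> 3) \<Longrightarrow> \<bar>slice \<delta> (Qk a R) w\<bar> \<le> B"
      "\<And>a w. (\<And>i. a i \<le> 3) \<Longrightarrow> norm w > 2 + 3 * R \<Longrightarrow> slice \<delta> (Qk a R) w = 0"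
      and "integrable lborel (slice \<delta> (Qt R))" and ir: "integrable lborel (slice \<delta> (Qr R))"
      and "\<And>w. \<bar>slice \<delta> (Qt R) w\<bar> \<le> B" using slice_facts[OF R \<delta>] by blast
    have s\<Psi>0: "smooth \<Psi>0" unfolding \<Psi>0_def by (rule smooth_conv[OF h fst k0])
    have sV: "smooth V" unfolding V_def by (rule smooth_conv[OF h id ik])
    have sZ: "smooth Z" unfolding Z_def by (rule smooth_conv[OF h id corr_integrable[OF R \<delta>]])
    have sZH: "smooth ZH" unfolding ZH_def by (rule smooth_conv[OF hh id corr_integrable[OF R \<delta>]])
    have sEr: "smooth Er" unfolding Er_def by (rule smooth_conv[OF h id ir])
    note [measurable] = smooth_borel_measurable[OF sV] smooth_borel_measurable[OF sZ]
      smooth_borel_measurable[OF sZH] smooth_borel_measurable[OF sEr] test_functions_borel[OF h] test_functions_borel[OF hh]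
    have \<Psi>: "\<Psi> \<in> test_functions ({-1<..<1} \<times> UNIV)"
      unfolding \<Psi>_def \<Psi>0_def by (rule conv_kern_test_function[OF R \<delta> h])
    have lap\<Psi>0: "lap \<Psi>0 = (\<lambda>z. Z z - V z)"
      unfolding \<Psi>0_def Z_def V_def by (rule ext) (rule lap_conv_kern[OF R \<delta> h])
    \<comment> \<open>The restriction to times from -1 on comes from the boundary term in
      \<open>slice_time_identity\<close>; at earlier times \<open>U\<close> is zero.\<close>
    have heatlap: "heat (lap \<Psi>) z = eta z * (ZH z - Er z + I z) + eta' z * (Z z - V z)" if "fst z \<ge> -1" for z
    proof -
      have "lap \<Psi> = (\<lambda>z. eta z * (Z z - V z))"
        unfolding \<Psi>_def lap_eta_mult[OF s\<Psi>0] by (simp only: fun_cong[OF lap\<Psi>0])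
      then have "heat (lap \<Psi>) z = eta z * heat (\<lambda>z. Z z - V z) z + eta' z * (Z z - V z)"
        using fun_cong[OF heat_eta_mult[OF smooth_diff[OF sZ sV]], of z] by (simp only:)
      also have "heat (\<lambda>z. Z z - V z) z = heat Z z - heat V z"
        using fun_cong[OF heat_diff[OF sZ sV], of z] .
      also have "heat Z z = ZH z" unfolding Z_def ZH_def by (rule heat_conv[OF h corr_integrable[OF R \<delta>]])
      also have "heat V z = Er z - I z" unfolding V_def Er_def I_def by (rule heat_conv_slice[OF R \<delta> h that])
      finally show ?thesis by (simp add: algebra_simps)
    qed
    define M where "M = (\<integral>\<^sup>+z. kpot h z * ennreal (?N z + eta z * ?N z ^ 2) \<partial>lborel)"
    define M1 where "M1 = (\<integral>\<^sup>+z. (kpot h z + kpot (heat h) z) * ennreal (?N z) \<partial>lborel)"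
    have M1: "M1 < \<infinity>"
    proof -
      have "M1 = (\<integral>\<^sup>+z. kpot h z * ennreal (?N z) \<partial>lborel) + (\<integral>\<^sup>+z. kpot (heat h) z * ennreal (?N z) \<partial>lborel)"
        unfolding M1_def distrib_right by (rule nn_integral_add) measurable
      moreover have "(\<integral>\<^sup>+z. kpot h z * ennreal (?N z) \<partial>lborel) < \<infinity>"
        by (rule kpot_L6_finite[OF h _ _ U6]) auto
      moreover have "(\<integral>\<^sup>+z. kpot (heat h) z * ennreal (?N z) \<partial>lborel) < \<infinity>"
        by (rule kpot_L6_finite[OF hh _ _ U6]) auto
      ultimately show ?thesis by simp
    qed
    have goal: "ennreal \<bar>\<integral>z. U z $ k * eta z * I z \<partial>lborel\<bar> \<le> ennreal D * M + ennreal (D * r) * M1"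
    \<comment> \<open>\<open>M\<close> contains the square of the field and is not known to be
      finite at this point; if it is infinite, the claim is trivial.\<close>
    proof (cases "M < \<infinity>")
      case False
      then have "M = \<infinity>" by (simp add: not_less top_unique)
      moreover have "D > 0" using C(1) E by (simp add: D_def)
      ultimately show ?thesis by (simp add: ennreal_mult_top)
    next
      case M: True
      define c where "c z = U z $ k * (eta z * (ZH z - Er z) + eta' z * (Z z - V z))" for z
      define f where "f z = U z $ k * heat (lap \<Psi>) z" for z
      have "(\<integral>\<^sup>+z. ennreal \<bar>c z\<bar> \<partial>lborel) \<le> ennreal (C * E) * M + ennreal (2 * C * E * r) * M1"
      proof -
        have "ennreal \<bar>c z\<bar> \<le> ennreal (C * E) * (kpot h z * ennreal (?N z + eta z * ?N z ^ 2))
           + ennreal (2 * C * E * r) * ((kpot h z + kpot (heat h) z) * ennreal (?N z))" for z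
        proof -
          have "\<bar>c z\<bar> \<le> ?N z * (E * (\<bar>ZH z\<bar> + \<bar>Er z\<bar>) + E * (\<bar>Z z\<bar> + \<bar>V z\<bar>))"
          proof -
            have "\<bar>eta z * (ZH z - Er z)\<bar> \<le> E * (\<bar>ZH z\<bar> + \<bar>Er z\<bar>)"
              unfolding abs_mult using eta_le[of z] eta_nonneg[of z] E by (intro mult_mono) (auto simp: E_def)
            moreover have "\<bar>eta' z * (Z z - V z)\<bar> \<le> E * (\<bar>Z z\<bar> + \<bar>V z\<bar>)"
              unfolding abs_mult using eta'_bound[of z] E by (intro mult_mono) (auto simp: E_def)
            ultimately have "\<bar>eta z * (ZH z - Er z) + eta' z * (Z z - V z)\<bar> \<le> E * (\<bar>ZH z\<bar> + \<bar>Er z\<bar>) + E * (\<bar>Z z\<bar> + \<bar>V z\<bar>)"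
              by linarith
            then show ?thesis unfolding c_def abs_mult by (intro mult_mono Unth) auto
          qed
          then have "ennreal \<bar>c z\<bar> \<le> ennreal (?N z * (E * (\<bar>ZH z\<bar> + \<bar>Er z\<bar>) + E * (\<bar>Z z\<bar> + \<bar>V z\<bar>)))"
            by (rule ennreal_leI)
          also have "\<dots> = ennreal (E * ?N z) * (ennreal \<bar>ZH z\<bar> + ennreal \<bar>Er z\<bar> + ennreal \<bar>Z z\<bar> + ennreal \<bar>V z\<bar>)"
          proof -
            have e: "?N z * (E * (\<bar>ZH z\<bar> + \<bar>Er z\<bar>) + E * (\<bar>Z z\<bar> + \<bar>V z\<bar>)) = (E * ?N z) * (\<bar>ZH z\<bar> + \<bar>Er z\<bar> + \<bar>Z z\<bar> + \<bar>V z\<bar>)"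
              by (simp add: algebra_simps)
            show ?thesis unfolding e using E by (simp add: ennreal_mult ennreal_plus)
          qed
          also have "\<dots> \<le> ennreal (E * ?N z) * (ennreal (C * r) * kpot (heat h) z + ennreal (C * r) * kpot h z
              + ennreal (C * r) * kpot h z + ennreal C * kpot h z)"
            unfolding ZH_def Er_def Z_def V_def r_def
            by (intro mult_left_mono add_mono C R \<delta> h hh) auto
          also have "\<dots> \<le> ennreal (E * ?N z) * (ennreal (2 * C * r) * (kpot h z + kpot (heat h) z) + ennreal C * kpot h z)"
          proof (rule mult_left_mono)
            have "ennreal (C * r) * kpot (heat h) z + ennreal (C * r) * kpot h z + ennreal (C * r) * kpot h z
               \<le> ennreal (2 * C * r) * kpot (heat h) z + ennreal (2 * C * r) * kpot h z"
            proof -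
              have "ennreal (2 * C * r) = ennreal (C * r) + ennreal (C * r)"
                using C(1) r by (simp flip: ennreal_plus)
              moreover have "ennreal (C * r) * kpot (heat h) z \<le> ennreal (2 * C * r) * kpot (heat h) z"
                using C(1) r by (intro mult_right_mono ennreal_leI) auto
              ultimately show ?thesis by (simp add: distrib_right add.assoc add_right_mono)
            qed
            then show "ennreal (C * r) * kpot (heat h) z + ennreal (C * r) * kpot h z
              + ennreal (C * r) * kpot h z + ennreal C * kpot h z
              \<le> ennreal (2 * C * r) * (kpot h z + kpot (heat h) z) + ennreal C * kpot h z"
              by (simp add: distrib_left add_ac add_mono)
          qed simp
          also have "\<dots> = ennreal (2 * C * E * r) * ((kpot h z + kpot (heat h) z) * ennreal (?N z))
              + ennreal (C * E) * (kpot h z * ennreal (?N z))"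
            using C(1) E r by (simp add: ennreal_mult distrib_left distrib_right mult_ac)
          also have "\<dots> \<le> ennreal (2 * C * E * r) * ((kpot h z + kpot (heat h) z) * ennreal (?N z))
              + ennreal (C * E) * (kpot h z * ennreal (?N z + eta z * ?N z ^ 2))"
            using eta_nonneg[of z] by (intro add_left_mono mult_left_mono ennreal_leI) auto
          finally show ?thesis by (simp add: add.commute)
        qed
        then have "(\<integral>\<^sup>+z. ennreal \<bar>c z\<bar> \<partial>lborel) \<le> (\<integral>\<^sup>+z. ennreal (C * E) * (kpot h z * ennreal (?N z + eta z * ?N z ^ 2))
           + ennreal (2 * C * E * r) * ((kpot h z + kpot (heat h) z) * ennreal (?N z)) \<partial>lborel)"
          by (rule nn_integral_mono)
        also have "\<dots> = ennreal (C * E) * M + ennreal (2 * C * E * r) * M1"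
          unfolding M_def M1_def by (subst nn_integral_add) (simp_all add: nn_integral_cmult)
        finally show ?thesis .
      qed
      moreover have "ennreal (C * E) * M + ennreal (2 * C * E * r) * M1 < \<infinity>"
        using M M1 by (simp add: ennreal_mult_less_top)
      moreover have "c \<in> borel_measurable lborel" unfolding c_def[abs_def] by measurable
      ultimately have ci: "integrable lborel c"
        and cb: "ennreal \<bar>\<integral>z. c z \<partial>lborel\<bar> \<le> ennreal (C * E) * M + ennreal (2 * C * E * r) * M1"
        using integrable_of_nn_bound[of c lborel] by blast+
      have fi: "integrable lborel f"
      proof -
        have g6: "integrable lborel (\<lambda>z. \<bar>U z $ k\<bar> ^ 6)"
        proof (rule integrableI_bounded)
          have "(\<integral>\<^sup>+z. ennreal (norm (\<bar>U z $ k\<bar> ^ 6)) \<partial>lborel) \<le> (\<integral>\<^sup>+z. ennreal (?N z ^ 6) \<partial>lborel)"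
          proof (intro nn_integral_mono ennreal_leI)
            fix z
            have "\<bar>U z $ k\<bar> ^ 6 \<le> ?N z ^ 6" by (intro power_mono Unth) auto
            then show "norm (\<bar>U z $ k\<bar> ^ 6) \<le> ?N z ^ 6" by simp
          qed
          then show "(\<integral>\<^sup>+z. ennreal (norm (\<bar>U z $ k\<bar> ^ 6)) \<partial>lborel) < \<infinity>" using U6 by (rule order_le_less_trans)
        qed measurable
        have hl: "heat (lap \<Psi>) \<in> test_functions ({-1<..<1} \<times> UNIV)"
          by (intro test_functions_heat test_functions_lap \<Psi>)
        obtain A where A: "A \<ge> 0" "\<And>x. \<bar>heat (lap \<Psi>) x\<bar> \<le> A" using test_functions_bounded[OF hl] by blast
        show ?thesis unfolding f_def[abs_def]
          using L6_times_test_bound(1)[OF Um g6 hl A(2), of 0] by simp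
      qed
      have fb: "ennreal \<bar>\<integral>z. f z \<partial>lborel\<bar> \<le> ennreal (36 * C) * M"
      proof -
        have entry: "ennreal \<bar>\<integral>z. U z $ i * U z $ j * dir_deriv (space_dir j) (leray k i \<Psi>) z \<partial>lborel\<bar> \<le> ennreal (4 * C) * M" for i j
        proof -
          have le: "dir_deriv (space_dir j) (leray k i \<Psi>) z = eta z * dir_deriv (space_dir j) (leray k i \<Psi>0) z" for z
            unfolding \<Psi>_def leray_eta_mult[OF s\<Psi>0] by (simp add: space_deriv_eta_mult[OF smooth_leray[OF s\<Psi>0]])
          have tm [measurable]: "dir_deriv (space_dir j) (leray k i \<Psi>) \<in> borel_measurable borel"
            by (intro test_functions_borel[OF test_functions_dir_deriv[OF test_functions_leray[OF \<Psi>] space_dir_Basis]])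
          have "ennreal \<bar>U z $ i * U z $ j * dir_deriv (space_dir j) (leray k i \<Psi>) z\<bar>
             \<le> ennreal (4 * C) * (kpot h z * ennreal (?N z + eta z * ?N z ^ 2))" for z
          proof -
            have "\<bar>U z $ i * U z $ j * dir_deriv (space_dir j) (leray k i \<Psi>) z\<bar>
               \<le> (eta z * ?N z ^ 2) * \<bar>dir_deriv (space_dir j) (leray k i \<Psi>0) z\<bar>"
            proof -
              have "\<bar>U z $ i\<bar> * \<bar>U z $ j\<bar> \<le> ?N z * ?N z" by (intro mult_mono Unth) auto
              then have "(\<bar>U z $ i\<bar> * \<bar>U z $ j\<bar>) * (eta z * \<bar>dir_deriv (space_dir j) (leray k i \<Psi>0) z\<bar>)
                \<le> (?N z * ?N z) * (eta z * \<bar>dir_deriv (space_dir j) (leray k i \<Psi>0) z\<bar>)"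
                using eta_nonneg[of z] by (intro mult_right_mono) auto
              then show ?thesis unfolding le using eta_nonneg[of z]
                by (simp add: abs_mult power2_eq_square mult_ac)
            qed
            then have "ennreal \<bar>U z $ i * U z $ j * dir_deriv (space_dir j) (leray k i \<Psi>) z\<bar>
               \<le> ennreal (eta z * ?N z ^ 2) * ennreal \<bar>dir_deriv (space_dir j) (leray k i \<Psi>0) z\<bar>"
              using eta_nonneg[of z] by (subst ennreal_mult[symmetric]) (auto intro: ennreal_leI)
            also have "\<dots> \<le> ennreal (?N z + eta z * ?N z ^ 2) * (4 * (ennreal C * kpot h z))"
            proof (intro mult_mono ennreal_leI)
              show "ennreal \<bar>dir_deriv (space_dir j) (leray k i \<Psi>0) z\<bar> \<le> 4 * (ennreal C * kpot h z)"
                by (rule leray_deriv_bound[OF s\<Psi>0]) (unfold \<Psi>0_def, rule C(2)[OF R \<delta> h])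
            qed auto
            also have "\<dots> = ennreal (4 * C) * (kpot h z * ennreal (?N z + eta z * ?N z ^ 2))"
              using C(1) by (simp add: ennreal_mult mult_ac)
            finally show ?thesis .
          qed
          then have "(\<integral>\<^sup>+z. ennreal \<bar>U z $ i * U z $ j * dir_deriv (space_dir j) (leray k i \<Psi>) z\<bar> \<partial>lborel)
            \<le> (\<integral>\<^sup>+z. ennreal (4 * C) * (kpot h z * ennreal (?N z + eta z * ?N z ^ 2)) \<partial>lborel)"
            by (rule nn_integral_mono)
          also have "\<dots> = ennreal (4 * C) * M" unfolding M_def by (rule nn_integral_cmult) measurable
          finally show ?thesis
            using M by (intro integrable_of_nn_bound(2)) (auto simp: ennreal_mult_less_top)
        qed
        have "(\<integral>z. f z \<partial>lborel) = (\<Sum>i\<in>UNIV. \<Sum>j\<in>UNIV. \<integral>z. U z $ i * U z $ j * dir_deriv (space_dir j) (leray k i \<Psi>) z \<partial>lborel)"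
          using NS \<Psi> unfolding weak_NS_def f_def by blast
        then have "ennreal \<bar>\<integral>z. f z \<partial>lborel\<bar> \<le> (\<Sum>i\<in>UNIV. ennreal \<bar>\<Sum>j\<in>UNIV. \<integral>z. U z $ i * U z $ j * dir_deriv (space_dir j) (leray k i \<Psi>) z \<partial>lborel\<bar>)"
          by (simp only: ennreal_abs_sum_le)
        also have "\<dots> \<le> (\<Sum>i\<in>(UNIV::3 set). \<Sum>j\<in>(UNIV::3 set). ennreal (4 * C) * M)"
          by (intro sum_mono order_trans[OF ennreal_abs_sum_le] entry)
        also have "\<dots> = ennreal (36 * C) * M"
        proof -
          have e: "ennreal (36 * C) = ennreal 9 * ennreal (4 * C)"
            using C(1) by (subst ennreal_mult[symmetric]) auto
          show ?thesis unfolding e by (simp flip: mult.assoc)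
        qed
        finally show ?thesis .
      qed
      have "U z $ k * eta z * I z = f z - c z" for z
      proof (cases "fst z \<in> {-1<..<1}")
        case True
        then have hl: "heat (lap \<Psi>) z = eta z * (ZH z - Er z + I z) + eta' z * (Z z - V z)"
          by (intro heatlap) auto
        show ?thesis unfolding f_def c_def hl by (simp add: algebra_simps)
      next
        case False
        then show ?thesis using U0[OF False] by (simp add: f_def c_def)
      qed
      then have "ennreal \<bar>\<integral>z. U z $ k * eta z * I z \<partial>lborel\<bar> = ennreal \<bar>(\<integral>z. f z \<partial>lborel) - (\<integral>z. c z \<partial>lborel)\<bar>"
        using Bochner_Integration.integral_diff[OF fi ci] by simp
      also have "\<dots> \<le> ennreal \<bar>\<integral>z. f z \<partial>lborel\<bar> + ennreal \<bar>\<integral>z. c z \<partial>lborel\<bar>" by (rule ennreal_abs_diff_le)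
      also have "\<dots> \<le> ennreal (36 * C) * M + (ennreal (C * E) * M + ennreal (2 * C * E * r) * M1)"
        by (intro add_mono fb cb)
      also have "\<dots> \<le> ennreal D * M + ennreal (D * r) * M1"
      proof -
        have "36 * C + C * E \<le> D" using mult_left_mono[OF E, of "36 * C"] C(1) by (simp add: D_def)
        then have "ennreal (36 * C + C * E) \<le> ennreal D" by (rule ennreal_leI)
        then have "ennreal (36 * C) + ennreal (C * E) \<le> ennreal D"
          using C(1) E by (subst (asm) ennreal_plus) auto
        then have 1: "ennreal (36 * C) * M + ennreal (C * E) * M \<le> ennreal D * M"
          unfolding distrib_right[symmetric] by (rule mult_right_mono) simp
        have le2: "2 * C * E * r \<le> D * r" unfolding D_def using C(1) E r by (intro mult_right_mono) auto
        have 2: "ennreal (2 * C * E * r) * M1 \<le> ennreal (D * r) * M1"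
          by (rule mult_right_mono[OF ennreal_leI[OF le2]]) simp
        show ?thesis using add_mono[OF 1 2] by (simp add: add.assoc)
      qed
      finally show ?thesis .
    qed
    then show "ennreal \<bar>\<integral>z. U z $ k * eta z * (\<integral>y. h (fst z, snd z + y) * Qk Z0 R \<delta> y \<partial>lborel) \<partial>lborel\<bar>
      \<le> ennreal D * (\<integral>\<^sup>+z. kpot h z * ennreal (norm (U z) + eta z * norm (U z) ^ 2) \<partial>lborel)
        + ennreal (D * R powr (-3/10)) * (\<integral>\<^sup>+z. (kpot h z + kpot (heat h) z) * ennreal (norm (U z)) \<partial>lborel)"
      unfolding I_def M_def M1_def r_def .
  qed
qed

lemma test_inequality:
  obtains C where "C \<ge> 0"
    "\<And>U h k. U \<in> borel_measurable borel \<Longrightarrow> (\<And>z. fst z \<notin> {-1<..<1} \<Longrightarrow> U z = 0) \<Longrightarrow>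
      (\<integral>\<^sup>+z. ennreal (norm (U z) ^ 6) \<partial>lborel) < \<infinity> \<Longrightarrow> weak_NS U \<Longrightarrow>
      h \<in> test_functions ({..<1} \<times> UNIV) \<Longrightarrow>
      ennreal \<bar>\<integral>z. U z $ k * eta z * h z \<partial>lborel\<bar>
      \<le> ennreal C * (\<integral>\<^sup>+z. kpot h z * ennreal (norm (U z) + eta z * norm (U z) ^ 2) \<partial>lborel)"
proof -
  obtain C where C: "C \<ge> 0"
    "\<And>U h k R \<delta>. U \<in> borel_measurable borel \<Longrightarrow> (\<And>z. fst z \<notin> {-1<..<1} \<Longrightarrow> U z = 0) \<Longrightarrow>
      (\<integral>\<^sup>+z. ennreal (norm (U z) ^ 6) \<partial>lborel) < \<infinity> \<Longrightarrow> weak_NS U \<Longrightarrow>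
      h \<in> test_functions ({..<1} \<times> UNIV) \<Longrightarrow> 2 \<le> R \<Longrightarrow> 0 < \<delta> \<Longrightarrow> \<delta> \<le> 1 \<Longrightarrow>
      ennreal \<bar>\<integral>z. U z $ k * eta z * (\<integral>y. h (fst z, snd z + y) * Qk Z0 R \<delta> y \<partial>lborel) \<partial>lborel\<bar>
      \<le> ennreal C * (\<integral>\<^sup>+z. kpot h z * ennreal (norm (U z) + eta z * norm (U z) ^ 2) \<partial>lborel)
        + ennreal (C * R powr (-3/10)) * (\<integral>\<^sup>+z. (kpot h z + kpot (heat h) z) * ennreal (norm (U z)) \<partial>lborel)"
    using mollified_estimate by blast
  show ?thesis
  proof (rule that[of C])
    show "C \<ge> 0" by fact
    fix U :: "real \<times> (real^3) \<Rightarrow> real^3" and h :: "real \<times> (real^3) \<Rightarrow> real" and k :: 3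
    assume U [measurable]: "U \<in> borel_measurable borel" and U0: "\<And>z. fst z \<notin> {-1<..<1} \<Longrightarrow> U z = 0"
      and U6: "(\<integral>\<^sup>+z. ennreal (norm (U z) ^ 6) \<partial>lborel) < \<infinity>" and NS: "weak_NS U"
      and h: "h \<in> test_functions ({..<1} \<times> UNIV)"
    have hh: "heat h \<in> test_functions ({..<1} \<times> UNIV)" by (rule test_functions_heat[OF h])
    note [measurable] = test_functions_borel[OF h] test_functions_borel[OF hh]
    have Um [measurable]: "(\<lambda>z. U z $ k) \<in> borel_measurable borel"
      using measurable_compose[OF U vec_nth_measurable[of k]] by simp
    define M where "M = (\<integral>\<^sup>+z. kpot h z * ennreal (norm (U z) + eta z * norm (U z) ^ 2) \<partial>lborel)"
    define M1 where "M1 = (\<integral>\<^sup>+z. (kpot h z + kpot (heat h) z) * ennreal (norm (U z)) \<partial>lborel)"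
    have M1: "M1 < \<infinity>"
    proof -
      have "M1 = (\<integral>\<^sup>+z. kpot h z * ennreal (norm (U z)) \<partial>lborel) + (\<integral>\<^sup>+z. kpot (heat h) z * ennreal (norm (U z)) \<partial>lborel)"
        unfolding M1_def distrib_right by (rule nn_integral_add) measurable
      moreover have "(\<integral>\<^sup>+z. kpot h z * ennreal (norm (U z)) \<partial>lborel) < \<infinity>"
        by (rule kpot_L6_finite[OF h _ _ U6]) auto
      moreover have "(\<integral>\<^sup>+z. kpot (heat h) z * ennreal (norm (U z)) \<partial>lborel) < \<infinity>"
        by (rule kpot_L6_finite[OF hh _ _ U6]) auto
      ultimately show ?thesis by simp
    qed
    define g where "g z = U z $ k * eta z" for z
    have gm [measurable]: "g \<in> borel_measurable borel" unfolding g_def[abs_def] by measurable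
    have g6: "integrable lborel (\<lambda>z. \<bar>g z\<bar> ^ 6)"
    proof (rule integrableI_bounded)
      have "(\<integral>\<^sup>+z. ennreal (norm (\<bar>g z\<bar> ^ 6)) \<partial>lborel) \<le> (\<integral>\<^sup>+z. ennreal ((2 * exp 4) ^ 6) * ennreal (norm (U z) ^ 6) \<partial>lborel)"
      proof (rule nn_integral_mono)
        fix z
        have "\<bar>g z\<bar> \<le> norm (U z) * (2 * exp 4)"
          unfolding g_def abs_mult using eta_le[of z] eta_nonneg[of z]
          by (intro mult_mono component_le_norm_cart) auto
        then have "\<bar>g z\<bar> ^ 6 \<le> (norm (U z) * (2 * exp 4)) ^ 6" by (intro power_mono) auto
        also have "\<dots> = (2 * exp 4) ^ 6 * norm (U z) ^ 6" by (simp only: power_mult_distrib mult_ac)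
        finally have "norm (\<bar>g z\<bar> ^ 6) \<le> (2 * exp 4) ^ 6 * norm (U z) ^ 6" by simp
        then have "ennreal (norm (\<bar>g z\<bar> ^ 6)) \<le> ennreal ((2 * exp 4) ^ 6 * norm (U z) ^ 6)" by (rule ennreal_leI)
        then show "ennreal (norm (\<bar>g z\<bar> ^ 6)) \<le> ennreal ((2 * exp 4) ^ 6) * ennreal (norm (U z) ^ 6)"
          by (subst (asm) ennreal_mult) auto
      qed
      also have "\<dots> = ennreal ((2 * exp 4) ^ 6) * (\<integral>\<^sup>+z. ennreal (norm (U z) ^ 6) \<partial>lborel)"
        by (rule nn_integral_cmult) measurable
      also have "\<dots> < \<infinity>" using U6 by (simp add: ennreal_mult_less_top)
      finally show "(\<integral>\<^sup>+z. ennreal (norm (\<bar>g z\<bar> ^ 6)) \<partial>lborel) < \<infinity>" .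
    qed measurable
    define a where "a n = (\<integral>z. g z * (\<integral>y. h (fst z, snd z + y) * Qk Z0 (real n + 2) (1 / (real n + 1)) y \<partial>lborel) \<partial>lborel)" for n
    have lim: "a \<longlonglongrightarrow> sqrt (4 * pi) ^ 3 * (\<integral>z. g z * h z \<partial>lborel)"
      unfolding a_def by (rule approximate_identity_limit[OF gm g6 h])
    have an: "ennreal \<bar>a n\<bar> \<le> ennreal C * M + ennreal (C * (real n + 2) powr (-3/10)) * M1" for n
      unfolding a_def g_def M_def M1_def by (rule C(2)[OF U U0 U6 NS h]) (auto simp: divide_le_eq)
    have "ennreal \<bar>\<integral>z. g z * h z \<partial>lborel\<bar> \<le> ennreal C * M"
    proof (cases "ennreal C * M < \<infinity>")
      case False
      then show ?thesis by (simp add: not_less top_unique)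
    next
      case True
      define m where "m = enn2real (ennreal C * M)"
      define m1 where "m1 = enn2real M1"
      have m: "ennreal C * M = ennreal m" "m \<ge> 0" using True by (simp_all add: m_def)
      have m1: "M1 = ennreal m1" "m1 \<ge> 0" using M1 by (simp_all add: m1_def)
      have le: "\<bar>a n\<bar> \<le> m + C * (real n + 2) powr (-3/10) * m1" for n
      proof -
        have "ennreal \<bar>a n\<bar> \<le> ennreal (m + C * (real n + 2) powr (-3/10) * m1)"
          using an[of n] C(1) m(2) m1(2) unfolding m(1) m1(1) by (simp add: ennreal_plus ennreal_mult)
        then show ?thesis using C(1) m(2) m1(2) by (subst (asm) ennreal_le_iff) auto
      qed
      have "(\<lambda>n. (real n + 2) powr (-3/10)) \<longlonglongrightarrow> 0"
      proof (rule tendsto_neg_powr)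
        have "filterlim (\<lambda>n. 2 + real n) at_top sequentially"
          by (rule filterlim_tendsto_add_at_top[OF tendsto_const filterlim_real_sequentially])
        then show "filterlim (\<lambda>n. real n + 2) at_top sequentially" by (simp add: add.commute)
      qed simp
      then have "(\<lambda>n. m + C * (real n + 2) powr (-3/10) * m1) \<longlonglongrightarrow> m + C * 0 * m1"
        by (intro tendsto_intros)
      moreover have "(\<lambda>n. \<bar>a n\<bar>) \<longlonglongrightarrow> \<bar>sqrt (4 * pi) ^ 3 * (\<integral>z. g z * h z \<partial>lborel)\<bar>"
        by (intro tendsto_intros lim)
      ultimately have "\<bar>sqrt (4 * pi) ^ 3 * (\<integral>z. g z * h z \<partial>lborel)\<bar> \<le> m + C * 0 * m1"
        using le by (intro LIMSEQ_le[of "\<lambda>n. \<bar>a n\<bar>" _ "\<lambda>n. m + C * (real n + 2) powr (-3/10) * m1"]) auto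
      moreover have "sqrt (4 * pi) ^ 3 \<ge> 1"
      proof (rule one_le_power)
        have "4 * pi \<ge> 1" using pi_ge_two by linarith
        then show "1 \<le> sqrt (4 * pi)" by simp
      qed
      then have "1 * \<bar>\<integral>z. g z * h z \<partial>lborel\<bar> \<le> sqrt (4 * pi) ^ 3 * \<bar>\<integral>z. g z * h z \<partial>lborel\<bar>"
        by (intro mult_right_mono) auto
      ultimately have "\<bar>\<integral>z. g z * h z \<partial>lborel\<bar> \<le> m" by (simp add: abs_mult)
      then show ?thesis unfolding m(1) by (rule ennreal_leI)
    qed
    then show "ennreal \<bar>\<integral>z. U z $ k * eta z * h z \<partial>lborel\<bar>
      \<le> ennreal C * (\<integral>\<^sup>+z. kpot h z * ennreal (norm (U z) + eta z * norm (U z) ^ 2) \<partial>lborel)"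
      unfolding g_def M_def .
  qed
qed

text \<open>The approximations \<open>1 - (1 - b)\<^sup>n\<close> of the indicator of a box increase to the indicator.\<close>

lemma open_approx_test_functions:
  fixes W :: "'a::euclidean_space set"
  assumes W: "open W" "bounded W" "closure W \<subseteq> \<Omega>"
  obtains h where "\<And>n. h n \<in> test_functions \<Omega>" "\<And>n z. 0 \<le> h n z" "\<And>n z. h n z \<le> indicator W z"
    "\<And>z. (\<lambda>n. h n z) \<longlonglongrightarrow> indicator W z"
proof -
  obtain D where D: "countable D" "D \<subseteq> Pow W" "\<And>X. X \<in> D \<Longrightarrow> \<exists>a b. X = box a b" "\<Union>D = W"
    using open_countable_Union_open_box[OF W(1)] by metis
  \<comment> \<open>\<open>from_nat_into\<close> enumerates nonempty sets only; the added box is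
    empty, so the union does not change.\<close>
  define D' where "D' = insert (box 0 (0::'a)) D"
  have D': "countable D'" "D' \<noteq> {}" "\<Union>D' = W"
    using D by (auto simp: D'_def)
  have D'_box: "\<exists>a b. X = box a b" if "X \<in> D'" for X using that D(3) unfolding D'_def by blast
  have r: "from_nat_into D' i \<in> D'" for i by (rule from_nat_into[OF D'(2)])
  then have "\<forall>i. \<exists>p. from_nat_into D' i = box (fst p) (snd p)" using D'_box by fastforce
  from choice[OF this] obtain p where p: "\<And>i. from_nat_into D' i = box (fst (p i)) (snd (p i))" by blast
  define b where "b i = bump (fst (p i)) (snd (p i))" for i
  have U: "(\<Union>i. box (fst (p i)) (snd (p i))) = W"
    unfolding p[symmetric] using range_from_nat_into[OF D'(2,1)] D'(3) by auto
  have b: "0 \<le> 1 - b i z" "1 - b i z \<le> 1" for i z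
    using bump_bounds[of "fst (p i)" "snd (p i)" z] by (auto simp: b_def)
  \<comment> \<open>The number of boxes and the power grow together: inside box \<open>j\<close> the
    factor \<open>(1 - b j z) ^ n\<close> occurs as soon as \<open>n > j\<close> and alone forces
    the product to 0.\<close>
  define h where "h n z = 1 - (\<Prod>i<n. (1 - b i z) ^ n)" for n z
  have le1: "(1 - b i z) ^ n \<le> 1" for i n z using b by (intro power_le_one)
  have h01: "0 \<le> h n z" "h n z \<le> 1" for n z
  proof -
    have "(\<Prod>i<n. (1 - b i z) ^ n) \<le> 1" using b le1 by (intro prod_le_1) auto
    then show "0 \<le> h n z" by (simp add: h_def)
    have "0 \<le> (\<Prod>i<n. (1 - b i z) ^ n)" using b by (intro prod_nonneg) auto
    then show "h n z \<le> 1" by (simp add: h_def)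
  qed
  have out: "h n z = 0" if "z \<notin> W" for n z
  proof -
    have "b i z = 0" for i using that U bump_nz_iff[of "fst (p i)" "snd (p i)" z] by (auto simp: b_def)
    then show ?thesis by (simp add: h_def)
  qed
  show ?thesis
  proof (rule that[of h])
    fix n z
    show "h n \<in> test_functions \<Omega>"
    proof (rule test_functionsI[where K = "closure W"])
      show "smooth (h n)" unfolding h_def[abs_def] b_def
        by (intro smooth_diff smooth_const smooth_prod smooth_power smooth_bump)
      show "compact (closure W)" using W(2) by simp
      show "h n x = 0" if "x \<notin> closure W" for x using that closure_subset[of W] by (intro out) auto
    qed fact
    show "0 \<le> h n z" by (rule h01)
    show "h n z \<le> indicator W z" using h01(2)[of n z] out[of z n] by (cases "z \<in> W") auto
    show "(\<lambda>n. h n z) \<longlonglongrightarrow> indicator W z"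
    proof (cases "z \<in> W")
      case False
      then show ?thesis by (simp add: out)
    next
      case True
      then obtain j where j: "z \<in> box (fst (p j)) (snd (p j))" using U by auto
      have bj: "\<bar>1 - b j z\<bar> < 1"
        using bump_bounds[of "fst (p j)" "snd (p j)" z] bump_nz_iff[of "fst (p j)" "snd (p j)" z] j
        by (auto simp: b_def)
      have "(\<lambda>n. \<Prod>i<n. (1 - b i z) ^ n) \<longlonglongrightarrow> 0"
      proof (rule tendsto_sandwich[of "\<lambda>_. 0" _ _ "\<lambda>n. (1 - b j z) ^ n"])
        show "\<forall>\<^sub>F n in sequentially. (0::real) \<le> (\<Prod>i<n. (1 - b i z) ^ n)"
          using b by (intro always_eventually allI prod_nonneg) auto
        show "\<forall>\<^sub>F n in sequentially. (\<Prod>i<n. (1 - b i z) ^ n) \<le> (1 - b j z) ^ n"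
        proof (rule eventually_sequentiallyI[of "Suc j"])
          fix n assume "Suc j \<le> n"
          then have "(\<Prod>i<n. (1 - b i z) ^ n) = (1 - b j z) ^ n * (\<Prod>i\<in>{..<n} - {j}. (1 - b i z) ^ n)"
            by (intro prod.remove) auto
          also have "\<dots> \<le> (1 - b j z) ^ n * 1"
            using b le1 by (intro mult_left_mono prod_le_1) auto
          finally show "(\<Prod>i<n. (1 - b i z) ^ n) \<le> (1 - b j z) ^ n" by simp
        qed
        show "(\<lambda>n. (1 - b j z) ^ n) \<longlonglongrightarrow> 0" by (rule LIMSEQ_power_zero) (use bj in simp)
      qed simp
      then have "(\<lambda>n. 1 - (\<Prod>i<n. (1 - b i z) ^ n)) \<longlonglongrightarrow> 1 - 0" by (intro tendsto_intros)
      then show ?thesis using True by (simp add: h_def)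
    qed
  qed
qed

text \<open>By outer regularity it suffices to compare the two densities on open sets, and open sets are tested by
  smooth functions.\<close>

lemma AE_le_of_test_functions:
  fixes f :: "'a::euclidean_space \<Rightarrow> real" and g :: "'a \<Rightarrow> ennreal"
  assumes [measurable]: "f \<in> borel_measurable borel" "g \<in> borel_measurable borel"
    and V: "open V" "bounded V" "closure V \<subseteq> \<Omega>"
    and fV: "set_integrable lborel V f" and gV: "(\<integral>\<^sup>+z\<in>V. g z \<partial>lborel) < \<infinity>"
    and test: "\<And>h. h \<in> test_functions \<Omega> \<Longrightarrow> (\<And>z. 0 \<le> h z) \<Longrightarrow> 
      ennreal (\<integral>z. f z * h z \<partial>lborel) \<le> (\<integral>\<^sup>+z. ennreal (h z) * g z \<partial>lborel)"
  shows "AE z in lborel. z \<in> V \<longrightarrow> ennreal (f z) \<le> g z"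
proof -
  have Vm [measurable]: "V \<in> sets borel" using V(1) by simp
  \<comment> \<open>The negative part of \<open>f\<close> is moved to the side of \<open>g\<close>,
    so that two measures with nonnegative densities are compared; the restriction to
    \<open>V\<close> makes them finite.\<close>
  define p where "p z = ennreal (f z) * indicator V z" for z
  define q where "q z = (ennreal (- f z) + g z) * indicator V z" for z
  have [measurable]: "p \<in> borel_measurable borel" "q \<in> borel_measurable borel"
    unfolding p_def[abs_def] q_def[abs_def] by measurable
  have fi: "(\<integral>\<^sup>+z. ennreal (norm (indicator V z * f z)) \<partial>lborel) < \<infinity>"
    using fV unfolding set_integrable_def by (simp add: integrable_iff_bounded)
  have fin: "(\<integral>\<^sup>+z. ennreal (s * f z) * indicator V z \<partial>lborel) < \<infinity>" if "\<bar>s\<bar> = 1" for s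
  proof -
    have "(\<integral>\<^sup>+z. ennreal (s * f z) * indicator V z \<partial>lborel) \<le> (\<integral>\<^sup>+z. ennreal (norm (indicator V z * f z)) \<partial>lborel)"
    proof (rule nn_integral_mono)
      fix z
      have "s * f z \<le> \<bar>f z\<bar>" using that abs_ge_self[of "s * f z"] by (simp add: abs_mult)
      then show "ennreal (s * f z) * indicator V z \<le> ennreal (norm (indicator V z * f z))"
        by (cases "z \<in> V") (auto intro: ennreal_leI)
    qed
    then show ?thesis using fi by (rule order_le_less_trans)
  qed
  have p_fin: "(\<integral>\<^sup>+z. p z \<partial>lborel) < \<infinity>" using fin[of 1] by (simp add: p_def)
  have q_fin: "(\<integral>\<^sup>+z. q z \<partial>lborel) < \<infinity>"
    using fin[of "-1"] gV by (simp add: q_def distrib_right nn_integral_add)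
  have open_le: "(\<integral>\<^sup>+z. p z * indicator W z \<partial>lborel) \<le> (\<integral>\<^sup>+z. q z * indicator W z \<partial>lborel)" if W0: "open W0" "W = W0 \<inter> V" for W W0
  proof -
    have W: "open W" "bounded W" "closure W \<subseteq> \<Omega>" "W \<subseteq> V"
      using that V closure_mono[of W V] by (auto intro: bounded_subset)
    note [measurable] = borel_open[OF W(1)]
    obtain h where h: "\<And>n. h n \<in> test_functions \<Omega>" "\<And>n z. 0 \<le> h n z" "\<And>n z. h n z \<le> indicator W z"
      "\<And>z. (\<lambda>n. h n z) \<longlonglongrightarrow> indicator W z"
      using open_approx_test_functions[OF W(1-3)] by blast
    note [measurable] = test_functions_borel[OF h(1)]
    have hV: "h n z = 0" if "z \<notin> V" for n z
    proof -
      have "z \<notin> W" using that W(4) by blast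
      then show ?thesis using h(2,3)[of n z] by simp
    qed
    have h1: "h n z \<le> 1" for n z using h(3)[of n z] by (cases "z \<in> W") auto
    have lim: "(\<lambda>n. \<integral>\<^sup>+z. ennreal (h n z) * r z \<partial>lborel) \<longlonglongrightarrow> (\<integral>\<^sup>+z. r z * indicator W z \<partial>lborel)"
      if [measurable]: "r \<in> borel_measurable borel" and r: "(\<integral>\<^sup>+z. r z \<partial>lborel) < \<infinity>" for r
    proof (rule nn_integral_dominated_convergence[where w = r])
      have "AE z in lborel. r z \<noteq> \<infinity>" by (rule nn_integral_PInf_AE) (use r in auto)
      then show "AE z in lborel. (\<lambda>n. ennreal (h n z) * r z) \<longlonglongrightarrow> r z * indicator W z"
      proof eventually_elim
        case (elim z)
        have "(\<lambda>n. ennreal (h n z)) \<longlonglongrightarrow> ennreal (indicator W z)" by (intro tendsto_ennrealI h(4))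
        then have "(\<lambda>n. r z * ennreal (h n z)) \<longlonglongrightarrow> r z * ennreal (indicator W z)"
          using elim by (intro ennreal_tendsto_cmult) (auto simp: less_top)
        then show ?case by (simp add: mult.commute ennreal_indicator)
      qed
      show "AE z in lborel. ennreal (h n z) * r z \<le> r z" for n
      proof (rule AE_I2)
        fix z
        have "ennreal (h n z) * r z \<le> 1 * r z" using h1[of n z] by (intro mult_right_mono) (auto simp: ennreal_le_1)
        then show "ennreal (h n z) * r z \<le> r z" by simp
      qed
    qed (use r in \<open>auto\<close>)
    have "(\<integral>\<^sup>+z. ennreal (h n z) * p z \<partial>lborel) \<le> (\<integral>\<^sup>+z. ennreal (h n z) * q z \<partial>lborel)" for n
    proof -
      define P where "P = (\<integral>\<^sup>+z. ennreal (f z * h n z) \<partial>lborel)"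
      define N where "N = (\<integral>\<^sup>+z. ennreal (- (f z * h n z)) \<partial>lborel)"
      have ep: "ennreal (h n z) * p z = ennreal (f z * h n z)" for z
        using h(2)[of n z] hV[of z n] by (cases "z \<in> V") (auto simp: p_def ennreal_mult'' mult.commute)
      have eq: "ennreal (h n z) * q z = ennreal (- (f z * h n z)) + ennreal (h n z) * g z" for z
      proof (cases "z \<in> V")
        case True
        have "ennreal (- (f z * h n z)) = ennreal (h n z) * ennreal (- f z)"
          using ennreal_mult''[OF h(2)[of n z], of "- f z"] by (simp add: mult.commute)
        then show ?thesis using True by (simp add: q_def distrib_left)
      qed (simp add: q_def hV)
      have int: "integrable lborel (\<lambda>z. f z * h n z)"
      proof (rule Bochner_Integration.integrable_bound[OF fV[unfolded set_integrable_def]])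
        show "AE z in lborel. norm (f z * h n z) \<le> norm (indicator V z *\<^sub>R f z)"
        proof (rule AE_I2)
          fix z
          show "norm (f z * h n z) \<le> norm (indicator V z *\<^sub>R f z)"
            using h(2)[of n z] h1[of n z] hV[of z n] by (cases "z \<in> V") (auto simp: abs_mult mult_left_le)
        qed
      qed measurable
      have PN: "P < \<infinity>" "N < \<infinity>"
        using int unfolding P_def N_def real_integrable_def by (auto simp: less_top)
      have "P \<le> N + (\<integral>\<^sup>+z. ennreal (h n z) * g z \<partial>lborel)"
      proof -
        have I: "(\<integral>z. f z * h n z \<partial>lborel) = enn2real P - enn2real N"
          unfolding P_def N_def by (rule real_lebesgue_integral_def[OF int])
        have "enn2real P \<le> enn2real N + max 0 (\<integral>z. f z * h n z \<partial>lborel)" unfolding I by simp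
        then have "ennreal (enn2real P) \<le> ennreal (enn2real N + max 0 (\<integral>z. f z * h n z \<partial>lborel))" by (rule ennreal_leI)
        also have "\<dots> = ennreal (enn2real N) + ennreal (max 0 (\<integral>z. f z * h n z \<partial>lborel))" by (simp add: ennreal_plus)
        also have "ennreal (max 0 (\<integral>z. f z * h n z \<partial>lborel)) = ennreal (\<integral>z. f z * h n z \<partial>lborel)"
          by (simp add: max_def ennreal_neg)
        also have "\<dots> \<le> (\<integral>\<^sup>+z. ennreal (h n z) * g z \<partial>lborel)" by (rule test[OF h(1,2)])
        finally show ?thesis using PN by (simp add: add_left_mono)
      qed
      then show ?thesis unfolding ep eq P_def N_def by (subst nn_integral_add) auto
    qed
    then show ?thesis
      by (intro LIMSEQ_le[OF lim[OF _ p_fin] lim[OF _ q_fin]]) auto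
  qed
  define \<mu> where "\<mu> = density lborel p"
  define \<nu> where "\<nu> = density lborel q"
  have em: "emeasure \<mu> A = (\<integral>\<^sup>+z. p z * indicator A z \<partial>lborel)" "emeasure \<nu> A = (\<integral>\<^sup>+z. q z * indicator A z \<partial>lborel)"
    if "A \<in> sets borel" for A
    using that by (simp_all add: \<mu>_def \<nu>_def emeasure_density)
  have le: "emeasure \<mu> A \<le> emeasure \<nu> A" if A: "A \<in> sets borel" for A
  proof -
    have "emeasure \<nu> A = (INF W \<in> {W. A \<subseteq> W \<and> open W}. emeasure \<nu> W)"
      using A q_fin by (intro outer_regular) (auto simp: \<nu>_def emeasure_density)
    also have "emeasure \<mu> A \<le> \<dots>"
    proof (rule INF_greatest)
      fix W assume "W \<in> {W. A \<subseteq> W \<and> open W}"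
      then have W: "A \<subseteq> W" "open W" by auto
      note [measurable] = borel_open[OF W(2)] A
      have pV: "p z * indicator (W \<inter> V) z = p z * indicator W z" "q z * indicator (W \<inter> V) z = q z * indicator W z" for z
        by (auto simp: p_def q_def indicator_def)
      have "emeasure \<mu> A \<le> emeasure \<mu> W"
        unfolding em[OF A] em[OF borel_open[OF W(2)]]
        by (intro nn_integral_mono mult_left_mono) (use W(1) in \<open>auto simp: indicator_def\<close>)
      also have "\<dots> \<le> emeasure \<nu> W"
        unfolding em[OF borel_open[OF W(2)]] using open_le[OF W(2) refl] unfolding pV .
      finally show "emeasure \<mu> A \<le> emeasure \<nu> W" .
    qed
    finally show ?thesis .
  qed
  \<comment> \<open>Here the densities are ordered one way and the measures the other. The measure
    with density \<open>q\<close> is finite, so the difference of densities integrates to zero over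
    this set and the set is null.\<close>
  define A where "A = {z. q z < p z}"
  have A [measurable]: "A \<in> sets borel" unfolding A_def by measurable
  have "AE z in lborel. q z * indicator A z = p z * indicator A z"
  proof -
    have fq: "(\<integral>\<^sup>+z. q z * indicator A z \<partial>lborel) \<noteq> \<infinity>"
    proof -
      have "(\<integral>\<^sup>+z. q z * indicator A z \<partial>lborel) \<le> (\<integral>\<^sup>+z. q z \<partial>lborel)"
        by (intro nn_integral_mono) (auto simp: indicator_def)
      then show ?thesis using q_fin by (auto simp: top_unique)
    qed
    have mono: "AE z in lborel. q z * indicator A z \<le> p z * indicator A z"
      by (rule AE_I2) (auto simp: A_def indicator_def)
    have "(\<integral>\<^sup>+z. p z * indicator A z \<partial>lborel) \<le> (\<integral>\<^sup>+z. q z * indicator A z \<partial>lborel)"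
      using le[OF A] unfolding em[OF A] .
    then have "(\<integral>\<^sup>+z. p z * indicator A z - q z * indicator A z \<partial>lborel) = 0"
      using fq mono by (subst nn_integral_diff) (auto simp: diff_eq_0_ennreal less_top top_unique)
    then have "AE z in lborel. p z * indicator A z - q z * indicator A z = 0"
      by (subst (asm) nn_integral_0_iff_AE) auto
    then show ?thesis using mono
      by eventually_elim (auto dest!: ennreal_minus_eq_0 intro: antisym)
  qed
  then show ?thesis
  proof eventually_elim
    case (elim z)
    then have pq: "p z \<le> q z" by (cases "z \<in> A") (auto simp: A_def)
    show ?case
    proof
      assume z: "z \<in> V"
      show "ennreal (f z) \<le> g z"
      proof (cases "f z \<ge> 0")
        case True
        then show ?thesis using pq z by (simp add: p_def q_def ennreal_neg)
      next
        case False
        then show ?thesis by (simp add: ennreal_neg)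
      qed
    qed
  qed
qed

section \<open>Contraction\<close>

text \<open>Serves to make the quadratic potential locally integrable: after integration in
  \<open>w\<close> the first two terms are bounded uniformly in the base point, and the last is a
  convolution of two integrable functions. With \<open>a = ker w powr (1/5)\<close> the idea is
  \<open>a ^ 5 \<le> a ^ 6 + a ^ 4\<close>, followed by a comparison of \<open>a\<close> with
  \<open>x\<close>.\<close>

lemma ker_square_split:
  assumes "0 \<le> x"
  shows "ker w * x\<^sup>2 \<le> 2 * ker w powr (6/5) + x ^ 6 + ker w powr (6/5) * x ^ 6"
proof -
  define a where "a = ker w powr (1/5)"
  have k: "ker w \<ge> 0" by (rule ker_nonneg)
  have a: "a \<ge> 0" by (simp add: a_def)
  have p: "ker w powr (n / 5) = a ^ n" if "n > 0" for n :: nat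
    using that k by (cases "ker w = 0") (simp_all add: a_def powr_powr flip: powr_realpow)
  have k5: "ker w = a ^ 5" using p[of 5] k by simp
  have k6: "ker w powr (6/5) = a ^ 6" using p[of 6] by simp
  have x2: "x\<^sup>2 \<le> 1 + x ^ 6" by (rule power_le_one_plus_power) (use assms in auto)
  have "a ^ 5 * x\<^sup>2 \<le> a ^ 6 * x\<^sup>2 + a ^ 4 * x\<^sup>2"
  proof -
    have "a ^ 5 \<le> a ^ 6 + a ^ 4"
    proof -
      have "0 \<le> a ^ 4 * ((a - 1/2)\<^sup>2 + 3/4)" by simp
      also have "\<dots> = a ^ 6 + a ^ 4 - a ^ 5" by (simp add: algebra_simps power_numeral_reduce power2_eq_square)
      finally show ?thesis by simp
    qed
    from mult_right_mono[OF this, of "x\<^sup>2"] show ?thesis by (simp add: algebra_simps)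
  qed
  moreover have "a ^ 6 * x\<^sup>2 \<le> a ^ 6 * (1 + x ^ 6)" using a by (intro mult_left_mono x2) auto
  moreover have "a ^ 4 * x\<^sup>2 \<le> a ^ 6 + x ^ 6"
  proof (cases "a \<le> x")
    case True
    then have "a ^ 4 * x\<^sup>2 \<le> x ^ 4 * x\<^sup>2" using a by (intro mult_right_mono power_mono) auto
    also have "\<dots> = x ^ 6" by (simp flip: power_add)
    finally show ?thesis using a by (simp add: add_increasing)
  next
    case False
    then have "a ^ 4 * x\<^sup>2 \<le> a ^ 4 * a\<^sup>2" using assms by (intro mult_left_mono power_mono) auto
    also have "\<dots> = a ^ 6" by (simp flip: power_add)
    finally show ?thesis using assms by (simp add: add_increasing2)
  qed
  ultimately show ?thesis unfolding k6 by (subst k5) (simp add: algebra_simps)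
qed

text \<open>For the \<open>4/5\<close>-th power the same exponents are available because \<open>4/5 = 2/3 * 6/5\<close>.\<close>

lemma ker_four_fifths_Young:
  assumes \<mu>: "\<mu> > 0" and x: "0 \<le> x"
  shows "ker w powr (4/5) * x\<^sup>2 \<le> \<mu> ^ 3 * ker w powr (6/5) + (1 / \<mu>) ^ 6 * x ^ 6"
proof -
  define a where "a = ker w powr (2/5)"
  define c where "c = sqrt \<mu>"
  have c: "c > 0" "\<mu> = c\<^sup>2" using \<mu> by (simp_all add: c_def)
  have a: "a \<ge> 0" by (simp add: a_def)
  have k4: "ker w powr (4/5) = a\<^sup>2" and k6: "ker w powr (6/5) = a ^ 3"
    using ker_nonneg[of w] by (cases "ker w = 0"; simp add: a_def powr_powr flip: powr_realpow)+
  \<comment> \<open>The scaling is chosen so that \<mu> cancels in \<open>b\<^sup>2 * y\<close> and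
    reappears as \<open>\<mu> ^ 3\<close> and \<open>(1 / \<mu>) ^ 6\<close> in the two
    cubes.\<close>
  define b y where "b = \<mu> * a" and "y = (x / \<mu>)\<^sup>2"
  have b: "b \<ge> 0" "y \<ge> 0" using a \<mu> by (auto simp: b_def y_def)
  have "b\<^sup>2 * y \<le> b ^ 3 + y ^ 3"
  proof (cases "b \<le> y")
    case True
    then have "b\<^sup>2 * y \<le> y\<^sup>2 * y" using b by (intro mult_right_mono power_mono) auto
    then show ?thesis using b by (simp add: power2_eq_square power3_eq_cube add_increasing)
  next
    case False
    then have "b\<^sup>2 * y \<le> b\<^sup>2 * b" using b by (intro mult_left_mono) auto
    then show ?thesis using b by (simp add: power2_eq_square power3_eq_cube add_increasing2)
  qed
  moreover have "b\<^sup>2 * y = a\<^sup>2 * x\<^sup>2" using \<mu> by (simp add: b_def y_def power_divide power_mult_distrib)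
  moreover have "b ^ 3 = \<mu> ^ 3 * a ^ 3" by (simp add: b_def power_mult_distrib)
  moreover have "y ^ 3 = (1 / \<mu>) ^ 6 * x ^ 6" by (simp add: y_def power_divide flip: power_mult)
  ultimately show ?thesis unfolding k4 k6 by simp
qed

text \<open>By \<open>kpot_swap\<close> the right side of \<open>test_inequality\<close> is the test
  function integrated against a fixed density, and \<open>AE_le_of_test_functions\<close> removes
  the test function, for each component and each sign. The 3 in the constant adds up the components;
  the 1 ensures \<open>D \<ge> 1\<close>.\<close>

lemma pointwise_inequality:
  obtains D where "D \<ge> 1"
    "\<And>U. U \<in> borel_measurable borel \<Longrightarrow> (\<And>z. fst z \<notin> {-1<..<1} \<Longrightarrow> U z = 0) \<Longrightarrow>
      (\<integral>\<^sup>+z. ennreal (norm (U z) ^ 6) \<partial>lborel) < \<infinity> \<Longrightarrow> weak_NS U \<Longrightarrow>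
      AE z in lborel. ennreal (eta z * norm (U z)) \<le>
        ennreal D * (\<integral>\<^sup>+w. ennreal (ker w) * ennreal (norm (U (z - w)) + eta (z - w) * norm (U (z - w)) ^ 2) \<partial>lborel)"
proof -
  obtain C where C: "C \<ge> 0"
    "\<And>U h k. U \<in> borel_measurable borel \<Longrightarrow> (\<And>z. fst z \<notin> {-1<..<1} \<Longrightarrow> U z = 0) \<Longrightarrow>
      (\<integral>\<^sup>+z. ennreal (norm (U z) ^ 6) \<partial>lborel) < \<infinity> \<Longrightarrow> weak_NS U \<Longrightarrow>
      h \<in> test_functions ({..<1} \<times> UNIV) \<Longrightarrow>
      ennreal \<bar>\<integral>z. U z $ k * eta z * h z \<partial>lborel\<bar>
      \<le> ennreal C * (\<integral>\<^sup>+z. kpot h z * ennreal (norm (U z) + eta z * norm (U z) ^ 2) \<partial>lborel)"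
    using test_inequality by blast
  show ?thesis
  proof (rule that[of "3 * C + 1"])
    show "3 * C + 1 \<ge> 1" using C(1) by simp
    fix U :: "real \<times> (real^3) \<Rightarrow> real^3"
    assume U [measurable]: "U \<in> borel_measurable borel" and U0: "\<And>z. fst z \<notin> {-1<..<1} \<Longrightarrow> U z = 0"
      and U6: "(\<integral>\<^sup>+z. ennreal (norm (U z) ^ 6) \<partial>lborel) < \<infinity>" and NS: "weak_NS U"
    let ?N = "\<lambda>z. norm (U z)"
    have Um [measurable]: "(\<lambda>z. U z $ i) \<in> borel_measurable borel" for i
      using measurable_compose[OF U vec_nth_measurable[of i]] by simp
    define P where "P z = (\<integral>\<^sup>+w. ennreal (ker w) * ennreal (?N (z - w) + eta (z - w) * ?N (z - w) ^ 2) \<partial>lborel)" for z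
    have Pm [measurable]: "P \<in> borel_measurable borel" unfolding P_def[abs_def] by measurable
    \<comment> \<open>These bounded open sets exhaust the times before 1, and their closures stay in
      the open half space in which test functions are allowed to be supported.\<close>
    define V where "V m = {..<1 - 1 / (real m + 1)} \<times> UNIV \<inter> ball (0 :: real \<times> (real^3)) (real m + 1)" for m
    have V: "open (V m)" "bounded (V m)" "closure (V m) \<subseteq> {..<1} \<times> UNIV" for m
    proof -
      show "open (V m)" unfolding V_def by (intro open_Int open_Times) auto
      show "bounded (V m)" unfolding V_def by (rule bounded_subset[OF bounded_ball]) auto
      have "closure (V m) \<subseteq> {..1 - 1 / (real m + 1)} \<times> UNIV"
        unfolding V_def by (intro closure_minimal closed_Times) auto
      also have "\<dots> \<subseteq> {..<1} \<times> UNIV" by (auto simp: less_le_trans intro: le_less_trans)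
      finally show "closure (V m) \<subseteq> {..<1} \<times> UNIV" .
    qed
    have Vm [measurable]: "V m \<in> sets borel" for m using V(1) by simp
    have Vfin: "emeasure lborel (V m) < \<infinity>" for m
      by (rule emeasure_bounded_finite[OF V(2)])
    have P_fin: "(\<integral>\<^sup>+z\<in>V m. P z \<partial>lborel) < \<infinity>" for m
    proof -
      define K where "K = (\<integral>\<^sup>+w. ennreal (ker w powr (6/5)) \<partial>lborel)"
      define L where "L = (\<integral>\<^sup>+z. ennreal (?N z ^ 6) \<partial>lborel)"
      define Q where "Q z = (\<integral>\<^sup>+w. ennreal (ker w powr (6/5)) * ennreal (?N (z - w) ^ 6) \<partial>lborel)" for z
      define A where "A = (K + L) + ennreal (2 * exp 4) * (2 * K + L)"
      have KL: "K < \<infinity>" "L < \<infinity>" using nn_integral_ker_finite U6 by (auto simp: K_def L_def)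
      have [measurable]: "Q \<in> borel_measurable borel" unfolding Q_def[abs_def] by measurable
      have refl6: "(\<integral>\<^sup>+w. ennreal (?N (z - w) ^ 6) \<partial>lborel) = L" for z
        unfolding L_def by (rule nn_integral_reflect[of "\<lambda>z. ennreal (?N z ^ 6)"]) measurable
      have PQ: "P z \<le> A + ennreal (2 * exp 4) * Q z" for z
      proof -
        have "P z \<le> (\<integral>\<^sup>+w. (ennreal (ker w powr (6/5)) + ennreal (?N (z - w) ^ 6)) + ennreal (2 * exp 4) *
            (2 * ennreal (ker w powr (6/5)) + ennreal (?N (z - w) ^ 6) + ennreal (ker w powr (6/5)) * ennreal (?N (z - w) ^ 6)) \<partial>lborel)"
          unfolding P_def
        proof (rule nn_integral_mono)
          fix w
          let ?x = "?N (z - w)"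
          have 1: "ker w * ?x \<le> ker w powr (6/5) + ?x ^ 6" by (rule Young_6_5) (auto simp: ker_nonneg)
          have "ker w * (eta (z - w) * ?x\<^sup>2) = eta (z - w) * (ker w * ?x\<^sup>2)" by simp
          also have "\<dots> \<le> (2 * exp 4) * (2 * ker w powr (6/5) + ?x ^ 6 + ker w powr (6/5) * ?x ^ 6)"
            using eta_le[of "z - w"] eta_nonneg[of "z - w"] ker_nonneg[of w]
            by (intro mult_mono ker_square_split) auto
          finally have "ker w * (?x + eta (z - w) * ?x\<^sup>2)
            \<le> (ker w powr (6/5) + ?x ^ 6) + (2 * exp 4) * (2 * ker w powr (6/5) + ?x ^ 6 + ker w powr (6/5) * ?x ^ 6)"
            using 1 by (simp add: distrib_left)
          then have "ennreal (ker w * (?x + eta (z - w) * ?x\<^sup>2))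
            \<le> ennreal ((ker w powr (6/5) + ?x ^ 6) + (2 * exp 4) * (2 * ker w powr (6/5) + ?x ^ 6 + ker w powr (6/5) * ?x ^ 6))"
            by (rule ennreal_leI)
          also have "\<dots> = (ennreal (ker w powr (6/5)) + ennreal (?x ^ 6)) + ennreal (2 * exp 4) *
            (2 * ennreal (ker w powr (6/5)) + ennreal (?x ^ 6) + ennreal (ker w powr (6/5)) * ennreal (?x ^ 6))"
          proof -
            define \<alpha> \<beta> \<gamma> :: real where "\<alpha> = ker w powr (6/5)" and "\<beta> = ?x ^ 6" and "\<gamma> = 2 * exp 4"
            have nn: "\<alpha> \<ge> 0" "\<beta> \<ge> 0" "\<gamma> \<ge> 0" by (auto simp: \<alpha>_def \<beta>_def \<gamma>_def)
            have "ennreal ((\<alpha> + \<beta>) + \<gamma> * (2 * \<alpha> + \<beta> + \<alpha> * \<beta>)) = ennreal (\<alpha> + \<beta>) + ennreal \<gamma> * ennreal (2 * \<alpha> + \<beta> + \<alpha> * \<beta>)"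
              using nn by (subst ennreal_plus) (auto simp: ennreal_mult simp del: ennreal_plus)
            also have "\<dots> = (ennreal \<alpha> + ennreal \<beta>) + ennreal \<gamma> * (2 * ennreal \<alpha> + ennreal \<beta> + ennreal \<alpha> * ennreal \<beta>)"
              using nn by (simp add: ennreal_mult)
            finally show ?thesis unfolding \<alpha>_def \<beta>_def \<gamma>_def .
          qed
          finally show "ennreal (ker w) * ennreal (?x + eta (z - w) * ?x\<^sup>2) \<le> (ennreal (ker w powr (6/5)) + ennreal (?x ^ 6)) + ennreal (2 * exp 4) *
            (2 * ennreal (ker w powr (6/5)) + ennreal (?x ^ 6) + ennreal (ker w powr (6/5)) * ennreal (?x ^ 6))"
            using eta_nonneg[of "z - w"] ker_nonneg[of w] by (subst ennreal_mult[symmetric]) auto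
        qed
        also have "\<dots> = (K + L) + ennreal (2 * exp 4) * (2 * K + L + Q z)"
          by (simp add: nn_integral_add nn_integral_cmult refl6 K_def Q_def)
        also have "\<dots> = A + ennreal (2 * exp 4) * Q z" by (simp add: A_def distrib_left add.assoc)
        finally show ?thesis .
      qed
      have QI: "(\<integral>\<^sup>+z. Q z \<partial>lborel) = K * L"
      proof -
        have "(\<integral>\<^sup>+z. Q z \<partial>lborel) = (\<integral>\<^sup>+w. \<integral>\<^sup>+z. ennreal (ker w powr (6/5)) * ennreal (?N (z - w) ^ 6) \<partial>lborel \<partial>lborel)"
          unfolding Q_def by (rule lborel_pair.Fubini') measurable
        also have "\<dots> = (\<integral>\<^sup>+w. ennreal (ker w powr (6/5)) * L \<partial>lborel)"
        proof (rule nn_integral_cong)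
          fix w
          have "(\<integral>\<^sup>+z. ennreal (?N (z - w) ^ 6) \<partial>lborel) = L"
            unfolding L_def using nn_integral_translate[of "\<lambda>z. ennreal (?N z ^ 6)" "- w"] by simp
          then show "(\<integral>\<^sup>+z. ennreal (ker w powr (6/5)) * ennreal (?N (z - w) ^ 6) \<partial>lborel) = ennreal (ker w powr (6/5)) * L"
            by (simp add: nn_integral_cmult)
        qed
        also have "\<dots> = K * L" unfolding K_def by (rule nn_integral_multc) measurable
        finally show ?thesis .
      qed
      have "(\<integral>\<^sup>+z\<in>V m. P z \<partial>lborel) \<le> (\<integral>\<^sup>+z. A * indicator (V m) z + ennreal (2 * exp 4) * Q z \<partial>lborel)"
      proof (rule nn_integral_mono)
        fix z
        show "P z * indicator (V m) z \<le> A * indicator (V m) z + ennreal (2 * exp 4) * Q z"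
          using PQ[of z] by (cases "z \<in> V m") auto
      qed
      also have "\<dots> = A * emeasure lborel (V m) + ennreal (2 * exp 4) * (K * L)"
        by (simp add: nn_integral_add nn_integral_cmult QI)
      also have "\<dots> < \<infinity>" using KL Vfin[of m] by (simp add: A_def ennreal_mult_less_top)
      finally show ?thesis .
    qed
    have comp: "AE z in lborel. z \<in> V m \<longrightarrow> ennreal (s * (U z $ k * eta z)) \<le> ennreal C * P z" if s: "\<bar>s\<bar> = 1" for m k s
    proof (rule AE_le_of_test_functions[OF _ _ V])
      show "(\<lambda>z. s * (U z $ k * eta z)) \<in> borel_measurable borel" "(\<lambda>z. ennreal C * P z) \<in> borel_measurable borel"
        by measurable
      show "(\<integral>\<^sup>+z\<in>V m. ennreal C * P z \<partial>lborel) < \<infinity>"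
        using P_fin[of m] by (simp add: mult.assoc nn_integral_cmult ennreal_mult_less_top)
      show "set_integrable lborel (V m) (\<lambda>z. s * (U z $ k * eta z))"
        unfolding set_integrable_def
      proof (rule integrableI_bounded)
        have "(\<integral>\<^sup>+z. ennreal (norm (indicator (V m) z *\<^sub>R (s * (U z $ k * eta z)))) \<partial>lborel)
          \<le> (\<integral>\<^sup>+z. ennreal (2 * exp 4) * (indicator (V m) z + ennreal (?N z ^ 6)) \<partial>lborel)"
        proof (rule nn_integral_mono)
          fix z
          show "ennreal (norm (indicator (V m) z *\<^sub>R (s * (U z $ k * eta z)))) \<le> ennreal (2 * exp 4) * (indicator (V m) z + ennreal (?N z ^ 6))"
          proof (cases "z \<in> V m")
            case True
            have "\<bar>U z $ k\<bar> \<le> 1 + ?N z ^ 6"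
              using component_le_norm_cart[of "U z" k] power_le_one_plus_power[of "?N z" 1 6] by simp
            then have "\<bar>s * (U z $ k * eta z)\<bar> \<le> (1 + ?N z ^ 6) * (2 * exp 4)"
              unfolding abs_mult using s eta_le[of z] eta_nonneg[of z] by (simp add: mult_mono)
            then have "ennreal \<bar>s * (U z $ k * eta z)\<bar> \<le> ennreal ((2 * exp 4) * (1 + ?N z ^ 6))"
              by (intro ennreal_leI) (simp add: mult.commute)
            also have "\<dots> = ennreal (2 * exp 4) * (1 + ennreal (?N z ^ 6))"
              by (subst ennreal_mult) auto
            finally show ?thesis using True by simp
          qed simp
        qed
        also have "\<dots> < \<infinity>" using Vfin[of m] U6 by (simp add: nn_integral_cmult nn_integral_add ennreal_mult_less_top)
        finally show "(\<integral>\<^sup>+z. ennreal (norm (indicator (V m) z *\<^sub>R (s * (U z $ k * eta z)))) \<partial>lborel) < \<infinity>" .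
      qed measurable
      fix h :: "real \<times> (real^3) \<Rightarrow> real"
      assume h: "h \<in> test_functions ({..<1} \<times> UNIV)" "\<And>z. 0 \<le> h z"
      note [measurable] = test_functions_borel[OF h(1)]
      have "(\<integral>z. s * (U z $ k * eta z) * h z \<partial>lborel) = s * (\<integral>z. U z $ k * eta z * h z \<partial>lborel)"
        by (simp add: mult.assoc)
      also have "\<dots> \<le> \<bar>s * (\<integral>z. U z $ k * eta z * h z \<partial>lborel)\<bar>" by (rule abs_ge_self)
      also have "\<dots> = \<bar>\<integral>z. U z $ k * eta z * h z \<partial>lborel\<bar>" using s by (simp add: abs_mult)
      finally have "ennreal (\<integral>z. s * (U z $ k * eta z) * h z \<partial>lborel) \<le> ennreal \<bar>\<integral>z. U z $ k * eta z * h z \<partial>lborel\<bar>"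
        by (rule ennreal_leI)
      also have "\<dots> \<le> ennreal C * (\<integral>\<^sup>+z. kpot h z * ennreal (?N z + eta z * ?N z ^ 2) \<partial>lborel)"
        by (rule C(2)[OF U U0 U6 NS h(1)])
      also have "(\<integral>\<^sup>+z. kpot h z * ennreal (?N z + eta z * ?N z ^ 2) \<partial>lborel) = (\<integral>\<^sup>+z. ennreal \<bar>h z\<bar> * P z \<partial>lborel)"
        unfolding P_def by (rule kpot_swap) measurable
      also have "ennreal C * \<dots> = (\<integral>\<^sup>+z. ennreal (h z) * (ennreal C * P z) \<partial>lborel)"
        using h(2) by (simp add: nn_integral_cmult[symmetric] mult_ac)
      finally show "ennreal (\<integral>z. s * (U z $ k * eta z) * h z \<partial>lborel) \<le> (\<integral>\<^sup>+z. ennreal (h z) * (ennreal C * P z) \<partial>lborel)" .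
    qed
    have "AE z in lborel. \<forall>m k. z \<in> V m \<longrightarrow> ennreal (1 * (U z $ k * eta z)) \<le> ennreal C * P z \<and> ennreal ((-1) * (U z $ k * eta z)) \<le> ennreal C * P z"
      unfolding AE_all_countable
    proof (intro allI)
      fix m k
      show "AE z in lborel. z \<in> V m \<longrightarrow> ennreal (1 * (U z $ k * eta z)) \<le> ennreal C * P z \<and> ennreal ((-1) * (U z $ k * eta z)) \<le> ennreal C * P z"
      proof -
        have "AE z in lborel. z \<in> V m \<longrightarrow> ennreal (1 * (U z $ k * eta z)) \<le> ennreal C * P z" by (rule comp) simp
        moreover have "AE z in lborel. z \<in> V m \<longrightarrow> ennreal ((-1) * (U z $ k * eta z)) \<le> ennreal C * P z" by (rule comp) simp
        ultimately show ?thesis by eventually_elim blast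
      qed
    qed
    then show "AE z in lborel. ennreal (eta z * ?N z) \<le> ennreal (3 * C + 1) *
        (\<integral>\<^sup>+w. ennreal (ker w) * ennreal (norm (U (z - w)) + eta (z - w) * norm (U (z - w)) ^ 2) \<partial>lborel)"
      unfolding P_def[symmetric]
    proof eventually_elim
      case (elim z)
      show ?case
      proof (cases "fst z < 1")
        case False
        then show ?thesis using U0[of z] by simp
      next
        case True
        obtain m1 :: nat where m1: "1 / (1 - fst z) < m1" using reals_Archimedean2 by blast
        obtain m2 :: nat where m2: "norm z < m2" using reals_Archimedean2 by blast
        define m where "m = max m1 m2"
        have "z \<in> V m"
        proof -
          have "1 / (1 - fst z) < real m + 1" using m1 by (simp add: m_def)
          then have "1 / (real m + 1) < 1 - fst z" using True by (simp add: field_simps)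
          moreover have "norm z < real m + 1" using m2 by (simp add: m_def)
          ultimately show ?thesis by (simp add: V_def mem_Times_iff)
        qed
        then have c: "ennreal \<bar>U z $ k * eta z\<bar> \<le> ennreal C * P z" for k
          using elim by (cases "U z $ k * eta z \<ge> 0") auto
        have "eta z * ?N z \<le> (\<Sum>k\<in>UNIV. \<bar>U z $ k * eta z\<bar>)"
          using mult_left_mono[OF norm_le_l1_cart[of "U z"] eta_nonneg[of z]] eta_nonneg[of z]
          by (simp add: abs_mult sum_distrib_left mult.commute)
        then have "ennreal (eta z * ?N z) \<le> (\<Sum>k\<in>UNIV. ennreal \<bar>U z $ k * eta z\<bar>)"
          by (subst sum_ennreal) (auto intro: ennreal_leI)
        also have "\<dots> \<le> (\<Sum>k\<in>(UNIV :: 3 set). ennreal C * P z)" by (intro sum_mono c)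
        also have "\<dots> = ennreal (3 * C) * P z"
        proof -
          have e: "ennreal (3 * C) = ennreal 3 * ennreal C" using C(1) by (subst ennreal_mult) auto
          show ?thesis unfolding e by (simp add: mult.assoc)
        qed
        also have "\<dots> \<le> ennreal (3 * C + 1) * P z" by (intro mult_right_mono ennreal_leI) auto
        finally show ?thesis .
      qed
    qed
  qed
qed

lemma small_L6_bounded:
  obtains c :: real where "c > 0"
    "\<And>U. U \<in> borel_measurable borel \<Longrightarrow> (\<And>z. fst z \<notin> {-1<..<1} \<Longrightarrow> U z = 0) \<Longrightarrow>
      (\<integral>\<^sup>+z. ennreal (norm (U z) ^ 6) \<partial>lborel) \<le> ennreal c \<Longrightarrow> weak_NS U \<Longrightarrow>
      AE z in lborel. eta z * norm (U z) \<le> 1"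
proof -
  obtain D where D: "D \<ge> 1"
    "\<And>U. U \<in> borel_measurable borel \<Longrightarrow> (\<And>z. fst z \<notin> {-1<..<1} \<Longrightarrow> U z = 0) \<Longrightarrow>
      (\<integral>\<^sup>+z. ennreal (norm (U z) ^ 6) \<partial>lborel) < \<infinity> \<Longrightarrow> weak_NS U \<Longrightarrow>
      AE z in lborel. ennreal (eta z * norm (U z)) \<le>
        ennreal D * (\<integral>\<^sup>+w. ennreal (ker w) * ennreal (norm (U (z - w)) + eta (z - w) * norm (U (z - w)) ^ 2) \<partial>lborel)"
    using pointwise_inequality by blast
  define K where "K = enn2real (\<integral>\<^sup>+w. ennreal (ker w powr (6/5)) \<partial>lborel)"
  have K: "(\<integral>\<^sup>+w. ennreal (ker w powr (6/5)) \<partial>lborel) = ennreal K" "K \<ge> 0"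
    using nn_integral_ker_finite by (simp_all add: K_def)
  \<comment> \<open>The Young parameter \<mu> is fixed first: \<open>\<mu> * X = 1/4\<close> makes
    the kernel terms of both Young inequalities at most 1/4. Then \<open>c\<close> is chosen so
    small that the terms with the field, weighted by \<open>(1 / \<mu>) ^ 6\<close>, add at most
    another 1/4. The outcome is \<open>s1\<close> for the linear term and \<open>s2\<close> for the
    contraction.\<close>
  define X where "X = 1 + D * K + D\<^sup>2 * K\<^sup>2"
  define \<mu> where "\<mu> = 1 / (4 * X)"
  define c where "c = \<mu> ^ 6 / (4 * (1 + D + D\<^sup>2 * K))"
  have DK: "0 \<le> D * K" "0 \<le> D\<^sup>2 * K" "0 \<le> D\<^sup>2 * K\<^sup>2" using D(1) K(2) by auto
  have X: "X \<ge> 1" using DK by (simp add: X_def)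
  have \<mu>: "0 < \<mu>" "\<mu> \<le> 1" using X by (auto simp: \<mu>_def divide_le_eq)
  have \<mu>X: "\<mu> * X = 1/4" using X by (simp add: \<mu>_def)
  have c: "c > 0" using \<mu> D(1) DK by (auto simp: c_def intro!: divide_pos_pos add_pos_nonneg)
  have cX: "(1 / \<mu>) ^ 6 * c * (1 + D + D\<^sup>2 * K) = 1/4"
  proof -
    have "1 + D + D\<^sup>2 * K > 0" using D(1) DK by linarith
    then show ?thesis using \<mu> by (simp add: c_def power_divide)
  qed
  have cp: "0 \<le> (1 / \<mu>) ^ 6 * c" using \<mu> c by simp
  have s1: "D * (\<mu> powr (6/5) * K + (1 / \<mu>) ^ 6 * c) \<le> 1/2"
  proof -
    have "\<mu> powr (6/5) \<le> \<mu> powr 1" using \<mu> by (intro powr_mono') auto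
    then have "\<mu> powr (6/5) * (D * K) \<le> \<mu> * (D * K)" using \<mu> DK by (intro mult_right_mono) auto
    also have "\<dots> \<le> \<mu> * X" using \<mu> DK by (intro mult_left_mono) (auto simp: X_def)
    finally have 1: "\<mu> powr (6/5) * (D * K) \<le> 1/4" using \<mu>X by simp
    have "(1 / \<mu>) ^ 6 * c * D \<le> (1 / \<mu>) ^ 6 * c * (1 + D + D\<^sup>2 * K)" using cp DK by (intro mult_left_mono) auto
    then have 2: "(1 / \<mu>) ^ 6 * c * D \<le> 1/4" using cX by simp
    show ?thesis using 1 2 by (simp add: algebra_simps)
  qed
  have s2: "D\<^sup>2 * (\<mu> ^ 3 * K + (1 / \<mu>) ^ 6 * c) * K \<le> 1/2"
  proof -
    have "\<mu> ^ 3 \<le> \<mu>" using \<mu> power_decreasing[of 1 3 \<mu>] by simp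
    then have "\<mu> ^ 3 * (D\<^sup>2 * K\<^sup>2) \<le> \<mu> * (D\<^sup>2 * K\<^sup>2)" using DK by (intro mult_right_mono) auto
    also have "\<dots> \<le> \<mu> * X" using \<mu> DK by (intro mult_left_mono) (auto simp: X_def)
    finally have 1: "\<mu> ^ 3 * (D\<^sup>2 * K\<^sup>2) \<le> 1/4" using \<mu>X by simp
    have "(1 / \<mu>) ^ 6 * c * (D\<^sup>2 * K) \<le> (1 / \<mu>) ^ 6 * c * (1 + D + D\<^sup>2 * K)" using cp D(1) by (intro mult_left_mono) auto
    then have 2: "(1 / \<mu>) ^ 6 * c * (D\<^sup>2 * K) \<le> 1/4" using cX by simp
    show ?thesis using 1 2 by (simp add: algebra_simps power2_eq_square)
  qed
  show ?thesis
  proof (rule that[OF c])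
    fix U :: "real \<times> (real^3) \<Rightarrow> real^3"
    assume U [measurable]: "U \<in> borel_measurable borel" and U0: "\<And>z. fst z \<notin> {-1<..<1} \<Longrightarrow> U z = 0"
      and U6: "(\<integral>\<^sup>+z. ennreal (norm (U z) ^ 6) \<partial>lborel) \<le> ennreal c" and NS: "weak_NS U"
    define N where "N z = norm (U z)" for z
    have Nm [measurable]: "N \<in> borel_measurable borel" unfolding N_def[abs_def] by measurable
    have N0: "N z \<ge> 0" for z by (simp add: N_def)
    have N6: "(\<integral>\<^sup>+z. ennreal (N z ^ 6) \<partial>lborel) \<le> ennreal c" using U6 by (simp add: N_def)
    define v where "v z = max 0 (eta z * N z - 1)" for z
    have vm [measurable]: "v \<in> borel_measurable borel" unfolding v_def[abs_def] by measurable
    have v0: "v z \<ge> 0" for z by (simp add: v_def)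
    define T where "T z = (\<integral>\<^sup>+w. ennreal (ker w * N (z - w)) * ennreal (v (z - w)) \<partial>lborel)" for z
    have Tm [measurable]: "T \<in> borel_measurable borel" unfolding T_def[abs_def] by measurable
    have kerN: "ennreal D * (\<integral>\<^sup>+w. ennreal (ker w) * ennreal (N (z - w)) \<partial>lborel) \<le> ennreal (1/2)" for z
    proof -
      have "(\<integral>\<^sup>+w. ennreal (ker w) * ennreal (N (z - w)) \<partial>lborel)
        \<le> ennreal (\<mu> powr (6/5)) * ennreal K + ennreal ((1 / \<mu>) ^ 6) * (\<integral>\<^sup>+z. ennreal (N z ^ 6) \<partial>lborel)"
        using ker_Young[OF \<mu>(1) Nm N0, of z] unfolding K(1) .
      also have "\<dots> \<le> ennreal (\<mu> powr (6/5)) * ennreal K + ennreal ((1 / \<mu>) ^ 6) * ennreal c"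
        by (intro add_left_mono mult_left_mono N6) auto
      also have "\<dots> = ennreal (\<mu> powr (6/5) * K + (1 / \<mu>) ^ 6 * c)"
        using K(2) c \<mu> by (simp add: ennreal_mult ennreal_plus)
      finally have "ennreal D * (\<integral>\<^sup>+w. ennreal (ker w) * ennreal (N (z - w)) \<partial>lborel)
        \<le> ennreal D * ennreal (\<mu> powr (6/5) * K + (1 / \<mu>) ^ 6 * c)" by (rule mult_left_mono) simp
      also have "\<dots> = ennreal (D * (\<mu> powr (6/5) * K + (1 / \<mu>) ^ 6 * c))"
        using D(1) K(2) cp by (intro ennreal_mult[symmetric]) auto
      also have "\<dots> \<le> ennreal (1/2)" by (rule ennreal_leI[OF s1])
      finally show ?thesis .
    qed
    have fin6: "(\<integral>\<^sup>+z. ennreal (norm (U z) ^ 6) \<partial>lborel) < \<infinity>" using U6 by (auto intro: order_le_less_trans)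
    have "AE z in lborel. ennreal (eta z * norm (U z)) \<le> ennreal D *
        (\<integral>\<^sup>+w. ennreal (ker w) * ennreal (norm (U (z - w)) + eta (z - w) * norm (U (z - w)) ^ 2) \<partial>lborel)"
      by (rule D(2)[of U]) (use U U0 fin6 NS in auto)
    then have vT: "AE z in lborel. ennreal (v z) \<le> ennreal D * T z"
    proof eventually_elim
      case (elim z)
      have "ennreal (eta z * N z) \<le> ennreal D *
        (\<integral>\<^sup>+w. ennreal (ker w) * ennreal (N (z - w) + eta (z - w) * N (z - w) ^ 2) \<partial>lborel)"
        using elim by (simp only: N_def)
      also have "\<dots> \<le> ennreal D * (\<integral>\<^sup>+w. 2 * (ennreal (ker w) * ennreal (N (z - w))) + ennreal (ker w * N (z - w)) * ennreal (v (z - w)) \<partial>lborel)"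
      proof (intro mult_left_mono nn_integral_mono)
        fix w
        \<comment> \<open>Only one of the two factors \<open>N\<close> is estimated through
          \<open>v\<close>; the other stays as the small coefficient. The 1 doubles the linear term,
          whose total contribution \<open>2 * (1/2)\<close> is exactly the threshold subtracted in
          \<open>v\<close>.\<close>
        have "eta (z - w) * N (z - w) \<le> 1 + v (z - w)" by (simp add: v_def)
        then have "N (z - w) * (eta (z - w) * N (z - w)) \<le> N (z - w) * (1 + v (z - w))" by (intro mult_left_mono N0)
        then have "N (z - w) + eta (z - w) * N (z - w) ^ 2 \<le> 2 * N (z - w) + N (z - w) * v (z - w)"
          by (simp add: power2_eq_square algebra_simps)
        then have "ennreal (N (z - w) + eta (z - w) * N (z - w) ^ 2) \<le> ennreal (2 * N (z - w) + N (z - w) * v (z - w))"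
          by (rule ennreal_leI)
        also have "\<dots> = 2 * ennreal (N (z - w)) + ennreal (N (z - w)) * ennreal (v (z - w))"
          using N0 v0 by (simp add: ennreal_mult ennreal_plus)
        finally have "ennreal (ker w) * ennreal (N (z - w) + eta (z - w) * N (z - w) ^ 2)
          \<le> ennreal (ker w) * (2 * ennreal (N (z - w)) + ennreal (N (z - w)) * ennreal (v (z - w)))" by (rule mult_left_mono) simp
        also have "\<dots> = 2 * (ennreal (ker w) * ennreal (N (z - w))) + ennreal (ker w * N (z - w)) * ennreal (v (z - w))"
          using ker_nonneg N0 by (simp add: ennreal_mult distrib_left mult_ac)
        finally show "ennreal (ker w) * ennreal (N (z - w) + eta (z - w) * N (z - w) ^ 2)
          \<le> 2 * (ennreal (ker w) * ennreal (N (z - w))) + ennreal (ker w * N (z - w)) * ennreal (v (z - w))" .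
      qed auto
      also have "\<dots> = 2 * (ennreal D * (\<integral>\<^sup>+w. ennreal (ker w) * ennreal (N (z - w)) \<partial>lborel)) + ennreal D * T z"
      proof -
        have "(\<integral>\<^sup>+w. 2 * (ennreal (ker w) * ennreal (N (z - w))) + ennreal (ker w * N (z - w)) * ennreal (v (z - w)) \<partial>lborel)
          = (\<integral>\<^sup>+w. 2 * (ennreal (ker w) * ennreal (N (z - w))) \<partial>lborel) + T z"
          unfolding T_def by (rule nn_integral_add) measurable
        also have "(\<integral>\<^sup>+w. 2 * (ennreal (ker w) * ennreal (N (z - w))) \<partial>lborel)
          = 2 * (\<integral>\<^sup>+w. ennreal (ker w) * ennreal (N (z - w)) \<partial>lborel)"
          by (rule nn_integral_cmult) measurable
        finally show ?thesis by (simp only: distrib_left mult_ac)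
      qed
      also have "\<dots> \<le> 2 * ennreal (1/2) + ennreal D * T z"
        by (intro add_right_mono mult_left_mono kerN) auto
      also have "2 * ennreal (1/2) = 1"
      proof -
        have "2 * ennreal (1/2) = ennreal 2 * ennreal (1/2)" by simp
        also have "\<dots> = ennreal (2 * (1/2))" by (rule ennreal_mult[symmetric]) auto
        finally show ?thesis by simp
      qed
      finally have le: "ennreal (eta z * N z) \<le> 1 + ennreal D * T z" .
      show "ennreal (v z) \<le> ennreal D * T z"
      proof (cases "eta z * N z \<le> 1")
        case True
        then show ?thesis by (simp add: v_def)
      next
        case False
        then have "1 + ennreal (v z) = ennreal (eta z * N z)"
          by (simp add: v_def flip: ennreal_1 ennreal_plus)
        then have "1 + ennreal (v z) \<le> 1 + ennreal D * T z" using le by (simp only:)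
        then show ?thesis by (simp add: ennreal_add_left_cancel_le)
      qed
    qed
    define S where "S = (\<integral>\<^sup>+z. (ennreal (v z))\<^sup>2 \<partial>lborel)"
    \<comment> \<open>The kernel is split into the powers 2/5 and 3/5. The first goes with
      \<open>N\<close>, and by \<open>ker_four_fifths_Young\<close> the integral of the square is
      small uniformly in \<open>z\<close>. The second goes with \<open>v\<close>, and its square
      carries the integrable weight \<open>ker w powr (6/5)\<close>, so integration in
      \<open>z\<close> returns a multiple of \<open>S\<close>.\<close>
    have Tsq: "(ennreal D * T z)\<^sup>2 \<le> ennreal (D\<^sup>2 * (\<mu> ^ 3 * K + (1 / \<mu>) ^ 6 * c)) * (\<integral>\<^sup>+w. ennreal (ker w powr (6/5)) * (ennreal (v (z - w)))\<^sup>2 \<partial>lborel)" for z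
    proof -
      define f where "f w = ennreal (ker w powr (2/5) * N (z - w))" for w
      define g where "g w = ennreal (ker w powr (3/5) * v (z - w))" for w
      have [measurable]: "f \<in> borel_measurable borel" "g \<in> borel_measurable borel"
        unfolding f_def[abs_def] g_def[abs_def] by measurable
      have "T z = (\<integral>\<^sup>+w. f w * g w \<partial>lborel)"
        unfolding T_def
      proof (rule nn_integral_cong)
        fix w
        have "ker w powr (2/5) * ker w powr (3/5) = ker w"
          using ker_nonneg[of w] by (simp flip: powr_add)
        then have "ker w * N (z - w) * v (z - w) = (ker w powr (2/5) * ker w powr (3/5)) * N (z - w) * v (z - w)"
          by (simp only:)
        also have "\<dots> = (ker w powr (2/5) * N (z - w)) * (ker w powr (3/5) * v (z - w))"
          by (simp only: mult_ac)
        finally have "ker w * N (z - w) * v (z - w) = (ker w powr (2/5) * N (z - w)) * (ker w powr (3/5) * v (z - w))" .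
        then show "ennreal (ker w * N (z - w)) * ennreal (v (z - w)) = f w * g w"
          unfolding f_def g_def using ker_nonneg N0 v0 by (simp flip: ennreal_mult)
      qed
      then have "(T z)\<^sup>2 \<le> (\<integral>\<^sup>+w. (f w)\<^sup>2 \<partial>lborel) * (\<integral>\<^sup>+w. (g w)\<^sup>2 \<partial>lborel)"
        by (simp add: Cauchy_Schwarz_nn_integral)
      also have "(\<integral>\<^sup>+w. (g w)\<^sup>2 \<partial>lborel) = (\<integral>\<^sup>+w. ennreal (ker w powr (6/5)) * (ennreal (v (z - w)))\<^sup>2 \<partial>lborel)"
      proof (rule nn_integral_cong)
        fix w
        have "(ker w powr (3/5))\<^sup>2 = ker w powr (6/5)"
          by (cases "ker w = 0") (simp_all add: powr_powr power2_eq_square flip: powr_add)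
        then show "(g w)\<^sup>2 = ennreal (ker w powr (6/5)) * (ennreal (v (z - w)))\<^sup>2"
          unfolding g_def using v0 by (simp add: ennreal_power power_mult_distrib ennreal_mult)
      qed
      also have "(\<integral>\<^sup>+w. (f w)\<^sup>2 \<partial>lborel) \<le> ennreal (\<mu> ^ 3 * K + (1 / \<mu>) ^ 6 * c)"
      proof -
        have "(\<integral>\<^sup>+w. (f w)\<^sup>2 \<partial>lborel) \<le> (\<integral>\<^sup>+w. ennreal (\<mu> ^ 3) * ennreal (ker w powr (6/5)) + ennreal ((1 / \<mu>) ^ 6) * ennreal (N (z - w) ^ 6) \<partial>lborel)"
        proof (rule nn_integral_mono)
          fix w
          have "(ker w powr (2/5))\<^sup>2 = ker w powr (4/5)"
            by (cases "ker w = 0") (simp_all add: powr_powr power2_eq_square flip: powr_add)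
          then have "(f w)\<^sup>2 = ennreal (ker w powr (4/5) * (N (z - w))\<^sup>2)"
            unfolding f_def using N0 by (simp add: ennreal_power power_mult_distrib)
          also have "\<dots> \<le> ennreal (\<mu> ^ 3 * ker w powr (6/5) + (1 / \<mu>) ^ 6 * N (z - w) ^ 6)"
            by (rule ennreal_leI[OF ker_four_fifths_Young[OF \<mu>(1) N0]])
          also have "\<dots> = ennreal (\<mu> ^ 3) * ennreal (ker w powr (6/5)) + ennreal ((1 / \<mu>) ^ 6) * ennreal (N (z - w) ^ 6)"
            using \<mu> N0 by (simp add: ennreal_plus ennreal_mult)
          finally show "(f w)\<^sup>2 \<le> ennreal (\<mu> ^ 3) * ennreal (ker w powr (6/5)) + ennreal ((1 / \<mu>) ^ 6) * ennreal (N (z - w) ^ 6)" .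
        qed
        also have "\<dots> = ennreal (\<mu> ^ 3) * ennreal K + ennreal ((1 / \<mu>) ^ 6) * (\<integral>\<^sup>+w. ennreal (N (z - w) ^ 6) \<partial>lborel)"
          by (simp add: nn_integral_add nn_integral_cmult K(1))
        also have "(\<integral>\<^sup>+w. ennreal (N (z - w) ^ 6) \<partial>lborel) = (\<integral>\<^sup>+z. ennreal (N z ^ 6) \<partial>lborel)"
          by (rule nn_integral_reflect[of "\<lambda>z. ennreal (N z ^ 6)"]) measurable
        also have "ennreal (\<mu> ^ 3) * ennreal K + ennreal ((1 / \<mu>) ^ 6) * (\<integral>\<^sup>+z. ennreal (N z ^ 6) \<partial>lborel)
          \<le> ennreal (\<mu> ^ 3) * ennreal K + ennreal ((1 / \<mu>) ^ 6) * ennreal c"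
          by (intro add_left_mono mult_left_mono N6) auto
        also have "\<dots> = ennreal (\<mu> ^ 3 * K + (1 / \<mu>) ^ 6 * c)"
          using K(2) c \<mu> by (simp add: ennreal_mult ennreal_plus)
        finally show ?thesis .
      qed
      finally have T2: "(T z)\<^sup>2 \<le> ennreal (\<mu> ^ 3 * K + (1 / \<mu>) ^ 6 * c) * (\<integral>\<^sup>+w. ennreal (ker w powr (6/5)) * (ennreal (v (z - w)))\<^sup>2 \<partial>lborel)"
        by (simp add: mult_right_mono)
      have "(ennreal D * T z)\<^sup>2 = ennreal (D\<^sup>2) * (T z)\<^sup>2"
        using D(1) by (simp add: power_mult_distrib ennreal_power)
      also have "\<dots> \<le> ennreal (D\<^sup>2) * (ennreal (\<mu> ^ 3 * K + (1 / \<mu>) ^ 6 * c) * (\<integral>\<^sup>+w. ennreal (ker w powr (6/5)) * (ennreal (v (z - w)))\<^sup>2 \<partial>lborel))"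
        by (intro mult_left_mono T2) auto
      also have "\<dots> = ennreal (D\<^sup>2 * (\<mu> ^ 3 * K + (1 / \<mu>) ^ 6 * c)) * (\<integral>\<^sup>+w. ennreal (ker w powr (6/5)) * (ennreal (v (z - w)))\<^sup>2 \<partial>lborel)"
        by (subst ennreal_mult) (use K(2) \<mu> cp in \<open>auto simp: mult.assoc simp del: ennreal_plus\<close>)
      finally show ?thesis .
    qed
    have S_le: "S \<le> ennreal (1/2) * S"
    proof -
      let ?A = "ennreal (D\<^sup>2 * (\<mu> ^ 3 * K + (1 / \<mu>) ^ 6 * c))"
      have "S \<le> (\<integral>\<^sup>+z. ?A * (\<integral>\<^sup>+w. ennreal (ker w powr (6/5)) * (ennreal (v (z - w)))\<^sup>2 \<partial>lborel) \<partial>lborel)"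
        unfolding S_def
      proof (rule nn_integral_mono_AE)
        show "AE z in lborel. (ennreal (v z))\<^sup>2 \<le> ?A * (\<integral>\<^sup>+w. ennreal (ker w powr (6/5)) * (ennreal (v (z - w)))\<^sup>2 \<partial>lborel)"
          using vT
        proof eventually_elim
          case (elim z)
          then have "(ennreal (v z))\<^sup>2 \<le> (ennreal D * T z)\<^sup>2" by (intro power_mono) auto
          then show ?case using Tsq[of z] by (rule order_trans)
        qed
      qed
      also have "\<dots> = ?A * (\<integral>\<^sup>+z. \<integral>\<^sup>+w. ennreal (ker w powr (6/5)) * (ennreal (v (z - w)))\<^sup>2 \<partial>lborel \<partial>lborel)"
        by (rule nn_integral_cmult) measurable
      also have "(\<integral>\<^sup>+z. \<integral>\<^sup>+w. ennreal (ker w powr (6/5)) * (ennreal (v (z - w)))\<^sup>2 \<partial>lborel \<partial>lborel)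
        = (\<integral>\<^sup>+w. \<integral>\<^sup>+z. ennreal (ker w powr (6/5)) * (ennreal (v (z - w)))\<^sup>2 \<partial>lborel \<partial>lborel)"
        by (rule lborel_pair.Fubini') measurable
      also have "\<dots> = (\<integral>\<^sup>+w. ennreal (ker w powr (6/5)) * S \<partial>lborel)"
      proof (rule nn_integral_cong)
        fix w
        have "(\<integral>\<^sup>+z. (ennreal (v (z - w)))\<^sup>2 \<partial>lborel) = S"
          unfolding S_def using nn_integral_translate[of "\<lambda>z. (ennreal (v z))\<^sup>2" "- w"] by simp
        then show "(\<integral>\<^sup>+z. ennreal (ker w powr (6/5)) * (ennreal (v (z - w)))\<^sup>2 \<partial>lborel) = ennreal (ker w powr (6/5)) * S"
          by (simp add: nn_integral_cmult)
      qed
      also have "\<dots> = ennreal K * S" unfolding K(1)[symmetric] by (rule nn_integral_multc) measurable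
      also have "?A * (ennreal K * S) = ennreal (D\<^sup>2 * (\<mu> ^ 3 * K + (1 / \<mu>) ^ 6 * c) * K) * S"
        using K(2) cp \<mu> by (subst ennreal_mult) (auto simp: mult.assoc simp del: ennreal_plus)
      also have "\<dots> \<le> ennreal (1/2) * S" by (rule mult_right_mono[OF ennreal_leI[OF s2]]) simp
      finally show ?thesis .
    qed
    \<comment> \<open>The inequality \<open>S_le\<close> is vacuous for an infinite
      \<open>S\<close>. Where \<open>v\<close> is nonzero, \<open>eta z * N z\<close> exceeds 1, so
      the square may be replaced by the sixth power.\<close>
    have S_fin: "S < \<infinity>"
    proof -
      have "S \<le> (\<integral>\<^sup>+z. ennreal ((2 * exp 4) ^ 6) * ennreal (N z ^ 6) \<partial>lborel)"
        unfolding S_def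
      proof (rule nn_integral_mono)
        fix z
        have "(v z)\<^sup>2 \<le> (eta z * N z) ^ 6"
        proof (cases "eta z * N z \<le> 1")
          case True
          then show ?thesis using eta_nonneg[of z] N0[of z] by (simp add: v_def)
        next
          case False
          then have "(v z)\<^sup>2 \<le> (eta z * N z)\<^sup>2" by (intro power_mono) (auto simp: v_def)
          also have "\<dots> \<le> (eta z * N z) ^ 6" using False by (intro power_increasing) auto
          finally show ?thesis .
        qed
        also have "\<dots> \<le> ((2 * exp 4) * N z) ^ 6"
          using eta_nonneg[of z] eta_le[of z] N0[of z] by (intro power_mono mult_right_mono mult_nonneg_nonneg) auto
        finally have "(v z)\<^sup>2 \<le> (2 * exp 4) ^ 6 * N z ^ 6" by (simp only: power_mult_distrib)
        then have "ennreal ((v z)\<^sup>2) \<le> ennreal ((2 * exp 4) ^ 6 * N z ^ 6)" by (rule ennreal_leI)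
        then show "(ennreal (v z))\<^sup>2 \<le> ennreal ((2 * exp 4) ^ 6) * ennreal (N z ^ 6)"
          using v0[of z] N0[of z] by (subst (asm) ennreal_mult) (auto simp: ennreal_power)
      qed
      also have "\<dots> = ennreal ((2 * exp 4) ^ 6) * (\<integral>\<^sup>+z. ennreal (N z ^ 6) \<partial>lborel)"
        by (rule nn_integral_cmult) measurable
      also have "\<dots> < \<infinity>" using fin6 by (simp add: N_def ennreal_mult_less_top)
      finally show ?thesis .
    qed
    have "S = 0"
    proof -
      define r where "r = enn2real S"
      have r: "S = ennreal r" "r \<ge> 0" using S_fin by (simp_all add: r_def)
      have "ennreal r \<le> ennreal (1/2 * r)" using S_le r(2) unfolding r(1) by (subst ennreal_mult) auto
      then have "r \<le> 1/2 * r" using r(2) by (subst (asm) ennreal_le_iff) auto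
      then show ?thesis using r by simp
    qed
    then have "AE z in lborel. (ennreal (v z))\<^sup>2 = 0"
      unfolding S_def by (subst (asm) nn_integral_0_iff_AE) auto
    then show "AE z in lborel. eta z * norm (U z) \<le> 1"
    proof eventually_elim
      case (elim z)
      then have "v z = 0" using v0[of z] by (simp add: ennreal_eq_0_iff antisym)
      then show ?case by (simp add: v_def N_def max_def split: if_splits)
    qed
  qed
qed

theorem proposition1p2:
  shows "\<exists>C>0. \<forall>u :: real \<times> (real^3) \<Rightarrow> real^3.
    NS_solution (-1) 1 u \<longrightarrow>
    Lp_space 6 ({-1..1} \<times> UNIV) u \<longrightarrow>
    Lp_norm 6 ({-1..1} \<times> UNIV) u \<le> C \<longrightarrow>
    (AE z in lebesgue_on ({-1/2..1} \<times> UNIV). norm (u z) \<le> 1)"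
proof -
  obtain c :: real where c: "c > 0"
    "\<And>U. U \<in> borel_measurable borel \<Longrightarrow> (\<And>z. fst z \<notin> {-1<..<1} \<Longrightarrow> U z = 0) \<Longrightarrow>
      (\<integral>\<^sup>+z. ennreal (norm (U z) ^ 6) \<partial>lborel) \<le> ennreal c \<Longrightarrow> weak_NS U \<Longrightarrow>
      AE z in lborel. eta z * norm (U z) \<le> 1"
    using small_L6_bounded by blast
  show ?thesis
  \<comment> \<open>The smallness is required of the sixth power of the norm; a norm of at most 1
    dominates its own sixth power.\<close>
  proof (intro exI[of _ "min 1 c"] conjI allI impI)
    show "0 < min 1 c" using c(1) by simp
    fix u :: "real \<times> (real^3) \<Rightarrow> real^3"
    assume sol: "NS_solution (-1) 1 u" and Lp: "Lp_space 6 ({-1..1} \<times> UNIV) u"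
      and small: "Lp_norm 6 ({-1..1} \<times> UNIV) u \<le> min 1 c"
    obtain U :: "real \<times> (real^3) \<Rightarrow> real^3" where U: "U \<in> borel_measurable borel"
      "\<And>z. fst z \<notin> {-1<..<1} \<Longrightarrow> U z = 0"
      "AE z in lebesgue. fst z \<in> {-1<..<1} \<longrightarrow> u z = U z"
      "(\<integral>\<^sup>+z. ennreal (norm (U z) ^ 6) \<partial>lborel) \<le> ennreal (Lp_norm 6 ({-1..1} \<times> UNIV) u ^ 6)"
      "\<And>k \<Psi>. \<Psi> \<in> test_functions ({-1<..<1} \<times> UNIV) \<Longrightarrow>
       (\<integral>z. U z $ k * heat (lap \<Psi>) z \<partial>lborel) =
       (\<Sum>i\<in>UNIV. \<Sum>j\<in>UNIV. \<integral>z. U z $ i * U z $ j * dir_deriv (space_dir j) (leray k i \<Psi>) z \<partial>lborel)"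
      using NS_lborel_form[OF sol Lp] by blast
    have NS: "weak_NS U" unfolding weak_NS_def using U(5) by blast
    have "Lp_norm 6 ({-1..1} \<times> UNIV) u ^ 6 \<le> c"
    proof -
      have n0: "0 \<le> Lp_norm 6 ({-1..1} \<times> UNIV) u" by (simp add: Lp_norm_def)
      have "Lp_norm 6 ({-1..1} \<times> UNIV) u ^ 6 \<le> Lp_norm 6 ({-1..1} \<times> UNIV) u ^ 1"
        using n0 small by (intro power_decreasing) auto
      then show ?thesis using small by simp
    qed
    then have N6: "(\<integral>\<^sup>+z. ennreal (norm (U z) ^ 6) \<partial>lborel) \<le> ennreal c"
      using U(4) by (auto intro: order_trans ennreal_leI)
    have "AE z in lborel. eta z * norm (U z) \<le> 1"
      by (rule c(2)[of U]) (use U(1,2) N6 NS in auto)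
    then have A: "AE z in lebesgue. eta z * norm (U z) \<le> 1" by (rule AE_completion)
    \<comment> \<open>\<open>U\<close> represents \<open>u\<close> on the open time interval only,
      while the conclusion includes time 1; that slice is a null set.\<close>
    have B: "AE z in lebesgue. fst (z :: real \<times> (real^3)) \<noteq> 1"
    proof -
      have "negligible {w :: real \<times> (real^3). time_dir \<bullet> w = 1}"
        by (rule negligible_hyperplane) (simp add: zero_prod_def)
      then have "{w :: real \<times> (real^3). time_dir \<bullet> w = 1} \<in> null_sets lebesgue"
        by (simp add: negligible_iff_null_sets)
      then have "AE w in lebesgue. w \<notin> {w :: real \<times> (real^3). time_dir \<bullet> w = 1}" by (rule AE_not_in)
      then show ?thesis by (simp add: inner_prod_def)
    qed
    have S: "({-1/2..1} \<times> UNIV :: (real \<times> (real^3)) set) \<in> sets lebesgue"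
      by (intro sets_completionI_sets) (simp add: borel_closed closed_Times)
    have "AE z in lebesgue. z \<in> {-1/2..1} \<times> (UNIV :: (real^3) set) \<longrightarrow> norm (u z) \<le> 1"
      using A B U(3)
    proof eventually_elim
      case (elim z)
      show ?case
      proof
        assume "z \<in> {-1/2..1} \<times> UNIV"
        then have z: "fst z \<ge> -1/2" "fst z \<le> 1" by (auto simp: mem_Times_iff)
        then have "u z = U z" using elim by auto
        moreover have "1 * norm (U z) \<le> eta z * norm (U z)" using eta_ge_1[OF z(1)] by (intro mult_right_mono) auto
        ultimately show "norm (u z) \<le> 1" using elim(1) by simp
      qed
    qed
    then show "AE z in lebesgue_on ({-1/2..1} \<times> UNIV). norm (u z) \<le> 1"
      using S by (subst AE_restrict_space_iff) auto
  qed
qed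

end
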